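(* Assume $\sum_{z\in\mathbb{Z}^d}b^2(z)<\infty$, $\sum_{x\in\mathbb{Z}^d}\mu(x)<\infty$, and that one of the following conditions, which guarantee $\|\mathcal{A}\|_\mu<\infty$, holds: (1) (light tail) $a(z)\le c\,e^{-\eta|z|}$ for all $z$ with some $c,\eta>0$, and $\mu(z)>e^{-\gamma|z|}$ for all $z$, with $\gamma<2\eta$; (2) (moderate or heavy tail) for all sufficiently large $|z|$, $a(z)\le C(\dot z)/|z|^{d+\alpha}$, $\dot z=z/|z|$, with $C$ a positive continuous function on $S^{d-1}$ and $\alpha>2$ (moderate) or $0<\alpha<2$ (heavy), and $\mu(z)\sim C(\delta_2)/(1+|z|^{d+\delta_2})$ as $|z|\to\infty$ with a constant $C(\delta_2)>0$ and $0<\delta_2<2\alpha$. Then the Itô equation $$u(t,x)=1+\int_0^t\varkappa\mathcal{A}u(s,x)\,ds+\int_0^t u(s,x)\,dW(s,x),\qquad t\ge0,\ x\in\mathbb{Z}^d,$$ has a solution $u(t,\cdot)$ in $l^2(\mathbb{Z}^d,\mu)$, and this solution is unique and continuous in time (as an $l^2(\mathbb{Z}^d,\mu)$-valued process).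
   Context: $\varkappa>0$. The kernel $a:\mathbb{Z}^d\to[0,\infty)$ satisfies $a(z)=a(-z)$, $a(0)=0$, $a(z)>0$ if $|z|=1$, $\sum_z a(z)=1$, and $\mathcal{A}f(x)=\sum_{z\neq0}a(z)(f(x+z)-f(x))$. $W(t,x)=\sum_{z}b(x-z)w(t,z)$, where $\{w(\cdot,z)\}_{z\in\mathbb{Z}^d}$ are independent standard Brownian motions and $b:\mathbb{Z}^d\to\mathbb{R}$. $l^2(\mathbb{Z}^d,\mu)$ has norm $\|f\|_\mu^2=\sum_x|f(x)|^2\mu(x)$, $\mu(x)>0$; $\|\mathcal{A}\|_\mu$ is the operator norm on it. Standing regularity of $\mu$: $\mu(x)=\mu(|x|_\infty)$ and $\frac{\mu(0)}{\mu(1)}\ge\frac{\mu(1)}{\mu(2)}\ge\cdots\ge1$; in (1), $|\cdot|=|\cdot|_\infty$. A solution is a process with values in $l^2(\mathbb{Z}^d,\mu)$, continuous in time and adapted to the filtration generated by $\{w(\cdot,z)\}$, satisfying the equation almost surely for every $x$ and $t$ (the stochastic integral is an Itô integral); uniqueness is up to indistinguishability. The equation is the integrated (Itô) form of $\partial_tu=\varkappa\mathcal{A}u+\dot W(t,x)u$, $u(0,x)\equiv1$. *)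

theory Defs
  imports "HOL-Probability.Probability" "HOL-Library.Landau_Symbols"
begin

section \<open>The lattice and the weighted space\<close>

text \<open>The lattice \<open>\<int>\<^sup>d\<close> is \<^typ>\<open>int ^ 'd\<close> with \<open>d = CARD('d)\<close>.\<close>

definition real_point :: "int ^ 'd \<Rightarrow> real ^ 'd::finite" where
  "real_point z = (\<chi> i. real_of_int (z $ i))"

definition euclid_norm :: "int ^ 'd::finite \<Rightarrow> real" where
  "euclid_norm z = norm (real_point z)"

definition sup_norm :: "int ^ 'd::finite \<Rightarrow> nat" where
  "sup_norm z = Max (range (\<lambda>i. nat \<bar>z $ i\<bar>))"

definition l2w :: "(int ^ 'd::finite \<Rightarrow> real) \<Rightarrow> (int ^ 'd \<Rightarrow> real) set" where
  "l2w \<mu> = {f. (\<lambda>x. \<bar>f x\<bar>\<^sup>2 * \<mu> x) summable_on UNIV}"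

definition l2w_norm :: "(int ^ 'd::finite \<Rightarrow> real) \<Rightarrow> (int ^ 'd \<Rightarrow> real) \<Rightarrow> real" where
  "l2w_norm \<mu> f = sqrt (\<Sum>\<^sub>\<infinity>x\<in>UNIV. \<bar>f x\<bar>\<^sup>2 * \<mu> x)"

text \<open>
  Since \<open>CARD('d) \<ge> 1\<close>, the sup norm attains every natural number, so the profile \<open>m\<close> below
  is determined by \<open>\<mu>\<close>; \<open>m n\<close> is what is usually abbreviated to \<open>\<mu>(n)\<close>.
\<close>

definition regular_weight :: "(int ^ 'd::finite \<Rightarrow> real) \<Rightarrow> bool" where
  "regular_weight \<mu> \<longleftrightarrow> (\<forall>x. \<mu> x > 0) \<and>
     (\<exists>m. (\<forall>x. \<mu> x = m (sup_norm x)) \<and>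
          (\<forall>n. m n / m (Suc n) \<ge> m (Suc n) / m (Suc (Suc n))) \<and>
          (\<forall>n. m n / m (Suc n) \<ge> 1))"


section \<open>The kernel and its generator\<close>

definition walk_kernel :: "(int ^ 'd::finite \<Rightarrow> real) \<Rightarrow> bool" where
  "walk_kernel a \<longleftrightarrow> (\<forall>z. a z \<ge> 0) \<and> (\<forall>z. a z = a (- z)) \<and> a 0 = 0 \<and>
     (\<forall>z. euclid_norm z = 1 \<longrightarrow> a z > 0) \<and> (a has_sum 1) UNIV"

definition generator ::
    "(int ^ 'd::finite \<Rightarrow> real) \<Rightarrow> (int ^ 'd \<Rightarrow> real) \<Rightarrow> int ^ 'd \<Rightarrow> real" where
  "generator a f x = (\<Sum>\<^sub>\<infinity>z\<in>UNIV - {0}. a z * (f (x + z) - f x))"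

text \<open>
  \<open>\<parallel>\<A>\<parallel>\<^sub>\<mu> < \<infinity>\<close>. The summability clause rules out that \<^const>\<open>generator\<close> takes the
  default value \<open>0\<close> of a divergent sum.
\<close>

definition generator_bounded ::
    "(int ^ 'd::finite \<Rightarrow> real) \<Rightarrow> (int ^ 'd \<Rightarrow> real) \<Rightarrow> bool" where
  "generator_bounded a \<mu> \<longleftrightarrow> (\<exists>K. \<forall>f \<in> l2w \<mu>.
     (\<forall>x. (\<lambda>z. a z * (f (x + z) - f x)) summable_on (UNIV - {0})) \<and>
     generator a f \<in> l2w \<mu> \<and> l2w_norm \<mu> (generator a f) \<le> K * l2w_norm \<mu> f)"

definition light_tail ::
    "(int ^ 'd::finite \<Rightarrow> real) \<Rightarrow> (int ^ 'd \<Rightarrow> real) \<Rightarrow> bool" where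
  "light_tail a \<mu> \<longleftrightarrow> (\<exists>c \<eta> \<gamma> :: real. c > 0 \<and> \<eta> > 0 \<and> \<gamma> < 2 * \<eta> \<and>
     (\<forall>z. a z \<le> c * exp (- \<eta> * real (sup_norm z))) \<and>
     (\<forall>z. \<mu> z > exp (- \<gamma> * real (sup_norm z))))"

text \<open>
  The kernel is compared with a function of the Euclidean direction \<open>z / |z| \<in> S\<^sup>d\<^sup>-\<^sup>1\<close> and
  of the Euclidean length. The weight depends on the sup norm only, so for \<open>d \<ge> 2\<close> it can be
  asymptotically equivalent to a power of \<open>|z|\<close> only if \<open>|z|\<close> is the sup norm there.
\<close>

definition moderate_or_heavy_tail ::
    "(int ^ 'd::finite \<Rightarrow> real) \<Rightarrow> (int ^ 'd \<Rightarrow> real) \<Rightarrow> bool" where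
  "moderate_or_heavy_tail a \<mu> \<longleftrightarrow>
     (\<exists>(C :: real ^ 'd \<Rightarrow> real) (\<alpha> :: real) (\<delta> :: real) (C\<^sub>\<delta> :: real).
       continuous_on (sphere 0 1) C \<and> (\<forall>v \<in> sphere 0 1. C v > 0) \<and>
       (\<alpha> > 2 \<or> (0 < \<alpha> \<and> \<alpha> < 2)) \<and>
       (\<exists>R. \<forall>z. euclid_norm z \<ge> R \<longrightarrow>
          a z \<le> C (real_point z /\<^sub>R euclid_norm z) / euclid_norm z powr (real CARD('d) + \<alpha>)) \<and>
       0 < \<delta> \<and> \<delta> < 2 * \<alpha> \<and> C\<^sub>\<delta> > 0 \<and>
       \<mu> \<sim>[filtercomap sup_norm at_top]
         (\<lambda>z. C\<^sub>\<delta> / (1 + real (sup_norm z) powr (real CARD('d) + \<delta>))))"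


section \<open>The noise\<close>

text \<open>Processes have type \<^typ>\<open>real \<Rightarrow> 'w \<Rightarrow> real\<close>; only times \<open>t \<ge> 0\<close> matter.\<close>

definition standard_brownian_motion :: "'w measure \<Rightarrow> (real \<Rightarrow> 'w \<Rightarrow> real) \<Rightarrow> bool" where
  "standard_brownian_motion M B \<longleftrightarrow>
     (\<forall>t\<ge>0. B t \<in> borel_measurable M) \<and>
     (AE \<omega> in M. B 0 \<omega> = 0) \<and>
     (AE \<omega> in M. continuous_on {0..} (\<lambda>t. B t \<omega>)) \<and>
     (\<forall>s t. 0 \<le> s \<and> s < t \<longrightarrow>
        distributed M lborel (\<lambda>\<omega>. B t \<omega> - B s \<omega>) (normal_density 0 (sqrt (t - s)))) \<and>
     (\<forall>(n::nat) (\<tau> :: nat \<Rightarrow> real). 0 \<le> \<tau> 0 \<and> (\<forall>i<n. \<tau> i < \<tau> (Suc i)) \<longrightarrow>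
        prob_space.indep_vars M (\<lambda>_. borel) (\<lambda>i \<omega>. B (\<tau> (Suc i)) \<omega> - B (\<tau> i) \<omega>) {..<n})"

text \<open>
  Independence of the processes is independence of the path-valued random variables, i.e. of the
  \<open>\<sigma>\<close>-algebras they generate.
\<close>

definition independent_brownian_motions ::
    "'w measure \<Rightarrow> (real \<Rightarrow> int ^ 'd::finite \<Rightarrow> 'w \<Rightarrow> real) \<Rightarrow> bool" where
  "independent_brownian_motions M w \<longleftrightarrow>
     (\<forall>z. standard_brownian_motion M (\<lambda>t. w t z)) \<and>
     prob_space.indep_vars M (\<lambda>_. PiM {0..} (\<lambda>_. borel)) (\<lambda>z \<omega>. \<lambda>t\<in>{0..}. w t z \<omega>) UNIV"

text \<open>
  \<open>W(t,x) = \<Sum>\<^sub>z b(x - z) w(t,z)\<close>. For square summable \<open>b\<close> the series need not converge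
  absolutely; it converges unconditionally in mean square, which determines \<open>W(t,x)\<close> up to a null
  set.
\<close>

definition noise_field ::
    "'w measure \<Rightarrow> (int ^ 'd::finite \<Rightarrow> real) \<Rightarrow> (real \<Rightarrow> int ^ 'd \<Rightarrow> 'w \<Rightarrow> real) \<Rightarrow>
     (real \<Rightarrow> int ^ 'd \<Rightarrow> 'w \<Rightarrow> real) \<Rightarrow> bool" where
  "noise_field M b w W \<longleftrightarrow> (\<forall>t\<ge>0. \<forall>x. W t x \<in> borel_measurable M \<and>
     ((\<lambda>S. \<integral>\<^sup>+\<omega>. ennreal ((W t x \<omega> - (\<Sum>z\<in>S. b (x - z) * w t z \<omega>))\<^sup>2) \<partial>M) \<longlongrightarrow> 0)
       (finite_subsets_at_top UNIV))"

text \<open>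
  The filtration generated by the Brownian motions, with the usual augmentation by null sets
  (without it not even \<open>W\<close> itself is adapted).
\<close>

definition noise_filtration ::
    "'w measure \<Rightarrow> (real \<Rightarrow> int ^ 'd::finite \<Rightarrow> 'w \<Rightarrow> real) \<Rightarrow> real \<Rightarrow> 'w measure" where
  "noise_filtration M w t = sigma (space M)
     ({w s z -` A \<inter> space M | s z A. 0 \<le> s \<and> s \<le> t \<and> A \<in> sets borel} \<union> null_sets M)"


section \<open>The Ito integral\<close>

text \<open>
  A list of triples \<open>(s, r, \<xi>)\<close> stands for the step process
  \<open>\<Sum> \<xi> \<cdot> indicator {s<..r}\<close>. The intervals may overlap; both the process and its integral are
  additive in the list, so this yields nothing but the usual step processes.
\<close>

type_synonym 'w step_process = "(real \<times> real \<times> ('w \<Rightarrow> real)) list"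

definition step_value :: "'w step_process \<Rightarrow> real \<Rightarrow> 'w \<Rightarrow> real" where
  "step_value S q \<omega> = (\<Sum>(s, r, \<xi>)\<leftarrow>S. \<xi> \<omega> * indicator {s<..r} q)"

definition step_integral :: "(real \<Rightarrow> 'w \<Rightarrow> real) \<Rightarrow> 'w step_process \<Rightarrow> real \<Rightarrow> 'w \<Rightarrow> real" where
  "step_integral X S t \<omega> = (\<Sum>(s, r, \<xi>)\<leftarrow>S. \<xi> \<omega> * (X (min r t) \<omega> - X (min s t) \<omega>))"

definition nonanticipating_step ::
    "'w measure \<Rightarrow> (real \<Rightarrow> 'w measure) \<Rightarrow> 'w step_process \<Rightarrow> bool" where
  "nonanticipating_step M F S \<longleftrightarrow> (\<forall>(s, r, \<xi>) \<in> set S. 0 \<le> s \<and> s \<le> r \<and>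
     \<xi> \<in> borel_measurable (F s) \<and> (\<exists>K. \<forall>\<omega>\<in>space M. \<bar>\<xi> \<omega>\<bar> \<le> K))"

text \<open>
  \<open>ito_integral M F X H t J\<close>: the random variable \<open>J\<close> is (a version of) \<open>\<integral>\<^sub>0\<^sup>t H dX\<close>, for a
  progressively measurable integrand \<open>H\<close> and a Brownian integrator \<open>X\<close> (of any variance): there
  are step processes \<open>H\<^sub>k\<close> such that \<open>\<integral>\<^sub>0\<^sup>t |H - H\<^sub>k|\<^sup>2 ds \<rightarrow> 0\<close> and \<open>\<integral>\<^sub>0\<^sup>t H\<^sub>k dX \<rightarrow> J\<close> in
  probability. Progressive measurability makes the events below measurable.
\<close>

definition ito_integral ::
    "'w measure \<Rightarrow> (real \<Rightarrow> 'w measure) \<Rightarrow> (real \<Rightarrow> 'w \<Rightarrow> real) \<Rightarrow> (real \<Rightarrow> 'w \<Rightarrow> real) \<Rightarrow>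
     real \<Rightarrow> ('w \<Rightarrow> real) \<Rightarrow> bool" where
  "ito_integral M F X H t J \<longleftrightarrow>
     (\<forall>T\<in>{0..t}. (\<lambda>(s, \<omega>). H s \<omega>) \<in> borel_measurable (restrict_space borel {0..T} \<Otimes>\<^sub>M F T)) \<and>
     J \<in> borel_measurable M \<and>
     (\<exists>S :: nat \<Rightarrow> 'w step_process.
        (\<forall>k. nonanticipating_step M F (S k)) \<and>
        (\<forall>\<epsilon>>0. (\<lambda>k. measure M {\<omega> \<in> space M.
            (\<integral>\<^sup>+s\<in>{0..t}. ennreal ((H s \<omega> - step_value (S k) s \<omega>)\<^sup>2) \<partial>lborel) > ennreal \<epsilon>})
            \<longlonglongrightarrow> 0) \<and>
        (\<forall>\<epsilon>>0. (\<lambda>k. measure M {\<omega> \<in> space M. \<bar>step_integral X (S k) t \<omega> - J \<omega>\<bar> > \<epsilon>})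
            \<longlonglongrightarrow> 0))"


section \<open>Solutions\<close>

text \<open>
  Adaptedness is stated coordinatewise, which on the separable Hilbert space \<open>l\<^sup>2(\<int>\<^sup>d,\<mu>)\<close> is the
  same as Borel measurability of the state.
\<close>

definition anderson_solution ::
    "'w measure \<Rightarrow> (real \<Rightarrow> 'w measure) \<Rightarrow> (real \<Rightarrow> int ^ 'd::finite \<Rightarrow> 'w \<Rightarrow> real) \<Rightarrow> real \<Rightarrow>
     (int ^ 'd \<Rightarrow> real) \<Rightarrow> (int ^ 'd \<Rightarrow> real) \<Rightarrow> (real \<Rightarrow> int ^ 'd \<Rightarrow> 'w \<Rightarrow> real) \<Rightarrow> bool" where
  "anderson_solution M F W \<kappa> a \<mu> u \<longleftrightarrow>
     (\<forall>\<omega>\<in>space M. \<forall>t\<ge>0. (\<lambda>x. u t x \<omega>) \<in> l2w \<mu>) \<and>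
     (\<forall>\<omega>\<in>space M. \<forall>t\<ge>0.
        ((\<lambda>s. l2w_norm \<mu> (\<lambda>x. u s x \<omega> - u t x \<omega>)) \<longlongrightarrow> 0) (at t within {0..})) \<and>
     (\<forall>t\<ge>0. \<forall>x. u t x \<in> borel_measurable (F t)) \<and>
     (\<forall>t\<ge>0. \<forall>x. \<exists>J. ito_integral M F (\<lambda>s. W s x) (\<lambda>s. u s x) t J \<and>
        (AE \<omega> in M. u t x \<omega> =
           1 + (LINT s:{0..t}|lborel. \<kappa> * generator a (\<lambda>y. u s y \<omega>) x) + J \<omega>))"

end

theory Submission
  imports Defs
begin

text \<open>
  On \<open>l\<^sup>2(\<int>\<^sup>d, \<mu>)\<close> the generator is bounded: in the light-tailed case by the Cauchy--Schwarz
  inequality with the weight \<open>(\<mu> 0 / \<mu> z) ^ (1/2)\<close>, in the other case because the kernel is comparable to a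
  convolution near the diagonal and Hilbert--Schmidt away from it. Each \<open>W(\<cdot>, x)\<close> has a continuous
  version whose increments over \<open>[s, r]\<close> have, given the past, mean \<open>0\<close> and variance
  \<open>(r - s) \<Sum>\<^sub>z b\<^sup>2(z)\<close>. Ito's isometry and Doob's inequality, summed over \<open>x\<close> with the weights
  \<open>\<mu> x\<close>, bound the stochastic integral of a process in terms of \<open>\<integral>\<^sub>0\<^sup>t E \<parallel>u(s)\<parallel>\<^sub>\<mu>\<^sup>2 ds\<close>, uniformly in
  time; since the constant function \<open>1\<close> lies in the space, Picard iteration converges. For the
  difference of two solutions no moments are known; it is cut off when its norm exceeds \<open>n\<close>, the
  equation persists up to that time, and Gronwall's argument shows that the truncation vanishes.
\<close>

section \<open>Boundedness of the generator\<close>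

text \<open>Estimates are kept in \<open>ennreal\<close>, for squared quantities, with (x + y)^2 <=
  2 x^2 + 2 y^2 as triangle inequality; most powers of 2 in the constants come from there. No single
  Picard step has to be a contraction: it is bounded by a time integral of the previous difference,
  and iterating gives c (C T)^k / k!, which beats the weights 2^k that turn bounds on squared
  increments into uniform convergence. Two obstacles shape the rest. \<open>W t x\<close> is fixed
  only up to a null set at each separate time, while maximal inequalities need continuous paths; so
  the work is done with a continuous version, and the integral is carried over because a step
  integral looks at finitely many times. And the stochastic integral of an arbitrary solution is
  known only as a limit in probability. Cutting off the solution is compatible with that limit
  because step processes that are small in L^2(0, t) on an event have small integrals on that event,
  whatever the event is.\<close>

lemma sum_squares_bound_ennreal: "2 * (a * b) \<le> a\<^sup>2 + (b::ennreal)\<^sup>2"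
proof (cases a; cases b)
  fix r s :: real
  assume rs: "a = ennreal r" "0 \<le> r" "b = ennreal s" "0 \<le> s"
  have "ennreal (2 * r * s) \<le> ennreal (r\<^sup>2 + s\<^sup>2)"
    by (intro ennreal_leI sum_squares_bound)
  thus ?thesis using rs
    by (simp add: ennreal_mult' ennreal_power ennreal_plus[symmetric] mult.assoc del: ennreal_plus)
qed (auto simp: power2_eq_square ennreal_top_mult ennreal_mult_top)

lemma power2_sum_le_ennreal: "(a + b)\<^sup>2 \<le> 2 * a\<^sup>2 + 2 * (b::ennreal)\<^sup>2"
proof -
  have "(a + b)\<^sup>2 = a\<^sup>2 + b\<^sup>2 + (a * b + a * b)"
    by (simp add: power2_eq_square distrib_left distrib_right ac_simps)
  also have "\<dots> = a\<^sup>2 + b\<^sup>2 + 2 * (a * b)" by (simp only: mult_2[symmetric])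
  also have "\<dots> \<le> a\<^sup>2 + b\<^sup>2 + (a\<^sup>2 + b\<^sup>2)"
    by (intro add_left_mono sum_squares_bound_ennreal)
  finally show ?thesis by (simp add: mult_2 ac_simps)
qed

text \<open>Symmetrization: twice the left side is an iterated integral of 2 u v with u = f x g y
  and v = f y g x, and 2 u v <= u^2 + v^2 pointwise. Both iterated integrals are evaluated by
  pulling constants out of the inner one, which is valid for every measure and for infinite
  values.\<close>

lemma Cauchy_Schwarz_nn_integral:
  assumes [measurable]: "f \<in> borel_measurable M" "g \<in> borel_measurable M"
  shows "(\<integral>\<^sup>+x. f x * g x \<partial>M)\<^sup>2 \<le> (\<integral>\<^sup>+x. (f x)\<^sup>2 \<partial>M) * (\<integral>\<^sup>+x. (g x)\<^sup>2 \<partial>M)"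
    (is "?I\<^sup>2 \<le> ?F * ?G")
proof -
  have "2 * ?I\<^sup>2 = (\<integral>\<^sup>+x. \<integral>\<^sup>+y. 2 * ((f x * g y) * (f y * g x)) \<partial>M \<partial>M)"
  proof -
    have "(\<integral>\<^sup>+y. 2 * ((f x * g y) * (f y * g x)) \<partial>M) = (2 * ?I) * (f x * g x)" for x
    proof -
      have "(\<integral>\<^sup>+y. 2 * ((f x * g y) * (f y * g x)) \<partial>M) = (\<integral>\<^sup>+y. (2 * (f x * g x)) * (f y * g y) \<partial>M)"
        by (intro nn_integral_cong) (simp add: ac_simps)
      also have "\<dots> = (2 * (f x * g x)) * ?I"
        by (rule nn_integral_cmult) simp
      finally show ?thesis by (simp only: mult.assoc mult.commute[of ?I])
    qed
    hence "(\<integral>\<^sup>+x. \<integral>\<^sup>+y. 2 * ((f x * g y) * (f y * g x)) \<partial>M \<partial>M) = (2 * ?I) * ?I"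
      by (simp only:) (simp add: nn_integral_cmult)
    thus ?thesis by (simp add: power2_eq_square mult.assoc)
  qed
  also have "\<dots> \<le> (\<integral>\<^sup>+x. \<integral>\<^sup>+y. (f x * g y)\<^sup>2 + (f y * g x)\<^sup>2 \<partial>M \<partial>M)"
    by (intro nn_integral_mono sum_squares_bound_ennreal)
  also have "\<dots> = 2 * (?F * ?G)"
    by (simp add: power_mult_distrib nn_integral_add nn_integral_cmult nn_integral_multc mult_2 ac_simps)
  finally show ?thesis
    by (simp add: ennreal_mult_le_mult_iff)
qed

section \<open>Translations, and two weighted bounds for averaging kernels\<close>

lemma nn_integral_shift_count_space:
  fixes x :: "'a::group_add"
  shows "(\<integral>\<^sup>+z. h (x + z) \<partial>count_space UNIV) = (\<integral>\<^sup>+z. h z \<partial>count_space UNIV)"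
  by (intro nn_integral_bij_count_space bij_betwI[where g="\<lambda>y. - x + y"]) (auto simp: add.assoc[symmetric])

lemma nn_integral_shift_count_space':
  fixes x :: "'a::ab_group_add"
  shows "(\<integral>\<^sup>+z. h (z + x) \<partial>count_space UNIV) = (\<integral>\<^sup>+z. h z \<partial>count_space UNIV)"
  using nn_integral_shift_count_space[of h x] by (simp add: add.commute)

lemma nn_integral_swap_count_space:
  "(\<integral>\<^sup>+x. \<integral>\<^sup>+y. f x y \<partial>count_space UNIV \<partial>count_space UNIV) =
   (\<integral>\<^sup>+y. \<integral>\<^sup>+x. f x y \<partial>count_space UNIV \<partial>count_space UNIV)"
  using nn_integral_fst_count_space[of "\<lambda>(x, y). f x y"] nn_integral_snd_count_space[of "\<lambda>(x, y). f x y"]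
  by simp

text \<open>Schur's test with the weight h: split a = sqrt (a h) sqrt (a / h) and apply
  Cauchy-Schwarz, which costs one factor \<open>?S\<close>. The hypothesis \<open>near\<close> then
  trades \<open>\<mu> x / h z\<close> for \<open>h z * \<mu> (x + z)\<close>, and translation
  invariance turns the remaining double sum into a second factor \<open>?S\<close>.\<close>

lemma near_kernel_bound:
  fixes a h \<mu> :: "'a::ab_group_add \<Rightarrow> real" and g :: "'a \<Rightarrow> ennreal"
  assumes nn: "\<And>z. a z \<ge> 0" "\<And>x. \<mu> x \<ge> 0" "\<And>z. h z > 0"
    and near: "\<And>x z. N x z \<Longrightarrow> \<mu> x \<le> (h z)\<^sup>2 * \<mu> (x + z)"
  shows "(\<integral>\<^sup>+x. \<mu> x * (\<integral>\<^sup>+z. a z * (of_bool (N x z) * g (x + z)) \<partial>count_space UNIV)\<^sup>2 \<partial>count_space UNIV)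
    \<le> (\<integral>\<^sup>+z. a z * h z \<partial>count_space UNIV)\<^sup>2 * (\<integral>\<^sup>+x. \<mu> x * (g x)\<^sup>2 \<partial>count_space UNIV)"
    (is "?L \<le> ?S\<^sup>2 * ?G")
proof -
  have inner: "(\<integral>\<^sup>+z. a z * (of_bool (N x z) * g (x + z)) \<partial>count_space UNIV)\<^sup>2
      \<le> ?S * (\<integral>\<^sup>+z. ennreal (a z / h z) * (of_bool (N x z) * (g (x + z))\<^sup>2) \<partial>count_space UNIV)" for x
  proof -
    have eq: "ennreal (a z) = ennreal (sqrt (a z * h z)) * ennreal (sqrt (a z / h z))" for z
    proof -
      have "sqrt (a z * h z) * sqrt (a z / h z) = a z"
        using nn(1)[of z] nn(3)[of z] by (simp add: real_sqrt_mult[symmetric] power2_eq_square[symmetric])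
      thus ?thesis using nn(1)[of z] nn(3)[of z] by (metis ennreal_mult less_imp_le mult_nonneg_nonneg real_sqrt_ge_zero divide_nonneg_pos)
    qed
    have "(\<integral>\<^sup>+z. a z * (of_bool (N x z) * g (x + z)) \<partial>count_space UNIV)\<^sup>2 =
      (\<integral>\<^sup>+z. ennreal (sqrt (a z * h z)) * (ennreal (sqrt (a z / h z)) * (of_bool (N x z) * g (x + z))) \<partial>count_space UNIV)\<^sup>2"
      by (simp add: eq mult.assoc)
    also have "\<dots> \<le> (\<integral>\<^sup>+z. (ennreal (sqrt (a z * h z)))\<^sup>2 \<partial>count_space UNIV) *
        (\<integral>\<^sup>+z. (ennreal (sqrt (a z / h z)) * (of_bool (N x z) * g (x + z)))\<^sup>2 \<partial>count_space UNIV)"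
      by (intro Cauchy_Schwarz_nn_integral) auto
    also have "\<dots> = ?S * (\<integral>\<^sup>+z. ennreal (a z / h z) * (of_bool (N x z) * (g (x + z))\<^sup>2) \<partial>count_space UNIV)"
      using nn less_imp_le[OF nn(3)]
      by (intro arg_cong2[where f="(*)"] nn_integral_cong)
         (auto simp: power_mult_distrib ennreal_power divide_nonneg_pos ennreal_mult)
    finally show ?thesis .
  qed
  have "?L \<le> (\<integral>\<^sup>+x. \<mu> x * (?S * (\<integral>\<^sup>+z. ennreal (a z / h z) * (of_bool (N x z) * (g (x + z))\<^sup>2) \<partial>count_space UNIV)) \<partial>count_space UNIV)"
    by (intro nn_integral_mono mult_left_mono inner) auto
  also have "\<dots> = ?S * (\<integral>\<^sup>+x. \<integral>\<^sup>+z. ennreal (\<mu> x) * (ennreal (a z / h z) * (of_bool (N x z) * (g (x + z))\<^sup>2)) \<partial>count_space UNIV \<partial>count_space UNIV)"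
    by (subst nn_integral_cmult[symmetric], simp, subst nn_integral_cmult, simp)
       (auto intro!: nn_integral_cong simp: ac_simps nn_integral_cmult[symmetric])
  also have "(\<integral>\<^sup>+x. \<integral>\<^sup>+z. ennreal (\<mu> x) * (ennreal (a z / h z) * (of_bool (N x z) * (g (x + z))\<^sup>2)) \<partial>count_space UNIV \<partial>count_space UNIV)
    \<le> (\<integral>\<^sup>+x. \<integral>\<^sup>+z. ennreal (a z * h z) * (\<mu> (x + z) * (g (x + z))\<^sup>2) \<partial>count_space UNIV \<partial>count_space UNIV)"
  proof (intro nn_integral_mono)
    fix x z
    show "ennreal (\<mu> x) * (ennreal (a z / h z) * (of_bool (N x z) * (g (x + z))\<^sup>2)) \<le> ennreal (a z * h z) * (\<mu> (x + z) * (g (x + z))\<^sup>2)"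
    proof (cases "N x z")
      case True
      have "\<mu> x * (a z / h z) \<le> (h z)\<^sup>2 * \<mu> (x + z) * (a z / h z)"
        using near[OF True] nn(1)[of z] nn(3)[of z] by (intro mult_right_mono) auto
      also have "\<dots> = a z * h z * \<mu> (x + z)"
        using nn(3)[of z] by (simp add: power2_eq_square)
      finally have "ennreal (\<mu> x) * ennreal (a z / h z) \<le> ennreal (a z * h z) * ennreal (\<mu> (x + z))"
        using nn(1,2) nn(3)[of z] by (simp add: ennreal_mult[symmetric] divide_nonneg_pos less_imp_le ennreal_leI)
      from mult_right_mono[OF this, of "(g (x + z))\<^sup>2"] show ?thesis
        using True by (simp add: mult.assoc)
    qed auto
  qed
  also have "(\<integral>\<^sup>+x. \<integral>\<^sup>+z. ennreal (a z * h z) * (\<mu> (x + z) * (g (x + z))\<^sup>2) \<partial>count_space UNIV \<partial>count_space UNIV) = ?S * ?G"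
    by (subst nn_integral_swap_count_space)
       (simp add: nn_integral_cmult nn_integral_multc nn_integral_shift_count_space'[of "\<lambda>y. \<mu> y * (g y)\<^sup>2"])
  finally show ?thesis
    by (simp add: power2_eq_square mult.assoc mult_left_mono)
qed

text \<open>A Hilbert-Schmidt bound: the majorant of \<open>a z\<close> depends on the target point
  x + z only, so Cauchy-Schwarz over the target bounds the inner sum uniformly in x, and summing
  over x costs the total mass of \<mu>.\<close>

lemma far_kernel_bound:
  fixes a \<rho> \<mu> :: "'a::ab_group_add \<Rightarrow> real" and g :: "'a \<Rightarrow> ennreal"
  assumes nn: "\<And>z. a z \<ge> 0" "\<And>x. \<mu> x \<ge> 0" "\<And>z. \<rho> z \<ge> 0"
    and far: "\<And>x z. N x z \<Longrightarrow> (a z)\<^sup>2 \<le> \<rho> (x + z) * \<mu> (x + z)"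
  shows "(\<integral>\<^sup>+x. \<mu> x * (\<integral>\<^sup>+z. a z * (of_bool (N x z) * g (x + z)) \<partial>count_space UNIV)\<^sup>2 \<partial>count_space UNIV)
    \<le> (\<integral>\<^sup>+z. \<mu> z \<partial>count_space UNIV) * (\<integral>\<^sup>+z. \<rho> z \<partial>count_space UNIV) * (\<integral>\<^sup>+x. \<mu> x * (g x)\<^sup>2 \<partial>count_space UNIV)"
    (is "?L \<le> ?U * ?R * ?G")
proof -
  have inner: "(\<integral>\<^sup>+z. a z * (of_bool (N x z) * g (x + z)) \<partial>count_space UNIV)\<^sup>2 \<le> ?R * ?G" for x
  proof -
    have "(\<integral>\<^sup>+z. a z * (of_bool (N x z) * g (x + z)) \<partial>count_space UNIV) \<le>
        (\<integral>\<^sup>+z. ennreal (sqrt (\<rho> (x + z))) * (ennreal (sqrt (\<mu> (x + z))) * g (x + z)) \<partial>count_space UNIV)"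
    proof (intro nn_integral_mono)
      fix z
      show "a z * (of_bool (N x z) * g (x + z)) \<le> ennreal (sqrt (\<rho> (x + z))) * (ennreal (sqrt (\<mu> (x + z))) * g (x + z))"
      proof (cases "N x z")
        case True
        have "a z \<le> sqrt (\<rho> (x + z)) * sqrt (\<mu> (x + z))"
          using far[OF True] nn(1)[of z] by (metis real_sqrt_le_mono real_sqrt_mult real_sqrt_unique)
        hence "ennreal (a z) \<le> ennreal (sqrt (\<rho> (x + z))) * ennreal (sqrt (\<mu> (x + z)))"
          using nn by (simp add: ennreal_mult[symmetric] ennreal_leI)
        from mult_right_mono[OF this, of "g (x + z)"] show ?thesis
          using True by (simp add: mult.assoc)
      qed auto
    qed
    also have "\<dots> = (\<integral>\<^sup>+y. ennreal (sqrt (\<rho> y)) * (ennreal (sqrt (\<mu> y)) * g y) \<partial>count_space UNIV)"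
      by (rule nn_integral_shift_count_space)
    finally have "(\<integral>\<^sup>+z. a z * (of_bool (N x z) * g (x + z)) \<partial>count_space UNIV)\<^sup>2 \<le> \<dots>\<^sup>2"
      by (simp add: power_mono)
    also have "\<dots> \<le> (\<integral>\<^sup>+y. (ennreal (sqrt (\<rho> y)))\<^sup>2 \<partial>count_space UNIV) * (\<integral>\<^sup>+y. (ennreal (sqrt (\<mu> y)) * g y)\<^sup>2 \<partial>count_space UNIV)"
      by (intro Cauchy_Schwarz_nn_integral) auto
    also have "\<dots> = ?R * ?G"
      using nn by (simp add: power_mult_distrib ennreal_power)
    finally show ?thesis .
  qed
  have "?L \<le> (\<integral>\<^sup>+x. \<mu> x * (?R * ?G) \<partial>count_space UNIV)"
    by (intro nn_integral_mono mult_left_mono inner) auto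
  also have "\<dots> = ?U * ?R * ?G"
    by (simp add: nn_integral_multc mult.assoc)
  finally show ?thesis .
qed

section \<open>The sup norm and regular weights\<close>

lemma le_sup_norm: "nat \<bar>z $ i\<bar> \<le> sup_norm z"
  unfolding sup_norm_def by (rule Max_ge) auto

lemma sup_norm_le: "(\<And>i. nat \<bar>z $ i\<bar> \<le> n) \<Longrightarrow> sup_norm z \<le> n"
  unfolding sup_norm_def by (subst Max_le_iff) auto

lemma sup_norm_add: "sup_norm (x + z) \<le> sup_norm x + sup_norm z"
proof (rule sup_norm_le)
  fix i
  show "nat \<bar>(x + z) $ i\<bar> \<le> sup_norm x + sup_norm z"
    using le_sup_norm[of x i] le_sup_norm[of z i] by simp
qed

lemma sup_norm_const: "sup_norm (\<chi> i. int n :: int ^ 'd::finite) = n"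
  by (simp add: sup_norm_def)

lemma sup_norm_0 [simp]: "sup_norm 0 = 0"
  by (simp add: sup_norm_def)

text \<open>The points with all coordinates equal to n show that m is positive at every n; with this
  the quotients in \<open>regular_weight\<close> can be cleared of denominators.\<close>

lemma regular_weight_profile:
  fixes \<mu> :: "int ^ 'd::finite \<Rightarrow> real"
  assumes "regular_weight \<mu>"
  obtains m where "\<And>x. \<mu> x = m (sup_norm x)" "\<And>n. m n > 0" "decseq m"
    "decseq (\<lambda>n. m n / m (Suc n))"
proof -
  from assms obtain m where m: "\<And>x. \<mu> x = m (sup_norm x)"
    "\<And>n. m n / m (Suc n) \<ge> m (Suc n) / m (Suc (Suc n))" "\<And>n. m n / m (Suc n) \<ge> 1" "\<And>x. \<mu> x > 0"
    unfolding regular_weight_def by auto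
  have pos: "m n > 0" for n
    using m(1)[of "\<chi> i. int n"] m(4)[of "\<chi> i. int n"] by (simp add: sup_norm_const)
  have "decseq m"
    using m(3) pos by (intro decseq_SucI) (simp add: le_divide_eq)
  moreover have "decseq (\<lambda>n. m n / m (Suc n))"
    using m(2) by (intro decseq_SucI)
  ultimately show thesis using m(1) pos by (intro that[of m])
qed

text \<open>Decreasing quotients m n / m (n + 1) say that log m is convex, whence m j * m k <= m 0 *
  m (j + k). Since m decreases, the triangle inequality for the sup norm then replaces j + k by the
  norm of x + z.\<close>

lemma regular_weight_shift:
  assumes "regular_weight \<mu>"
  shows "\<mu> x \<le> \<mu> 0 / \<mu> z * \<mu> (x + z)"
proof -
  obtain m where m: "\<And>x. \<mu> x = m (sup_norm x)" "\<And>n. m n > 0" "decseq m"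
    "decseq (\<lambda>n. m n / m (Suc n))"
    using regular_weight_profile[OF assms] by blast
  have sub: "m j * m k \<le> m 0 * m (j + k)" for j k
  proof (induction k)
    case (Suc k)
    have "m (j + k) / m (Suc (j + k)) \<le> m k / m (Suc k)"
      using m(4) by (simp add: decseq_def)
    hence r: "m (j + k) * m (Suc k) \<le> m k * m (Suc (j + k))"
      using m(2) by (simp add: field_simps)
    have "(m j * m (Suc k)) * m k = (m j * m k) * m (Suc k)" by simp
    also have "\<dots> \<le> m 0 * m (j + k) * m (Suc k)"
      using Suc m(2) by (intro mult_right_mono) (auto intro: less_imp_le)
    also have "\<dots> \<le> m 0 * (m k * m (Suc (j + k)))"
      using r m(2)[of 0] by (simp add: mult.assoc)
    finally have "(m j * m (Suc k)) * m k \<le> (m 0 * m (j + Suc k)) * m k" by (simp add: ac_simps)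
    thus ?case using m(2)[of k] by simp
  qed simp
  have "m (sup_norm x) * m (sup_norm z) \<le> m 0 * m (sup_norm x + sup_norm z)" by (rule sub)
  also have "\<dots> \<le> m 0 * m (sup_norm (x + z))"
    using m(2)[of 0] decseqD[OF m(3) sup_norm_add[of x z]] by simp
  finally show ?thesis using m(2)[of "sup_norm z"] by (simp add: m(1) field_simps)
qed

section \<open>Sums over the lattice as integrals for counting measure, and their
  convergence\<close>

lemma summable_on_iff_nn_integral:
  fixes f :: "'a \<Rightarrow> real"
  assumes "\<And>x. f x \<ge> 0"
  shows "f summable_on UNIV \<longleftrightarrow> (\<integral>\<^sup>+x. ennreal (f x) \<partial>count_space UNIV) < \<top>"
proof -
  have "f summable_on UNIV \<longleftrightarrow> (\<lambda>x. norm (f x)) summable_on UNIV"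
    using assms by simp
  also have "\<dots> \<longleftrightarrow> integrable (count_space UNIV) f"
    using abs_summable_equivalent[of f UNIV] by (simp add: Infinite_Set_Sum.abs_summable_on_def)
  also have "\<dots> \<longleftrightarrow> (\<integral>\<^sup>+x. ennreal (f x) \<partial>count_space UNIV) < \<top>"
    using assms by (simp add: integrable_iff_bounded)
  finally show ?thesis .
qed

lemma infsum_eq_integral_count_space:
  fixes f :: "'a \<Rightarrow> real"
  assumes "(\<lambda>x. \<bar>f x\<bar>) summable_on UNIV"
  shows "infsum f UNIV = (\<integral>x. f x \<partial>count_space UNIV)"
proof -
  have "Infinite_Set_Sum.abs_summable_on f UNIV"
    using assms abs_summable_equivalent[of f UNIV] by simp
  from infsetsum_infsum[OF this] show ?thesis by (simp add: infsetsum_def)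
qed

lemma ennreal_infsum:
  fixes f :: "'a \<Rightarrow> real"
  assumes "\<And>x. f x \<ge> 0" "f summable_on UNIV"
  shows "ennreal (infsum f UNIV) = (\<integral>\<^sup>+x. ennreal (f x) \<partial>count_space UNIV)"
  using assms summable_on_iff_nn_integral[of f]
  by (subst infsum_eq_integral_count_space) (simp_all add: integral_eq_nn_integral)

text \<open>Each coordinate is at most the sup norm, so for decreasing \<psi> the d-th power of
  \<psi> at the norm is at most the product of \<psi> over the coordinates. Over a cube this product
  sums to the d-th power of a one-dimensional sum, so no lattice points on spheres are
  counted.\<close>

lemma lattice_summable:
  fixes \<psi> :: "nat \<Rightarrow> real"
  assumes "decseq \<psi>" "\<And>n. \<psi> n \<ge> 0" "summable \<psi>"
  shows "(\<lambda>z::int ^ 'd::finite. \<psi> (sup_norm z) ^ CARD('d)) summable_on UNIV"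
proof (rule nonneg_bdd_above_summable_on)
  show "bdd_above (sum (\<lambda>z::int ^ 'd. \<psi> (sup_norm z) ^ CARD('d)) ` {F. F \<subseteq> UNIV \<and> finite F})"
  proof (rule bdd_aboveI2)
    fix F :: "(int ^ 'd) set" assume "F \<in> {F. F \<subseteq> UNIV \<and> finite F}"
    hence F: "finite F" by simp
    define N where "N = Max (insert 0 (sup_norm ` F))"
    have N: "sup_norm z \<le> N" if "z \<in> F" for z
      using that F unfolding N_def by (intro Max_ge) auto
    define I where "I = {- int N..int N}"
    have one: "(\<Sum>k\<in>I. \<psi> (nat \<bar>k\<bar>)) \<le> 2 * suminf \<psi>"
    proof -
      \<comment> \<open>Both halves contain 0; the double count only enlarges the right
        side.\<close>
      have "(\<Sum>k\<in>I. \<psi> (nat \<bar>k\<bar>)) \<le> (\<Sum>k\<in>{0..int N}. \<psi> (nat \<bar>k\<bar>)) + (\<Sum>k\<in>{- int N..0}. \<psi> (nat \<bar>k\<bar>))"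
        using assms(2) unfolding I_def
        by (subst sum.union_inter[symmetric])
           (auto intro!: sum_mono2 add_increasing2 sum_nonneg simp: ivl_disj_un)
      also have "(\<Sum>k\<in>{0..int N}. \<psi> (nat \<bar>k\<bar>)) = (\<Sum>n\<le>N. \<psi> n)"
        by (rule sum.reindex_bij_witness[of _ int nat]) auto
      also have "(\<Sum>k\<in>{- int N..0}. \<psi> (nat \<bar>k\<bar>)) = (\<Sum>n\<le>N. \<psi> n)"
        by (rule sum.reindex_bij_witness[of _ "\<lambda>n. - int n" "\<lambda>k. nat (- k)"]) auto
      also have "(\<Sum>n\<le>N. \<psi> n) \<le> suminf \<psi>"
        using assms by (intro sum_le_suminf) auto
      finally show ?thesis by simp
    qed
    have "(\<Sum>z\<in>F. \<psi> (sup_norm z) ^ CARD('d)) \<le> (\<Sum>z\<in>F. \<Prod>i\<in>UNIV. \<psi> (nat \<bar>z $ i\<bar>))"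
    proof (rule sum_mono)
      fix z :: "int ^ 'd"
      have "\<psi> (sup_norm z) ^ CARD('d) = (\<Prod>i\<in>(UNIV::'d set). \<psi> (sup_norm z))" by simp
      also have "\<dots> \<le> (\<Prod>i\<in>UNIV. \<psi> (nat \<bar>z $ i\<bar>))"
        using assms(2) decseqD[OF assms(1) le_sup_norm] by (intro prod_mono) auto
      finally show "\<psi> (sup_norm z) ^ CARD('d) \<le> (\<Prod>i\<in>UNIV. \<psi> (nat \<bar>z $ i\<bar>))" .
    qed
    also have "\<dots> = (\<Sum>p\<in>($) ` F. \<Prod>i\<in>UNIV. \<psi> (nat \<bar>p i\<bar>))"
      by (subst sum.reindex) (auto simp: inj_on_def vec_eq_iff fun_eq_iff)
    also have "\<dots> \<le> (\<Sum>p\<in>PiE (UNIV::'d set) (\<lambda>_. I). \<Prod>i\<in>UNIV. \<psi> (nat \<bar>p i\<bar>))"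
    proof (rule sum_mono2)
      show "($) ` F \<subseteq> PiE (UNIV::'d set) (\<lambda>_. I)"
      proof
        fix p assume "p \<in> ($) ` F"
        then obtain z where z: "z \<in> F" "p = ($) z" by auto
        have "z $ i \<in> I" for i using N[OF z(1)] le_sup_norm[of z i] by (auto simp: I_def)
        thus "p \<in> PiE UNIV (\<lambda>_. I)" using z by auto
      qed
    qed (auto intro!: finite_PiE prod_nonneg assms(2) simp: I_def)
    also have "\<dots> = (\<Sum>k\<in>I. \<psi> (nat \<bar>k\<bar>)) ^ CARD('d)"
      by (subst prod_sum_PiE[symmetric]) (auto simp: I_def)
    also have "\<dots> \<le> (2 * suminf \<psi>) ^ CARD('d)"
      using one assms(2) by (intro power_mono sum_nonneg) auto
    finally show "(\<Sum>z\<in>F. \<psi> (sup_norm z) ^ CARD('d)) \<le> (2 * suminf \<psi>) ^ CARD('d)" .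
  qed
qed (use assms(2) in auto)

text \<open>The one-dimensional profile is the d-th root of the summand, so s > d becomes the
  condition s / d > 1 for a convergent power series of reciprocals.\<close>

lemma lattice_summable_powr:
  assumes "s > real CARD('d)"
  shows "(\<lambda>z::int ^ 'd::finite. (1 + real (sup_norm z)) powr (- s)) summable_on UNIV"
proof -
  define \<psi> where "\<psi> n = (1 + real n) powr (- s / CARD('d))" for n
  have "summable (\<lambda>n. real n powr (- s / CARD('d)))"
    using assms by (subst summable_real_powr_iff) (simp add: field_simps)
  hence "summable \<psi>"
    unfolding \<psi>_def using summable_Suc_iff[of "\<lambda>n. real n powr (- s / CARD('d))"] by (simp add: add.commute)
  moreover have "decseq \<psi>"
    using assms unfolding \<psi>_def by (intro decseq_SucI powr_mono2') (auto simp: field_simps)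
  moreover have "\<psi> n \<ge> 0" for n by (simp add: \<psi>_def)
  ultimately have "(\<lambda>z::int ^ 'd. \<psi> (sup_norm z) ^ CARD('d)) summable_on UNIV"
    by (intro lattice_summable)
  also have "(\<lambda>z::int ^ 'd. \<psi> (sup_norm z) ^ CARD('d)) = (\<lambda>z. (1 + real (sup_norm z)) powr (- s))"
    by (simp add: \<psi>_def powr_power)
  finally show ?thesis .
qed

lemma lattice_summable_exp:
  assumes "\<epsilon> > 0"
  shows "(\<lambda>z::int ^ 'd::finite. exp (- \<epsilon> * real (sup_norm z))) summable_on UNIV"
proof -
  define \<psi> where "\<psi> n = exp (- \<epsilon> / CARD('d)) ^ n" for n
  have "summable \<psi>"
    unfolding \<psi>_def using assms by (intro summable_geometric) (simp add: field_simps)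
  moreover have "decseq \<psi>"
    using assms unfolding \<psi>_def by (intro decseq_SucI) (auto simp: field_simps mult_le_cancel_right1)
  moreover have "\<psi> n \<ge> 0" for n by (simp add: \<psi>_def)
  ultimately have "(\<lambda>z::int ^ 'd. \<psi> (sup_norm z) ^ CARD('d)) summable_on UNIV"
    by (intro lattice_summable)
  also have "(\<lambda>z::int ^ 'd. \<psi> (sup_norm z) ^ CARD('d)) = (\<lambda>z. exp (- \<epsilon> * real (sup_norm z)))"
    by (simp add: \<psi>_def exp_of_nat_mult[symmetric] power_mult[symmetric] mult.commute)
  finally show ?thesis .
qed

text \<open>Boundedness of the averaging operator on the weighted space, K being a bound for the
  square of its norm. Letting g take values in \<open>ennreal\<close> makes convergence of the
  averages a consequence of the bound instead of a precondition.\<close>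

definition kernel_bound :: "(int ^ 'd::finite \<Rightarrow> real) \<Rightarrow> (int ^ 'd \<Rightarrow> real) \<Rightarrow> ennreal \<Rightarrow> bool" where
  "kernel_bound a \<mu> K \<longleftrightarrow> K < \<top> \<and>
    (\<forall>g. (\<integral>\<^sup>+x. \<mu> x * (\<integral>\<^sup>+z. a z * g (x + z) \<partial>count_space UNIV)\<^sup>2 \<partial>count_space UNIV)
      \<le> K * (\<integral>\<^sup>+x. \<mu> x * (g x)\<^sup>2 \<partial>count_space UNIV))"

text \<open>By \<open>regular_weight_shift\<close> the chosen weight makes every pair x, z near. The
  product a h decays like exp (- (\<eta> - \<gamma> / 2) |z|), so
  \<open>\<gamma> < 2 * \<eta>\<close> is what makes the Schur sum converge.\<close>

lemma light_tail_kernel_bound: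
  fixes \<mu> :: "int ^ 'd::finite \<Rightarrow> real"
  assumes "regular_weight \<mu>" "walk_kernel a" "light_tail a \<mu>"
  shows "\<exists>K. kernel_bound a \<mu> K"
proof -
  from assms(3) obtain c \<eta> \<gamma> :: real where c: "c > 0" "\<eta> > 0" "\<gamma> < 2 * \<eta>"
    "\<And>z. a z \<le> c * exp (- \<eta> * real (sup_norm z))" "\<And>z. \<mu> z > exp (- \<gamma> * real (sup_norm z))"
    unfolding light_tail_def by blast
  have a: "\<And>z. a z \<ge> 0" using assms(2) by (simp add: walk_kernel_def)
  have \<mu>: "\<And>z. \<mu> z > 0" using assms(1) by (simp add: regular_weight_def)
  define h where "h z = sqrt (\<mu> 0 / \<mu> z)" for z
  have h: "h z > 0" for z using \<mu> by (simp add: h_def)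
  let ?S = "\<integral>\<^sup>+z. a z * h z \<partial>count_space UNIV"
  have "a z * h z \<le> c * sqrt (\<mu> 0) * exp (- (\<eta> - \<gamma> / 2) * real (sup_norm z))" for z
  proof -
    have "h z \<le> sqrt (\<mu> 0 / exp (- \<gamma> * real (sup_norm z)))"
      unfolding h_def using \<mu> c(5)[of z] by (intro real_sqrt_le_mono divide_left_mono) (auto simp: less_imp_le)
    also have "\<dots> = sqrt (\<mu> 0) * exp (\<gamma> / 2 * real (sup_norm z))"
      by (rule real_sqrt_unique) (use \<mu>[of 0] in \<open>auto simp: power_mult_distrib exp_minus field_simps exp_double[symmetric]\<close>)
    finally have "a z * h z \<le> (c * exp (- \<eta> * real (sup_norm z))) * (sqrt (\<mu> 0) * exp (\<gamma> / 2 * real (sup_norm z)))"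
      using a c(4)[of z] h[of z] c(1) by (intro mult_mono) (auto intro: less_imp_le)
    also have "\<dots> = c * sqrt (\<mu> 0) * (exp (- \<eta> * real (sup_norm z)) * exp (\<gamma> / 2 * real (sup_norm z)))" by simp
    also have "\<dots> = c * sqrt (\<mu> 0) * exp (- (\<eta> - \<gamma> / 2) * real (sup_norm z))"
      by (simp only: exp_add[symmetric]) (simp add: algebra_simps)
    finally show ?thesis .
  qed
  moreover have "(\<lambda>z. c * sqrt (\<mu> 0) * exp (- (\<eta> - \<gamma> / 2) * real (sup_norm z))) summable_on UNIV"
    using c(3) by (intro summable_on_cmult_right lattice_summable_exp) auto
  ultimately have "(\<lambda>z. a z * h z) summable_on UNIV"
    using a h by (intro summable_on_comparison_test[of _ UNIV "\<lambda>z. a z * h z"]) (auto intro!: mult_nonneg_nonneg less_imp_le[OF h])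
  hence "?S < \<top>"
    using a h by (subst summable_on_iff_nn_integral[symmetric]) (auto intro!: mult_nonneg_nonneg less_imp_le[OF h])
  hence "?S\<^sup>2 < \<top>"
    by (simp add: power2_eq_square ennreal_mult_less_top)
  moreover have "\<mu> x \<le> (h z)\<^sup>2 * \<mu> (x + z)" for x z
    using regular_weight_shift[OF assms(1), of x z] \<mu> by (simp add: h_def less_imp_le)
  hence "(\<integral>\<^sup>+x. \<mu> x * (\<integral>\<^sup>+z. a z * (of_bool True * g (x + z)) \<partial>count_space UNIV)\<^sup>2 \<partial>count_space UNIV)
      \<le> ?S\<^sup>2 * (\<integral>\<^sup>+x. \<mu> x * (g x)\<^sup>2 \<partial>count_space UNIV)" for g :: "int ^ 'd \<Rightarrow> ennreal"
    using a h \<mu> by (intro near_kernel_bound) (auto intro: less_imp_le)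
  ultimately show ?thesis unfolding kernel_bound_def by (intro exI[of _ "?S\<^sup>2"]) simp
qed

text \<open>Asymptotic equivalence yields constants outside a ball. Inside it \<mu> takes finitely
  many values, one for each radius, so a minimum and a maximum over the radii complete the two-sided
  bound.\<close>

lemma power_weight_bounds:
  fixes \<mu> :: "int ^ 'd::finite \<Rightarrow> real"
  assumes "regular_weight \<mu>" "C > 0" "p > 0"
    and asymp: "\<mu> \<sim>[filtercomap sup_norm at_top] (\<lambda>z. C / (1 + real (sup_norm z) powr p))"
  obtains c\<^sub>1 c\<^sub>2 where "c\<^sub>1 > 0" "c\<^sub>2 > 0"
    "\<And>z. c\<^sub>1 * (1 + real (sup_norm z)) powr (- p) \<le> \<mu> z"
    "\<And>z. \<mu> z \<le> c\<^sub>2 * (1 + real (sup_norm z)) powr (- p)"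
proof -
  obtain m where m: "\<And>x. \<mu> x = m (sup_norm x)" "\<And>n. m n > 0"
    by (rule regular_weight_profile[OF assms(1)]) (rule that)
  define r where "r n = m n * (1 + real n) powr p" for n
  have r: "r n > 0" for n using m(2)[of n] by (simp add: r_def)
  have g: "C / (1 + real (sup_norm z) powr p) > 0" for z :: "int ^ 'd"
    using assms(2) by (intro divide_pos_pos add_pos_nonneg) auto
  \<comment> \<open>Asymptotic equivalence counts 0/0 as 1; positivity of the comparison function
    turns it into a genuine limit of quotients.\<close>
  have "((\<lambda>z. \<mu> z / (C / (1 + real (sup_norm z) powr p))) \<longlongrightarrow> 1) (filtercomap sup_norm at_top)"
    using asymp_equivD_strong[OF asymp] g by (metis (mono_tags, lifting) always_eventually less_irrefl)
  hence "eventually (\<lambda>z. \<bar>\<mu> z / (C / (1 + real (sup_norm z) powr p)) - 1\<bar> < 1/2) (filtercomap (sup_norm :: int ^ 'd \<Rightarrow> nat) at_top)"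
    by (auto simp: tendsto_iff dist_real_def dest: spec[of _ "1/2"])
  then obtain N where N: "\<And>z :: int ^ 'd. sup_norm z \<ge> N \<Longrightarrow> \<bar>\<mu> z / (C / (1 + real (sup_norm z) powr p)) - 1\<bar> < 1/2"
    by (auto simp: eventually_filtercomap eventually_at_top_linorder)
  \<comment> \<open>The bounds 1/2 and 3/2 for the quotient are combined with 1 + n^p <= 2 (1 + n)^p
    and (1 + n)^p <= 2^p (1 + n^p). The latter uses n >= 1, which is why the range starts at
    \<open>Suc N\<close>.\<close>
  have big: "C / 4 \<le> r n \<and> r n \<le> 3 / 2 * C * 2 powr p" if n: "n \<ge> Suc N" for n
  proof -
    define q where "q = C / (1 + real n powr p)"
    have q: "q > 0" using assms(2) unfolding q_def by (intro divide_pos_pos add_pos_nonneg) auto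
    have "\<bar>m n / q - 1\<bar> < 1/2"
      using N[of "\<chi> i. int n"] n by (simp add: sup_norm_const m(1) q_def)
    hence "1/2 < m n / q" "m n / q < 3/2" by linarith+
    hence mq: "q / 2 \<le> m n" "m n \<le> 3/2 * q" using q by (auto simp: field_simps)
    have "1 + real n powr p \<le> (1 + real n) powr p + (1 + real n) powr p"
      using assms(3) by (intro add_mono ge_one_powr_ge_zero powr_mono2) auto
    hence "C * (1 + real n powr p) \<le> C * (2 * (1 + real n) powr p)"
      using assms(2) by (intro mult_left_mono) auto
    hence lo: "C \<le> q * (2 * (1 + real n) powr p)"
      unfolding q_def by (simp add: pos_le_divide_eq add_pos_nonneg)
    have "(1 + real n) powr p \<le> (2 * real n) powr p"
      using n assms(3) by (intro powr_mono2) auto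
    also have "\<dots> \<le> 2 powr p * (1 + real n powr p)"
      by (simp add: powr_mult)
    finally have "C * (1 + real n) powr p \<le> C * (2 powr p * (1 + real n powr p))"
      using assms(2) by (intro mult_left_mono) auto
    hence hi: "q * (1 + real n) powr p \<le> C * 2 powr p"
      unfolding q_def by (simp add: pos_divide_le_eq add_pos_nonneg mult.assoc)
    have "q / 2 * (1 + real n) powr p \<le> r n" "r n \<le> 3/2 * q * (1 + real n) powr p"
      unfolding r_def using mq by (intro mult_right_mono; simp)+
    with lo hi show ?thesis by (simp add: field_simps)
  qed
  define c\<^sub>1 where "c\<^sub>1 = Min (insert (C / 4) (r ` {..N}))"
  define c\<^sub>2 where "c\<^sub>2 = Max (insert (3 / 2 * C * 2 powr p) (r ` {..N}))"
  have c1: "c\<^sub>1 > 0" unfolding c\<^sub>1_def using r assms(2) by (subst Min_gr_iff) auto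
  have c2: "c\<^sub>2 > 0" unfolding c\<^sub>2_def using assms(2) by (subst Max_gr_iff) auto
  have lo: "c\<^sub>1 \<le> r n" for n
  proof (cases "n \<le> N")
    case True
    thus ?thesis unfolding c\<^sub>1_def by (intro Min_le) auto
  next
    case False
    have "c\<^sub>1 \<le> C / 4" unfolding c\<^sub>1_def by (intro Min_le) auto
    thus ?thesis using big[of n] False assms(2) by simp
  qed
  have hi: "r n \<le> c\<^sub>2" for n
  proof (cases "n \<le> N")
    case True
    thus ?thesis unfolding c\<^sub>2_def by (intro Max_ge) auto
  next
    case False
    have "3 / 2 * C * 2 powr p \<le> c\<^sub>2" unfolding c\<^sub>2_def by (intro Max_ge) auto
    thus ?thesis using big[of n] False by simp
  qed
  have eq: "\<mu> z = r (sup_norm z) * (1 + real (sup_norm z)) powr (- p)" for z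
    by (simp add: r_def m(1) powr_minus field_simps)
  show thesis
    using c1 c2 lo hi by (intro that[of c\<^sub>1 c\<^sub>2]) (simp_all add: eq mult_right_mono)
qed

text \<open>C is bounded because the sphere is compact, and within the radius R the kernel is at
  most 1 because its total mass is 1. The origin is harmless since \<open>a 0 = 0\<close>; elsewhere
  the Euclidean norm is at least 1, so 1 + |z| in the sup norm is at most twice the Euclidean
  norm.\<close>

lemma power_kernel_bound:
  fixes a :: "int ^ 'd::finite \<Rightarrow> real"
  assumes a: "walk_kernel a" and C: "continuous_on (sphere 0 1) C" and q: "q > 0"
    and tail: "\<And>z. euclid_norm z \<ge> R \<Longrightarrow> a z \<le> C (real_point z /\<^sub>R euclid_norm z) / euclid_norm z powr q"
  obtains A where "A > 0" "\<And>z. a z \<le> A * (1 + real (sup_norm z)) powr (- q)"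
proof -
  have a0: "a 0 = 0" and nn: "\<And>z. a z \<ge> 0" and sum: "(a has_sum 1) UNIV"
    using a by (auto simp: walk_kernel_def)
  have le1: "a z \<le> 1" for z
  proof -
    have "sum a {z} \<le> infsum a UNIV"
      using nn sum by (intro finite_sum_le_infsum) (auto simp: summable_on_def)
    thus ?thesis using sum by (simp add: infsumI)
  qed
  have "compact (C ` sphere 0 1)" using C by (intro compact_continuous_image) auto
  then obtain B where B: "\<And>v. v \<in> sphere 0 1 \<Longrightarrow> \<bar>C v\<bar> \<le> B"
    by (metis bounded_iff compact_imp_bounded imageI real_norm_def)
  define B' where "B' = max B 0"
  have B': "B' \<ge> 0" "\<And>v. v \<in> sphere 0 1 \<Longrightarrow> C v \<le> B'" using B unfolding B'_def by (force)+
  define T where "T = max R 0"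
  have sup_le: "real (sup_norm z) \<le> euclid_norm z" for z :: "int ^ 'd"
  proof -
    have "sup_norm z \<in> range (\<lambda>i. nat \<bar>z $ i\<bar>)" unfolding sup_norm_def by (rule Max_in) auto
    then obtain i where "sup_norm z = nat \<bar>z $ i\<bar>" by auto
    hence "real (sup_norm z) = \<bar>real_point z $ i\<bar>" by (simp add: real_point_def)
    also have "\<dots> \<le> euclid_norm z" unfolding euclid_norm_def by (rule component_le_norm_cart)
    finally show ?thesis .
  qed
  \<comment> \<open>The first summand serves the points where the tail bound holds, the second those
    of Euclidean norm below R.\<close>
  define A where "A = B' * 2 powr q + (1 + T) powr q"
  have A: "A > 0" using B'(1) unfolding A_def T_def by (intro add_nonneg_pos) auto
  have "a z \<le> A * (1 + real (sup_norm z)) powr (- q)" for z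
  proof (cases "z = 0")
    case True
    thus ?thesis using A a0 by simp
  next
    case nz: False
    have s1: "sup_norm z \<ge> 1"
    proof (rule ccontr)
      assume "\<not> sup_norm z \<ge> 1"
      hence "nat \<bar>z $ i\<bar> \<le> 0" for i using le_sup_norm[of z i] by simp
      hence "z = 0" by (simp add: vec_eq_iff)
      thus False using nz by simp
    qed
    have e1: "euclid_norm z \<ge> 1" using sup_le[of z] s1 by simp
    have P: "(1 + real (sup_norm z)) powr q > 0" using s1 by simp
    have "a z * (1 + real (sup_norm z)) powr q \<le> A"
    proof (cases "euclid_norm z \<ge> R")
      case True
      have "norm (real_point z) \<noteq> 0" using e1 unfolding euclid_norm_def by linarith
      hence "norm (real_point z /\<^sub>R euclid_norm z) = 1"
        by (simp add: euclid_norm_def)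
      hence "C (real_point z /\<^sub>R euclid_norm z) \<le> B'" by (intro B') simp
      hence "C (real_point z /\<^sub>R euclid_norm z) / euclid_norm z powr q \<le> B' / euclid_norm z powr q"
        by (intro divide_right_mono) auto
      with tail[OF True] have "a z \<le> B' / euclid_norm z powr q" by linarith
      hence "a z * (1 + real (sup_norm z)) powr q \<le> B' / euclid_norm z powr q * (2 * euclid_norm z) powr q"
        using nn[of z] s1 sup_le[of z] q e1 by (intro mult_mono powr_mono2) auto
      also have "\<dots> = B' * 2 powr q" using e1 by (simp add: powr_mult)
      also have "\<dots> \<le> A" unfolding A_def by simp
      finally show ?thesis .
    next
      case False
      have "a z * (1 + real (sup_norm z)) powr q \<le> 1 * (1 + T) powr q"
        using le1[of z] sup_le[of z] False q unfolding T_def by (intro mult_mono powr_mono2) auto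
      also have "\<dots> \<le> A" using B'(1) unfolding A_def by simp
      finally show ?thesis .
    qed
    thus ?thesis using P by (simp add: powr_minus field_simps)
  qed
  thus thesis using A that by blast
qed

text \<open>
  The kernel is split according to whether \<open>|x + z| \<le> 2 |x|\<close>. On this set the weights are
  comparable; on its complement the operator is Hilbert--Schmidt, which is where \<open>\<delta> < 2\<alpha>\<close> enters.
\<close>

lemma heavy_tail_kernel_bound:
  fixes \<mu> :: "int ^ 'd::finite \<Rightarrow> real"
  assumes "regular_weight \<mu>" "walk_kernel a" "\<mu> summable_on UNIV" "moderate_or_heavy_tail a \<mu>"
  shows "\<exists>K. kernel_bound a \<mu> K"
proof -
  from assms(4)[unfolded moderate_or_heavy_tail_def] obtain C \<alpha> \<delta> C\<^sub>\<delta> R where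
    C: "continuous_on (sphere 0 1) (C :: real ^ 'd \<Rightarrow> real)" "\<alpha> > 2 \<or> 0 < \<alpha> \<and> \<alpha> < (2::real)"
      "\<forall>z. euclid_norm z \<ge> R \<longrightarrow>
          a z \<le> C (real_point z /\<^sub>R euclid_norm z) / euclid_norm z powr (real CARD('d) + \<alpha>)"
      "0 < \<delta>" "\<delta> < 2 * \<alpha>" "C\<^sub>\<delta> > 0"
      "\<mu> \<sim>[filtercomap sup_norm at_top] (\<lambda>z. C\<^sub>\<delta> / (1 + real (sup_norm z) powr (real CARD('d) + \<delta>)))"
    by (elim exE conjE) (rule that)
  have \<alpha>: "\<alpha> > 0" using C(2) by auto
  have a: "\<And>z. a z \<ge> 0" using assms(2) by (simp add: walk_kernel_def)
  have \<mu>: "\<And>z. \<mu> z > 0" using assms(1) by (simp add: regular_weight_def)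
  define p where "p = real CARD('d) + \<delta>"
  define q where "q = real CARD('d) + \<alpha>"
  have pq: "p > 0" "q > 0" "2 * q - p > real CARD('d)" using C(4,5) \<alpha> by (auto simp: p_def q_def)
  obtain c\<^sub>1 c\<^sub>2 where c: "c\<^sub>1 > 0" "c\<^sub>2 > 0"
    "\<And>z. c\<^sub>1 * (1 + real (sup_norm z)) powr (- p) \<le> \<mu> z"
    "\<And>z. \<mu> z \<le> c\<^sub>2 * (1 + real (sup_norm z)) powr (- p)"
    using power_weight_bounds[OF assms(1) C(6) pq(1) C(7)[folded p_def]] by blast
  from C(3) have R: "\<And>z. euclid_norm z \<ge> R \<Longrightarrow>
      a z \<le> C (real_point z /\<^sub>R euclid_norm z) / euclid_norm z powr q"
    unfolding q_def by blast
  obtain A where A: "A > 0" "\<And>z. a z \<le> A * (1 + real (sup_norm z)) powr (- q)"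
    using power_kernel_bound[OF assms(2) C(1) pq(2) R] by blast
  define N where "N x z \<longleftrightarrow> sup_norm (x + z) \<le> 2 * sup_norm x" for x z :: "int ^ 'd"
  \<comment> \<open>From |x + z| <= 2 |x| follows 1 + |x| >= (1 + |x + z|) / 2, so on N the weight
    at x exceeds the weight at x + z at most by this constant squared. Hence the Schur weight can be
    constant in z.\<close>
  define h where "h = sqrt (c\<^sub>2 * 2 powr p / c\<^sub>1)"
  have h: "h > 0" using c unfolding h_def by simp
  \<comment> \<open>Chosen so that \<rho> times the lower bound for \<mu> equals the square of the
    bound for the far part of a. The exponent is
    \<open>2 * q - p = d + 2 * \<alpha> - \<delta>\<close>, which exceeds d, so \<rho> is
    summable.\<close>
  define \<rho> where "\<rho> y = A\<^sup>2 * 2 powr (2 * q) / c\<^sub>1 * (1 + real (sup_norm y)) powr (- (2 * q - p))" for y :: "int ^ 'd"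
  have \<rho>: "\<rho> y \<ge> 0" for y using A(1) c(1) unfolding \<rho>_def by simp
  have near: "\<mu> x \<le> h\<^sup>2 * \<mu> (x + z)" if "N x z" for x z
  proof -
    have "real (sup_norm (x + z)) \<le> 2 * real (sup_norm x)"
      using that unfolding N_def by linarith
    hence "((1 + real (sup_norm (x + z))) / 2) powr p \<le> (1 + real (sup_norm x)) powr p"
      using pq(1) by (intro powr_mono2) auto
    hence "(1 + real (sup_norm x)) powr (- p) \<le> ((1 + real (sup_norm (x + z))) / 2) powr (- p)"
      unfolding powr_minus by (intro le_imp_inverse_le) auto
    also have "\<dots> = 2 powr p * (1 + real (sup_norm (x + z))) powr (- p)"
      by (simp add: powr_divide powr_minus_divide)
    finally have "(1 + real (sup_norm x)) powr (- p) \<le> 2 powr p * (1 + real (sup_norm (x + z))) powr (- p)" .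
    hence "c\<^sub>2 * (1 + real (sup_norm x)) powr (- p) \<le> c\<^sub>2 * (2 powr p * (1 + real (sup_norm (x + z))) powr (- p))"
      using c(2) by (intro mult_left_mono) auto
    with c(4)[of x] have "\<mu> x \<le> c\<^sub>2 * 2 powr p / c\<^sub>1 * (c\<^sub>1 * (1 + real (sup_norm (x + z))) powr (- p))"
      using c(1) by simp
    also have "\<dots> \<le> c\<^sub>2 * 2 powr p / c\<^sub>1 * \<mu> (x + z)"
      using c by (intro mult_left_mono) auto
    finally show ?thesis using c unfolding h_def by simp
  qed
  have far: "(a z)\<^sup>2 \<le> \<rho> (x + z) * \<mu> (x + z)" if "\<not> N x z" for x z
  proof -
    let ?n = "1 + real (sup_norm (x + z))"
    \<comment> \<open>Together these give |z| > |x + z| / 2: a far target is reached only by a long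
      jump.\<close>
    have "real (sup_norm (x + z)) > 2 * real (sup_norm x)" "real (sup_norm (x + z)) \<le> real (sup_norm x) + real (sup_norm z)"
      using that sup_norm_add[of x z] unfolding N_def by linarith+
    hence "(1 + real (sup_norm z)) powr (- q) \<le> (?n / 2) powr (- q)"
      using pq(2) by (intro powr_mono2') auto
    hence "a z \<le> A * (?n / 2) powr (- q)"
      using A(1) by (intro order_trans[OF A(2)[of z]] mult_left_mono) auto
    hence "(a z)\<^sup>2 \<le> (A * (?n / 2) powr (- q))\<^sup>2"
      using a[of z] by (intro power_mono) auto
    also have "\<dots> = A\<^sup>2 * 2 powr (2 * q) * ?n powr (- (2 * q - p)) * ?n powr (- p)"
    proof -
      have t: "?n > 0" by simp
      have "((?n / 2) powr (- q))\<^sup>2 = (?n / 2) powr (- (2 * q))"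
        by (simp only: power2_eq_square powr_add[symmetric]) simp
      also have "\<dots> = 2 powr (2 * q) * ?n powr (- (2 * q))"
        using t by (simp add: powr_divide powr_minus_divide)
      also have "?n powr (- (2 * q)) = ?n powr (- (2 * q - p)) * ?n powr (- p)"
        by (simp only: powr_add[symmetric]) simp
      finally show ?thesis by (simp only: power_mult_distrib mult.assoc)
    qed
    also have "\<dots> = \<rho> (x + z) * (c\<^sub>1 * ?n powr (- p))"
      using c(1) by (simp add: \<rho>_def)
    also have "\<dots> \<le> \<rho> (x + z) * \<mu> (x + z)"
      using c(3) \<rho> by (intro mult_left_mono) auto
    finally show ?thesis .
  qed
  let ?U = "\<integral>\<^sup>+z. \<mu> z \<partial>count_space UNIV" and ?R = "\<integral>\<^sup>+z. \<rho> z \<partial>count_space UNIV"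
  let ?S = "\<integral>\<^sup>+z. a z * h \<partial>count_space UNIV"
  have "?U < \<top>" using assms(3) \<mu> by (subst summable_on_iff_nn_integral[symmetric]) (auto intro: less_imp_le)
  moreover have "\<rho> summable_on UNIV"
    unfolding \<rho>_def by (intro summable_on_cmult_right lattice_summable_powr pq)
  hence "?R < \<top>" using \<rho> by (subst summable_on_iff_nn_integral[symmetric]) auto
  moreover have "(\<lambda>z. a z * h) summable_on UNIV"
    using assms(2) by (intro summable_on_cmult_left) (auto simp: walk_kernel_def summable_on_def)
  hence "?S < \<top>" using a h by (subst summable_on_iff_nn_integral[symmetric]) auto
  ultimately have fin: "2 * ?S\<^sup>2 + 2 * (?U * ?R) < \<top>"
    by (simp add: power2_eq_square ennreal_mult_less_top)
  have "(\<integral>\<^sup>+x. \<mu> x * (\<integral>\<^sup>+z. a z * g (x + z) \<partial>count_space UNIV)\<^sup>2 \<partial>count_space UNIV)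
      \<le> (2 * ?S\<^sup>2 + 2 * (?U * ?R)) * (\<integral>\<^sup>+x. \<mu> x * (g x)\<^sup>2 \<partial>count_space UNIV)" (is "?L \<le> _ * ?G") for g :: "int ^ 'd \<Rightarrow> ennreal"
  proof -
    let ?P = "\<lambda>x. \<integral>\<^sup>+z. a z * (of_bool (N x z) * g (x + z)) \<partial>count_space UNIV"
    let ?Q = "\<lambda>x. \<integral>\<^sup>+z. a z * (of_bool (\<not> N x z) * g (x + z)) \<partial>count_space UNIV"
    have split: "(\<integral>\<^sup>+z. a z * g (x + z) \<partial>count_space UNIV) = ?P x + ?Q x" for x
      by (subst nn_integral_add[symmetric]) (auto intro!: nn_integral_cong)
    have "?L \<le> (\<integral>\<^sup>+x. 2 * (\<mu> x * (?P x)\<^sup>2) + 2 * (\<mu> x * (?Q x)\<^sup>2) \<partial>count_space UNIV)"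
    proof (rule nn_integral_mono)
      fix x
      have "\<mu> x * (?P x + ?Q x)\<^sup>2 \<le> \<mu> x * (2 * (?P x)\<^sup>2 + 2 * (?Q x)\<^sup>2)"
        by (intro mult_left_mono power2_sum_le_ennreal) auto
      also have "\<dots> = 2 * (\<mu> x * (?P x)\<^sup>2) + 2 * (\<mu> x * (?Q x)\<^sup>2)"
        by (simp add: distrib_left mult.left_commute)
      finally show "\<mu> x * (\<integral>\<^sup>+z. a z * g (x + z) \<partial>count_space UNIV)\<^sup>2 \<le> 2 * (\<mu> x * (?P x)\<^sup>2) + 2 * (\<mu> x * (?Q x)\<^sup>2)"
        by (simp only: split)
    qed
    also have "\<dots> = 2 * (\<integral>\<^sup>+x. \<mu> x * (?P x)\<^sup>2 \<partial>count_space UNIV) + 2 * (\<integral>\<^sup>+x. \<mu> x * (?Q x)\<^sup>2 \<partial>count_space UNIV)"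
      by (simp add: nn_integral_add nn_integral_cmult)
    also have "\<dots> \<le> 2 * (?S\<^sup>2 * ?G) + 2 * (?U * ?R * ?G)"
      using a h \<mu> near far \<rho>
      by (intro add_mono mult_left_mono near_kernel_bound far_kernel_bound) (auto intro: less_imp_le)
    also have "\<dots> = (2 * ?S\<^sup>2 + 2 * (?U * ?R)) * ?G"
      by (simp add: distrib_right mult.assoc)
    finally show ?thesis .
  qed
  thus ?thesis unfolding kernel_bound_def using fin by blast
qed

section \<open>The weighted space and the generator on it\<close>

lemma real_summable_on_diff:
  fixes f g :: "'a \<Rightarrow> real"
  assumes "f summable_on A" "g summable_on A"
  shows "(\<lambda>x. f x - g x) summable_on A"
  using summable_on_add[OF assms(1), of "\<lambda>x. - g x"] summable_on_uminus[of g A] assms(2) by simp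

lemma real_infsum_diff:
  fixes f g :: "'a \<Rightarrow> real"
  assumes "f summable_on A" "g summable_on A"
  shows "(\<Sum>\<^sub>\<infinity>x\<in>A. f x - g x) = infsum f A - infsum g A"
  using infsum_add[OF assms(1), of "\<lambda>x. - g x"] summable_on_uminus[of g A] assms(2)
  by (simp add: infsum_uminus)

text \<open>The squared norm as an extended number, so that membership in the space is finiteness.
  In contrast, \<open>l2w_norm\<close> takes the default value 0 on divergent sums.\<close>

definition nsq :: "('a \<Rightarrow> real) \<Rightarrow> ('a \<Rightarrow> real) \<Rightarrow> ennreal" where
  "nsq \<mu> f = (\<integral>\<^sup>+x. ennreal (\<mu> x * (f x)\<^sup>2) \<partial>count_space UNIV)"

lemma l2w_iff_nsq:
  assumes "\<And>x. \<mu> x \<ge> 0"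
  shows "f \<in> l2w \<mu> \<longleftrightarrow> nsq \<mu> f < \<top>"
  unfolding l2w_def nsq_def using assms
  by (simp add: summable_on_iff_nn_integral[symmetric] mult.commute)

lemma ennreal_l2w_norm_sq:
  assumes "\<And>x. \<mu> x \<ge> 0" "f \<in> l2w \<mu>"
  shows "ennreal ((l2w_norm \<mu> f)\<^sup>2) = nsq \<mu> f"
proof -
  have "(\<Sum>\<^sub>\<infinity>x\<in>UNIV. \<bar>f x\<bar>\<^sup>2 * \<mu> x) \<ge> 0"
    using assms by (intro infsum_nonneg) auto
  hence "(l2w_norm \<mu> f)\<^sup>2 = (\<Sum>\<^sub>\<infinity>x\<in>UNIV. \<mu> x * (f x)\<^sup>2)"
    by (simp add: l2w_norm_def mult.commute)
  thus ?thesis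
    unfolding nsq_def using assms by (subst ennreal_infsum[symmetric]) (auto simp: l2w_def mult.commute)
qed

lemma l2w_norm_nonneg: "(\<And>x. \<mu> x \<ge> 0) \<Longrightarrow> l2w_norm \<mu> f \<ge> 0"
  unfolding l2w_norm_def by (intro real_sqrt_ge_zero infsum_nonneg) auto

lemma nsq_add_le:
  assumes "\<And>x. \<mu> x \<ge> 0"
  shows "nsq \<mu> (\<lambda>x. f x + g x) \<le> 2 * nsq \<mu> f + 2 * nsq \<mu> g"
proof -
  have "nsq \<mu> (\<lambda>x. f x + g x) \<le> (\<integral>\<^sup>+x. 2 * ennreal (\<mu> x * (f x)\<^sup>2) + 2 * ennreal (\<mu> x * (g x)\<^sup>2) \<partial>count_space UNIV)"
    unfolding nsq_def
  proof (intro nn_integral_mono)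
    fix x
    have "(f x + g x)\<^sup>2 \<le> 2 * (f x)\<^sup>2 + 2 * (g x)\<^sup>2"
      using sum_squares_bound[of "f x" "g x"] by (simp add: power2_sum)
    hence "\<mu> x * (f x + g x)\<^sup>2 \<le> \<mu> x * (2 * (f x)\<^sup>2 + 2 * (g x)\<^sup>2)"
      using assms by (intro mult_left_mono)
    hence "ennreal (\<mu> x * (f x + g x)\<^sup>2) \<le> ennreal (2 * (\<mu> x * (f x)\<^sup>2) + 2 * (\<mu> x * (g x)\<^sup>2))"
      by (intro ennreal_leI) (simp add: algebra_simps)
    thus "ennreal (\<mu> x * (f x + g x)\<^sup>2) \<le> 2 * ennreal (\<mu> x * (f x)\<^sup>2) + 2 * ennreal (\<mu> x * (g x)\<^sup>2)"
      using assms[of x] by (simp add: ennreal_mult')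
  qed
  thus ?thesis by (simp add: nn_integral_add nn_integral_cmult nsq_def)
qed

lemma nsq_minus [simp]: "nsq \<mu> (\<lambda>x. - f x) = nsq \<mu> f"
  by (simp add: nsq_def)

lemma nsq_diff_le:
  assumes "\<And>x. \<mu> x \<ge> 0"
  shows "nsq \<mu> (\<lambda>x. f x - g x) \<le> 2 * nsq \<mu> f + 2 * nsq \<mu> g"
  using nsq_add_le[where \<mu>=\<mu> and f=f and g="\<lambda>x. - g x", OF assms] by simp

lemma l2w_diff:
  assumes "\<And>x. \<mu> x \<ge> 0" "f \<in> l2w \<mu>" "g \<in> l2w \<mu>"
  shows "(\<lambda>x. f x - g x) \<in> l2w \<mu>"
proof -
  have "2 * nsq \<mu> f + 2 * nsq \<mu> g < \<top>"
    using assms(2,3) by (simp add: l2w_iff_nsq[OF assms(1)] ennreal_mult_less_top)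
  thus ?thesis using nsq_diff_le[where \<mu>=\<mu> and f=f and g=g, OF assms(1)]
    unfolding l2w_iff_nsq[OF assms(1)] by (rule le_less_trans[rotated])
qed

locale bounded_generator =
  fixes a \<mu> :: "int ^ 'd::finite \<Rightarrow> real" and K :: ennreal
  assumes walk: "walk_kernel a" and mu_pos: "\<And>x. \<mu> x > 0" and bound: "kernel_bound a \<mu> K"
begin

lemma mu_nonneg: "\<mu> x \<ge> 0" using mu_pos[of x] by simp

lemma a_nonneg: "a z \<ge> 0" using walk by (simp add: walk_kernel_def)

lemma K_finite: "K < \<top>" using bound by (simp add: kernel_bound_def)

lemma nsq_average:
  "(\<integral>\<^sup>+x. ennreal (\<mu> x) * (\<integral>\<^sup>+z. ennreal (a z * \<bar>f (x + z)\<bar>) \<partial>count_space UNIV)\<^sup>2 \<partial>count_space UNIV) \<le> K * nsq \<mu> f"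
proof -
  have "(\<integral>\<^sup>+x. \<mu> x * (\<integral>\<^sup>+z. a z * ennreal \<bar>f (x + z)\<bar> \<partial>count_space UNIV)\<^sup>2 \<partial>count_space UNIV)
      \<le> K * (\<integral>\<^sup>+x. \<mu> x * (ennreal \<bar>f x\<bar>)\<^sup>2 \<partial>count_space UNIV)"
    using bound unfolding kernel_bound_def by (elim conjE allE[of _ "\<lambda>x. ennreal \<bar>f x\<bar>"])
  thus ?thesis
    by (simp add: nsq_def ennreal_mult a_nonneg mu_nonneg ennreal_power)
qed

text \<open>A finite sum over x has finite terms, and \<mu> x > 0 lets this be divided out, so the
  averages converge absolutely at every single point.\<close>

lemma summable_average:
  assumes "f \<in> l2w \<mu>"
  shows "(\<lambda>z. a z * \<bar>f (x + z)\<bar>) summable_on UNIV"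
proof -
  let ?P = "\<lambda>x. \<integral>\<^sup>+z. ennreal (a z * \<bar>f (x + z)\<bar>) \<partial>count_space UNIV"
  have "K * nsq \<mu> f < \<top>"
    using assms K_finite by (simp add: l2w_iff_nsq mu_nonneg ennreal_mult_less_top)
  hence "(\<integral>\<^sup>+x. ennreal (\<mu> x) * (?P x)\<^sup>2 \<partial>count_space UNIV) < \<top>"
    using nsq_average[of f] by (rule le_less_trans[rotated])
  moreover have "ennreal (\<mu> x) * (?P x)\<^sup>2 \<le> (\<integral>\<^sup>+x. ennreal (\<mu> x) * (?P x)\<^sup>2 \<partial>count_space UNIV)"
    by (rule nn_integral_ge_point) simp
  ultimately have "ennreal (\<mu> x) * (?P x)\<^sup>2 < \<top>" by (rule le_less_trans[rotated])
  hence "?P x < \<top>"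
    using mu_pos[of x] by (auto simp: ennreal_mult_less_top power2_eq_square less_top)
  thus ?thesis by (subst summable_on_iff_nn_integral) (auto simp: a_nonneg)
qed

lemma summable_average':
  assumes "f \<in> l2w \<mu>"
  shows "(\<lambda>z. a z * f (x + z)) summable_on UNIV"
  by (rule abs_summable_summable) (use summable_average[OF assms, of x] in \<open>simp add: abs_mult a_nonneg\<close>)

lemma summable_a: "a summable_on UNIV" "infsum a UNIV = 1"
  using walk by (auto simp: walk_kernel_def summable_on_def infsumI)

lemma generator_summable:
  assumes "f \<in> l2w \<mu>"
  shows "(\<lambda>z. a z * (f (x + z) - f x)) summable_on UNIV"
  using real_summable_on_diff[OF summable_average'[OF assms, of x] summable_on_cmult_left[OF summable_a(1), of "f x"]]
  by (simp add: right_diff_distrib)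

text \<open>The omitted index 0 contributes nothing because \<open>a 0 = 0\<close>, and total mass 1
  sums the subtracted part to f x. The generator is thus the averaging operator minus the
  identity.\<close>

lemma generator_eq:
  assumes "f \<in> l2w \<mu>"
  shows "generator a f x = (\<Sum>\<^sub>\<infinity>z. a z * f (x + z)) - f x"
proof -
  have "generator a f x = (\<Sum>\<^sub>\<infinity>z. a z * (f (x + z) - f x))"
    unfolding generator_def using walk
    by (intro infsum_cong_neutral) (auto simp: walk_kernel_def)
  also have "\<dots> = (\<Sum>\<^sub>\<infinity>z. a z * f (x + z) - a z * f x)"
    by (simp add: right_diff_distrib)
  also have "\<dots> = (\<Sum>\<^sub>\<infinity>z. a z * f (x + z)) - (\<Sum>\<^sub>\<infinity>z. a z * f x)"
    using assms by (intro real_infsum_diff summable_average' summable_on_cmult_left summable_a)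
  also have "(\<Sum>\<^sub>\<infinity>z. a z * f x) = f x"
    using summable_a by (simp add: infsum_cmult_left)
  finally show ?thesis .
qed

text \<open>The factor 2 K + 2 is the quasi-triangle inequality applied to averaging operator minus
  identity.\<close>

lemma nsq_generator:
  assumes "f \<in> l2w \<mu>"
  shows "nsq \<mu> (generator a f) \<le> (2 * K + 2) * nsq \<mu> f"
proof -
  let ?A = "\<lambda>x. \<Sum>\<^sub>\<infinity>z. a z * f (x + z)"
  have "nsq \<mu> ?A \<le> K * nsq \<mu> f"
  proof (rule order_trans[OF _ nsq_average[of f]], unfold nsq_def, rule nn_integral_mono)
    fix x
    have "\<bar>?A x\<bar> \<le> (\<Sum>\<^sub>\<infinity>z. a z * \<bar>f (x + z)\<bar>)"
      using norm_infsum_bound[of "\<lambda>z. a z * f (x + z)" UNIV] summable_average[OF assms, of x]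
      by (simp add: abs_mult a_nonneg)
    hence "ennreal \<bar>?A x\<bar> \<le> (\<integral>\<^sup>+z. ennreal (a z * \<bar>f (x + z)\<bar>) \<partial>count_space UNIV)"
      using summable_average[OF assms, of x] by (subst ennreal_infsum[symmetric]) (auto simp: a_nonneg ennreal_leI)
    hence "ennreal (\<mu> x) * (ennreal \<bar>?A x\<bar>)\<^sup>2 \<le> ennreal (\<mu> x) * (\<integral>\<^sup>+z. ennreal (a z * \<bar>f (x + z)\<bar>) \<partial>count_space UNIV)\<^sup>2"
      by (intro mult_left_mono power_mono) auto
    thus "ennreal (\<mu> x * (?A x)\<^sup>2) \<le> ennreal (\<mu> x) * (\<integral>\<^sup>+z. ennreal (a z * \<bar>f (x + z)\<bar>) \<partial>count_space UNIV)\<^sup>2"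
      by (simp add: ennreal_mult mu_nonneg ennreal_power)
  qed
  hence le: "2 * nsq \<mu> ?A + 2 * nsq \<mu> f \<le> 2 * (K * nsq \<mu> f) + 2 * nsq \<mu> f"
    by (intro add_right_mono mult_left_mono) auto
  have "nsq \<mu> (generator a f) = nsq \<mu> (\<lambda>x. ?A x - f x)"
    using generator_eq[OF assms] by (simp add: nsq_def)
  also have "\<dots> \<le> 2 * nsq \<mu> ?A + 2 * nsq \<mu> f"
    by (rule nsq_diff_le[OF mu_nonneg])
  also note le
  finally show ?thesis by (simp add: distrib_right mult.assoc)
qed

lemma generator_l2w:
  assumes "f \<in> l2w \<mu>"
  shows "generator a f \<in> l2w \<mu>"
proof -
  have "(2 * K + 2) * nsq \<mu> f < \<top>"
    using assms K_finite by (simp add: l2w_iff_nsq mu_nonneg ennreal_mult_less_top)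
  thus ?thesis using nsq_generator[OF assms]
    unfolding l2w_iff_nsq[OF mu_nonneg] by (rule le_less_trans[rotated])
qed

lemma generator_bounded: "generator_bounded a \<mu>"
  unfolding generator_bounded_def
proof (intro exI[of _ "sqrt (enn2real (2 * K + 2))"] ballI conjI allI)
  fix f assume f: "f \<in> l2w \<mu>"
  show "(\<lambda>z. a z * (f (x + z) - f x)) summable_on UNIV - {0}" for x
    using generator_summable[OF f] by (rule summable_on_subset_banach) auto
  show "generator a f \<in> l2w \<mu>" using f by (rule generator_l2w)
  have fin: "2 * K + 2 < \<top>" using K_finite by (simp add: ennreal_mult_less_top)
  have "ennreal ((l2w_norm \<mu> (generator a f))\<^sup>2) \<le> (2 * K + 2) * ennreal ((l2w_norm \<mu> f)\<^sup>2)"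
    using nsq_generator[OF f] f generator_l2w[OF f] by (simp add: ennreal_l2w_norm_sq mu_nonneg)
  also have "2 * K + 2 = ennreal (enn2real (2 * K + 2))" using fin by simp
  also have "\<dots> * ennreal ((l2w_norm \<mu> f)\<^sup>2) = ennreal (enn2real (2 * K + 2) * (l2w_norm \<mu> f)\<^sup>2)"
    by (simp add: ennreal_mult)
  finally have "(l2w_norm \<mu> (generator a f))\<^sup>2 \<le> enn2real (2 * K + 2) * (l2w_norm \<mu> f)\<^sup>2"
    by (simp add: ennreal_le_iff)
  also have "\<dots> = (sqrt (enn2real (2 * K + 2)) * l2w_norm \<mu> f)\<^sup>2"
    by (simp add: power_mult_distrib)
  finally show "l2w_norm \<mu> (generator a f) \<le> sqrt (enn2real (2 * K + 2)) * l2w_norm \<mu> f"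
    by (rule power2_le_imp_le) (auto intro!: mult_nonneg_nonneg l2w_norm_nonneg mu_nonneg)
qed

lemma generator_diff:
  assumes f: "f \<in> l2w \<mu>" and g: "g \<in> l2w \<mu>"
  shows "generator a (\<lambda>x. f x - g x) x = generator a f x - generator a g x"
  using real_infsum_diff[OF summable_average'[OF f, of x] summable_average'[OF g, of x]]
  by (simp add: generator_eq[OF f] generator_eq[OF g] generator_eq[OF l2w_diff[OF mu_nonneg f g]] right_diff_distrib)

end

section \<open>Discrete stochastic integrals\<close>

primrec running_max :: "(nat \<Rightarrow> real) \<Rightarrow> nat \<Rightarrow> real" where
  "running_max m 0 = \<bar>m 0\<bar>"
| "running_max m (Suc n) = max (running_max m n) \<bar>m (Suc n)\<bar>"

lemma running_max_nonneg: "running_max m n \<ge> 0"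
  by (induction n) auto

lemma abs_le_running_max: "i \<le> n \<Longrightarrow> \<bar>m i\<bar> \<le> running_max m n"
  by (induction n) (auto simp: le_Suc_eq)

lemma running_max_sq_le_sum: "(running_max m n)\<^sup>2 \<le> (\<Sum>i\<le>n. (m i)\<^sup>2)"
proof (induction n)
  case (Suc n)
  have "(running_max m (Suc n))\<^sup>2 \<le> (running_max m n)\<^sup>2 + (m (Suc n))\<^sup>2"
    using running_max_nonneg[of m n] by (auto simp: max_def power2_eq_square abs_mult_self)
  with Suc show ?case by simp
qed simp

text \<open>Convexity of the square: a discrete form of d(x^2 / 2) = x dx with x taken at the right
  endpoint.\<close>

lemma half_square_diff_le: "x\<^sup>2 / 2 - y\<^sup>2 / 2 \<le> (x - y) * (x::real)"
proof -
  have "(x - y) * x - (x\<^sup>2 / 2 - y\<^sup>2 / 2) = (x - y)\<^sup>2 / 2"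
    by (simp add: power2_eq_square field_simps)
  thus ?thesis using zero_le_power2[of "x - y"] by linarith
qed

text \<open>
  A pathwise form of Doob's \<open>L\<^sup>2\<close> inequality: the sum on the right is a discrete stochastic
  integral, so that its expectation vanishes when \<open>m\<close> is a martingale.
\<close>

lemma running_max_pathwise:
  assumes "m 0 = 0"
  shows "(running_max m n)\<^sup>2 \<le> 4 * (m n)\<^sup>2 - 4 * (\<Sum>i<n. running_max m i * sgn (m i) * (m (Suc i) - m i))"
proof -
  let ?S = "\<lambda>n. \<Sum>i<n. running_max m i * sgn (m i) * (m (Suc i) - m i)"
  \<comment> \<open>Summation by parts for the product of maximum and |m|. The maximum grows only at
    times when it equals |m|, so its increment is paired with its own new value, which dominates the
    growth of half its square.\<close>
  have *: "(running_max m n)\<^sup>2 / 2 \<le> running_max m n * \<bar>m n\<bar> - ?S n" for n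
  proof (induction n)
    case (Suc n)
    let ?r = "running_max m n" and ?r' = "running_max m (Suc n)"
    have "sgn (m n) * (m (Suc n) - m n) \<le> \<bar>m (Suc n)\<bar> - \<bar>m n\<bar>"
      by (auto simp: sgn_if)
    hence "?r * (sgn (m n) * (m (Suc n) - m n)) \<le> ?r * (\<bar>m (Suc n)\<bar> - \<bar>m n\<bar>)"
      by (intro mult_left_mono running_max_nonneg)
    moreover have "?r'\<^sup>2 / 2 - ?r\<^sup>2 / 2 \<le> (?r' - ?r) * \<bar>m (Suc n)\<bar>"
    proof (cases "\<bar>m (Suc n)\<bar> \<le> ?r")
      case False
      hence "?r' = \<bar>m (Suc n)\<bar>" by simp
      thus ?thesis using half_square_diff_le[of ?r' ?r] by (simp only:)
    qed (simp add: max_def)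
    ultimately show ?case using Suc
      by (simp add: algebra_simps del: running_max.simps)
  qed (simp add: assms)
  \<comment> \<open>Completing the square absorbs the mixed product of maximum and |m|; this is the
    origin of the constant 4.\<close>
  have "0 \<le> (running_max m n - 2 * \<bar>m n\<bar>)\<^sup>2" by simp
  hence "4 * (running_max m n * \<bar>m n\<bar>) \<le> (running_max m n)\<^sup>2 + 4 * (m n)\<^sup>2"
    by (simp add: power2_diff power_mult_distrib)
  with *[of n] show ?thesis by linarith
qed

section \<open>Partition sums against an abstract integrator\<close>

definition partition_sum ::
    "(real \<Rightarrow> 'w \<Rightarrow> real) \<Rightarrow> (nat \<Rightarrow> real) \<Rightarrow> (nat \<Rightarrow> 'w \<Rightarrow> real) \<Rightarrow> nat \<Rightarrow> 'w \<Rightarrow> real" where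
  "partition_sum X \<tau> \<xi> n \<omega> = (\<Sum>i<n. \<xi> i \<omega> * (X (\<tau> (Suc i)) \<omega> - X (\<tau> i) \<omega>))"

lemma partition_sum_simps [simp]:
  "partition_sum X \<tau> \<xi> 0 \<omega> = 0"
  "partition_sum X \<tau> \<xi> (Suc n) \<omega> = partition_sum X \<tau> \<xi> n \<omega> + \<xi> n \<omega> * (X (\<tau> (Suc n)) \<omega> - X (\<tau> n) \<omega>)"
  by (simp_all add: partition_sum_def)

text \<open>The assumption \<open>null_F\<close> is what allows processes to be redefined on null
  sets, for continuity or finiteness on every path, without losing adaptedness.\<close>

locale filtered_prob_space = prob_space M for M :: "'w measure" +
  fixes F :: "real \<Rightarrow> 'w measure"
  assumes space_F: "space (F t) = space M"
    and sets_F: "sets (F t) \<subseteq> sets M"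
    and F_mono: "s \<le> t \<Longrightarrow> sets (F s) \<subseteq> sets (F t)"
    and null_F: "null_sets M \<subseteq> sets (F t)"
begin

lemma borel_measurable_F_mono: "f \<in> measurable (F s) N \<Longrightarrow> s \<le> t \<Longrightarrow> f \<in> measurable (F t) N"
  using F_mono[of s t] by (auto simp: measurable_def space_F)

lemma borel_measurable_F_M: "f \<in> measurable (F s) N \<Longrightarrow> f \<in> measurable M N"
  using sets_F[of s] by (auto simp: measurable_def space_F)

text \<open>M may be incomplete, so measurability of g for M is assumed: it makes the part of a
  preimage inside the exceptional set a null set in the sense of \<open>null_sets\<close>, hence an
  event of \<open>F t\<close>.\<close>

lemma borel_measurable_F_AE_eq:
  assumes f: "f \<in> borel_measurable (F t)" and g: "g \<in> borel_measurable M" and eq: "AE \<omega> in M. f \<omega> = g \<omega>"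
  shows "(g :: 'w \<Rightarrow> real) \<in> borel_measurable (F t)"
proof (rule measurableI)
  fix A :: "real set" assume A: "A \<in> sets borel"
  have fM: "f \<in> borel_measurable M" using f by (rule borel_measurable_F_M)
  let ?N = "{\<omega> \<in> space M. f \<omega> \<noteq> g \<omega>}"
  have N: "?N \<in> null_sets M"
    using eq fM g by (subst (asm) AE_iff_null) auto
  have "g -` A \<inter> ?N \<in> null_sets M"
  proof (rule null_sets_subset[OF N])
    have "g -` A \<inter> ?N = (g -` A \<inter> space M) \<inter> ?N" by auto
    also have "\<dots> \<in> sets M" using g A N by (intro sets.Int measurable_sets) auto
    finally show "g -` A \<inter> ?N \<in> sets M" .
  qed auto
  hence "(f -` A \<inter> space (F t) - ?N) \<union> (g -` A \<inter> ?N) \<in> sets (F t)"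
    using N null_F[of t] f A by (intro sets.Un sets.Diff measurable_sets) auto
  also have "(f -` A \<inter> space (F t) - ?N) \<union> (g -` A \<inter> ?N) = g -` A \<inter> space (F t)"
    by (auto simp: space_F)
  finally show "g -` A \<inter> space (F t) \<in> sets (F t)" .
qed auto

lemma mem_F_of_null:
  assumes "N \<in> null_sets M" shows "N \<in> sets (F t)" "space M - N \<in> sets (F t)"
  using assms null_F[of t] sets.compl_sets[of N "F t"] by (auto simp: space_F)

end

lemma abs_mult_le_sum_squares: "\<bar>x * y\<bar> \<le> x\<^sup>2 + (y::real)\<^sup>2"
proof -
  have "\<bar>x\<bar> * \<bar>y\<bar> \<le> (x\<^sup>2 + y\<^sup>2) / 2"
    using sum_squares_bound[of "\<bar>x\<bar>" "\<bar>y\<bar>"] by simp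
  also have "\<dots> \<le> x\<^sup>2 + y\<^sup>2" by (simp add: field_simps)
  finally show ?thesis by (simp add: abs_mult)
qed

lemma integrable_mult_of_squares:
  fixes f g :: "'a \<Rightarrow> real"
  assumes [measurable]: "f \<in> borel_measurable M" "g \<in> borel_measurable M"
    and "integrable M (\<lambda>x. (f x)\<^sup>2)" "integrable M (\<lambda>x. (g x)\<^sup>2)"
  shows "integrable M (\<lambda>x. f x * g x)"
  by (rule Bochner_Integration.integrable_bound[OF Bochner_Integration.integrable_add[OF assms(3,4)]])
     (auto intro!: AE_I2 abs_mult_le_sum_squares)

definition clip :: "nat \<Rightarrow> real \<Rightarrow> real" where
  "clip n x = max (- real n) (min (real n) x)"

lemma clip_le: "\<bar>clip n x\<bar> \<le> \<bar>x\<bar>" "\<bar>clip n x\<bar> \<le> real n"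
  by (auto simp: clip_def)

lemma clip_eq: "\<bar>x\<bar> \<le> real n \<Longrightarrow> clip n x = x"
  by (auto simp: clip_def)

lemma borel_measurable_clip [measurable]: "clip n \<in> borel_measurable borel"
  unfolding clip_def by measurable

lemma clip_tendsto:
  assumes "x \<longlonglongrightarrow> l"
  shows "(\<lambda>n. clip n (x n)) \<longlonglongrightarrow> l"
proof (rule Lim_transform_eventually[OF assms])
  obtain N :: nat where N: "real N \<ge> \<bar>l\<bar> + 1" using real_arch_simple by blast
  have "eventually (\<lambda>n. dist (x n) l < 1) sequentially" using assms by (rule tendstoD) simp
  thus "eventually (\<lambda>n. x n = clip n (x n)) sequentially"
    using eventually_ge_at_top[of N]
  proof eventually_elim
    case (elim n)
    thus ?case using N by (intro clip_eq[symmetric]) (auto simp: dist_real_def)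
  qed
qed

text \<open>Conditional mean 0 and conditional variance \<open>B * (r - s)\<close> of the
  increments, tested against bounded \<zeta> known at time s. These identities hold for finite sums
  of Brownian motions and pass to mean-square limits, which is how the infinite series of the noise
  is reached.\<close>

locale integrator = filtered_prob_space M F for M :: "'w measure" and F +
  fixes X :: "real \<Rightarrow> 'w \<Rightarrow> real" and B :: real
  assumes B_nonneg: "B \<ge> 0"
    and adapted: "0 \<le> t \<Longrightarrow> X t \<in> borel_measurable (F t)"
    and increment_sq_integrable: "0 \<le> s \<Longrightarrow> s \<le> r \<Longrightarrow> integrable M (\<lambda>\<omega>. (X r \<omega> - X s \<omega>)\<^sup>2)"
    and increment_mean: "0 \<le> s \<Longrightarrow> s \<le> r \<Longrightarrow> \<zeta> \<in> borel_measurable (F s) \<Longrightarrow>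
      (\<And>\<omega>. \<omega> \<in> space M \<Longrightarrow> \<bar>\<zeta> \<omega>\<bar> \<le> c) \<Longrightarrow> (\<integral>\<omega>. \<zeta> \<omega> * (X r \<omega> - X s \<omega>) \<partial>M) = 0"
    and increment_variance: "0 \<le> s \<Longrightarrow> s \<le> r \<Longrightarrow> \<zeta> \<in> borel_measurable (F s) \<Longrightarrow>
      (\<And>\<omega>. \<omega> \<in> space M \<Longrightarrow> \<bar>\<zeta> \<omega>\<bar> \<le> c) \<Longrightarrow>
      (\<integral>\<omega>. \<zeta> \<omega> * (X r \<omega> - X s \<omega>)\<^sup>2 \<partial>M) = B * (r - s) * (\<integral>\<omega>. \<zeta> \<omega> \<partial>M)"
begin

lemma measurable_X [measurable]: "0 \<le> t \<Longrightarrow> X t \<in> borel_measurable M"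
  using adapted borel_measurable_F_M by blast

text \<open>Clipping and dominated convergence extend \<open>increment_mean\<close> to
  square-integrable factors. Such factors are the earlier partition sums in the isometry and the
  running maxima in the maximal inequality.\<close>

lemma increment_mean_L2:
  assumes sr: "0 \<le> s" "s \<le> r" and \<zeta>: "\<zeta> \<in> borel_measurable (F s)" "integrable M (\<lambda>\<omega>. (\<zeta> \<omega>)\<^sup>2)"
  shows "integrable M (\<lambda>\<omega>. \<zeta> \<omega> * (X r \<omega> - X s \<omega>))" "(\<integral>\<omega>. \<zeta> \<omega> * (X r \<omega> - X s \<omega>) \<partial>M) = 0"
proof -
  have [measurable]: "\<zeta> \<in> borel_measurable M" "X r \<in> borel_measurable M" "X s \<in> borel_measurable M"
    using \<zeta> sr borel_measurable_F_M by auto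
  show int: "integrable M (\<lambda>\<omega>. \<zeta> \<omega> * (X r \<omega> - X s \<omega>))"
    using \<zeta> sr by (intro integrable_mult_of_squares increment_sq_integrable) auto
  have "(\<lambda>n. \<integral>\<omega>. clip n (\<zeta> \<omega>) * (X r \<omega> - X s \<omega>) \<partial>M) \<longlonglongrightarrow> (\<integral>\<omega>. \<zeta> \<omega> * (X r \<omega> - X s \<omega>) \<partial>M)"
  proof (rule integral_dominated_convergence[where w="\<lambda>\<omega>. \<bar>\<zeta> \<omega> * (X r \<omega> - X s \<omega>)\<bar>"])
    show "integrable M (\<lambda>\<omega>. \<bar>\<zeta> \<omega> * (X r \<omega> - X s \<omega>)\<bar>)" using int by (rule integrable_abs)
  qed (auto intro!: AE_I2 tendsto_intros clip_tendsto mult_right_mono clip_le simp: abs_mult)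
  moreover have "(\<integral>\<omega>. clip n (\<zeta> \<omega>) * (X r \<omega> - X s \<omega>) \<partial>M) = 0" for n
    using sr \<zeta>(1) by (intro increment_mean[where c="real n"]) (auto simp: clip_le)
  ultimately show "(\<integral>\<omega>. \<zeta> \<omega> * (X r \<omega> - X s \<omega>) \<partial>M) = 0"
    by (simp add: LIMSEQ_const_iff)
qed

text \<open>Monotonicity is weak so that a finite partition can be represented by a sequence that
  stays at its last point.\<close>

definition step_partition :: "(nat \<Rightarrow> real) \<Rightarrow> (nat \<Rightarrow> 'w \<Rightarrow> real) \<Rightarrow> bool" where
  "step_partition \<tau> \<xi> \<longleftrightarrow> incseq \<tau> \<and> 0 \<le> \<tau> 0 \<and>
    (\<forall>i. \<xi> i \<in> borel_measurable (F (\<tau> i)) \<and> (\<exists>c. \<forall>\<omega>\<in>space M. \<bar>\<xi> i \<omega>\<bar> \<le> c))"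

lemma step_partition_nonneg: "step_partition \<tau> \<xi> \<Longrightarrow> 0 \<le> \<tau> i"
  unfolding step_partition_def incseq_def by (meson le0 order_trans)

lemma step_partition_mono: "step_partition \<tau> \<xi> \<Longrightarrow> i \<le> j \<Longrightarrow> \<tau> i \<le> \<tau> j"
  unfolding step_partition_def incseq_def by blast

lemma partition_sum_measurable:
  assumes "step_partition \<tau> \<xi>"
  shows "partition_sum X \<tau> \<xi> n \<in> borel_measurable (F (\<tau> n))"
proof -
  have "(\<lambda>\<omega>. \<Sum>i<n. \<xi> i \<omega> * (X (\<tau> (Suc i)) \<omega> - X (\<tau> i) \<omega>)) \<in> borel_measurable (F (\<tau> n))"
  proof (intro borel_measurable_sum borel_measurable_times borel_measurable_diff)
    fix i assume "i \<in> {..<n}"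
    hence "\<tau> i \<le> \<tau> n" "\<tau> (Suc i) \<le> \<tau> n" using step_partition_mono[OF assms] by auto
    moreover have "\<xi> i \<in> borel_measurable (F (\<tau> i))" using assms by (simp add: step_partition_def)
    ultimately show "\<xi> i \<in> borel_measurable (F (\<tau> n))" "X (\<tau> (Suc i)) \<in> borel_measurable (F (\<tau> n))"
        "X (\<tau> i) \<in> borel_measurable (F (\<tau> n))"
      using adapted[OF step_partition_nonneg[OF assms]] borel_measurable_F_mono by blast+
  qed
  thus ?thesis by (simp add: partition_sum_def[abs_def])
qed

lemma bounded_mult_square_integrable:
  assumes \<xi>: "\<xi> \<in> borel_measurable M" "\<And>\<omega>. \<omega> \<in> space M \<Longrightarrow> \<bar>\<xi> \<omega>\<bar> \<le> c"
    and f: "f \<in> borel_measurable M" "integrable M (\<lambda>\<omega>. (f \<omega>)\<^sup>2)"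
  shows "integrable M (\<lambda>\<omega>. (\<xi> \<omega> * f \<omega> :: real)\<^sup>2)"
proof (rule Bochner_Integration.integrable_bound)
  show "integrable M (\<lambda>\<omega>. c\<^sup>2 * (f \<omega>)\<^sup>2)" using f by simp
  show "(\<lambda>\<omega>. (\<xi> \<omega> * f \<omega>)\<^sup>2) \<in> borel_measurable M" using \<xi> f by simp
  show "AE \<omega> in M. norm ((\<xi> \<omega> * f \<omega>)\<^sup>2) \<le> norm (c\<^sup>2 * (f \<omega>)\<^sup>2)"
    using \<xi>(2) by (intro AE_I2) (auto simp: power_mult_distrib intro!: mult_right_mono abs_le_square_iff[THEN iffD1] order_trans[OF _ abs_ge_self])
qed

text \<open>Discrete Ito isometry. In the induction the cross term is an increment times a
  square-integrable factor known at \<open>\<tau> n\<close>, hence has mean 0; the new square is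
  evaluated by \<open>increment_variance\<close>.\<close>

lemma partition_sum_square:
  assumes part: "step_partition \<tau> \<xi>"
  shows "integrable M (\<lambda>\<omega>. (partition_sum X \<tau> \<xi> n \<omega>)\<^sup>2) \<and>
    (\<integral>\<omega>. (partition_sum X \<tau> \<xi> n \<omega>)\<^sup>2 \<partial>M) = B * (\<Sum>i<n. (\<tau> (Suc i) - \<tau> i) * (\<integral>\<omega>. (\<xi> i \<omega>)\<^sup>2 \<partial>M))"
proof (induction n)
  case (Suc n)
  let ?M = "partition_sum X \<tau> \<xi> n" and ?D = "\<lambda>\<omega>. X (\<tau> (Suc n)) \<omega> - X (\<tau> n) \<omega>"
  have sr: "0 \<le> \<tau> n" "\<tau> n \<le> \<tau> (Suc n)"
    using step_partition_nonneg[OF part] step_partition_mono[OF part, of n "Suc n"] by auto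
  have \<xi>F: "\<xi> n \<in> borel_measurable (F (\<tau> n))" using part by (simp add: step_partition_def)
  have \<xi>M[measurable]: "\<xi> n \<in> borel_measurable M" using \<xi>F by (rule borel_measurable_F_M)
  have MF: "?M \<in> borel_measurable (F (\<tau> n))" by (rule partition_sum_measurable[OF part])
  have MM[measurable]: "?M \<in> borel_measurable M" using MF by (rule borel_measurable_F_M)
  have [measurable]: "X (\<tau> (Suc n)) \<in> borel_measurable M" "X (\<tau> n) \<in> borel_measurable M"
    using step_partition_nonneg[OF part] by auto
  obtain c where c: "\<And>\<omega>. \<omega> \<in> space M \<Longrightarrow> \<bar>\<xi> n \<omega>\<bar> \<le> c" using part unfolding step_partition_def by blast
  have i1: "integrable M (\<lambda>\<omega>. (\<xi> n \<omega> * ?M \<omega>)\<^sup>2)"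
    using Suc c by (intro bounded_mult_square_integrable) auto
  have "(\<lambda>\<omega>. \<xi> n \<omega> * ?M \<omega>) \<in> borel_measurable (F (\<tau> n))" using \<xi>F MF by simp
  note cross = increment_mean_L2[OF sr(1) sr(2) this i1]
  have i2: "integrable M (\<lambda>\<omega>. (\<xi> n \<omega> * ?D \<omega>)\<^sup>2)"
    using c sr by (intro bounded_mult_square_integrable increment_sq_integrable) auto
  have "(\<integral>\<omega>. (\<xi> n \<omega>)\<^sup>2 * (?D \<omega>)\<^sup>2 \<partial>M) = B * (\<tau> (Suc n) - \<tau> n) * (\<integral>\<omega>. (\<xi> n \<omega>)\<^sup>2 \<partial>M)"
    using c \<xi>F sr by (intro increment_variance[where c="c\<^sup>2"]) (auto intro!: abs_le_square_iff[THEN iffD1] order_trans[OF _ abs_ge_self])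
  hence v: "(\<integral>\<omega>. (\<xi> n \<omega> * ?D \<omega>)\<^sup>2 \<partial>M) = B * (\<tau> (Suc n) - \<tau> n) * (\<integral>\<omega>. (\<xi> n \<omega>)\<^sup>2 \<partial>M)"
    by (simp add: power_mult_distrib)
  have eq: "(partition_sum X \<tau> \<xi> (Suc n) \<omega>)\<^sup>2 = (?M \<omega>)\<^sup>2 + 2 * (\<xi> n \<omega> * ?M \<omega> * ?D \<omega>) + (\<xi> n \<omega> * ?D \<omega>)\<^sup>2" for \<omega>
    by (simp add: power2_eq_square algebra_simps)
  have p: "integrable M (\<lambda>\<omega>. (?M \<omega>)\<^sup>2)" using Suc by blast
  have q: "integrable M (\<lambda>\<omega>. 2 * (\<xi> n \<omega> * ?M \<omega> * ?D \<omega>))" using cross(1) by (intro integrable_mult_right)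
  have "integrable M (\<lambda>\<omega>. (partition_sum X \<tau> \<xi> (Suc n) \<omega>)\<^sup>2)"
    unfolding eq by (intro Bochner_Integration.integrable_add p q i2)
  moreover have "(\<integral>\<omega>. (partition_sum X \<tau> \<xi> (Suc n) \<omega>)\<^sup>2 \<partial>M) =
      (\<integral>\<omega>. (?M \<omega>)\<^sup>2 \<partial>M) + (\<integral>\<omega>. 2 * (\<xi> n \<omega> * ?M \<omega> * ?D \<omega>) \<partial>M) + (\<integral>\<omega>. (\<xi> n \<omega> * ?D \<omega>)\<^sup>2 \<partial>M)"
    unfolding eq Bochner_Integration.integral_add[OF Bochner_Integration.integrable_add[OF p q] i2]
      Bochner_Integration.integral_add[OF p q] ..
  moreover have "(\<integral>\<omega>. 2 * (\<xi> n \<omega> * ?M \<omega> * ?D \<omega>) \<partial>M) = 0"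
    unfolding integral_mult_right_zero cross(2) by simp
  ultimately show ?case
    using Suc v by (simp add: distrib_left mult.assoc del: partition_sum_simps)
qed simp

text \<open>Doob's inequality, by integrating \<open>running_max_pathwise\<close>. The coefficients
  of its correction sum are products of \<open>\<xi> i\<close>, a sign and a running maximum; they
  are known at \<open>\<tau> i\<close> and square integrable, so the sum has expectation 0.\<close>

lemma partition_sum_maximal:
  assumes part: "step_partition \<tau> \<xi>"
  shows "(\<integral>\<^sup>+\<omega>. ennreal ((running_max (\<lambda>i. partition_sum X \<tau> \<xi> i \<omega>) n)\<^sup>2) \<partial>M)
    \<le> 4 * (\<integral>\<^sup>+\<omega>. ennreal ((partition_sum X \<tau> \<xi> n \<omega>)\<^sup>2) \<partial>M)"
proof -
  let ?M = "\<lambda>i \<omega>. partition_sum X \<tau> \<xi> i \<omega>"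
  let ?R = "\<lambda>i \<omega>. running_max (\<lambda>i. ?M i \<omega>) i"
  let ?D = "\<lambda>i \<omega>. X (\<tau> (Suc i)) \<omega> - X (\<tau> i) \<omega>"
  have MF: "?M i \<in> borel_measurable (F (\<tau> j))" if "i \<le> j" for i j
    using partition_sum_measurable[OF part, of i] step_partition_mono[OF part that] by (rule borel_measurable_F_mono)
  have RF: "?R i \<in> borel_measurable (F (\<tau> j))" if "i \<le> j" for i j
    using that by (induction i) (auto intro!: borel_measurable_max borel_measurable_abs MF simp del: partition_sum_simps)
  have [measurable]: "?R i \<in> borel_measurable M" "?M i \<in> borel_measurable M" for i
    using RF[OF order_refl] MF[OF order_refl] borel_measurable_F_M by blast+
  have R2: "integrable M (\<lambda>\<omega>. (?R i \<omega>)\<^sup>2)" for i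
  proof (rule Bochner_Integration.integrable_bound)
    show "integrable M (\<lambda>\<omega>. \<Sum>j\<le>i. (?M j \<omega>)\<^sup>2)"
      using partition_sum_square[OF part] by auto
    show "AE \<omega> in M. norm ((?R i \<omega>)\<^sup>2) \<le> norm (\<Sum>j\<le>i. (?M j \<omega>)\<^sup>2)"
      using running_max_sq_le_sum by (intro AE_I2) (auto simp: sum_nonneg)
  qed measurable
  let ?Z = "\<lambda>i \<omega>. \<xi> i \<omega> * (sgn (?M i \<omega>) * ?R i \<omega>)"
  have Z: "integrable M (\<lambda>\<omega>. ?Z i \<omega> * ?D i \<omega>)" "(\<integral>\<omega>. ?Z i \<omega> * ?D i \<omega> \<partial>M) = 0" for i
  proof -
    have \<xi>F: "\<xi> i \<in> borel_measurable (F (\<tau> i))" using part by (simp add: step_partition_def)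
    obtain c where c: "\<And>\<omega>. \<omega> \<in> space M \<Longrightarrow> \<bar>\<xi> i \<omega>\<bar> \<le> c" using part unfolding step_partition_def by blast
    have sg: "(\<lambda>\<omega>. sgn (?M i \<omega>)) \<in> borel_measurable (F (\<tau> i))"
      using MF[OF order_refl] by (rule measurable_compose) simp
    have ZF: "?Z i \<in> borel_measurable (F (\<tau> i))"
      by (intro borel_measurable_times \<xi>F sg RF[OF order_refl])
    have "integrable M (\<lambda>\<omega>. (sgn (?M i \<omega>) * ?R i \<omega>)\<^sup>2)"
      by (rule bounded_mult_square_integrable[OF borel_measurable_F_M[OF sg], where c=1])
         (use R2 in \<open>simp_all add: abs_sgn_eq del: running_max.simps partition_sum_simps\<close>)
    hence "integrable M (\<lambda>\<omega>. (?Z i \<omega>)\<^sup>2)"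
      by (rule bounded_mult_square_integrable[OF borel_measurable_F_M[OF \<xi>F] c, rotated 2])
         (assumption | intro borel_measurable_times borel_measurable_F_M[OF sg] borel_measurable_F_M[OF RF[OF order_refl]])+
    moreover have "0 \<le> \<tau> i" "\<tau> i \<le> \<tau> (Suc i)"
      using step_partition_nonneg[OF part] step_partition_mono[OF part, of i "Suc i"] by auto
    moreover note ZF
    ultimately
    show "integrable M (\<lambda>\<omega>. ?Z i \<omega> * ?D i \<omega>)" "(\<integral>\<omega>. ?Z i \<omega> * ?D i \<omega> \<partial>M) = 0"
      by (auto intro!: increment_mean_L2)
  qed
  have "(?R n \<omega>)\<^sup>2 \<le> 4 * (?M n \<omega>)\<^sup>2 - 4 * (\<Sum>i<n. ?Z i \<omega> * ?D i \<omega>)" for \<omega>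
    using running_max_pathwise[of "\<lambda>i. ?M i \<omega>" n] by (simp add: ac_simps)
  hence "(\<integral>\<omega>. (?R n \<omega>)\<^sup>2 \<partial>M) \<le> (\<integral>\<omega>. 4 * (?M n \<omega>)\<^sup>2 - 4 * (\<Sum>i<n. ?Z i \<omega> * ?D i \<omega>) \<partial>M)"
    using R2 Z partition_sum_square[OF part] by (intro integral_mono) auto
  also have "\<dots> = 4 * (\<integral>\<omega>. (?M n \<omega>)\<^sup>2 \<partial>M)"
    using Z partition_sum_square[OF part] by simp
  finally have "ennreal (\<integral>\<omega>. (?R n \<omega>)\<^sup>2 \<partial>M) \<le> ennreal (4 * (\<integral>\<omega>. (?M n \<omega>)\<^sup>2 \<partial>M))"
    by (rule ennreal_leI)
  thus ?thesis
    using R2 partition_sum_square[OF part] by (simp add: nn_integral_eq_integral ennreal_mult')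
qed

lemma nn_integral_partition_sum_square:
  assumes part: "step_partition \<tau> \<xi>"
  shows "(\<integral>\<^sup>+\<omega>. ennreal ((partition_sum X \<tau> \<xi> n \<omega>)\<^sup>2) \<partial>M) =
    ennreal B * (\<integral>\<^sup>+\<omega>. ennreal (\<Sum>i<n. (\<xi> i \<omega>)\<^sup>2 * (\<tau> (Suc i) - \<tau> i)) \<partial>M)"
proof -
  have int: "integrable M (\<lambda>\<omega>. (\<xi> i \<omega>)\<^sup>2)" for i
  proof -
    have \<xi>F: "\<xi> i \<in> borel_measurable (F (\<tau> i))" using part by (simp add: step_partition_def)
    obtain c where c: "\<And>\<omega>. \<omega> \<in> space M \<Longrightarrow> \<bar>\<xi> i \<omega>\<bar> \<le> c" using part unfolding step_partition_def by blast
    show ?thesis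
      using bounded_mult_square_integrable[OF borel_measurable_F_M[OF \<xi>F] c, of "\<lambda>_. 1"] by simp
  qed
  have mono: "\<tau> i \<le> \<tau> (Suc i)" for i using step_partition_mono[OF part] by simp
  have "(\<integral>\<^sup>+\<omega>. ennreal (\<Sum>i<n. (\<xi> i \<omega>)\<^sup>2 * (\<tau> (Suc i) - \<tau> i)) \<partial>M) = ennreal (\<integral>\<omega>. (\<Sum>i<n. (\<xi> i \<omega>)\<^sup>2 * (\<tau> (Suc i) - \<tau> i)) \<partial>M)"
    using int mono by (intro nn_integral_eq_integral) (auto intro!: AE_I2 sum_nonneg mult_nonneg_nonneg)
  also have "(\<integral>\<omega>. (\<Sum>i<n. (\<xi> i \<omega>)\<^sup>2 * (\<tau> (Suc i) - \<tau> i)) \<partial>M) = (\<Sum>i<n. (\<tau> (Suc i) - \<tau> i) * (\<integral>\<omega>. (\<xi> i \<omega>)\<^sup>2 \<partial>M))"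
    using int by (simp add: mult.commute)
  finally show ?thesis
    using partition_sum_square[OF part, of n] B_nonneg by (simp add: nn_integral_eq_integral ennreal_mult')
qed

end

section \<open>Step processes rewritten over a partition\<close>

lemma step_integral_Nil [simp]: "step_integral Y [] t \<omega> = 0"
  by (simp add: step_integral_def)

lemma step_integral_Cons [simp]:
  "step_integral Y ((s, r, \<zeta>) # S) t \<omega> = \<zeta> \<omega> * (Y (min r t) \<omega> - Y (min s t) \<omega>) + step_integral Y S t \<omega>"
  by (simp add: step_integral_def)

lemma step_value_Nil [simp]: "step_value [] q \<omega> = 0"
  by (simp add: step_value_def)

lemma step_value_Cons [simp]:
  "step_value ((s, r, \<zeta>) # S) q \<omega> = \<zeta> \<omega> * indicator {s<..r} q + step_value S q \<omega>"
  by (simp add: step_value_def)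

lemma step_integral_append: "step_integral Y (S @ S') t \<omega> = step_integral Y S t \<omega> + step_integral Y S' t \<omega>"
  by (simp add: step_integral_def)

lemma step_value_append: "step_value (S @ S') q \<omega> = step_value S q \<omega> + step_value S' q \<omega>"
  by (simp add: step_value_def)

definition step_uminus :: "'w step_process \<Rightarrow> 'w step_process" where
  "step_uminus S = map (\<lambda>(s, r, \<zeta>). (s, r, \<lambda>\<omega>. - \<zeta> \<omega>)) S"

lemma step_integral_uminus [simp]: "step_integral Y (step_uminus S) t \<omega> = - step_integral Y S t \<omega>"
  by (induction S) (auto simp: step_uminus_def)

lemma step_value_uminus [simp]: "step_value (step_uminus S) q \<omega> = - step_value S q \<omega>"
  by (induction S) (auto simp: step_uminus_def)

lemma nonanticipating_append:
  "nonanticipating_step M F S \<Longrightarrow> nonanticipating_step M F S' \<Longrightarrow> nonanticipating_step M F (S @ S')"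
  by (auto simp: nonanticipating_step_def)

lemma nonanticipating_uminus:
  "nonanticipating_step M F S \<Longrightarrow> nonanticipating_step M F (step_uminus S)"
  by (fastforce simp: nonanticipating_step_def step_uminus_def)

lemma nonanticipating_Cons:
  "nonanticipating_step M F ((s, r, \<zeta>) # S) \<longleftrightarrow> 0 \<le> s \<and> s \<le> r \<and> \<zeta> \<in> borel_measurable (F s) \<and>
     (\<exists>K. \<forall>\<omega>\<in>space M. \<bar>\<zeta> \<omega>\<bar> \<le> K) \<and> nonanticipating_step M F S"
  by (auto simp: nonanticipating_step_def)

text \<open>The hypothesis \<open>gap\<close> says that no cell of the partition has s or r in its
  interior. The increment over a step, stopped at \<open>\<tau> j\<close>, is then the sum of the
  increments over the cells inside the step.\<close>

lemma min_increment_telescope: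
  fixes Y :: "real \<Rightarrow> real"
  assumes "incseq \<tau>" "\<tau> 0 \<le> s" "s \<le> r"
    and gap: "\<And>q j. q \<in> {s, r} \<Longrightarrow> q \<le> \<tau> j \<or> \<tau> (Suc j) \<le> q"
  shows "Y (min r (\<tau> j)) - Y (min s (\<tau> j)) =
    (\<Sum>i<j. of_bool (s \<le> \<tau> i \<and> \<tau> (Suc i) \<le> r) * (Y (\<tau> (Suc i)) - Y (\<tau> i)))"
proof (induction j)
  case 0
  have "min r (\<tau> 0) = \<tau> 0" "min s (\<tau> 0) = \<tau> 0" using assms(2,3) by auto
  thus ?case by simp
next
  case (Suc j)
  have mono: "\<tau> j \<le> \<tau> (Suc j)" using assms(1) by (simp add: incseq_SucD)
  have step: "Y (min q (\<tau> (Suc j))) - Y (min q (\<tau> j)) = of_bool (\<tau> (Suc j) \<le> q) * (Y (\<tau> (Suc j)) - Y (\<tau> j))"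
    if "q \<in> {s, r}" for q
    using gap[OF that, of j] mono by (auto simp: min_def)
  \<comment> \<open>A degenerate cell needs its own case: located at s it is counted differently on
    the two sides, but its increment is 0.\<close>
  have "of_bool (\<tau> (Suc j) \<le> r) * (Y (\<tau> (Suc j)) - Y (\<tau> j)) - of_bool (\<tau> (Suc j) \<le> s) * (Y (\<tau> (Suc j)) - Y (\<tau> j))
      = of_bool (s \<le> \<tau> j \<and> \<tau> (Suc j) \<le> r) * (Y (\<tau> (Suc j)) - Y (\<tau> j))"
    using gap[of s j] mono assms(3) by (cases "\<tau> j = \<tau> (Suc j)") auto
  thus ?case using Suc step[of s] step[of r] by simp
qed

context integrator
begin

text \<open>The partition consists of 0, P and all endpoints, and the coefficient of a cell is the
  sum over the steps containing it. The identity is claimed for every Y: with the integrator it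
  rewrites the integral, and with indicator functions of time it recovers the values of the step
  process.\<close>

lemma ex_step_partition:
  assumes S: "nonanticipating_step M F S" and P: "finite P" "\<And>p. p \<in> P \<Longrightarrow> 0 \<le> p"
  shows "\<exists>\<tau> \<xi>. step_partition \<tau> \<xi> \<and> P \<subseteq> range \<tau> \<and>
    (\<forall>Y j \<omega>. step_integral Y S (\<tau> j) \<omega> = partition_sum Y \<tau> \<xi> j \<omega>)"
proof -
  define Q where "Q = insert 0 (P \<union> (\<Union>(s, r, \<zeta>)\<in>set S. {s, r}))"
  have Q: "finite Q" "Q \<noteq> {}" unfolding Q_def using P(1) by auto
  have Q0: "0 \<le> q" if q: "q \<in> Q" for q
    using q P(2) S unfolding Q_def nonanticipating_step_def by fastforce
  define L where "L = sorted_list_of_set Q"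
  define n where "n = card Q - 1"
  have L: "set L = Q" "sorted L" "length L = Suc n"
    using Q by (auto simp: L_def n_def card_gt_0_iff)
  \<comment> \<open>Beyond the last point the sequence is constant, so the later cells are
    degenerate.\<close>
  define \<tau> where "\<tau> i = L ! min i n" for i
  have inc: "incseq \<tau>"
    unfolding \<tau>_def incseq_def using L by (auto intro!: sorted_nth_mono)
  have range: "\<exists>k\<le>n. q = \<tau> k" if q: "q \<in> Q" for q
  proof -
    have "q \<in> set L" using q L(1) by simp
    then obtain k where "k < length L" "L ! k = q" by (auto simp: in_set_conv_nth)
    thus ?thesis using L(3) by (intro exI[of _ k]) (auto simp: \<tau>_def)
  qed
  have gap: "q \<le> \<tau> j \<or> \<tau> (Suc j) \<le> q" if q: "q \<in> Q" for q j
  proof -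
    obtain k where k: "q = \<tau> k" using range[OF q] by blast
    show ?thesis
      using incseqD[OF inc, of k j] incseqD[OF inc, of "Suc j" k] k by (cases "k \<le> j") auto
  qed
  have low: "\<tau> 0 \<le> q" if q: "q \<in> Q" for q
  proof -
    obtain k where "q = \<tau> k" using range[OF q] by blast
    thus ?thesis using incseqD[OF inc, of 0 k] by simp
  qed
  have "\<tau> 0 \<in> set L" unfolding \<tau>_def using L(3) by (intro nth_mem) simp
  hence \<tau>0: "0 \<le> \<tau> 0" using Q0 L(1) by simp
  define \<xi> where "\<xi> i \<omega> = (\<Sum>(s, r, \<zeta>)\<leftarrow>S. of_bool (s \<le> \<tau> i \<and> \<tau> (Suc i) \<le> r) * \<zeta> \<omega>)" for i \<omega>
  \<comment> \<open>A coefficient contributes only if its step starts no later than t, and then it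
    is known at time t.\<close>
  have "(\<lambda>\<omega>. \<Sum>(s, r, \<zeta>)\<leftarrow>S. of_bool (s \<le> t \<and> t' \<le> r) * \<zeta> \<omega>) \<in> borel_measurable (F t) \<and>
      (\<exists>c. \<forall>\<omega>\<in>space M. \<bar>\<Sum>(s, r, \<zeta>)\<leftarrow>S. of_bool (s \<le> t \<and> t' \<le> r) * \<zeta> \<omega>\<bar> \<le> c)" for t t'
    using S
  proof (induction S)
    case (Cons a S)
    obtain s r \<zeta> where a: "a = (s, r, \<zeta>)" by (cases a)
    from Cons.prems obtain c where c: "\<zeta> \<in> borel_measurable (F s)" "\<And>\<omega>. \<omega> \<in> space M \<Longrightarrow> \<bar>\<zeta> \<omega>\<bar> \<le> c"
      "nonanticipating_step M F S" by (auto simp: a nonanticipating_Cons)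
    from Cons.IH[OF c(3)] obtain c' where c': "\<And>\<omega>. \<omega> \<in> space M \<Longrightarrow> \<bar>\<Sum>(s, r, \<zeta>)\<leftarrow>S. of_bool (s \<le> t \<and> t' \<le> r) * \<zeta> \<omega>\<bar> \<le> c'" by blast
    have m1: "(\<lambda>\<omega>. of_bool (s \<le> t \<and> t' \<le> r) * \<zeta> \<omega>) \<in> borel_measurable (F t)"
      using borel_measurable_F_mono[OF c(1), of t] by (cases "s \<le> t") auto
    have bnd: "\<bar>of_bool (s \<le> t \<and> t' \<le> r) * \<zeta> \<omega> + (\<Sum>(s, r, \<zeta>)\<leftarrow>S. of_bool (s \<le> t \<and> t' \<le> r) * \<zeta> \<omega>)\<bar> \<le> c + c'"
      if "\<omega> \<in> space M" for \<omega>
    proof (intro order_trans[OF abs_triangle_ineq] add_mono c'[OF that])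
      have "\<bar>\<zeta> \<omega>\<bar> \<le> c" "0 \<le> c" using c(2)[OF that] by auto
      thus "\<bar>of_bool (s \<le> t \<and> t' \<le> r) * \<zeta> \<omega>\<bar> \<le> c" by (cases "s \<le> t \<and> t' \<le> r") simp_all
    qed
    show ?case
      unfolding a list.map sum_list.Cons prod.case
      by (intro conjI exI[of _ "c + c'"] ballI borel_measurable_add m1 bnd conjunct1[OF Cons.IH[OF c(3)]])
  qed auto
  hence part: "step_partition \<tau> \<xi>"
    unfolding step_partition_def \<xi>_def using inc \<tau>0 by auto
  have "step_integral Y S (\<tau> j) \<omega> = partition_sum Y \<tau> \<xi> j \<omega>" for Y j \<omega>
  proof -
    have "set S' \<subseteq> set S \<Longrightarrow> step_integral Y S' (\<tau> j) \<omega> =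
        (\<Sum>i<j. (\<Sum>(s, r, \<zeta>)\<leftarrow>S'. of_bool (s \<le> \<tau> i \<and> \<tau> (Suc i) \<le> r) * \<zeta> \<omega>) * (Y (\<tau> (Suc i)) \<omega> - Y (\<tau> i) \<omega>))" for S'
    proof (induction S')
      case (Cons a S')
      obtain s r \<zeta> where a: "a = (s, r, \<zeta>)" by (cases a)
      have mem: "(s, r, \<zeta>) \<in> set S" using Cons.prems by (auto simp: a)
      hence sr: "s \<in> Q" "r \<in> Q" unfolding Q_def by force+
      have "s \<le> r" using S mem unfolding nonanticipating_step_def by blast
      hence "Y (min r (\<tau> j)) \<omega> - Y (min s (\<tau> j)) \<omega> =
        (\<Sum>i<j. of_bool (s \<le> \<tau> i \<and> \<tau> (Suc i) \<le> r) * (Y (\<tau> (Suc i)) \<omega> - Y (\<tau> i) \<omega>))"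
        using gap sr low by (intro min_increment_telescope[OF inc]) auto
      thus ?case using Cons
        by (simp add: a sum.distrib[symmetric] sum_distrib_left algebra_simps)
    qed simp
    from this[of S] show ?thesis by (simp add: partition_sum_def \<xi>_def)
  qed
  moreover have "P \<subseteq> range \<tau>" using range by (auto simp: Q_def)
  ultimately show ?thesis using part by blast
qed

text \<open>Inserting Y t = of_bool (q <= t) into the identity \<open>eq\<close> turns the step
  integral into the value at q, expressed through the cell coefficients. Since q lies in at most one
  cell, squaring produces no mixed terms.\<close>

lemma nn_integral_step_value_square:
  assumes S: "nonanticipating_step M F S" and part: "step_partition \<tau> \<xi>"
    and eq: "\<And>Y j \<omega>. step_integral Y S (\<tau> j) \<omega> = partition_sum Y \<tau> \<xi> j \<omega>"
  shows "(\<integral>\<^sup>+q\<in>{0..\<tau> j}. ennreal ((step_value S q \<omega>)\<^sup>2) \<partial>lborel) = ennreal (\<Sum>i<j. (\<xi> i \<omega>)\<^sup>2 * (\<tau> (Suc i) - \<tau> i))"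
proof -
  have mono: "\<tau> i \<le> \<tau> k" if "i \<le> k" for i k using step_partition_mono[OF part that] .
  have pw: "ennreal ((step_value S q \<omega>)\<^sup>2) * indicator {0..\<tau> j} q =
      (\<Sum>i<j. ennreal ((\<xi> i \<omega>)\<^sup>2) * indicator {\<tau> i<..\<tau> (Suc i)} q)" for q
  proof (cases "q < 0")
    case True
    have "q \<notin> {\<tau> i<..\<tau> (Suc i)}" for i
      using True step_partition_nonneg[OF part, of i] by auto
    hence "(\<Sum>i<j. ennreal ((\<xi> i \<omega>)\<^sup>2) * indicator {\<tau> i<..\<tau> (Suc i)} q) = 0"
      by (intro sum.neutral) auto
    thus ?thesis using True by simp
  next
    case False
    let ?Y = "\<lambda>t (_::'w). of_bool (q \<le> t) :: real"
    have "step_integral ?Y S T \<omega> = step_value S q \<omega> * of_bool (q \<le> T)" for T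
      using S
    proof (induction S)
      case (Cons a S)
      obtain s r \<zeta> where a: "a = (s, r, \<zeta>)" by (cases a)
      have "s \<le> r" using Cons.prems by (simp add: a nonanticipating_Cons)
      thus ?case using Cons by (auto simp: a nonanticipating_Cons indicator_def algebra_simps min_def)
    qed simp
    hence v: "step_value S q \<omega> * of_bool (q \<le> \<tau> j) = partition_sum ?Y \<tau> \<xi> j \<omega>"
      using eq[of ?Y j \<omega>] by simp
    have "(partition_sum ?Y \<tau> \<xi> j \<omega>)\<^sup>2 = (\<Sum>i<j. (\<xi> i \<omega>)\<^sup>2 * indicator {\<tau> i<..\<tau> (Suc i)} q)"
    proof (induction j)
      case (Suc j)
      show ?case
      proof (cases "q \<in> {\<tau> j<..\<tau> (Suc j)}")
        case True
        have "\<not> q \<le> \<tau> i" if "i \<le> j" for i using True mono[OF that] by auto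
        hence "partition_sum ?Y \<tau> \<xi> j \<omega> = 0" by (simp add: partition_sum_def)
        moreover have "(\<Sum>i<j. (\<xi> i \<omega>)\<^sup>2 * indicator {\<tau> i<..\<tau> (Suc i)} q) = 0"
          using Suc \<open>partition_sum ?Y \<tau> \<xi> j \<omega> = 0\<close> by simp
        ultimately show ?thesis using True by simp
      next
        case False
        hence "\<xi> j \<omega> * (?Y (\<tau> (Suc j)) \<omega> - ?Y (\<tau> j) \<omega>) = 0" using mono[of j "Suc j"] by auto
        thus ?thesis using Suc False by (simp only: partition_sum_simps sum.lessThan_Suc) simp
      qed
    qed simp
    hence "(step_value S q \<omega>)\<^sup>2 * indicator {0..\<tau> j} q = (\<Sum>i<j. (\<xi> i \<omega>)\<^sup>2 * indicator {\<tau> i<..\<tau> (Suc i)} q)"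
      using v False by (cases "q \<le> \<tau> j") (auto simp: indicator_def)
    hence "ennreal ((step_value S q \<omega>)\<^sup>2 * indicator {0..\<tau> j} q) = (\<Sum>i<j. ennreal ((\<xi> i \<omega>)\<^sup>2 * indicator {\<tau> i<..\<tau> (Suc i)} q))"
      by simp
    thus ?thesis by (simp add: ennreal_mult' ennreal_indicator)
  qed
  have "(\<integral>\<^sup>+q\<in>{0..\<tau> j}. ennreal ((step_value S q \<omega>)\<^sup>2) \<partial>lborel) = (\<Sum>i<j. ennreal ((\<xi> i \<omega>)\<^sup>2) * ennreal (\<tau> (Suc i) - \<tau> i))"
    unfolding pw using mono by (subst nn_integral_sum) (auto simp: nn_integral_cmult_indicator)
  also have "\<dots> = (\<Sum>i<j. ennreal ((\<xi> i \<omega>)\<^sup>2 * (\<tau> (Suc i) - \<tau> i)))"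
    using mono by (simp add: ennreal_mult)
  also have "\<dots> = ennreal (\<Sum>i<j. (\<xi> i \<omega>)\<^sup>2 * (\<tau> (Suc i) - \<tau> i))"
    using mono by (intro sum_ennreal) simp
  finally show ?thesis .
qed

text \<open>T and all points of P are made partition points, so the supremum over P is dominated by
  the running maximum up to the index of T; the maximal inequality and the isometry do the
  rest.\<close>

lemma step_integral_maximal:
  assumes S: "nonanticipating_step M F S" and P: "finite P" "P \<subseteq> {0..T}" and T: "0 \<le> T"
  shows "(\<integral>\<^sup>+\<omega>. (SUP p\<in>P. ennreal ((step_integral X S p \<omega>)\<^sup>2)) \<partial>M) \<le>
    4 * ennreal B * (\<integral>\<^sup>+\<omega>. (\<integral>\<^sup>+q\<in>{0..T}. ennreal ((step_value S q \<omega>)\<^sup>2) \<partial>lborel) \<partial>M)"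
proof -
  have "\<exists>\<tau> \<xi>. step_partition \<tau> \<xi> \<and> insert T P \<subseteq> range \<tau> \<and>
      (\<forall>Y j \<omega>. step_integral Y S (\<tau> j) \<omega> = partition_sum Y \<tau> \<xi> j \<omega>)"
    by (rule ex_step_partition[OF S]) (use P T in auto)
  then obtain \<tau> \<xi> j where part: "step_partition \<tau> \<xi>" and PR: "P \<subseteq> range \<tau>" and j: "T = \<tau> j" and
    eq: "\<And>Y j \<omega>. step_integral Y S (\<tau> j) \<omega> = partition_sum Y \<tau> \<xi> j \<omega>"
    by blast
  have "(\<integral>\<^sup>+\<omega>. (SUP p\<in>P. ennreal ((step_integral X S p \<omega>)\<^sup>2)) \<partial>M) \<le>
      (\<integral>\<^sup>+\<omega>. ennreal ((running_max (\<lambda>i. partition_sum X \<tau> \<xi> i \<omega>) j)\<^sup>2) \<partial>M)"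
  proof (intro nn_integral_mono SUP_least ennreal_leI)
    fix \<omega> p assume p: "p \<in> P"
    then obtain k where k: "p = \<tau> k" using PR by auto
    \<comment> \<open>The sequence may repeat the value T after index j; a point of P found there is
      T itself.\<close>
    have "p = \<tau> (min k j)"
    proof (cases "k \<le> j")
      case False
      hence "T \<le> p" using step_partition_mono[OF part, of j k] j k by simp
      hence "p = T" using p P by auto
      thus ?thesis using j False by (simp add: min_def)
    qed (simp add: k min_def)
    hence "\<bar>step_integral X S p \<omega>\<bar> \<le> running_max (\<lambda>i. partition_sum X \<tau> \<xi> i \<omega>) j"
      using eq[of X "min k j" \<omega>] abs_le_running_max[of "min k j" j "\<lambda>i. partition_sum X \<tau> \<xi> i \<omega>"] by simp
    thus "(step_integral X S p \<omega>)\<^sup>2 \<le> (running_max (\<lambda>i. partition_sum X \<tau> \<xi> i \<omega>) j)\<^sup>2"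
      by (rule abs_le_square_iff[THEN iffD1, OF order_trans[OF _ abs_ge_self]])
  qed
  also have "\<dots> \<le> 4 * (\<integral>\<^sup>+\<omega>. ennreal ((partition_sum X \<tau> \<xi> j \<omega>)\<^sup>2) \<partial>M)"
    by (rule partition_sum_maximal[OF part])
  also have "\<dots> = 4 * ennreal B * (\<integral>\<^sup>+\<omega>. (\<integral>\<^sup>+q\<in>{0..T}. ennreal ((step_value S q \<omega>)\<^sup>2) \<partial>lborel) \<partial>M)"
    using nn_integral_partition_sum_square[OF part] nn_integral_step_value_square[OF S part eq] j
    by (simp add: mult.assoc)
  finally show ?thesis .
qed

lemma step_integral_measurable:
  assumes S: "nonanticipating_step M F S" and t: "0 \<le> t"
  shows "step_integral X S t \<in> borel_measurable (F t)"
proof -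
  have "\<exists>\<tau> \<xi>. step_partition \<tau> \<xi> \<and> {t} \<subseteq> range \<tau> \<and>
      (\<forall>Y j \<omega>. step_integral Y S (\<tau> j) \<omega> = partition_sum Y \<tau> \<xi> j \<omega>)"
    by (rule ex_step_partition[OF S]) (use t in auto)
  then obtain \<tau> \<xi> j where part: "step_partition \<tau> \<xi>" and j: "t = \<tau> j" and
    eq: "\<And>Y j \<omega>. step_integral Y S (\<tau> j) \<omega> = partition_sum Y \<tau> \<xi> j \<omega>"
    by blast
  have "step_integral X S t = partition_sum X \<tau> \<xi> j" using eq[of X j] j by auto
  thus ?thesis using partition_sum_measurable[OF part] j by metis
qed

text \<open>
  Replacing \<open>\<xi>\<^sub>i\<close> by \<open>0\<close> as soon as \<open>\<integral> S\<^sup>2\<close> has exceeded \<open>c\<close> keeps the step process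
  nonanticipating, does not change its integral where \<open>\<integral> S\<^sup>2 \<le> c\<close>, and makes its second
  moment at most \<open>B c\<close>.
\<close>

lemma step_integral_truncated:
  assumes S: "nonanticipating_step M F S" and t: "0 \<le> t" and c: "c \<ge> 0" and e: "e > 0" and A: "A \<in> sets M"
  shows "measure M {\<omega> \<in> A. \<bar>step_integral X S t \<omega>\<bar> > e} \<le> B * c / e\<^sup>2 +
    measure M {\<omega> \<in> A. (\<integral>\<^sup>+q\<in>{0..t}. ennreal ((step_value S q \<omega>)\<^sup>2) \<partial>lborel) > ennreal c}"
proof -
  have "\<exists>\<tau> \<xi>. step_partition \<tau> \<xi> \<and> {t} \<subseteq> range \<tau> \<and>
      (\<forall>Y j \<omega>. step_integral Y S (\<tau> j) \<omega> = partition_sum Y \<tau> \<xi> j \<omega>)"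
    by (rule ex_step_partition[OF S]) (use t in auto)
  then obtain \<tau> \<xi> j where part: "step_partition \<tau> \<xi>" and j: "t = \<tau> j" and
    eq: "\<And>Y j \<omega>. step_integral Y S (\<tau> j) \<omega> = partition_sum Y \<tau> \<xi> j \<omega>"
    by blast
  define V where "V k \<omega> = (\<Sum>i<k. (\<xi> i \<omega>)\<^sup>2 * (\<tau> (Suc i) - \<tau> i))" for k \<omega>
  have mono: "\<tau> i \<le> \<tau> k" if "i \<le> k" for i k using step_partition_mono[OF part that] .
  have \<xi>F: "\<xi> i \<in> borel_measurable (F (\<tau> k))" if "i \<le> k" for i k
    using part mono[OF that] borel_measurable_F_mono unfolding step_partition_def by blast
  \<comment> \<open>The sum up to and including cell i is already known at its left endpoint, since
    it involves the coefficient but not the increment. So the decision to switch off cell i may take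
    its own contribution into account.\<close>
  have VF: "V (Suc i) \<in> borel_measurable (F (\<tau> i))" for i
    unfolding V_def[abs_def] by (intro borel_measurable_sum borel_measurable_times borel_measurable_power \<xi>F) auto
  have [measurable]: "V j \<in> borel_measurable M"
    unfolding V_def[abs_def] by (intro borel_measurable_sum borel_measurable_times borel_measurable_power borel_measurable_F_M[OF \<xi>F[OF order_refl]]) auto
  have Vmono: "V i \<omega> \<le> V k \<omega>" if "i \<le> k" for i k \<omega>
    unfolding V_def using that mono by (intro sum_mono2) auto
  define \<xi>' where "\<xi>' i \<omega> = (if V (Suc i) \<omega> \<le> c then \<xi> i \<omega> else 0)" for i \<omega>
  have part': "step_partition \<tau> \<xi>'"
    unfolding step_partition_def
  proof (intro conjI allI)
    fix i
    show "\<xi>' i \<in> borel_measurable (F (\<tau> i))"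
      unfolding \<xi>'_def[abs_def] using VF[of i] \<xi>F[of i i]
      by (intro measurable_If) auto
    obtain K where "\<And>\<omega>. \<omega> \<in> space M \<Longrightarrow> \<bar>\<xi> i \<omega>\<bar> \<le> K" using part unfolding step_partition_def by blast
    thus "\<exists>K. \<forall>\<omega>\<in>space M. \<bar>\<xi>' i \<omega>\<bar> \<le> K"
      unfolding \<xi>'_def by (intro exI[of _ "max K 0"]) (auto simp: le_max_iff_disj)
  qed (use part in \<open>auto simp: step_partition_def\<close>)
  have trunc_eq: "partition_sum X \<tau> \<xi>' j \<omega> = step_integral X S t \<omega>" if "V j \<omega> \<le> c" for \<omega>
  proof -
    have "\<xi>' i \<omega> = \<xi> i \<omega>" if "i < j" for i
      using Vmono[of "Suc i" j \<omega>] that \<open>V j \<omega> \<le> c\<close> by (auto simp: \<xi>'_def)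
    hence "partition_sum X \<tau> \<xi>' j \<omega> = partition_sum X \<tau> \<xi> j \<omega>"
      unfolding partition_sum_def by (intro sum.cong) auto
    thus ?thesis using eq[of X j \<omega>] j by simp
  qed
  have small: "(\<Sum>i<k. (\<xi>' i \<omega>)\<^sup>2 * (\<tau> (Suc i) - \<tau> i)) \<le> c" for \<omega> k
  proof -
    \<comment> \<open>The bound is strengthened for the induction: while V stays below c each term
      enters both sides, and afterwards nothing is added on the left.\<close>
    have "(\<Sum>i<k. (\<xi>' i \<omega>)\<^sup>2 * (\<tau> (Suc i) - \<tau> i)) \<le> min c (V k \<omega>)"
    proof (induction k)
      case (Suc k)
      show ?case
      proof (cases "V (Suc k) \<omega> \<le> c")
        case True
        thus ?thesis using Suc by (simp add: \<xi>'_def V_def)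
      next
        case False
        thus ?thesis using Suc Vmono[of k "Suc k" \<omega>] by (simp add: \<xi>'_def)
      qed
    qed (simp add: V_def c)
    thus ?thesis by simp
  qed
  let ?M' = "partition_sum X \<tau> \<xi>' j"
  have [measurable]: "?M' \<in> borel_measurable M"
    using partition_sum_measurable[OF part'] by (rule borel_measurable_F_M)
  have int: "integrable M (\<lambda>\<omega>. (?M' \<omega>)\<^sup>2)" using partition_sum_square[OF part'] by blast
  have "(\<integral>\<^sup>+\<omega>. ennreal ((?M' \<omega>)\<^sup>2) \<partial>M) \<le> ennreal B * (\<integral>\<^sup>+\<omega>. ennreal c \<partial>M)"
    unfolding nn_integral_partition_sum_square[OF part']
    by (intro mult_left_mono nn_integral_mono ennreal_leI small) auto
  hence "ennreal (\<integral>\<omega>. (?M' \<omega>)\<^sup>2 \<partial>M) \<le> ennreal (B * c)"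
    using int B_nonneg c by (simp add: nn_integral_eq_integral emeasure_space_1 ennreal_mult)
  hence le: "(\<integral>\<omega>. (?M' \<omega>)\<^sup>2 \<partial>M) \<le> B * c"
    using B_nonneg c by (simp add: ennreal_le_iff)
  have "measure M {\<omega> \<in> space M. (?M' \<omega>)\<^sup>2 \<ge> e\<^sup>2} \<le> (\<integral>\<omega>. (?M' \<omega>)\<^sup>2 \<partial>M) / e\<^sup>2"
    using int e by (intro integral_Markov_inequality_measure[where A="{}"]) auto
  also have "\<dots> \<le> B * c / e\<^sup>2" using le e by (intro divide_right_mono) auto
  finally have cheb: "measure M {\<omega> \<in> space M. (?M' \<omega>)\<^sup>2 \<ge> e\<^sup>2} \<le> B * c / e\<^sup>2" .
  have V_eq: "(\<integral>\<^sup>+q\<in>{0..t}. ennreal ((step_value S q \<omega>)\<^sup>2) \<partial>lborel) = ennreal (V j \<omega>)" for \<omega>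
    using nn_integral_step_value_square[OF S part eq] j by (simp add: V_def)
  have A': "A \<subseteq> space M" using A by (rule sets.sets_into_space)
  have m: "{\<omega> \<in> A. ennreal c < ennreal (V j \<omega>)} \<in> sets M"
  proof -
    have "{\<omega> \<in> A. ennreal c < ennreal (V j \<omega>)} = A \<inter> {\<omega> \<in> space M. ennreal c < ennreal (V j \<omega>)}" using A' by auto
    also have "\<dots> \<in> sets M" by (rule sets.Int[OF A]) measurable
    finally show ?thesis .
  qed
  have m': "{\<omega> \<in> space M. (?M' \<omega>)\<^sup>2 \<ge> e\<^sup>2} \<in> sets M" by measurable
  have "measure M {\<omega> \<in> A. \<bar>step_integral X S t \<omega>\<bar> > e} \<le>
    measure M ({\<omega> \<in> space M. (?M' \<omega>)\<^sup>2 \<ge> e\<^sup>2} \<union> {\<omega> \<in> A. ennreal c < ennreal (V j \<omega>)})"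
  proof (rule finite_measure_mono)
    show "{\<omega> \<in> A. \<bar>step_integral X S t \<omega>\<bar> > e} \<subseteq> {\<omega> \<in> space M. (?M' \<omega>)\<^sup>2 \<ge> e\<^sup>2} \<union> {\<omega> \<in> A. ennreal c < ennreal (V j \<omega>)}"
    proof
      fix \<omega> assume \<omega>: "\<omega> \<in> {\<omega> \<in> A. \<bar>step_integral X S t \<omega>\<bar> > e}"
      show "\<omega> \<in> {\<omega> \<in> space M. (?M' \<omega>)\<^sup>2 \<ge> e\<^sup>2} \<union> {\<omega> \<in> A. ennreal c < ennreal (V j \<omega>)}"
      proof (cases "V j \<omega> \<le> c")
        case True
        hence "\<bar>?M' \<omega>\<bar> > e" using \<omega> trunc_eq by simp
        hence "(?M' \<omega>)\<^sup>2 \<ge> e\<^sup>2" using e by (intro abs_le_square_iff[THEN iffD1]) auto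
        thus ?thesis using \<omega> A' by auto
      next
        case False
        thus ?thesis using \<omega> c by (auto simp: ennreal_less_iff)
      qed
    qed
  qed (use m m' in auto)
  also have "\<dots> \<le> measure M {\<omega> \<in> space M. (?M' \<omega>)\<^sup>2 \<ge> e\<^sup>2} + measure M {\<omega> \<in> A. ennreal c < ennreal (V j \<omega>)}"
    by (rule measure_Un_le[OF m' m])
  finally show ?thesis using cheb unfolding V_eq by linarith
qed

end

section \<open>Running suprema of continuous processes\<close>

text \<open>The square inside the supremum matches second moments, at the price of a factor 2 in the
  triangle inequality.\<close>

definition psup :: "real \<Rightarrow> (real \<Rightarrow> real) \<Rightarrow> ennreal" where
  "psup T f = (SUP t\<in>{0..T}. ennreal ((f t)\<^sup>2))"

lemma psup_upper: "0 \<le> t \<Longrightarrow> t \<le> T \<Longrightarrow> ennreal ((f t)\<^sup>2) \<le> psup T f"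
  unfolding psup_def by (intro SUP_upper) auto

lemma psup_least: "(\<And>t. 0 \<le> t \<Longrightarrow> t \<le> T \<Longrightarrow> ennreal ((f t)\<^sup>2) \<le> c) \<Longrightarrow> psup T f \<le> c"
  unfolding psup_def by (intro SUP_least) auto

lemma psup_mono: "T \<le> T' \<Longrightarrow> psup T f \<le> psup T' f"
  by (intro psup_least psup_upper) auto

lemma psup_cong: "(\<And>t. 0 \<le> t \<Longrightarrow> t \<le> T \<Longrightarrow> f t = g t) \<Longrightarrow> psup T f = psup T g"
  unfolding psup_def by (intro SUP_cong) auto

lemma psup_0 [simp]: "psup T (\<lambda>_. 0) = 0"
  by (intro antisym psup_least) auto

lemma psup_minus_commute: "psup T (\<lambda>t. f t - g t) = psup T (\<lambda>t. g t - f t)"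
  unfolding psup_def by (simp add: power2_commute)

lemma square_add_le: "(x + y)\<^sup>2 \<le> 2 * x\<^sup>2 + 2 * (y::real)\<^sup>2"
  using sum_squares_bound[of x y] by (simp add: power2_sum)

lemma ennreal_square_add_le: "ennreal ((x + y)\<^sup>2) \<le> 2 * ennreal (x\<^sup>2) + 2 * ennreal (y\<^sup>2)"
proof -
  have "ennreal ((x + y)\<^sup>2) \<le> ennreal (2 * x\<^sup>2 + 2 * y\<^sup>2)"
    by (intro ennreal_leI square_add_le)
  thus ?thesis by (simp add: ennreal_mult')
qed

lemma psup_add_le: "psup T (\<lambda>t. f t + g t) \<le> 2 * psup T f + 2 * psup T g"
  by (intro psup_least order_trans[OF ennreal_square_add_le] add_mono mult_left_mono psup_upper) auto

lemma psup_triangle: "psup T (\<lambda>t. f t - h t) \<le> 2 * psup T (\<lambda>t. f t - g t) + 2 * psup T (\<lambda>t. g t - h t)"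
  using psup_add_le[of T "\<lambda>t. f t - g t" "\<lambda>t. g t - h t"] by simp

text \<open>One dense sequence serves all continuous functions simultaneously. This makes the
  supremum of a process with continuous paths measurable and accessible to monotone
  convergence.\<close>

lemma ex_psup_countable:
  assumes "0 \<le> T"
  shows "\<exists>d::nat \<Rightarrow> real. range d \<subseteq> {0..T} \<and>
    (\<forall>f. continuous_on {0..T} f \<longrightarrow> psup T f = (SUP n. ennreal ((f (d n))\<^sup>2)))"
proof -
  obtain D where D: "countable D" "D \<subseteq> {0..T}" "{0..T} \<subseteq> closure D"
    using separable[of "{0..T}"] by blast
  have "D \<noteq> {}" using D(3) assms by auto
  then obtain d :: "nat \<Rightarrow> real" where d: "D = range d"
    using D(1) by (metis uncountable_def)
  have "psup T f \<le> (SUP n. ennreal ((f (d n))\<^sup>2))" if f: "continuous_on {0..T} f" for f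
  proof (rule psup_least)
    fix t assume t: "0 \<le> t" "t \<le> T"
    then obtain s where s: "\<And>n. s n \<in> D" "s \<longlonglongrightarrow> t" using D(3) by (auto simp: closure_sequential subset_iff)
    have "(\<lambda>n. f (s n)) \<longlonglongrightarrow> f t"
      using s t D(2) by (intro continuous_on_tendsto_compose[OF f]) (auto simp: subset_iff)
    hence "(\<lambda>n. ennreal ((f (s n))\<^sup>2)) \<longlonglongrightarrow> ennreal ((f t)\<^sup>2)"
      by (intro tendsto_ennrealI tendsto_power)
    moreover have "ennreal ((f (s n))\<^sup>2) \<le> (SUP n. ennreal ((f (d n))\<^sup>2))" for n
      using s(1)[of n] unfolding d by (auto intro: SUP_upper2)
    ultimately show "ennreal ((f t)\<^sup>2) \<le> (SUP n. ennreal ((f (d n))\<^sup>2))"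
      using LIMSEQ_le_const2 by blast
  qed
  moreover have "(SUP n. ennreal ((f (d n))\<^sup>2)) \<le> psup T f" for f
    using D(2)[unfolded d image_subset_iff] by (intro SUP_least psup_upper) auto
  ultimately show ?thesis using D(2) unfolding d by (intro exI[of _ d]) (auto intro: antisym)
qed

lemma borel_measurable_psup:
  assumes "0 \<le> T" and meas: "\<And>t. 0 \<le> t \<Longrightarrow> t \<le> T \<Longrightarrow> (\<lambda>\<omega>. Y t \<omega>) \<in> borel_measurable M"
    and cont: "\<And>\<omega>. \<omega> \<in> space M \<Longrightarrow> continuous_on {0..T} (\<lambda>t. Y t \<omega>)"
  shows "(\<lambda>\<omega>. psup T (\<lambda>t. Y t \<omega>)) \<in> borel_measurable M"
proof -
  obtain d :: "nat \<Rightarrow> real" where d: "range d \<subseteq> {0..T}"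
    "\<And>f. continuous_on {0..T} f \<Longrightarrow> psup T f = (SUP n. ennreal ((f (d n))\<^sup>2))"
    using ex_psup_countable[OF assms(1)] by blast
  have "(\<lambda>\<omega>. SUP n. ennreal ((Y (d n) \<omega>)\<^sup>2)) \<in> borel_measurable M"
    using d(1)[unfolded image_subset_iff]
    by (intro borel_measurable_SUP measurable_compose[OF _ measurable_ennreal] borel_measurable_power meas) auto
  thus ?thesis using d(2)[OF cont] by (subst measurable_cong) auto
qed

lemma continuous_on_atLeast_0:
  fixes f :: "real \<Rightarrow> real"
  assumes "\<And>n::nat. continuous_on {0..real n} f"
  shows "continuous_on {0..} f"
  unfolding continuous_on_eq_continuous_within
proof
  fix t :: real assume t: "t \<in> {0..}"
  obtain n :: nat where n: "t < real n" using reals_Archimedean2 by blast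
  have "continuous (at t within {0..real n}) f"
    using assms[of n] t n by (auto simp: continuous_on_eq_continuous_within)
  moreover have "at t within {0..real n} = at t within {0..}"
    using t n by (intro at_within_nhd[of t "{..<real n}"]) auto
  ultimately show "continuous (at t within {0..}) f" by simp
qed

lemma ennreal_2_power: "ennreal (2 ^ k) = 2 ^ k"
  by (metis ennreal_numeral ennreal_power zero_le_numeral)

text \<open>Cauchy--Schwarz with the weights \<open>2\<^sup>-\<^sup>k\<close>.\<close>

lemma telescope_square_le:
  fixes y :: "nat \<Rightarrow> real"
  shows "(y (n + m) - y n)\<^sup>2 \<le> 2 * (\<Sum>k<m. 2 ^ k * (y (Suc (n + k)) - y (n + k))\<^sup>2)"
proof (induction m arbitrary: n)
  case (Suc m)
  have "(y (n + Suc m) - y n)\<^sup>2 = ((y (Suc n) - y n) + (y (Suc n + m) - y (Suc n)))\<^sup>2" by simp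
  also have "\<dots> \<le> 2 * (y (Suc n) - y n)\<^sup>2 + 2 * (y (Suc n + m) - y (Suc n))\<^sup>2" by (rule square_add_le)
  also have "\<dots> \<le> 2 * (y (Suc n) - y n)\<^sup>2 + 2 * (2 * (\<Sum>k<m. 2 ^ k * (y (Suc (Suc n + k)) - y (Suc n + k))\<^sup>2))"
    by (intro add_left_mono mult_left_mono Suc) auto
  also have "\<dots> = 2 * (\<Sum>k<Suc m. 2 ^ k * (y (Suc (n + k)) - y (n + k))\<^sup>2)"
    by (simp only: sum.lessThan_Suc_shift) (simp add: sum_distrib_left mult.assoc)
  finally show ?case .
qed simp

text \<open>Weights 2^k on the squared increments bound all differences from index n on by a
  multiple of 2^-n, uniformly in time, so the sequence is uniformly Cauchy on bounded intervals. The
  tail bound is kept explicit so that expectations can be taken in it later.\<close>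

lemma pathwise_uniform_limit:
  fixes y :: "nat \<Rightarrow> real \<Rightarrow> real"
  assumes cont: "\<And>n. continuous_on {0..} (y n)"
    and sum: "\<And>T::nat. (\<Sum>k. 2 ^ k * psup (real T) (\<lambda>t. y (Suc k) t - y k t)) < \<top>"
  shows "\<exists>z. continuous_on {0..} z \<and> (\<forall>t\<ge>0. (\<lambda>n. y n t) \<longlonglongrightarrow> z t) \<and>
    (\<forall>T n. psup T (\<lambda>t. z t - y n t) \<le> 2 * (\<Sum>k. 2 ^ k * psup T (\<lambda>t. y (Suc (n + k)) t - y (n + k) t)))"
proof -
  let ?d = "\<lambda>T k. psup T (\<lambda>t. y (Suc k) t - y k t)"
  have bound: "ennreal ((y (n + m) t - y n t)\<^sup>2) \<le> 2 * (\<Sum>k. 2 ^ k * ?d T (n + k))"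
    if t: "0 \<le> t" "t \<le> T" for n m t T
  proof -
    have "ennreal ((y (n + m) t - y n t)\<^sup>2) \<le> ennreal (2 * (\<Sum>k<m. 2 ^ k * (y (Suc (n + k)) t - y (n + k) t)\<^sup>2))"
      using telescope_square_le[of "\<lambda>n. y n t" n m] by (rule ennreal_leI)
    also have "\<dots> = 2 * (\<Sum>k<m. 2 ^ k * ennreal ((y (Suc (n + k)) t - y (n + k) t)\<^sup>2))"
    proof -
      have "ennreal (\<Sum>k<m. 2 ^ k * (y (Suc (n + k)) t - y (n + k) t)\<^sup>2) =
          (\<Sum>k<m. ennreal (2 ^ k * (y (Suc (n + k)) t - y (n + k) t)\<^sup>2))"
        by (rule sum_ennreal[symmetric]) simp
      also have "\<dots> = (\<Sum>k<m. 2 ^ k * ennreal ((y (Suc (n + k)) t - y (n + k) t)\<^sup>2))"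
        by (intro sum.cong refl) (simp add: ennreal_mult ennreal_2_power)
      finally show ?thesis by (simp add: ennreal_mult sum_nonneg)
    qed
    also have "\<dots> \<le> 2 * (\<Sum>k<m. 2 ^ k * ?d T (n + k))"
      using t by (intro mult_left_mono sum_mono psup_upper) auto
    also have "\<dots> \<le> 2 * (\<Sum>k. 2 ^ k * ?d T (n + k))"
      by (intro mult_left_mono sum_le_suminf) auto
    finally show ?thesis .
  qed
  have ucauchy: "uniformly_Cauchy_on {0..real T} y" for T :: nat
  proof -
    define C where "C = enn2real (\<Sum>k. 2 ^ k * ?d (real T) k)"
    have C: "(\<Sum>k. 2 ^ k * ?d (real T) k) = ennreal C" "C \<ge> 0" using sum[of T] by (auto simp: C_def)
    \<comment> \<open>The weight 2^k on the increment with index n + k equals 2^(n + k) / 2^n, and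
      the tail of the full series is at most C.\<close>
    have small: "(y (n + m) t - y n t)\<^sup>2 \<le> 2 * C / 2 ^ n" if t: "0 \<le> t" "t \<le> real T" for n m t
    proof -
      have "(\<Sum>k. 2 ^ n * (2 ^ k * ?d (real T) (n + k))) \<le> (\<Sum>k. 2 ^ k * ?d (real T) k)"
      proof -
        have "(\<Sum>k. 2 ^ n * (2 ^ k * ?d (real T) (n + k))) = (\<Sum>k. 2 ^ (k + n) * ?d (real T) (k + n))"
          by (simp add: power_add ac_simps)
        also have "\<dots> \<le> (\<Sum>k. 2 ^ k * ?d (real T) k)"
          by (subst (2) suminf_offset[of _ n]) auto
        finally show ?thesis .
      qed
      hence "2 ^ n * (\<Sum>k. 2 ^ k * ?d (real T) (n + k)) \<le> ennreal C"
        by (simp add: C(1)[symmetric])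
      have "ennreal (2 ^ n) * ennreal ((y (n + m) t - y n t)\<^sup>2) \<le> 2 ^ n * (2 * (\<Sum>k. 2 ^ k * ?d (real T) (n + k)))"
        using bound[OF t, of n m] by (intro mult_mono) (auto simp: ennreal_2_power)
      also have "\<dots> = 2 * (2 ^ n * (\<Sum>k. 2 ^ k * ?d (real T) (n + k)))" by (simp add: ac_simps)
      also have "\<dots> \<le> 2 * ennreal C"
        using \<open>2 ^ n * (\<Sum>k. 2 ^ k * ?d (real T) (n + k)) \<le> ennreal C\<close> by (intro mult_left_mono) auto
      finally have "ennreal (2 ^ n * (y (n + m) t - y n t)\<^sup>2) \<le> ennreal (2 * C)"
        using C(2) by (simp add: ennreal_mult ennreal_2_power)
      thus ?thesis using C(2) by (simp add: ennreal_le_iff field_simps)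
    qed
    show ?thesis
    proof (rule uniformly_Cauchy_onI')
      fix e :: real assume e: "e > 0"
      obtain N :: nat where N: "2 * C / e\<^sup>2 < 2 ^ N" using real_arch_pow[of 2 "2 * C / e\<^sup>2"] by auto
      show "\<exists>N. \<forall>x\<in>{0..real T}. \<forall>m\<ge>N. \<forall>n>m. dist (y m x) (y n x) < e"
      proof (intro exI[of _ N] ballI allI impI)
        fix t and m n :: nat assume t: "t \<in> {0..real T}" and mn: "m \<ge> N" "n > m"
        have "(y n t - y m t)\<^sup>2 \<le> 2 * C / 2 ^ m"
          using small[of t m "n - m"] t mn by simp
        also have "\<dots> \<le> 2 * C / 2 ^ N"
          using mn C(2) by (intro divide_left_mono) auto
        also have "\<dots> < e\<^sup>2" using N e by (simp add: field_simps)
        finally have "\<bar>y n t - y m t\<bar>\<^sup>2 < e\<^sup>2" by simp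
        hence "\<bar>y n t - y m t\<bar> < e" using e by (intro power2_less_imp_less[of _ e]) auto
        thus "dist (y m t) (y n t) < e" by (simp add: dist_real_def abs_minus_commute)
      qed
    qed
  qed
  define z where "z t = lim (\<lambda>n. y n t)" for t
  have unif: "uniform_limit {0..real T} y z sequentially" for T :: nat
  proof -
    have "uniformly_convergent_on {0..real T} y"
      using ucauchy by (rule Cauchy_uniformly_convergent)
    thus ?thesis unfolding z_def[abs_def] by (simp add: uniformly_convergent_uniform_limit_iff)
  qed
  have lim: "(\<lambda>n. y n t) \<longlonglongrightarrow> z t" if "t \<ge> 0" for t
  proof -
    obtain T :: nat where "t \<le> real T" using real_arch_simple by blast
    thus ?thesis using that by (intro tendsto_uniform_limitI[OF unif[of T]]) auto
  qed
  have "continuous_on {0..} z"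
  proof (rule continuous_on_atLeast_0)
    fix T :: nat
    show "continuous_on {0..real T} z"
      by (rule uniform_limit_theorem[OF _ unif]) (auto intro!: always_eventually continuous_on_subset[OF cont])
  qed
  moreover have "psup T (\<lambda>t. z t - y n t) \<le> 2 * (\<Sum>k. 2 ^ k * ?d T (n + k))" for T n
  proof (rule psup_least)
    fix t assume t: "0 \<le> t" "t \<le> T"
    have "(\<lambda>m. ennreal ((y (m + n) t - y n t)\<^sup>2)) \<longlonglongrightarrow> ennreal ((z t - y n t)\<^sup>2)"
      by (intro tendsto_ennrealI tendsto_power tendsto_diff tendsto_const LIMSEQ_ignore_initial_segment lim t)
    thus "ennreal ((z t - y n t)\<^sup>2) \<le> 2 * (\<Sum>k. 2 ^ k * ?d T (n + k))"
      using bound[OF t, of n] LIMSEQ_le_const2 unfolding add.commute[of _ n] by blast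
  qed
  ultimately show ?thesis using lim by blast
qed

section \<open>Uniform limits of continuous adapted processes\<close>

context filtered_prob_space
begin

definition continuous_adapted :: "(real \<Rightarrow> 'w \<Rightarrow> real) \<Rightarrow> bool" where
  "continuous_adapted Y \<longleftrightarrow> (\<forall>\<omega>\<in>space M. continuous_on {0..} (\<lambda>t. Y t \<omega>)) \<and> (\<forall>t\<ge>0. Y t \<in> borel_measurable (F t))"

lemma continuous_adapted_measurable: "continuous_adapted Y \<Longrightarrow> 0 \<le> t \<Longrightarrow> Y t \<in> borel_measurable M"
  unfolding continuous_adapted_def using borel_measurable_F_M by blast

lemma continuous_adapted_diff:
  "continuous_adapted Y \<Longrightarrow> continuous_adapted Z \<Longrightarrow> continuous_adapted (\<lambda>t \<omega>. Y t \<omega> - Z t \<omega>)"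
  unfolding continuous_adapted_def by (auto intro!: continuous_on_diff borel_measurable_diff)

lemma measurable_psup:
  assumes "continuous_adapted Y" "0 \<le> T"
  shows "(\<lambda>\<omega>. psup T (\<lambda>t. Y t \<omega>)) \<in> borel_measurable M"
  using assms continuous_adapted_measurable[OF assms(1)] unfolding continuous_adapted_def
  by (intro borel_measurable_psup) (auto intro: continuous_on_subset)

lemma measurable_psup_diff:
  assumes "continuous_adapted Y" "continuous_adapted Z" "0 \<le> T"
  shows "(\<lambda>\<omega>. psup T (\<lambda>t. Y t \<omega> - Z t \<omega>)) \<in> borel_measurable M"
  using measurable_psup[OF continuous_adapted_diff] assms by blast

text \<open>Summable expectations make the pathwise series finite almost surely, for all natural
  horizons at once. Off this event the limit is set to 0; the event lies in every \<open>F t\<close>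
  because null sets do, so the limit stays adapted. The pathwise tail bound is integrated term by
  term.\<close>

lemma ex_uniform_limit_process:
  assumes Y: "\<And>n. continuous_adapted (Y n)"
    and sum: "\<And>T. 0 \<le> T \<Longrightarrow> (\<Sum>k. 2 ^ k * (\<integral>\<^sup>+\<omega>. psup T (\<lambda>t. Y (Suc k) t \<omega> - Y k t \<omega>) \<partial>M)) < \<top>"
  shows "\<exists>Z. continuous_adapted Z \<and> (\<forall>T\<ge>0. \<forall>n. (\<integral>\<^sup>+\<omega>. psup T (\<lambda>t. Z t \<omega> - Y n t \<omega>) \<partial>M)
    \<le> 2 * (\<Sum>k. 2 ^ k * (\<integral>\<^sup>+\<omega>. psup T (\<lambda>t. Y (Suc (n + k)) t \<omega> - Y (n + k) t \<omega>) \<partial>M)))"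
proof -
  let ?S = "\<lambda>T \<omega>. \<Sum>k. 2 ^ k * psup T (\<lambda>t. Y (Suc k) t \<omega> - Y k t \<omega>)"
  have m: "(\<lambda>\<omega>. psup T (\<lambda>t. Y j t \<omega> - Y k t \<omega>)) \<in> borel_measurable M" if "0 \<le> T" for T j k
    using Y that by (intro measurable_psup_diff)
  have mS: "?S T \<in> borel_measurable M" if "0 \<le> T" for T
    using m[OF that] by (intro borel_measurable_suminf_order borel_measurable_times) auto
  define G where "G = {\<omega> \<in> space M. \<forall>T::nat. ?S (real T) \<omega> < \<top>}"
  have "G = (\<Inter>T::nat. {\<omega> \<in> space M. ?S (real T) \<omega> < \<top>})" by (auto simp: G_def)
  moreover have "{\<omega> \<in> space M. ?S (real T) \<omega> < \<top>} \<in> sets M" for T :: nat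
    using mS[of "real T"] by (intro borel_measurable_less) auto
  ultimately have GM: "G \<in> sets M" by auto
  have "AE \<omega> in M. \<forall>T::nat. ?S (real T) \<omega> < \<top>"
  proof (subst AE_all_countable, rule allI)
    fix T :: nat
    have "(\<integral>\<^sup>+\<omega>. ?S (real T) \<omega> \<partial>M) = (\<Sum>k. 2 ^ k * (\<integral>\<^sup>+\<omega>. psup (real T) (\<lambda>t. Y (Suc k) t \<omega> - Y k t \<omega>) \<partial>M))"
      using m[of "real T"] by (subst nn_integral_suminf) (auto simp: nn_integral_cmult)
    also have "\<dots> < \<top>" by (rule sum) simp
    finally have "AE \<omega> in M. ?S (real T) \<omega> \<noteq> \<infinity>"
      using mS[of "real T"] by (intro nn_integral_PInf_AE) auto
    thus "AE \<omega> in M. ?S (real T) \<omega> < \<top>" by eventually_elim (simp add: less_top)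
  qed
  hence AEG: "AE \<omega> in M. \<omega> \<in> G" by (auto simp: G_def)
  have "space M - G \<in> null_sets M"
    using AEG GM by (subst (asm) AE_iff_null) (auto simp: set_diff_eq)
  hence GF: "G \<in> sets (F t)" for t
    using mem_F_of_null(2)[of "space M - G" t] GM sets.sets_into_space[OF GM] by (simp add: double_diff)
  have "\<forall>\<omega>\<in>G. \<exists>z. continuous_on {0..} z \<and> (\<forall>t\<ge>0. (\<lambda>n. Y n t \<omega>) \<longlonglongrightarrow> z t) \<and>
    (\<forall>T n. psup T (\<lambda>t. z t - Y n t \<omega>) \<le> 2 * (\<Sum>k. 2 ^ k * psup T (\<lambda>t. Y (Suc (n + k)) t \<omega> - Y (n + k) t \<omega>)))"
    using Y unfolding G_def continuous_adapted_def by (intro ballI pathwise_uniform_limit) auto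
  from bchoice[OF this] obtain z where *: "\<forall>\<omega>\<in>G. continuous_on {0..} (z \<omega>) \<and> (\<forall>t\<ge>0. (\<lambda>n. Y n t \<omega>) \<longlonglongrightarrow> z \<omega> t) \<and>
    (\<forall>T n. psup T (\<lambda>t. z \<omega> t - Y n t \<omega>) \<le> 2 * (\<Sum>k. 2 ^ k * psup T (\<lambda>t. Y (Suc (n + k)) t \<omega> - Y (n + k) t \<omega>)))" ..
  have z: "\<And>\<omega>. \<omega> \<in> G \<Longrightarrow> continuous_on {0..} (z \<omega>)"
    "\<And>\<omega> t. \<omega> \<in> G \<Longrightarrow> t \<ge> 0 \<Longrightarrow> (\<lambda>n. Y n t \<omega>) \<longlonglongrightarrow> z \<omega> t"
    "\<And>\<omega> T n. \<omega> \<in> G \<Longrightarrow> psup T (\<lambda>t. z \<omega> t - Y n t \<omega>) \<le> 2 * (\<Sum>k. 2 ^ k * psup T (\<lambda>t. Y (Suc (n + k)) t \<omega> - Y (n + k) t \<omega>))"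
    using * by simp_all
  define Z where "Z t \<omega> = (if \<omega> \<in> G then z \<omega> t else 0)" for t \<omega>
  have "continuous_adapted Z"
    unfolding continuous_adapted_def
  proof (intro conjI ballI allI impI)
    fix \<omega> show "continuous_on {0..} (\<lambda>t. Z t \<omega>)" using z(1)[of \<omega>] by (cases "\<omega> \<in> G") (auto simp: Z_def)
  next
    fix t :: real assume t: "t \<ge> 0"
    show "Z t \<in> borel_measurable (F t)"
    proof (rule borel_measurable_LIMSEQ_real)
      show "(\<lambda>\<omega>. if \<omega> \<in> G then Y n t \<omega> else 0) \<in> borel_measurable (F t)" for n
        using Y[of n] t GF[of t] unfolding continuous_adapted_def by (intro measurable_If_set) auto
      show "(\<lambda>n. if \<omega> \<in> G then Y n t \<omega> else 0) \<longlonglongrightarrow> Z t \<omega>" for \<omega>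
        using z(2)[of \<omega> t] t by (auto simp: Z_def)
    qed
  qed
  moreover have "(\<integral>\<^sup>+\<omega>. psup T (\<lambda>t. Z t \<omega> - Y n t \<omega>) \<partial>M)
    \<le> 2 * (\<Sum>k. 2 ^ k * (\<integral>\<^sup>+\<omega>. psup T (\<lambda>t. Y (Suc (n + k)) t \<omega> - Y (n + k) t \<omega>) \<partial>M))" if T: "0 \<le> T" for T n
  proof -
    have "(\<integral>\<^sup>+\<omega>. psup T (\<lambda>t. Z t \<omega> - Y n t \<omega>) \<partial>M) \<le>
        (\<integral>\<^sup>+\<omega>. 2 * (\<Sum>k. 2 ^ k * psup T (\<lambda>t. Y (Suc (n + k)) t \<omega> - Y (n + k) t \<omega>)) \<partial>M)"
      using AEG by (intro nn_integral_mono_AE) (auto simp: Z_def z(3))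
    also have "\<dots> = 2 * (\<Sum>k. 2 ^ k * (\<integral>\<^sup>+\<omega>. psup T (\<lambda>t. Y (Suc (n + k)) t \<omega> - Y (n + k) t \<omega>) \<partial>M))"
      using m[OF T] by (simp add: nn_integral_cmult nn_integral_suminf borel_measurable_suminf_order)
    finally show ?thesis .
  qed
  ultimately show ?thesis by blast
qed

end

section \<open>Left-continuous adapted processes\<close>

text \<open>For s > 0 the largest multiple of 2^-k strictly below s. Ceiling minus one, instead of
  floor, fits the left-open intervals of step processes and makes left continuity enough for
  convergence along the grid. Subtraction on naturals yields the value 0 at s = 0.\<close>

definition grid :: "nat \<Rightarrow> real \<Rightarrow> real" where
  "grid k s = real (nat \<lceil>s * 2 ^ k\<rceil> - 1) / 2 ^ k"

lemma grid_nonneg: "0 \<le> grid k s"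
  by (simp add: grid_def)

lemma grid_0 [simp]: "grid k 0 = 0"
  by (simp add: grid_def)

lemma real_nat_ceiling_minus_1:
  assumes "0 < x" shows "real (nat \<lceil>x\<rceil> - 1) = of_int \<lceil>x\<rceil> - 1"
proof -
  have "\<lceil>x\<rceil> \<ge> 1" using assms by (simp add: one_le_ceiling)
  hence "int (nat \<lceil>x\<rceil> - 1) = \<lceil>x\<rceil> - 1" by linarith
  thus ?thesis by (metis of_int_1 of_int_diff of_int_of_nat_eq)
qed

lemma grid_less: "0 < s \<Longrightarrow> grid k s < s"
  using ceiling_correct[of "s * 2 ^ k"] real_nat_ceiling_minus_1[of "s * 2 ^ k"]
  by (simp add: grid_def field_simps)

lemma grid_ge: "0 < s \<Longrightarrow> s - 1 / 2 ^ k \<le> grid k s"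
  using ceiling_correct[of "s * 2 ^ k"] real_nat_ceiling_minus_1[of "s * 2 ^ k"]
  by (simp add: grid_def field_simps)

lemma grid_le: "0 \<le> s \<Longrightarrow> grid k s \<le> s"
  using grid_less[of s k] by (cases "s = 0") auto

lemma filterlim_grid:
  assumes "0 < s" shows "filterlim (\<lambda>k. grid k s) (at_left s) sequentially"
  unfolding filterlim_at
proof
  show "\<forall>\<^sub>F k in sequentially. grid k s \<in> {..<s} \<and> grid k s \<noteq> s"
    using grid_less[OF assms] by (intro always_eventually) (auto simp: less_le)
  have "(\<lambda>k. s - 1 / 2 ^ k) \<longlonglongrightarrow> s - 0"
    by (intro tendsto_diff tendsto_const) (simp add: LIMSEQ_divide_realpow_zero)
  hence "(\<lambda>k. s - 1 / 2 ^ k) \<longlonglongrightarrow> s" by simp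
  moreover have "(\<lambda>k. s) \<longlonglongrightarrow> s" by simp
  ultimately show "(\<lambda>k. grid k s) \<longlonglongrightarrow> s"
    by (rule tendsto_sandwich[rotated 2])
       (use grid_ge[OF assms] grid_le[of s] assms in \<open>simp_all add: always_eventually\<close>)
qed

section \<open>Measurability in time and chance, and dyadic approximation\<close>

context filtered_prob_space
begin

text \<open>Left continuity is the right class because the truncated solutions in the uniqueness
  proof jump to 0.\<close>

definition left_continuous_adapted :: "(real \<Rightarrow> 'w \<Rightarrow> real) \<Rightarrow> bool" where
  "left_continuous_adapted H \<longleftrightarrow> (\<forall>t\<ge>0. H t \<in> borel_measurable (F t)) \<and>
    (\<forall>\<omega>\<in>space M. \<forall>t>0. ((\<lambda>s. H s \<omega>) \<longlongrightarrow> H t \<omega>) (at_left t))"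

lemma continuous_imp_left_continuous_adapted:
  assumes "continuous_adapted Y" shows "left_continuous_adapted Y"
  unfolding left_continuous_adapted_def
proof (intro conjI ballI allI impI)
  fix \<omega> and t :: real assume \<omega>: "\<omega> \<in> space M" and t: "0 < t"
  have "continuous_on {0..} (\<lambda>t. Y t \<omega>)" using assms \<omega> by (simp add: continuous_adapted_def)
  hence "((\<lambda>s. Y s \<omega>) \<longlongrightarrow> Y t \<omega>) (at t within {0..})"
    using t by (auto simp: continuous_on_def)
  moreover have "at t within {0..} = at t" using t by (intro at_within_interior) auto
  ultimately show "((\<lambda>s. Y s \<omega>) \<longlongrightarrow> Y t \<omega>) (at_left t)"
    by (auto intro: filterlim_mono[OF _ order_refl at_le])
qed (use assms in \<open>simp add: continuous_adapted_def\<close>)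

lemma left_continuous_grid:
  assumes "left_continuous_adapted H" "\<omega> \<in> space M" "0 \<le> s"
  shows "(\<lambda>k. H (grid k s) \<omega>) \<longlonglongrightarrow> H s \<omega>"
proof (cases "s = 0")
  case False
  hence s: "0 < s" using assms(3) by simp
  have "((\<lambda>s. H s \<omega>) \<longlongrightarrow> H s \<omega>) (at_left s)"
    using assms(1,2) s by (simp add: left_continuous_adapted_def)
  from filterlim_compose[OF this filterlim_grid[OF s]] show ?thesis .
qed simp

text \<open>Evaluation at the grid point below the time gives a function with countably many time
  slices, each measurable for \<open>F T\<close>, and left continuity makes the process their limit.
  Clamping the time to [0, T] gives a function on the whole real line.\<close>

lemma progressively_measurable_stopped:
  assumes H: "left_continuous_adapted H" and T: "0 \<le> T"
  shows "(\<lambda>(s, \<omega>). H (max 0 (min s T)) \<omega>) \<in> borel_measurable (borel \<Otimes>\<^sub>M F T)"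
proof (rule borel_measurable_LIMSEQ_real)
  fix k
  \<comment> \<open>The guard keeps each slice measurable for \<open>F T\<close>; the index computed
    by \<open>?g\<close> always satisfies it, since a grid point does not exceed the clamped
    time.\<close>
  let ?f = "\<lambda>i (x :: real \<times> 'w). if real i / 2 ^ k \<le> T then H (real i / 2 ^ k) (snd x) else 0"
  let ?g = "\<lambda>x :: real \<times> 'w. nat \<lceil>max 0 (min (fst x) T) * 2 ^ k\<rceil> - 1"
  have "(\<lambda>x. ?f (?g x) x) \<in> borel_measurable (borel \<Otimes>\<^sub>M F T)"
  proof (rule measurable_compose_countable[where f="?f" and g="?g"])
    fix i
    show "?f i \<in> borel_measurable (borel \<Otimes>\<^sub>M F T)"
    proof (cases "real i / 2 ^ k \<le> T")
      case True
      have "H (real i / 2 ^ k) \<in> borel_measurable (F T)"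
        by (rule borel_measurable_F_mono[OF _ True]) (use H in \<open>simp add: left_continuous_adapted_def\<close>)
      from measurable_compose[OF measurable_snd this, of borel] show ?thesis
        using True by simp
    qed simp
  next
    show "?g \<in> measurable (borel \<Otimes>\<^sub>M F T) (count_space UNIV)" by measurable
  qed
  moreover have "(\<lambda>x. ?f (?g x) x) = (\<lambda>x :: real \<times> 'w. H (grid k (max 0 (min (fst x) T))) (snd x))"
  proof
    fix x :: "real \<times> 'w"
    have "grid k (max 0 (min (fst x) T)) \<le> T"
      using grid_le[of "max 0 (min (fst x) T)" k] T by auto
    thus "?f (?g x) x = H (grid k (max 0 (min (fst x) T))) (snd x)" unfolding grid_def by (rule if_P)
  qed
  ultimately show "(\<lambda>x. H (grid k (max 0 (min (fst x) T))) (snd x)) \<in> borel_measurable (borel \<Otimes>\<^sub>M F T)"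
    by (simp only:)
next
  fix x assume "x \<in> space ((borel :: real measure) \<Otimes>\<^sub>M F T)"
  hence "snd x \<in> space M" by (auto simp: space_pair_measure space_F)
  thus "(\<lambda>k. H (grid k (max 0 (min (fst x) T))) (snd x)) \<longlonglongrightarrow> (case x of (s, \<omega>) \<Rightarrow> H (max 0 (min s T)) \<omega>)"
    using left_continuous_grid[OF H, of "snd x" "max 0 (min (fst x) T)"] by (simp add: split_beta)
qed

lemma progressively_measurable:
  assumes H: "left_continuous_adapted H" and T: "0 \<le> T"
  shows "(\<lambda>(s, \<omega>). H s \<omega>) \<in> borel_measurable (restrict_space borel {0..T} \<Otimes>\<^sub>M F T)"
proof -
  have id: "(\<lambda>x. x) \<in> measurable (restrict_space borel {0..T}) (borel :: real measure)"
    by (rule measurable_restrict_space1) simp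
  have "(\<lambda>x. (fst x, snd x)) \<in> measurable (restrict_space borel {0..T} \<Otimes>\<^sub>M F T) (borel \<Otimes>\<^sub>M F T)"
    by (rule measurable_Pair[OF measurable_compose[OF measurable_fst id] measurable_snd])
  from measurable_compose[OF this progressively_measurable_stopped[OF H T]]
  have "(\<lambda>x. H (max 0 (min (fst x) T)) (snd x)) \<in> borel_measurable (restrict_space borel {0..T} \<Otimes>\<^sub>M F T)"
    by (simp add: split_beta)
  thus ?thesis
    by (subst measurable_cong[where g="\<lambda>x. H (max 0 (min (fst x) T)) (snd x)"])
       (auto simp: space_pair_measure space_restrict_space max_def min_def)
qed

text \<open>The indicator removes the times about which progressive measurability up to T says
  nothing.\<close>

definition jointly_measurable :: "real \<Rightarrow> (real \<Rightarrow> 'w \<Rightarrow> real) \<Rightarrow> bool" where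
  "jointly_measurable T H \<longleftrightarrow> (\<lambda>(\<omega>, s). indicator {0..T} s * H s \<omega>) \<in> borel_measurable (M \<Otimes>\<^sub>M lborel)"

lemma jointly_measurable_of_progressive:
  assumes "0 \<le> T" "(\<lambda>(s, \<omega>). H s \<omega>) \<in> borel_measurable (restrict_space borel {0..T} \<Otimes>\<^sub>M F T)"
  shows "jointly_measurable T H"
proof -
  have id: "(\<lambda>\<omega>. \<omega>) \<in> measurable M (F T)"
    using sets_F[of T] by (intro measurableI) (auto simp: space_F Int_absorb2[OF sets.sets_into_space])
  have "(\<lambda>s. max 0 (min s T)) \<in> measurable borel (restrict_space borel {0..T})"
    using assms(1) by (intro measurable_restrict_space2) auto
  hence "(\<lambda>x. (max 0 (min (snd x) T), fst x)) \<in> measurable (M \<Otimes>\<^sub>M lborel) (restrict_space borel {0..T} \<Otimes>\<^sub>M F T)"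
    by (intro measurable_Pair measurable_compose[OF measurable_snd] measurable_compose[OF measurable_fst id]) simp
  from measurable_compose[OF this assms(2)]
  have "(\<lambda>x. H (max 0 (min (snd x) T)) (fst x)) \<in> borel_measurable (M \<Otimes>\<^sub>M lborel)"
    by (simp add: split_beta)
  hence "(\<lambda>x. indicator {0..T} (snd x) * H (max 0 (min (snd x) T)) (fst x)) \<in> borel_measurable (M \<Otimes>\<^sub>M lborel)"
    by measurable
  moreover have "(\<lambda>x. indicator {0..T} (snd x) * H (max 0 (min (snd x) T)) (fst x)) = (\<lambda>(\<omega>, s). indicator {0..T} s * H s \<omega>)"
    by (auto simp: fun_eq_iff indicator_def max_def min_def)
  ultimately show ?thesis by (simp add: jointly_measurable_def)
qed

lemma left_continuous_jointly_measurable: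
  "left_continuous_adapted H \<Longrightarrow> 0 \<le> T \<Longrightarrow> jointly_measurable T H"
  by (intro jointly_measurable_of_progressive progressively_measurable)

lemma jointly_measurable_diff:
  assumes "jointly_measurable T H" "jointly_measurable T G"
  shows "jointly_measurable T (\<lambda>s \<omega>. H s \<omega> - G s \<omega>)"
  using borel_measurable_diff[OF assms[unfolded jointly_measurable_def]]
  by (simp add: jointly_measurable_def split_beta right_diff_distrib)

lemma jointly_measurable_square:
  assumes "jointly_measurable T H"
  shows "(\<lambda>(\<omega>, s). ennreal ((H s \<omega>)\<^sup>2) * indicator {0..T} s) \<in> borel_measurable (M \<Otimes>\<^sub>M lborel)"
proof -
  have "(\<lambda>x. ennreal ((indicator {0..T} (snd x) * H (snd x) (fst x))\<^sup>2)) \<in> borel_measurable (M \<Otimes>\<^sub>M lborel)"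
    using assms unfolding jointly_measurable_def split_beta by measurable
  also have "(\<lambda>x. ennreal ((indicator {0..T} (snd x) * H (snd x) (fst x))\<^sup>2)) =
      (\<lambda>(\<omega>, s). ennreal ((H s \<omega>)\<^sup>2) * indicator {0..T} s)"
    by (auto simp: fun_eq_iff indicator_def)
  finally show ?thesis .
qed

lemma measurable_path_square_integral:
  assumes "jointly_measurable T H"
  shows "(\<lambda>\<omega>. \<integral>\<^sup>+s\<in>{0..T}. ennreal ((H s \<omega>)\<^sup>2) \<partial>lborel) \<in> borel_measurable M"
  using lborel.borel_measurable_nn_integral[OF jointly_measurable_square[OF assms]] by simp

lemma jointly_measurable_step_value:
  assumes "nonanticipating_step M F S"
  shows "jointly_measurable T (step_value S)"
proof -
  have "(\<lambda>x. step_value S (snd x) (fst x)) \<in> borel_measurable (M \<Otimes>\<^sub>M lborel)"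
    using assms
  proof (induction S)
    case (Cons a S)
    obtain s r \<zeta> where a: "a = (s, r, \<zeta>)" by (cases a)
    have [measurable]: "\<zeta> \<in> borel_measurable M"
      using Cons.prems borel_measurable_F_M by (auto simp: a nonanticipating_Cons)
    have [measurable]: "(\<lambda>x. step_value S (snd x) (fst x)) \<in> borel_measurable (M \<Otimes>\<^sub>M lborel)"
      using Cons by (auto simp: a nonanticipating_Cons)
    show ?case unfolding a step_value_Cons by measurable
  qed simp
  thus ?thesis unfolding jointly_measurable_def split_beta by measurable
qed

text \<open>The square of the distance in L^2 of the product of M and Lebesgue measure on [0, T],
  whence the factors 2 in its triangle inequality.\<close>

definition l2_dist :: "real \<Rightarrow> (real \<Rightarrow> 'w \<Rightarrow> real) \<Rightarrow> (real \<Rightarrow> 'w \<Rightarrow> real) \<Rightarrow> ennreal" where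
  "l2_dist T H G = (\<integral>\<^sup>+\<omega>. (\<integral>\<^sup>+s\<in>{0..T}. ennreal ((H s \<omega> - G s \<omega>)\<^sup>2) \<partial>lborel) \<partial>M)"

lemma l2_dist_commute: "l2_dist T H G = l2_dist T G H"
  by (simp add: l2_dist_def power2_commute)

lemma l2_dist_mono: "T \<le> T' \<Longrightarrow> l2_dist T H G \<le> l2_dist T' H G"
  unfolding l2_dist_def by (intro nn_integral_mono mult_left_mono) (auto simp: indicator_def)

lemma path_square_triangle:
  assumes "jointly_measurable T H" "jointly_measurable T G" "jointly_measurable T K" "\<omega> \<in> space M"
  shows "(\<integral>\<^sup>+s\<in>{0..T}. ennreal ((H s \<omega> - K s \<omega>)\<^sup>2) \<partial>lborel) \<le>
    2 * (\<integral>\<^sup>+s\<in>{0..T}. ennreal ((H s \<omega> - G s \<omega>)\<^sup>2) \<partial>lborel) + 2 * (\<integral>\<^sup>+s\<in>{0..T}. ennreal ((G s \<omega> - K s \<omega>)\<^sup>2) \<partial>lborel)"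
proof -
  have m: "(\<lambda>s. ennreal ((H s \<omega>)\<^sup>2) * indicator {0..T} s) \<in> borel_measurable lborel"
    if "jointly_measurable T H" for H
    using measurable_compose[OF measurable_Pair1'[OF assms(4)] jointly_measurable_square[OF that]] by simp
  have "(\<integral>\<^sup>+s\<in>{0..T}. ennreal ((H s \<omega> - K s \<omega>)\<^sup>2) \<partial>lborel) \<le>
      (\<integral>\<^sup>+s. 2 * (ennreal ((H s \<omega> - G s \<omega>)\<^sup>2) * indicator {0..T} s) + 2 * (ennreal ((G s \<omega> - K s \<omega>)\<^sup>2) * indicator {0..T} s) \<partial>lborel)"
    using ennreal_square_add_le[of "H s \<omega> - G s \<omega>" "G s \<omega> - K s \<omega>" for s]
    by (intro nn_integral_mono) (simp add: indicator_def)
  also have "\<dots> = 2 * (\<integral>\<^sup>+s\<in>{0..T}. ennreal ((H s \<omega> - G s \<omega>)\<^sup>2) \<partial>lborel) + 2 * (\<integral>\<^sup>+s\<in>{0..T}. ennreal ((G s \<omega> - K s \<omega>)\<^sup>2) \<partial>lborel)"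
    using m[OF jointly_measurable_diff[OF assms(1,2)]] m[OF jointly_measurable_diff[OF assms(2,3)]]
    by (simp add: nn_integral_add nn_integral_cmult)
  finally show ?thesis .
qed

lemma l2_dist_triangle:
  assumes "jointly_measurable T H" "jointly_measurable T G" "jointly_measurable T K"
  shows "l2_dist T H K \<le> 2 * l2_dist T H G + 2 * l2_dist T G K"
proof -
  have "l2_dist T H K \<le> (\<integral>\<^sup>+\<omega>. 2 * (\<integral>\<^sup>+s\<in>{0..T}. ennreal ((H s \<omega> - G s \<omega>)\<^sup>2) \<partial>lborel) +
      2 * (\<integral>\<^sup>+s\<in>{0..T}. ennreal ((G s \<omega> - K s \<omega>)\<^sup>2) \<partial>lborel) \<partial>M)"
    unfolding l2_dist_def by (intro nn_integral_mono path_square_triangle assms)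
  also have "\<dots> = 2 * l2_dist T H G + 2 * l2_dist T G K"
    using measurable_path_square_integral[OF jointly_measurable_diff[OF assms(1,2)]]
      measurable_path_square_integral[OF jointly_measurable_diff[OF assms(2,3)]]
    by (simp add: l2_dist_def nn_integral_add nn_integral_cmult)
  finally show ?thesis .
qed

text \<open>Clipping at level k makes the coefficients bounded, as
  \<open>nonanticipating_step\<close> demands, and disappears in the limit. The last interval may
  reach beyond T.\<close>

definition grid_steps :: "(real \<Rightarrow> 'w \<Rightarrow> real) \<Rightarrow> real \<Rightarrow> nat \<Rightarrow> 'w step_process" where
  "grid_steps H T k = map (\<lambda>i. (real i / 2 ^ k, real (Suc i) / 2 ^ k, \<lambda>\<omega>. clip k (H (real i / 2 ^ k) \<omega>))) [0..<nat \<lceil>T * 2 ^ k\<rceil>]"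

lemma nonanticipating_grid_steps:
  assumes "left_continuous_adapted H"
  shows "nonanticipating_step M F (grid_steps H T k)"
  unfolding nonanticipating_step_def grid_steps_def
proof (clarsimp simp: divide_right_mono, intro conjI)
  fix i
  show "(\<lambda>\<omega>. clip k (H (real i / 2 ^ k) \<omega>)) \<in> borel_measurable (F (real i / 2 ^ k))"
    using assms by (intro measurable_compose[OF _ borel_measurable_clip]) (auto simp: left_continuous_adapted_def)
  show "\<exists>K. \<forall>\<omega>\<in>space M. \<bar>clip k (H (real i / 2 ^ k) \<omega>)\<bar> \<le> K"
    using clip_le(2) by blast
qed

lemma step_value_grid_steps:
  assumes "0 < s" "s \<le> T"
  shows "step_value (grid_steps H T k) s \<omega> = clip k (H (grid k s) \<omega>)"
proof -
  define j where "j = nat \<lceil>s * 2 ^ k\<rceil> - 1"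
  have pos: "0 < s * 2 ^ k" using assms(1) by simp
  have iff: "s \<in> {real i / 2 ^ k<..real (Suc i) / 2 ^ k} \<longleftrightarrow> i = j" for i
  proof -
    have "s \<in> {real i / 2 ^ k<..real (Suc i) / 2 ^ k} \<longleftrightarrow> real i < s * 2 ^ k \<and> s * 2 ^ k \<le> real i + 1"
      by (auto simp: field_simps)
    also have "\<dots> \<longleftrightarrow> \<lceil>s * 2 ^ k\<rceil> = int i + 1"
      by (simp add: ceiling_eq_iff)
    also have "\<dots> \<longleftrightarrow> i = j" using pos by (auto simp: j_def one_le_ceiling nat_eq_iff le_nat_iff)
    finally show ?thesis .
  qed
  have "s * 2 ^ k \<le> T * 2 ^ k" using assms(2) by simp
  hence "\<lceil>s * 2 ^ k\<rceil> \<le> \<lceil>T * 2 ^ k\<rceil>" by (rule ceiling_mono)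
  moreover have "\<lceil>s * 2 ^ k\<rceil> \<ge> 1" using pos by (simp add: one_le_ceiling)
  ultimately have j: "j < nat \<lceil>T * 2 ^ k\<rceil>" unfolding j_def by linarith
  have "step_value (grid_steps H T k) s \<omega> =
      (\<Sum>i<nat \<lceil>T * 2 ^ k\<rceil>. clip k (H (real i / 2 ^ k) \<omega>) * indicator {real i / 2 ^ k<..real (Suc i) / 2 ^ k} s)"
    unfolding step_value_def grid_steps_def
    by (simp add: interv_sum_list_conv_sum_set_nat atLeast0LessThan o_def del: of_nat_Suc)
  also have "\<dots> = (\<Sum>i<nat \<lceil>T * 2 ^ k\<rceil>. if i = j then clip k (H (real j / 2 ^ k) \<omega>) else 0)"
    using iff by (intro sum.cong refl) (auto simp: indicator_def simp del: of_nat_Suc)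
  also have "\<dots> = clip k (H (grid k s) \<omega>)"
    using j by (simp add: grid_def j_def)
  finally show ?thesis .
qed

text \<open>Dominated convergence on the product space, with pointwise convergence from left
  continuity. The majorant D is a separate datum because measurability of \<open>psup\<close> is
  established for continuous paths, whereas H may jump.\<close>

lemma grid_steps_l2_tendsto:
  assumes H: "left_continuous_adapted H" and T: "0 \<le> T"
    and D: "D \<in> borel_measurable M" "(\<integral>\<^sup>+\<omega>. D \<omega> \<partial>M) < \<top>" "\<And>\<omega>. \<omega> \<in> space M \<Longrightarrow> psup T (\<lambda>t. H t \<omega>) \<le> D \<omega>"
  shows "(\<lambda>k. l2_dist T H (step_value (grid_steps H T k))) \<longlonglongrightarrow> 0"
proof -
  \<comment> \<open>The half-open interval drops s = 0, where these step processes vanish whatever H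
    is; a single time does not affect the integral.\<close>
  let ?u = "\<lambda>k (x :: 'w \<times> real). ennreal ((H (snd x) (fst x) - step_value (grid_steps H T k) (snd x) (fst x))\<^sup>2) * indicator {0<..T} (snd x)"
  have jm: "jointly_measurable T (\<lambda>s \<omega>. H s \<omega> - step_value (grid_steps H T k) s \<omega>)" for k
    using H T nonanticipating_grid_steps
    by (intro jointly_measurable_diff left_continuous_jointly_measurable jointly_measurable_step_value)
  have um: "?u k \<in> borel_measurable (M \<Otimes>\<^sub>M lborel)" for k
  proof -
    have "(\<lambda>x. (case x of (\<omega>, s) \<Rightarrow> ennreal ((H s \<omega> - step_value (grid_steps H T k) s \<omega>)\<^sup>2) * indicator {0..T} s) * indicator {0<..T} (snd x))
        \<in> borel_measurable (M \<Otimes>\<^sub>M lborel)"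
      using jointly_measurable_square[OF jm[of k]] by measurable
    also have "(\<lambda>x. (case x of (\<omega>, s) \<Rightarrow> ennreal ((H s \<omega> - step_value (grid_steps H T k) s \<omega>)\<^sup>2) * indicator {0..T} s) * indicator {0<..T} (snd x)) = ?u k"
      by (auto simp: fun_eq_iff indicator_def)
    finally show ?thesis .
  qed
  have eq: "l2_dist T H (step_value (grid_steps H T k)) = (\<integral>\<^sup>+x. ?u k x \<partial>(M \<Otimes>\<^sub>M lborel))" for k
  proof -
    have "l2_dist T H (step_value (grid_steps H T k)) = (\<integral>\<^sup>+\<omega>. \<integral>\<^sup>+s. ?u k (\<omega>, s) \<partial>lborel \<partial>M)"
      unfolding l2_dist_def
      by (intro nn_integral_cong nn_integral_cong_AE eventually_mono[OF AE_lborel_singleton[of 0]])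
         (auto simp: indicator_def)
    also have "\<dots> = (\<integral>\<^sup>+x. ?u k x \<partial>(M \<Otimes>\<^sub>M lborel))"
      by (rule lborel.nn_integral_fst[OF um])
    finally show ?thesis .
  qed
  have "(\<lambda>k. \<integral>\<^sup>+x. ?u k x \<partial>(M \<Otimes>\<^sub>M lborel)) \<longlonglongrightarrow> (\<integral>\<^sup>+x. 0 \<partial>(M \<Otimes>\<^sub>M (lborel :: real measure)))"
  proof (rule nn_integral_dominated_convergence[where w="\<lambda>x. 4 * D (fst x) * indicator {0..T} (snd x)"])
    show "(\<lambda>x. 4 * D (fst x) * indicator {0..T} (snd x)) \<in> borel_measurable (M \<Otimes>\<^sub>M lborel)"
      using D(1) by measurable
    show "AE x in M \<Otimes>\<^sub>M lborel. ?u k x \<le> 4 * D (fst x) * indicator {0..T} (snd x)" for k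
    proof (rule AE_I2)
      fix x assume "x \<in> space (M \<Otimes>\<^sub>M (lborel :: real measure))"
      hence \<omega>: "fst x \<in> space M" by (auto simp: space_pair_measure)
      show "?u k x \<le> 4 * D (fst x) * indicator {0..T} (snd x)"
      proof (cases "0 < snd x \<and> snd x \<le> T")
        case True
        let ?h = "H (snd x) (fst x)" and ?c = "clip k (H (grid k (snd x)) (fst x))"
        have "ennreal ((?h - ?c)\<^sup>2) \<le> 2 * ennreal (?h\<^sup>2) + 2 * ennreal (?c\<^sup>2)"
          using ennreal_square_add_le[of ?h "- ?c"] by simp
        also have "ennreal (?h\<^sup>2) \<le> D (fst x)"
          using True by (intro order_trans[OF psup_upper D(3)[OF \<omega>]]) auto
        also have "ennreal (?c\<^sup>2) \<le> ennreal ((H (grid k (snd x)) (fst x))\<^sup>2)"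
          using clip_le(1) by (intro ennreal_leI) (simp add: abs_le_square_iff[symmetric])
        also have "\<dots> \<le> D (fst x)"
          using True grid_nonneg grid_le[of "snd x" k] by (intro order_trans[OF psup_upper D(3)[OF \<omega>]]) auto
        finally have "ennreal ((?h - ?c)\<^sup>2) \<le> 2 * D (fst x) + 2 * D (fst x)" by (simp add: mult_left_mono add_mono)
        also have "\<dots> = 4 * D (fst x)" by (simp add: distrib_right[symmetric])
        finally show ?thesis using True by (simp add: step_value_grid_steps)
      qed auto
    qed
    have "(\<integral>\<^sup>+x. 4 * D (fst x) * indicator {0..T} (snd x) \<partial>(M \<Otimes>\<^sub>M lborel)) =
        (\<integral>\<^sup>+\<omega>. \<integral>\<^sup>+s. 4 * D \<omega> * indicator {0..T} s \<partial>lborel \<partial>M)"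
      using D(1) by (subst lborel.nn_integral_fst[symmetric]) auto
    also have "\<dots> = 4 * ennreal T * (\<integral>\<^sup>+\<omega>. D \<omega> \<partial>M)"
      using D(1) T by (simp add: nn_integral_cmult_indicator nn_integral_cmult nn_integral_multc ac_simps)
    also have "\<dots> < \<infinity>" using D(2) by (simp add: ennreal_mult_less_top)
    finally show "(\<integral>\<^sup>+x. 4 * D (fst x) * indicator {0..T} (snd x) \<partial>(M \<Otimes>\<^sub>M lborel)) < \<infinity>" .
    show "AE x in M \<Otimes>\<^sub>M lborel. (\<lambda>k. ?u k x) \<longlonglongrightarrow> 0"
    proof (rule AE_I2)
      fix x assume "x \<in> space (M \<Otimes>\<^sub>M (lborel :: real measure))"
      hence \<omega>: "fst x \<in> space M" by (auto simp: space_pair_measure)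
      show "(\<lambda>k. ?u k x) \<longlonglongrightarrow> 0"
      proof (cases "0 < snd x \<and> snd x \<le> T")
        case True
        have "(\<lambda>k. clip k (H (grid k (snd x)) (fst x))) \<longlonglongrightarrow> H (snd x) (fst x)"
          using True by (intro clip_tendsto left_continuous_grid[OF H \<omega>]) auto
        hence "(\<lambda>k. ennreal ((H (snd x) (fst x) - clip k (H (grid k (snd x)) (fst x)))\<^sup>2)) \<longlonglongrightarrow> ennreal ((H (snd x) (fst x) - H (snd x) (fst x))\<^sup>2)"
          by (intro tendsto_ennrealI tendsto_intros)
        thus ?thesis using True by (simp add: step_value_grid_steps)
      qed auto
    qed
  qed (use um in auto)
  thus ?thesis by (simp add: eq)
qed

end

section \<open>The Ito integral as a continuous process\<close>

lemma suminf_geometric_finite: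
  fixes f :: "nat \<Rightarrow> ennreal"
  assumes fin: "\<And>k. f k < \<top>" and le: "\<And>k. N \<le> k \<Longrightarrow> f k \<le> ennreal (c * (1/4) ^ k)" and c: "0 \<le> c"
  shows "(\<Sum>k. f k) < \<top>"
proof -
  have s: "(\<lambda>k. c * (1/4::real) ^ k) sums (c * (1 / (1 - 1/4)))"
    by (intro sums_mult geometric_sums) simp
  have "(\<Sum>k. f (k + N)) \<le> (\<Sum>k. ennreal (c * (1/4) ^ (k + N)))"
    using le by (intro suminf_le) auto
  also have "\<dots> \<le> (\<Sum>k. ennreal (c * (1/4) ^ k))"
    using c by (intro suminf_le ennreal_leI mult_left_mono power_decreasing) auto
  also have "\<dots> = ennreal (c * (1 / (1 - 1/4)))"
    using s c by (intro suminf_ennreal_eq) auto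
  also have "\<dots> < \<top>" by simp
  finally have "(\<Sum>k. f (k + N)) < \<top>" .
  moreover have "(\<Sum>k<N. f k) < \<top>" using fin by simp
  ultimately show ?thesis by (subst suminf_offset[of _ N]) (auto simp: ennreal_add_eq_top less_top[symmetric])
qed

context prob_space
begin

lemma markov_tendsto:
  assumes f: "\<And>k. f k \<in> borel_measurable M" and lim: "(\<lambda>k. \<integral>\<^sup>+\<omega>. f k \<omega> \<partial>M) \<longlonglongrightarrow> 0" and e: "0 < e"
  shows "(\<lambda>k. measure M {\<omega> \<in> space M. f k \<omega> > ennreal e}) \<longlonglongrightarrow> 0"
proof -
  have le: "emeasure M {\<omega> \<in> space M. f k \<omega> > ennreal e} \<le> ennreal (1 / e) * (\<integral>\<^sup>+\<omega>. f k \<omega> \<partial>M)" for k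
  proof -
    have "emeasure M {\<omega> \<in> space M. f k \<omega> > ennreal e} \<le> emeasure M {\<omega> \<in> space M. 1 \<le> ennreal (1 / e) * f k \<omega>}"
    proof (rule emeasure_mono)
      show "{\<omega> \<in> space M. f k \<omega> > ennreal e} \<subseteq> {\<omega> \<in> space M. 1 \<le> ennreal (1 / e) * f k \<omega>}"
      proof clarify
        fix \<omega> assume "ennreal e < f k \<omega>"
        hence "ennreal (1 / e) * ennreal e \<le> ennreal (1 / e) * f k \<omega>"
          by (intro mult_left_mono) auto
        thus "1 \<le> ennreal (1 / e) * f k \<omega>" using e by (simp add: ennreal_mult[symmetric])
      qed
      show "{\<omega> \<in> space M. 1 \<le> ennreal (1 / e) * f k \<omega>} \<in> sets M" using f[of k] by measurable
    qed
    also have "\<dots> \<le> ennreal (1 / e) * (\<integral>\<^sup>+\<omega>. f k \<omega> * indicator (space M) \<omega> \<partial>M)"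
      using f[of k] by (intro nn_integral_Markov_inequality) auto
    also have "(\<integral>\<^sup>+\<omega>. f k \<omega> * indicator (space M) \<omega> \<partial>M) = (\<integral>\<^sup>+\<omega>. f k \<omega> \<partial>M)"
      by (intro nn_integral_cong) simp
    finally show ?thesis .
  qed
  have "(\<lambda>k. ennreal (1 / e) * (\<integral>\<^sup>+\<omega>. f k \<omega> \<partial>M)) \<longlonglongrightarrow> ennreal (1 / e) * 0"
    by (intro ennreal_tendsto_cmult lim) simp
  hence up: "(\<lambda>k. ennreal (1 / e) * (\<integral>\<^sup>+\<omega>. f k \<omega> \<partial>M)) \<longlonglongrightarrow> 0" by simp
  have "(\<lambda>k. emeasure M {\<omega> \<in> space M. f k \<omega> > ennreal e}) \<longlonglongrightarrow> 0"
    by (rule tendsto_sandwich[OF _ _ tendsto_const up]) (auto intro: always_eventually le)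
  hence "(\<lambda>k. ennreal (measure M {\<omega> \<in> space M. f k \<omega> > ennreal e})) \<longlonglongrightarrow> ennreal 0"
    by (simp add: emeasure_eq_measure)
  thus ?thesis by (rule tendsto_ennrealD) auto
qed

end

locale continuous_integrator = integrator M F X B for M :: "'w measure" and F X B +
  assumes continuous: "\<omega> \<in> space M \<Longrightarrow> continuous_on {0..} (\<lambda>t. X t \<omega>)"
begin

lemma step_integral_continuous_adapted:
  assumes S: "nonanticipating_step M F S"
  shows "continuous_adapted (step_integral X S)"
  unfolding continuous_adapted_def
proof (intro conjI ballI allI impI)
  fix \<omega> assume \<omega>: "\<omega> \<in> space M"
  have X: "continuous_on {0..} (\<lambda>t. X (min r t) \<omega>)" if "0 \<le> r" for r
    using that by (intro continuous_on_compose2[OF continuous[OF \<omega>]] continuous_intros) auto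
  show "continuous_on {0..} (\<lambda>t. step_integral X S t \<omega>)"
    using S
  proof (induction S)
    case (Cons a S)
    obtain s r \<zeta> where a: "a = (s, r, \<zeta>)" by (cases a)
    have sr: "0 \<le> s" "0 \<le> r" "nonanticipating_step M F S"
      using Cons.prems by (auto simp: a nonanticipating_Cons)
    show ?case unfolding a step_integral_Cons
      by (intro continuous_on_add continuous_on_mult continuous_on_diff continuous_on_const X sr Cons.IH)
  qed simp
qed (use step_integral_measurable[OF S] in auto)

text \<open>The maximal inequality over the finite initial segments of a dense sequence, followed by
  monotone convergence.\<close>

lemma step_integral_psup:
  assumes S: "nonanticipating_step M F S" and T: "0 \<le> T"
  shows "(\<integral>\<^sup>+\<omega>. psup T (\<lambda>t. step_integral X S t \<omega>) \<partial>M) \<le> 4 * ennreal B * l2_dist T (step_value S) (\<lambda>_ _. 0)"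
proof -
  note ca = step_integral_continuous_adapted[OF S]
  obtain d :: "nat \<Rightarrow> real" where d: "range d \<subseteq> {0..T}"
    "\<And>f. continuous_on {0..T} f \<Longrightarrow> psup T f = (SUP n. ennreal ((f (d n))\<^sup>2))"
    using ex_psup_countable[OF T] by blast
  let ?g = "\<lambda>n \<omega>. SUP p\<in>d ` {..n}. ennreal ((step_integral X S p \<omega>)\<^sup>2)"
  have "(\<integral>\<^sup>+\<omega>. psup T (\<lambda>t. step_integral X S t \<omega>) \<partial>M) = (\<integral>\<^sup>+\<omega>. (SUP n. ?g n \<omega>) \<partial>M)"
  proof (rule nn_integral_cong)
    fix \<omega> assume \<omega>: "\<omega> \<in> space M"
    have "continuous_on {0..T} (\<lambda>t. step_integral X S t \<omega>)"
      using ca \<omega> by (auto simp: continuous_adapted_def intro: continuous_on_subset)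
    from d(2)[OF this] have "psup T (\<lambda>t. step_integral X S t \<omega>) = (SUP n. ennreal ((step_integral X S (d n) \<omega>)\<^sup>2))" .
    also have "\<dots> = (SUP n. ?g n \<omega>)"
      by (intro antisym SUP_least) (auto intro!: SUP_upper2[of _ _ _ "\<lambda>n. ?g n \<omega>"] SUP_upper)
    finally show "psup T (\<lambda>t. step_integral X S t \<omega>) = (SUP n. ?g n \<omega>)" .
  qed
  also have "\<dots> = (SUP n. \<integral>\<^sup>+\<omega>. ?g n \<omega> \<partial>M)"
  proof (rule nn_integral_monotone_convergence_SUP)
    show "incseq ?g" by (intro incseq_SucI le_funI SUP_subset_mono) auto
    show "?g n \<in> borel_measurable M" for n
      using d(1)[unfolded image_subset_iff] continuous_adapted_measurable[OF ca]
      by (intro borel_measurable_SUP measurable_compose[OF _ measurable_ennreal] borel_measurable_power) auto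
  qed
  also have "\<dots> \<le> 4 * ennreal B * l2_dist T (step_value S) (\<lambda>_ _. 0)"
    using d(1) by (intro SUP_least) (auto simp: l2_dist_def intro!: step_integral_maximal[OF S _ _ T])
  finally show ?thesis .
qed

lemma step_integral_psup_diff:
  assumes S: "nonanticipating_step M F S" "nonanticipating_step M F S'" and T: "0 \<le> T"
  shows "(\<integral>\<^sup>+\<omega>. psup T (\<lambda>t. step_integral X S t \<omega> - step_integral X S' t \<omega>) \<partial>M) \<le>
    4 * ennreal B * l2_dist T (step_value S) (step_value S')"
  using step_integral_psup[OF nonanticipating_append[OF S(1) nonanticipating_uminus[OF S(2)]] T]
  by (simp add: step_integral_append step_value_append l2_dist_def)

text \<open>Stronger than \<open>ito_integral\<close>: one sequence of step processes serves all
  horizons, and the convergence is in mean square, uniformly in time. The result is a process with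
  continuous paths, not a random variable for each t.\<close>

definition ito_process :: "(real \<Rightarrow> 'w \<Rightarrow> real) \<Rightarrow> (real \<Rightarrow> 'w \<Rightarrow> real) \<Rightarrow> bool" where
  "ito_process H Y \<longleftrightarrow> continuous_adapted Y \<and> (\<forall>T\<ge>0. jointly_measurable T H) \<and>
    (\<exists>S. (\<forall>k. nonanticipating_step M F (S k)) \<and>
      (\<forall>T\<ge>0. (\<lambda>k. l2_dist T H (step_value (S k))) \<longlonglongrightarrow> 0) \<and>
      (\<forall>T\<ge>0. (\<lambda>k. \<integral>\<^sup>+\<omega>. psup T (\<lambda>t. Y t \<omega> - step_integral X (S k) t \<omega>) \<partial>M) \<longlonglongrightarrow> 0))"

text \<open>The estimate for step processes passes to the limit. The factor is 64 = 4 * 4 * 4: two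
  nested quasi-triangle inequalities for the suprema, the constant of the maximal inequality, and
  two more for \<open>l2_dist\<close>. Taking H' = 0 bounds a single integral.\<close>

lemma ito_process_bound:
  assumes Y: "ito_process H Y" and Y': "ito_process H' Y'" and T: "0 \<le> T"
  shows "(\<integral>\<^sup>+\<omega>. psup T (\<lambda>t. Y t \<omega> - Y' t \<omega>) \<partial>M) \<le> 64 * ennreal B * l2_dist T H H'"
proof -
  obtain S where S: "\<And>k. nonanticipating_step M F (S k)"
    "(\<lambda>k. l2_dist T H (step_value (S k))) \<longlonglongrightarrow> 0"
    "(\<lambda>k. \<integral>\<^sup>+\<omega>. psup T (\<lambda>t. Y t \<omega> - step_integral X (S k) t \<omega>) \<partial>M) \<longlonglongrightarrow> 0"
    using Y T unfolding ito_process_def by blast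
  obtain S' where S': "\<And>k. nonanticipating_step M F (S' k)"
    "(\<lambda>k. l2_dist T H' (step_value (S' k))) \<longlonglongrightarrow> 0"
    "(\<lambda>k. \<integral>\<^sup>+\<omega>. psup T (\<lambda>t. Y' t \<omega> - step_integral X (S' k) t \<omega>) \<partial>M) \<longlonglongrightarrow> 0"
    using Y' T unfolding ito_process_def by blast
  have ca: "continuous_adapted Y" "continuous_adapted Y'" and jm: "jointly_measurable T H" "jointly_measurable T H'"
    using Y Y' T by (auto simp: ito_process_def)
  let ?a = "\<lambda>k. \<integral>\<^sup>+\<omega>. psup T (\<lambda>t. Y t \<omega> - step_integral X (S k) t \<omega>) \<partial>M"
  let ?a' = "\<lambda>k. \<integral>\<^sup>+\<omega>. psup T (\<lambda>t. Y' t \<omega> - step_integral X (S' k) t \<omega>) \<partial>M"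
  let ?b = "\<lambda>k. l2_dist T H (step_value (S k))" and ?b' = "\<lambda>k. l2_dist T H' (step_value (S' k))"
  let ?L = "l2_dist T H H'"
  have le: "(\<integral>\<^sup>+\<omega>. psup T (\<lambda>t. Y t \<omega> - Y' t \<omega>) \<partial>M) \<le>
      2 * ?a k + 2 * (2 * (4 * ennreal B * (2 * ?b k + 2 * (2 * ?L + 2 * ?b' k))) + 2 * ?a' k)" for k
  proof -
    let ?I = "step_integral X (S k)" and ?I' = "step_integral X (S' k)"
    have m: "(\<lambda>\<omega>. psup T (\<lambda>t. Y t \<omega> - ?I t \<omega>)) \<in> borel_measurable M"
      "(\<lambda>\<omega>. psup T (\<lambda>t. ?I t \<omega> - ?I' t \<omega>)) \<in> borel_measurable M"
      "(\<lambda>\<omega>. psup T (\<lambda>t. ?I' t \<omega> - Y' t \<omega>)) \<in> borel_measurable M"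
      using ca S(1) S'(1) T by (auto intro!: measurable_psup_diff step_integral_continuous_adapted)
    have "(\<integral>\<^sup>+\<omega>. psup T (\<lambda>t. Y t \<omega> - Y' t \<omega>) \<partial>M) \<le>
      (\<integral>\<^sup>+\<omega>. 2 * psup T (\<lambda>t. Y t \<omega> - ?I t \<omega>) + 2 * (2 * psup T (\<lambda>t. ?I t \<omega> - ?I' t \<omega>) + 2 * psup T (\<lambda>t. ?I' t \<omega> - Y' t \<omega>)) \<partial>M)"
    proof (rule nn_integral_mono)
      fix \<omega>
      have "psup T (\<lambda>t. Y t \<omega> - Y' t \<omega>) \<le> 2 * psup T (\<lambda>t. Y t \<omega> - ?I t \<omega>) + 2 * psup T (\<lambda>t. ?I t \<omega> - Y' t \<omega>)"
        by (rule psup_triangle)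
      also have "\<dots> \<le> 2 * psup T (\<lambda>t. Y t \<omega> - ?I t \<omega>) + 2 * (2 * psup T (\<lambda>t. ?I t \<omega> - ?I' t \<omega>) + 2 * psup T (\<lambda>t. ?I' t \<omega> - Y' t \<omega>))"
        by (intro add_left_mono mult_left_mono psup_triangle) auto
      finally show "psup T (\<lambda>t. Y t \<omega> - Y' t \<omega>) \<le> \<dots>" .
    qed
    also have "\<dots> = 2 * ?a k + 2 * (2 * (\<integral>\<^sup>+\<omega>. psup T (\<lambda>t. ?I t \<omega> - ?I' t \<omega>) \<partial>M) + 2 * ?a' k)"
      using m by (simp add: nn_integral_add nn_integral_cmult psup_minus_commute[of T "\<lambda>t. ?I' t \<omega>" for \<omega>])
    also have "(\<integral>\<^sup>+\<omega>. psup T (\<lambda>t. ?I t \<omega> - ?I' t \<omega>) \<partial>M) \<le> 4 * ennreal B * l2_dist T (step_value (S k)) (step_value (S' k))"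
      by (rule step_integral_psup_diff[OF S(1) S'(1) T])
    also have "l2_dist T (step_value (S k)) (step_value (S' k)) \<le> 2 * l2_dist T (step_value (S k)) H + 2 * l2_dist T H (step_value (S' k))"
      using jm S(1) S'(1) by (intro l2_dist_triangle jointly_measurable_step_value)
    also have "l2_dist T (step_value (S k)) H = ?b k" by (rule l2_dist_commute)
    also have "l2_dist T H (step_value (S' k)) \<le> 2 * ?L + 2 * ?b' k"
      using jm S'(1) by (intro l2_dist_triangle jointly_measurable_step_value)
    finally show ?thesis by (simp add: mult_left_mono add_mono)
  qed
  have "(\<lambda>k. 2 * ?a k + 2 * (2 * (4 * ennreal B * (2 * ?b k + 2 * (2 * ?L + 2 * ?b' k))) + 2 * ?a' k)) \<longlonglongrightarrow>
      2 * 0 + 2 * (2 * (4 * ennreal B * (2 * 0 + 2 * (2 * ?L + 2 * 0))) + 2 * 0)"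
    by (intro tendsto_add ennreal_tendsto_cmult S S' tendsto_const) (auto simp: ennreal_mult_less_top)
  hence "(\<integral>\<^sup>+\<omega>. psup T (\<lambda>t. Y t \<omega> - Y' t \<omega>) \<partial>M) \<le> 2 * 0 + 2 * (2 * (4 * ennreal B * (2 * 0 + 2 * (2 * ?L + 2 * 0))) + 2 * 0)"
    using le by (intro LIMSEQ_le_const) blast+
  also have "\<dots> = 64 * ennreal B * ?L"
  proof -
    have "2 * (2 * (4 * ennreal B * (2 * (2 * ?L)))) = (2 * 2 * 4 * 2 * 2) * ennreal B * ?L"
      by (simp only: mult.assoc mult.left_commute[of "ennreal B"])
    thus ?thesis by simp
  qed
  finally show ?thesis .
qed

lemma ito_process_0: "ito_process (\<lambda>_ _. 0) (\<lambda>_ _. 0)"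
  unfolding ito_process_def
  by (intro conjI exI[of _ "\<lambda>_. []"])
     (auto simp: continuous_adapted_def jointly_measurable_def l2_dist_def nonanticipating_step_def split_beta)

text \<open>Step processes are bounded. This controls the first terms of the approximating series,
  to which the geometric bound does not apply yet.\<close>

lemma step_value_l2_finite:
  assumes "nonanticipating_step M F S" "nonanticipating_step M F S'" "0 \<le> T"
  shows "l2_dist T (step_value S) (step_value S') < \<top>"
proof -
  have bdd: "\<exists>c\<ge>0. \<forall>\<omega>\<in>space M. \<forall>s. \<bar>step_value S s \<omega>\<bar> \<le> c" if "nonanticipating_step M F S" for S
    using that
  proof (induction S)
    case (Cons a S)
    obtain s r \<zeta> where a: "a = (s, r, \<zeta>)" by (cases a)
    obtain K where K: "\<And>\<omega>. \<omega> \<in> space M \<Longrightarrow> \<bar>\<zeta> \<omega>\<bar> \<le> K" and S: "nonanticipating_step M F S"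
      using Cons.prems by (auto simp: a nonanticipating_Cons)
    from Cons.IH[OF S] obtain c where c: "0 \<le> c" "\<And>\<omega> s. \<omega> \<in> space M \<Longrightarrow> \<bar>step_value S s \<omega>\<bar> \<le> c" by blast
    have "\<bar>step_value (a # S) q \<omega>\<bar> \<le> \<bar>K\<bar> + c" if "\<omega> \<in> space M" for q \<omega>
    proof -
      have "\<bar>\<zeta> \<omega> * indicator {s<..r} q\<bar> \<le> \<bar>K\<bar>" using K[OF that] by (auto simp: indicator_def)
      with c(2)[OF that, of q] show ?thesis by (simp add: a)
    qed
    thus ?case using c(1) by (intro exI[of _ "\<bar>K\<bar> + c"]) auto
  qed auto
  obtain c where c: "\<And>\<omega> s. \<omega> \<in> space M \<Longrightarrow> \<bar>step_value (S @ step_uminus S') s \<omega>\<bar> \<le> c"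
    using bdd[OF nonanticipating_append[OF assms(1) nonanticipating_uminus[OF assms(2)]]] by blast
  have "l2_dist T (step_value S) (step_value S') \<le> (\<integral>\<^sup>+\<omega>. (\<integral>\<^sup>+s. ennreal (c\<^sup>2) * indicator {0..T} s \<partial>lborel) \<partial>M)"
    unfolding l2_dist_def
  proof (intro nn_integral_mono mult_right_mono ennreal_leI)
    fix \<omega> s assume \<omega>: "\<omega> \<in> space M"
    have "\<bar>step_value S s \<omega> - step_value S' s \<omega>\<bar> \<le> \<bar>c\<bar>"
      using c[OF \<omega>, of s] by (simp add: step_value_append)
    thus "(step_value S s \<omega> - step_value S' s \<omega>)\<^sup>2 \<le> c\<^sup>2" by (simp add: abs_le_square_iff)
  qed auto
  also have "\<dots> < \<top>"
    using assms(3) by (simp add: nn_integral_cmult_indicator emeasure_space_1 ennreal_mult_less_top)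
  finally show ?thesis .
qed

text \<open>The n-th step process has squared error at most 8^-n on the growing horizon [0, n], so
  one sequence serves all T. Against the weights 2^k this leaves a geometric series with ratio 1/4,
  valid from the index on at which n >= T.\<close>

lemma ex_ito_process:
  assumes H: "left_continuous_adapted H"
    and dom: "\<And>T. 0 \<le> T \<Longrightarrow> \<exists>D\<in>borel_measurable M. (\<integral>\<^sup>+\<omega>. D \<omega> \<partial>M) < \<top> \<and> (\<forall>\<omega>\<in>space M. psup T (\<lambda>t. H t \<omega>) \<le> D \<omega>)"
  shows "\<exists>Y. ito_process H Y"
proof -
  have "\<exists>S. nonanticipating_step M F S \<and> l2_dist (real n) H (step_value S) \<le> ennreal ((1/8) ^ n)" for n
  proof -
    obtain D where "D \<in> borel_measurable M" "(\<integral>\<^sup>+\<omega>. D \<omega> \<partial>M) < \<top>" "\<And>\<omega>. \<omega> \<in> space M \<Longrightarrow> psup (real n) (\<lambda>t. H t \<omega>) \<le> D \<omega>"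
      using dom[of "real n"] by auto
    hence "(\<lambda>k. l2_dist (real n) H (step_value (grid_steps H (real n) k))) \<longlonglongrightarrow> 0"
      by (intro grid_steps_l2_tendsto[OF H]) auto
    hence "\<forall>\<^sub>F k in sequentially. l2_dist (real n) H (step_value (grid_steps H (real n) k)) < ennreal ((1/8) ^ n)"
      by (rule order_tendstoD) simp
    then obtain k where "l2_dist (real n) H (step_value (grid_steps H (real n) k)) < ennreal ((1/8) ^ n)"
      by (auto simp: eventually_sequentially)
    thus ?thesis using nonanticipating_grid_steps[OF H] by (intro exI[of _ "grid_steps H (real n) k"]) auto
  qed
  then obtain S where S: "\<And>n. nonanticipating_step M F (S n)" "\<And>n. l2_dist (real n) H (step_value (S n)) \<le> ennreal ((1/8) ^ n)"
    by metis
  have jm: "jointly_measurable T H" "jointly_measurable T (step_value (S n))" if "0 \<le> T" for T n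
    using left_continuous_jointly_measurable[OF H that] jointly_measurable_step_value[OF S(1)] by auto
  have dist: "l2_dist T H (step_value (S n)) \<le> ennreal ((1/8) ^ n)" if "T \<le> real n" for T n
    using l2_dist_mono[OF that] S(2)[of n] by (rule order_trans)
  \<comment> \<open>The factor 16 is 4 from the maximal inequality times 2 + 2 from the triangle
    inequality, with 8^-(n + 1) rounded up to 8^-n.\<close>
  have diff: "4 * ennreal B * l2_dist T (step_value (S (Suc n))) (step_value (S n)) \<le> ennreal (16 * B * (1/8) ^ n)"
    if T: "0 \<le> T" "T \<le> real n" for T n
  proof -
    have "l2_dist T (step_value (S (Suc n))) (step_value (S n)) \<le>
        2 * l2_dist T (step_value (S (Suc n))) H + 2 * l2_dist T H (step_value (S n))"
      using jm[OF T(1)] by (intro l2_dist_triangle)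
    also have "\<dots> \<le> 2 * ennreal ((1/8) ^ Suc n) + 2 * ennreal ((1/8) ^ n)"
      using dist[of T n] dist[of T "Suc n"] T(2) by (intro add_mono mult_left_mono) (auto simp: l2_dist_commute[of T "step_value (S (Suc n))" H])
    also have "\<dots> \<le> 2 * ennreal ((1/8) ^ n) + 2 * ennreal ((1/8) ^ n)"
      by (intro add_mono mult_left_mono ennreal_leI power_decreasing) auto
    also have "\<dots> = 4 * ennreal ((1/8) ^ n)" by (simp add: distrib_right[symmetric])
    finally have "4 * ennreal B * l2_dist T (step_value (S (Suc n))) (step_value (S n)) \<le> 4 * ennreal B * (4 * ennreal ((1/8) ^ n))"
      by (intro mult_left_mono) auto
    also have "\<dots> = ennreal (16 * B * (1/8) ^ n)"
    proof -
      have "ennreal (16 * (B * (1/8) ^ n)) = 16 * (ennreal B * ennreal ((1/8) ^ n))"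
        using B_nonneg by (subst ennreal_mult) (auto simp: ennreal_mult)
      thus ?thesis by (simp add: mult.assoc mult.left_commute[of "ennreal B"])
    qed
    finally show ?thesis .
  qed
  let ?d = "\<lambda>T k. \<integral>\<^sup>+\<omega>. psup T (\<lambda>t. step_integral X (S (Suc k)) t \<omega> - step_integral X (S k) t \<omega>) \<partial>M"
  have d_le: "2 ^ k * ?d T (n + k) \<le> ennreal (16 * B * (1/8) ^ n * (1/4) ^ k)" if T: "0 \<le> T" "T \<le> real (n + k)" for T n k
  proof -
    have "2 ^ k * ?d T (n + k) \<le> 2 ^ k * ennreal (16 * B * (1/8) ^ (n + k))"
      using step_integral_psup_diff[OF S(1) S(1) T(1)] diff[OF T] by (intro mult_left_mono) (auto intro: order_trans)
    also have "\<dots> = ennreal (2 ^ k * (16 * B * (1/8) ^ (n + k)))"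
      using B_nonneg by (subst ennreal_mult) (auto simp: ennreal_2_power)
    also have "2 ^ k * (16 * B * (1/8) ^ (n + k)) = 16 * B * (1/8) ^ n * (2 * (1/8)) ^ k"
      by (simp only: power_add power_mult_distrib) (simp add: ac_simps)
    finally show ?thesis by simp
  qed
  have fin: "(\<Sum>k. 2 ^ k * ?d T k) < \<top>" if T: "0 \<le> T" for T
  proof -
    obtain N :: nat where N: "T \<le> real N" using real_arch_simple by blast
    show ?thesis
    proof (rule suminf_geometric_finite)
      show "2 ^ k * ?d T k < \<top>" for k
      proof -
        have "?d T k \<le> 4 * ennreal B * l2_dist T (step_value (S (Suc k))) (step_value (S k))"
          by (rule step_integral_psup_diff[OF S(1) S(1) T])
        also have "\<dots> < \<top>"
          using step_value_l2_finite[OF S(1) S(1) T] by (simp add: ennreal_mult_less_top)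
        finally have "?d T k < \<top>" .
        moreover have "(2::ennreal) ^ k < \<top>" by (simp add: ennreal_2_power[symmetric])
        ultimately show ?thesis by (simp add: ennreal_mult_less_top)
      qed
      show "2 ^ k * ?d T k \<le> ennreal (16 * B * (1/4) ^ k)" if "N \<le> k" for k
        using d_le[of T 0 k] T N that by simp
      show "0 \<le> 16 * B" using B_nonneg by simp
    qed
  qed
  obtain Z where Z: "continuous_adapted Z" "\<And>T n. 0 \<le> T \<Longrightarrow>
    (\<integral>\<^sup>+\<omega>. psup T (\<lambda>t. Z t \<omega> - step_integral X (S n) t \<omega>) \<partial>M) \<le> 2 * (\<Sum>k. 2 ^ k * ?d T (n + k))"
    using ex_uniform_limit_process[of "\<lambda>n. step_integral X (S n)", OF step_integral_continuous_adapted[OF S(1)] fin]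
    by auto
  have "ito_process H Z"
    unfolding ito_process_def
  proof (intro conjI exI[of _ S] allI impI)
    fix T :: real assume T: "0 \<le> T"
    obtain N :: nat where N: "T \<le> real N" using real_arch_simple by blast
    have g: "(\<lambda>n. ennreal (c * (1/8) ^ n)) \<longlonglongrightarrow> 0" for c :: real
    proof -
      have "(\<lambda>n. c * (1/8) ^ n) \<longlonglongrightarrow> c * 0" by (intro tendsto_mult tendsto_const LIMSEQ_power_zero) simp
      from tendsto_ennrealI[OF this] show ?thesis by simp
    qed
    show "(\<lambda>k. l2_dist T H (step_value (S k))) \<longlonglongrightarrow> 0"
    proof (rule tendsto_sandwich[OF _ _ tendsto_const g[of 1]])
      show "\<forall>\<^sub>F k in sequentially. l2_dist T H (step_value (S k)) \<le> ennreal (1 * (1/8) ^ k)"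
        using eventually_ge_at_top[of N]
      proof eventually_elim
        case (elim k)
        thus ?case using dist[of T k] N by simp
      qed
    qed simp
    show "(\<lambda>k. \<integral>\<^sup>+\<omega>. psup T (\<lambda>t. Z t \<omega> - step_integral X (S k) t \<omega>) \<partial>M) \<longlonglongrightarrow> 0"
    proof (rule tendsto_sandwich[OF _ _ tendsto_const g[of "2 * (16 * B * (1 / (1 - 1/4)))"]])
      show "\<forall>\<^sub>F n in sequentially. (\<integral>\<^sup>+\<omega>. psup T (\<lambda>t. Z t \<omega> - step_integral X (S n) t \<omega>) \<partial>M)
          \<le> ennreal (2 * (16 * B * (1 / (1 - 1/4))) * (1/8) ^ n)"
        using eventually_ge_at_top[of N]
      proof eventually_elim
        case (elim n)
        have "(\<Sum>k. 2 ^ k * ?d T (n + k)) \<le> (\<Sum>k. ennreal (16 * B * (1/8) ^ n * (1/4) ^ k))"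
          using elim N T by (intro suminf_le d_le) auto
        also have "\<dots> = ennreal (16 * B * (1/8) ^ n * (1 / (1 - 1/4)))"
          using B_nonneg by (intro suminf_ennreal_eq sums_mult geometric_sums) auto
        finally have "2 * (\<Sum>k. 2 ^ k * ?d T (n + k)) \<le> 2 * ennreal (16 * B * (1/8) ^ n * (1 / (1 - 1/4)))"
          by (intro mult_left_mono) auto
        also have "\<dots> = ennreal (2 * (16 * B * (1/8) ^ n * (1 / (1 - 1/4))))"
          by (metis ennreal_mult' ennreal_numeral zero_le_numeral)
        also have "2 * (16 * B * (1/8) ^ n * (1 / (1 - 1/4))) = 2 * (16 * B * (1 / (1 - 1/4))) * (1/8) ^ n"
          by (simp add: ac_simps)
        finally show ?case using Z(2)[OF T, of n] by (rule order_trans[rotated])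
      qed
    qed simp
  qed (use Z jm S(1) in auto)
  thus ?thesis by blast
qed

end

section \<open>Integrals defined by limits in probability, and their localization\<close>

lemma ito_integral_progressive:
  "ito_integral M F X H t J \<Longrightarrow> 0 \<le> t \<Longrightarrow>
    (\<lambda>(s, \<omega>). H s \<omega>) \<in> borel_measurable (restrict_space borel {0..t} \<Otimes>\<^sub>M F t)"
  unfolding ito_integral_def by simp

lemma (in integrator) ito_integral_jointly_measurable:
  assumes "ito_integral M F Y H t J" "0 \<le> t" shows "jointly_measurable t H"
  using assms by (intro jointly_measurable_of_progressive ito_integral_progressive)

context filtered_prob_space
begin

lemma measure_mono2:
  assumes "A \<subseteq> B \<union> C" "B \<in> sets M" "C \<in> sets M"
  shows "measure M A \<le> measure M B + measure M C"
proof -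
  have "measure M A \<le> measure M (B \<union> C)" using assms by (intro finite_measure_mono) auto
  also have "\<dots> \<le> measure M B + measure M C" using assms by (intro measure_Un_le)
  finally show ?thesis .
qed

text \<open>A step integral evaluates the integrator at finitely many times, so it is almost surely
  unchanged even if the exceptional null set varies with the time. This exchanges \<open>W\<close>
  for its continuous version and back.\<close>

lemma ito_integral_AE_cong:
  assumes J: "ito_integral M F X H t J" and t: "0 \<le> t"
    and X: "\<And>s. 0 \<le> s \<Longrightarrow> X s \<in> borel_measurable M" and X': "\<And>s. 0 \<le> s \<Longrightarrow> X' s \<in> borel_measurable M"
    and eq: "\<And>s. 0 \<le> s \<Longrightarrow> AE \<omega> in M. X s \<omega> = X' s \<omega>"
  shows "ito_integral M F X' H t J"
proof -
  obtain S where S: "\<And>k. nonanticipating_step M F (S k)" and Sint: "\<And>\<epsilon>. \<epsilon> > 0 \<Longrightarrow> (\<lambda>k. measure M {\<omega> \<in> space M.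
            (\<integral>\<^sup>+s\<in>{0..t}. ennreal ((H s \<omega> - step_value (S k) s \<omega>)\<^sup>2) \<partial>lborel) > ennreal \<epsilon>}) \<longlonglongrightarrow> 0"
       and lim: "\<And>\<epsilon>. \<epsilon> > 0 \<Longrightarrow> (\<lambda>k. measure M {\<omega> \<in> space M. \<bar>step_integral X (S k) t \<omega> - J \<omega>\<bar> > \<epsilon>}) \<longlonglongrightarrow> 0"
    using J unfolding ito_integral_def by blast
  have Jm[measurable]: "J \<in> borel_measurable M" using J by (simp add: ito_integral_def)
  have step: "step_integral X S t \<in> borel_measurable M \<and> step_integral X' S t \<in> borel_measurable M \<and>
      (AE \<omega> in M. step_integral X S t \<omega> = step_integral X' S t \<omega>)" if "nonanticipating_step M F S" for S
    using that
  proof (induction S)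
    case (Cons a S)
    obtain s r \<zeta> where a: "a = (s, r, \<zeta>)" by (cases a)
    have sr: "0 \<le> min s t" "0 \<le> min r t" and [measurable]: "\<zeta> \<in> borel_measurable M" and S: "nonanticipating_step M F S"
      using Cons.prems t borel_measurable_F_M by (auto simp: a nonanticipating_Cons)
    note [measurable] = X[OF sr(1)] X[OF sr(2)] X'[OF sr(1)] X'[OF sr(2)]
    have [measurable]: "step_integral X S t \<in> borel_measurable M" "step_integral X' S t \<in> borel_measurable M"
      and IH: "AE \<omega> in M. step_integral X S t \<omega> = step_integral X' S t \<omega>" using Cons.IH[OF S] by auto
    have 1: "(\<lambda>\<omega>. \<zeta> \<omega> * (X (min r t) \<omega> - X (min s t) \<omega>) + step_integral X S t \<omega>) \<in> borel_measurable M"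
      "(\<lambda>\<omega>. \<zeta> \<omega> * (X' (min r t) \<omega> - X' (min s t) \<omega>) + step_integral X' S t \<omega>) \<in> borel_measurable M"
      by measurable
    have 2: "AE \<omega> in M. \<zeta> \<omega> * (X (min r t) \<omega> - X (min s t) \<omega>) + step_integral X S t \<omega> =
        \<zeta> \<omega> * (X' (min r t) \<omega> - X' (min s t) \<omega>) + step_integral X' S t \<omega>"
      using eq[OF sr(1)] eq[OF sr(2)] IH by eventually_elim simp
    show ?case using 1 2 by (simp add: a fun_eq_iff cong: measurable_cong)
  qed (auto simp: fun_eq_iff cong: measurable_cong)
  have same: "measure M {\<omega> \<in> space M. \<bar>step_integral X (S k) t \<omega> - J \<omega>\<bar> > \<epsilon>} =
      measure M {\<omega> \<in> space M. \<bar>step_integral X' (S k) t \<omega> - J \<omega>\<bar> > \<epsilon>}" for k \<epsilon>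
  proof (rule measure_eq_AE)
    note [measurable] = conjunct1[OF step[OF S[of k]]] conjunct1[OF conjunct2[OF step[OF S[of k]]]]
    show "{\<omega> \<in> space M. \<bar>step_integral X (S k) t \<omega> - J \<omega>\<bar> > \<epsilon>} \<in> sets M"
      "{\<omega> \<in> space M. \<bar>step_integral X' (S k) t \<omega> - J \<omega>\<bar> > \<epsilon>} \<in> sets M" by measurable
    show "AE \<omega> in M. (\<omega> \<in> {\<omega> \<in> space M. \<bar>step_integral X (S k) t \<omega> - J \<omega>\<bar> > \<epsilon>}) =
        (\<omega> \<in> {\<omega> \<in> space M. \<bar>step_integral X' (S k) t \<omega> - J \<omega>\<bar> > \<epsilon>})"
      using step[OF S[of k]] by auto
  qed
  show ?thesis
    unfolding ito_integral_def
    using J S Sint lim[unfolded same] by (auto simp: ito_integral_def intro!: exI[of _ S])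
qed

end

context continuous_integrator
begin

text \<open>Markov's inequality turns both mean-square limits into limits in probability along the
  same step processes.\<close>

lemma ito_process_imp_ito_integral:
  assumes Y: "ito_process H Y" and H: "left_continuous_adapted H" and t: "0 \<le> t"
  shows "ito_integral M F X H t (Y t)"
proof -
  obtain S where S: "\<And>k. nonanticipating_step M F (S k)"
    "(\<lambda>k. l2_dist t H (step_value (S k))) \<longlonglongrightarrow> 0"
    "(\<lambda>k. \<integral>\<^sup>+\<omega>. psup t (\<lambda>s. Y s \<omega> - step_integral X (S k) s \<omega>) \<partial>M) \<longlonglongrightarrow> 0"
    using Y t unfolding ito_process_def by blast
  have ca: "continuous_adapted Y" using Y by (simp add: ito_process_def)
  have "(\<lambda>k. measure M {\<omega> \<in> space M.
      (\<integral>\<^sup>+s\<in>{0..t}. ennreal ((H s \<omega> - step_value (S k) s \<omega>)\<^sup>2) \<partial>lborel) > ennreal \<epsilon>}) \<longlonglongrightarrow> 0" if "\<epsilon> > 0" for \<epsilon>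
    using S(2) that unfolding l2_dist_def
    by (intro markov_tendsto measurable_path_square_integral jointly_measurable_diff
          left_continuous_jointly_measurable[OF H t] jointly_measurable_step_value S(1))
  moreover have "(\<lambda>k. measure M {\<omega> \<in> space M. \<bar>step_integral X (S k) t \<omega> - Y t \<omega>\<bar> > \<epsilon>}) \<longlonglongrightarrow> 0" if e: "\<epsilon> > 0" for \<epsilon>
  proof (rule tendsto_sandwich[OF _ _ tendsto_const])
    have m: "(\<lambda>\<omega>. psup t (\<lambda>s. Y s \<omega> - step_integral X (S k) s \<omega>)) \<in> borel_measurable M" for k
      by (intro measurable_psup_diff ca step_integral_continuous_adapted S(1) t)
    show "(\<lambda>k. measure M {\<omega> \<in> space M. psup t (\<lambda>s. Y s \<omega> - step_integral X (S k) s \<omega>) > ennreal (\<epsilon>\<^sup>2)}) \<longlonglongrightarrow> 0"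
      using S(3) m e by (intro markov_tendsto) auto
    show "\<forall>\<^sub>F k in sequentially. measure M {\<omega> \<in> space M. \<bar>step_integral X (S k) t \<omega> - Y t \<omega>\<bar> > \<epsilon>}
        \<le> measure M {\<omega> \<in> space M. psup t (\<lambda>s. Y s \<omega> - step_integral X (S k) s \<omega>) > ennreal (\<epsilon>\<^sup>2)}"
    proof (intro always_eventually allI finite_measure_mono)
      fix k
      show "{\<omega> \<in> space M. \<bar>step_integral X (S k) t \<omega> - Y t \<omega>\<bar> > \<epsilon>}
        \<subseteq> {\<omega> \<in> space M. psup t (\<lambda>s. Y s \<omega> - step_integral X (S k) s \<omega>) > ennreal (\<epsilon>\<^sup>2)}"
      proof clarify
        fix \<omega> assume \<omega>: "\<omega> \<in> space M" "\<bar>step_integral X (S k) t \<omega> - Y t \<omega>\<bar> > \<epsilon>"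
        hence "\<epsilon>\<^sup>2 < \<bar>step_integral X (S k) t \<omega> - Y t \<omega>\<bar>\<^sup>2" using e by (intro power_strict_mono) auto
        hence "ennreal (\<epsilon>\<^sup>2) < ennreal ((Y t \<omega> - step_integral X (S k) t \<omega>)\<^sup>2)"
          by (simp add: ennreal_less_iff power2_commute)
        also have "\<dots> \<le> psup t (\<lambda>s. Y s \<omega> - step_integral X (S k) s \<omega>)" using t by (intro psup_upper) auto
        finally show "ennreal (\<epsilon>\<^sup>2) < psup t (\<lambda>s. Y s \<omega> - step_integral X (S k) s \<omega>)" .
      qed
      show "{\<omega> \<in> space M. psup t (\<lambda>s. Y s \<omega> - step_integral X (S k) s \<omega>) > ennreal (\<epsilon>\<^sup>2)} \<in> sets M"
        using m[of k] by measurable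
    qed
  qed simp
  ultimately show ?thesis
    unfolding ito_integral_def
    using progressively_measurable[OF H] continuous_adapted_measurable[OF ca t] S(1)
    by (intro conjI exI[of _ S]) auto
qed

text \<open>For given \<eta> the truncation level makes the Chebyshev term at most \<eta> / 2, and
  the other term tends to 0 by hypothesis. A is any event and may depend on the future, since
  truncation alters the coefficients and leaves A alone.\<close>

lemma step_integral_local_tendsto:
  assumes R: "\<And>k. nonanticipating_step M F (R k)" and t: "0 \<le> t" and A: "A \<in> sets M"
    and lim: "\<And>\<delta>. \<delta> > 0 \<Longrightarrow> (\<lambda>k. measure M {\<omega> \<in> A. (\<integral>\<^sup>+q\<in>{0..t}. ennreal ((step_value (R k) q \<omega>)\<^sup>2) \<partial>lborel) > ennreal \<delta>}) \<longlonglongrightarrow> 0"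
    and e: "\<epsilon> > 0"
  shows "(\<lambda>k. measure M {\<omega> \<in> A. \<bar>step_integral X (R k) t \<omega>\<bar> > \<epsilon>}) \<longlonglongrightarrow> 0"
proof (rule tendstoI)
  fix \<eta> :: real assume \<eta>: "\<eta> > 0"
  \<comment> \<open>Solves B c / \<epsilon>^2 <= \<eta> / 2; the denominator B + 1 avoids division
    by 0 when B = 0.\<close>
  define c where "c = \<eta> / 2 * \<epsilon>\<^sup>2 / (B + 1)"
  have c: "c > 0" using \<eta> e B_nonneg unfolding c_def by (intro divide_pos_pos mult_pos_pos) auto
  have "B * c \<le> (B + 1) * c" using c by (intro mult_right_mono) auto
  also have "\<dots> = \<eta> / 2 * \<epsilon>\<^sup>2" using B_nonneg
    unfolding c_def by (subst times_divide_eq_right, subst nonzero_mult_div_cancel_left) auto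
  finally have Bc: "B * c / \<epsilon>\<^sup>2 \<le> \<eta> / 2" using e by (simp add: field_simps)
  have "\<forall>\<^sub>F k in sequentially. measure M {\<omega> \<in> A. (\<integral>\<^sup>+q\<in>{0..t}. ennreal ((step_value (R k) q \<omega>)\<^sup>2) \<partial>lborel) > ennreal c} < \<eta> / 2"
    using lim[OF c] \<eta> by (intro order_tendstoD(2)) auto
  thus "\<forall>\<^sub>F k in sequentially. dist (measure M {\<omega> \<in> A. \<bar>step_integral X (R k) t \<omega>\<bar> > \<epsilon>}) 0 < \<eta>"
  proof eventually_elim
    case (elim k)
    have "measure M {\<omega> \<in> A. \<bar>step_integral X (R k) t \<omega>\<bar> > \<epsilon>} < \<eta>"
      using step_integral_truncated[OF R[of k] t less_imp_le[OF c] e A] Bc elim by linarith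
    thus ?case by simp
  qed
qed

text \<open>
  No moments of \<open>H\<close> are involved, which is what makes localization without stopping times possible.
\<close>

lemma ito_integral_local:
  assumes J: "ito_integral M F X H t J" and Y: "ito_process H' Y" and A: "A \<in> sets M" and t: "0 \<le> t"
    and eq: "\<And>\<omega> s. \<omega> \<in> A \<Longrightarrow> 0 \<le> s \<Longrightarrow> s \<le> t \<Longrightarrow> H s \<omega> = H' s \<omega>"
  shows "AE \<omega> in M. \<omega> \<in> A \<longrightarrow> J \<omega> = Y t \<omega>"
proof -
  obtain S where S: "\<And>k. nonanticipating_step M F (S k)" "\<And>\<epsilon>. \<epsilon> > 0 \<Longrightarrow> (\<lambda>k. measure M {\<omega> \<in> space M.
            (\<integral>\<^sup>+s\<in>{0..t}. ennreal ((H s \<omega> - step_value (S k) s \<omega>)\<^sup>2) \<partial>lborel) > ennreal \<epsilon>}) \<longlonglongrightarrow> 0"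
       "\<And>\<epsilon>. \<epsilon> > 0 \<Longrightarrow> (\<lambda>k. measure M {\<omega> \<in> space M. \<bar>step_integral X (S k) t \<omega> - J \<omega>\<bar> > \<epsilon>}) \<longlonglongrightarrow> 0"
    using J unfolding ito_integral_def by blast
  obtain S' where S': "\<And>k. nonanticipating_step M F (S' k)"
    "(\<lambda>k. l2_dist t H' (step_value (S' k))) \<longlonglongrightarrow> 0"
    "(\<lambda>k. \<integral>\<^sup>+\<omega>. psup t (\<lambda>s. Y s \<omega> - step_integral X (S' k) s \<omega>) \<partial>M) \<longlonglongrightarrow> 0"
    using Y t unfolding ito_process_def by blast
  have ca: "continuous_adapted Y" and jm': "jointly_measurable t H'" using Y t by (auto simp: ito_process_def)
  have jm: "jointly_measurable t H" by (rule ito_integral_jointly_measurable[OF J t])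
  have Jm[measurable]: "J \<in> borel_measurable M" using J by (simp add: ito_integral_def)
  have Ym[measurable]: "Y t \<in> borel_measurable M" using continuous_adapted_measurable[OF ca t] .
  have As: "A \<subseteq> space M" using A by (rule sets.sets_into_space)
  \<comment> \<open>On A the integrands agree, so there R measures how far the two approximating
    sequences are apart, and its square integral over [0, t] tends to 0 in probability.\<close>
  define R where "R k = S k @ step_uminus (S' k)" for k
  have R: "nonanticipating_step M F (R k)" for k
    unfolding R_def by (intro nonanticipating_append nonanticipating_uminus S S')
  let ?u = "\<lambda>k \<omega>. \<integral>\<^sup>+s\<in>{0..t}. ennreal ((H s \<omega> - step_value (S k) s \<omega>)\<^sup>2) \<partial>lborel"
  let ?u' = "\<lambda>k \<omega>. \<integral>\<^sup>+s\<in>{0..t}. ennreal ((H' s \<omega> - step_value (S' k) s \<omega>)\<^sup>2) \<partial>lborel"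
  have um: "?u k \<in> borel_measurable M" "?u' k \<in> borel_measurable M" for k
    by (intro measurable_path_square_integral jointly_measurable_diff jm jm' jointly_measurable_step_value S S')+
  have lim': "(\<lambda>k. measure M {\<omega> \<in> space M. ?u' k \<omega> > ennreal \<epsilon>}) \<longlonglongrightarrow> 0" if "\<epsilon> > 0" for \<epsilon>
    using S'(2) that um unfolding l2_dist_def by (intro markov_tendsto) auto
  have R_small: "(\<lambda>k. measure M {\<omega> \<in> A. (\<integral>\<^sup>+q\<in>{0..t}. ennreal ((step_value (R k) q \<omega>)\<^sup>2) \<partial>lborel) > ennreal \<delta>}) \<longlonglongrightarrow> 0"
    if \<delta>: "\<delta> > 0" for \<delta>
  proof (rule tendsto_sandwich[OF _ _ tendsto_const])
    have "(\<lambda>k. measure M {\<omega> \<in> space M. ?u k \<omega> > ennreal (\<delta>/4)} + measure M {\<omega> \<in> space M. ?u' k \<omega> > ennreal (\<delta>/4)}) \<longlonglongrightarrow> 0 + 0"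
      using \<delta> by (intro tendsto_add S(2) lim') auto
    thus "(\<lambda>k. measure M {\<omega> \<in> space M. ?u k \<omega> > ennreal (\<delta>/4)} + measure M {\<omega> \<in> space M. ?u' k \<omega> > ennreal (\<delta>/4)}) \<longlonglongrightarrow> 0"
      by simp
    show "\<forall>\<^sub>F k in sequentially. measure M {\<omega> \<in> A. (\<integral>\<^sup>+q\<in>{0..t}. ennreal ((step_value (R k) q \<omega>)\<^sup>2) \<partial>lborel) > ennreal \<delta>} \<le>
        measure M {\<omega> \<in> space M. ?u k \<omega> > ennreal (\<delta>/4)} + measure M {\<omega> \<in> space M. ?u' k \<omega> > ennreal (\<delta>/4)}"
    proof (intro always_eventually allI measure_mono2)
      fix k
      show "{\<omega> \<in> A. (\<integral>\<^sup>+q\<in>{0..t}. ennreal ((step_value (R k) q \<omega>)\<^sup>2) \<partial>lborel) > ennreal \<delta>} \<subseteq>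
        {\<omega> \<in> space M. ?u k \<omega> > ennreal (\<delta>/4)} \<union> {\<omega> \<in> space M. ?u' k \<omega> > ennreal (\<delta>/4)}"
      proof (rule subsetI, rule ccontr)
        fix \<omega> assume \<omega>: "\<omega> \<in> {\<omega> \<in> A. (\<integral>\<^sup>+q\<in>{0..t}. ennreal ((step_value (R k) q \<omega>)\<^sup>2) \<partial>lborel) > ennreal \<delta>}"
          "\<omega> \<notin> {\<omega> \<in> space M. ?u k \<omega> > ennreal (\<delta>/4)} \<union> {\<omega> \<in> space M. ?u' k \<omega> > ennreal (\<delta>/4)}"
        have \<omega>s: "\<omega> \<in> space M" using \<omega> As by auto
        have le: "?u k \<omega> \<le> ennreal (\<delta>/4)" "?u' k \<omega> \<le> ennreal (\<delta>/4)" using \<omega>(2) \<omega>s by (auto simp: not_less)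
        have "(\<integral>\<^sup>+q\<in>{0..t}. ennreal ((step_value (R k) q \<omega>)\<^sup>2) \<partial>lborel) =
            (\<integral>\<^sup>+q\<in>{0..t}. ennreal ((step_value (S k) q \<omega> - step_value (S' k) q \<omega>)\<^sup>2) \<partial>lborel)"
          by (simp add: R_def step_value_append)
        also have "\<dots> \<le> 2 * (\<integral>\<^sup>+q\<in>{0..t}. ennreal ((step_value (S k) q \<omega> - H q \<omega>)\<^sup>2) \<partial>lborel) +
            2 * (\<integral>\<^sup>+q\<in>{0..t}. ennreal ((H q \<omega> - step_value (S' k) q \<omega>)\<^sup>2) \<partial>lborel)"
          by (intro path_square_triangle jm jointly_measurable_step_value S S' \<omega>s)
        also have "(\<integral>\<^sup>+q\<in>{0..t}. ennreal ((step_value (S k) q \<omega> - H q \<omega>)\<^sup>2) \<partial>lborel) = ?u k \<omega>"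
          by (simp add: power2_commute)
        also have "(\<integral>\<^sup>+q\<in>{0..t}. ennreal ((H q \<omega> - step_value (S' k) q \<omega>)\<^sup>2) \<partial>lborel) = ?u' k \<omega>"
          using eq \<omega> by (intro nn_integral_cong) (auto simp: indicator_def)
        also have "2 * ?u k \<omega> + 2 * ?u' k \<omega> \<le> 2 * ennreal (\<delta>/4) + 2 * ennreal (\<delta>/4)"
          using le by (intro add_mono mult_left_mono) auto
        also have "\<dots> = ennreal 2 * ennreal (\<delta>/4) + ennreal 2 * ennreal (\<delta>/4)" by simp
        also have "\<dots> = ennreal \<delta>"
          using \<delta> by (simp only: ennreal_mult[symmetric] ennreal_plus[symmetric] zero_le_numeral divide_nonneg_pos less_imp_le zero_less_numeral mult_nonneg_nonneg) simp
        finally show False using \<omega>(1) by auto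
      qed
    qed (use um in measurable)
  qed (simp add: always_eventually)
  note I_small = step_integral_local_tendsto[OF R t A R_small]
  let ?I = "\<lambda>k. step_integral X (S k) t" and ?I' = "\<lambda>k. step_integral X (S' k) t"
  have Im[measurable]: "?I k \<in> borel_measurable M" "?I' k \<in> borel_measurable M" "step_integral X (R k) t \<in> borel_measurable M" for k
    using step_integral_measurable[OF _ t] S(1) S'(1) R borel_measurable_F_M by blast+
  \<comment> \<open>Three errors of size \<epsilon>: from J to its step integrals, between the two
    sequences of step integrals, and from the second sequence to Y.\<close>
  have zero: "measure M {\<omega> \<in> A. \<bar>J \<omega> - Y t \<omega>\<bar> > 3 * \<epsilon>} = 0" if e: "\<epsilon> > 0" for \<epsilon>
  proof -
    let ?p = "\<lambda>k. measure M {\<omega> \<in> space M. \<bar>?I k \<omega> - J \<omega>\<bar> > \<epsilon>} + (measure M {\<omega> \<in> A. \<bar>step_integral X (R k) t \<omega>\<bar> > \<epsilon>} +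
      measure M {\<omega> \<in> space M. psup t (\<lambda>s. Y s \<omega> - step_integral X (S' k) s \<omega>) > ennreal (\<epsilon>\<^sup>2)})"
    have pm: "(\<lambda>\<omega>. psup t (\<lambda>s. Y s \<omega> - step_integral X (S' k) s \<omega>)) \<in> borel_measurable M" for k
      by (intro measurable_psup_diff ca step_integral_continuous_adapted S' t)
    have "?p \<longlonglongrightarrow> 0 + (0 + 0)"
      using e S'(3) pm by (intro tendsto_add S(3) I_small markov_tendsto) auto
    hence "?p \<longlonglongrightarrow> 0" by simp
    moreover have "measure M {\<omega> \<in> A. \<bar>J \<omega> - Y t \<omega>\<bar> > 3 * \<epsilon>} \<le> ?p k" for k
    proof -
      have AR: "{\<omega> \<in> A. \<bar>step_integral X (R k) t \<omega>\<bar> > \<epsilon>} \<in> sets M"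
      proof -
        have "{\<omega> \<in> A. \<bar>step_integral X (R k) t \<omega>\<bar> > \<epsilon>} = A \<inter> {\<omega> \<in> space M. \<bar>step_integral X (R k) t \<omega>\<bar> > \<epsilon>}" using As by auto
        also have "\<dots> \<in> sets M" by (rule sets.Int[OF A]) measurable
        finally show ?thesis .
      qed
      have ps: "{\<omega> \<in> space M. psup t (\<lambda>s. Y s \<omega> - step_integral X (S' k) s \<omega>) > ennreal (\<epsilon>\<^sup>2)} \<in> sets M"
        using pm[of k] by measurable
      have sub: "{\<omega> \<in> A. \<bar>J \<omega> - Y t \<omega>\<bar> > 3 * \<epsilon>} \<subseteq> {\<omega> \<in> space M. \<bar>?I k \<omega> - J \<omega>\<bar> > \<epsilon>} \<union>
          ({\<omega> \<in> A. \<bar>step_integral X (R k) t \<omega>\<bar> > \<epsilon>} \<union>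
           {\<omega> \<in> space M. psup t (\<lambda>s. Y s \<omega> - step_integral X (S' k) s \<omega>) > ennreal (\<epsilon>\<^sup>2)})"
      proof (rule subsetI, rule ccontr)
        fix \<omega> assume \<omega>: "\<omega> \<in> {\<omega> \<in> A. \<bar>J \<omega> - Y t \<omega>\<bar> > 3 * \<epsilon>}" "\<omega> \<notin> {\<omega> \<in> space M. \<bar>?I k \<omega> - J \<omega>\<bar> > \<epsilon>} \<union>
          ({\<omega> \<in> A. \<bar>step_integral X (R k) t \<omega>\<bar> > \<epsilon>} \<union>
           {\<omega> \<in> space M. psup t (\<lambda>s. Y s \<omega> - step_integral X (S' k) s \<omega>) > ennreal (\<epsilon>\<^sup>2)})"
        hence \<omega>s: "\<omega> \<in> space M" "\<omega> \<in> A" using As by auto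
        have 1: "\<bar>?I k \<omega> - J \<omega>\<bar> \<le> \<epsilon>" and 2: "\<bar>?I k \<omega> - ?I' k \<omega>\<bar> \<le> \<epsilon>"
          using \<omega>(2) \<omega>s by (auto simp: R_def step_integral_append)
        have "ennreal ((Y t \<omega> - ?I' k \<omega>)\<^sup>2) \<le> psup t (\<lambda>s. Y s \<omega> - step_integral X (S' k) s \<omega>)"
          using t by (intro psup_upper) auto
        also have "\<dots> \<le> ennreal (\<epsilon>\<^sup>2)" using \<omega>(2) \<omega>s by (auto simp: not_less)
        finally have "(Y t \<omega> - ?I' k \<omega>)\<^sup>2 \<le> \<epsilon>\<^sup>2" by simp
        hence 3: "\<bar>Y t \<omega> - ?I' k \<omega>\<bar> \<le> \<epsilon>" using e by (intro power2_le_imp_le[of "\<bar>Y t \<omega> - ?I' k \<omega>\<bar>"]) auto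
        have "\<bar>J \<omega> - Y t \<omega>\<bar> \<le> 3 * \<epsilon>" using 1 2 3 by linarith
        thus False using \<omega>(1) by auto
      qed
      have "measure M {\<omega> \<in> A. \<bar>J \<omega> - Y t \<omega>\<bar> > 3 * \<epsilon>} \<le> measure M {\<omega> \<in> space M. \<bar>?I k \<omega> - J \<omega>\<bar> > \<epsilon>} +
          measure M ({\<omega> \<in> A. \<bar>step_integral X (R k) t \<omega>\<bar> > \<epsilon>} \<union>
           {\<omega> \<in> space M. psup t (\<lambda>s. Y s \<omega> - step_integral X (S' k) s \<omega>) > ennreal (\<epsilon>\<^sup>2)})"
        using sub AR ps by (intro measure_mono2) auto
      also have "\<dots> \<le> ?p k" using AR ps by (intro add_left_mono measure_Un_le)
      finally show ?thesis .
    qed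
    ultimately have "measure M {\<omega> \<in> A. \<bar>J \<omega> - Y t \<omega>\<bar> > 3 * \<epsilon>} \<le> 0"
      by (intro LIMSEQ_le_const) auto
    thus ?thesis using measure_nonneg[of M] by (simp add: order_antisym)
  qed
  have "AE \<omega> in M. \<forall>n::nat. \<not> (\<omega> \<in> A \<and> \<bar>J \<omega> - Y t \<omega>\<bar> > 3 * (1 / Suc n))"
  proof (subst AE_all_countable, rule allI)
    fix n :: nat
    have "{\<omega> \<in> A. \<bar>J \<omega> - Y t \<omega>\<bar> > 3 * (1 / Suc n)} = A \<inter> {\<omega> \<in> space M. \<bar>J \<omega> - Y t \<omega>\<bar> > 3 * (1 / Suc n)}" using As by auto
    also have "\<dots> \<in> sets M" by (rule sets.Int[OF A]) measurable
    finally have "{\<omega> \<in> A. \<bar>J \<omega> - Y t \<omega>\<bar> > 3 * (1 / Suc n)} \<in> null_sets M"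
      using zero[of "1 / Suc n"] by (simp add: null_sets_def emeasure_eq_measure)
    thus "AE \<omega> in M. \<not> (\<omega> \<in> A \<and> \<bar>J \<omega> - Y t \<omega>\<bar> > 3 * (1 / Suc n))"
      by (rule AE_I'[of _ M]) auto
  qed
  thus ?thesis
  proof eventually_elim
    case (elim \<omega>)
    show ?case
    proof (rule impI, rule ccontr)
      assume \<omega>: "\<omega> \<in> A" "J \<omega> \<noteq> Y t \<omega>"
      then obtain n where "1 / Suc n < \<bar>J \<omega> - Y t \<omega>\<bar> / 3"
        using reals_Archimedean[of "\<bar>J \<omega> - Y t \<omega>\<bar> / 3"] by (auto simp: inverse_eq_divide)
      thus False using elim \<omega>(1) by (auto simp: field_simps)
    qed
  qed
qed

text \<open>Concatenating the approximations of H with the negated ones of H' approximates the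
  difference. The shares \<delta> / 4 compensate for the factors 2 in the inequality for square
  integrals.\<close>

lemma ito_integral_diff:
  assumes J: "ito_integral M F X H t J" and J': "ito_integral M F X H' t J'" and t: "0 \<le> t"
  shows "ito_integral M F X (\<lambda>s \<omega>. H s \<omega> - H' s \<omega>) t (\<lambda>\<omega>. J \<omega> - J' \<omega>)"
proof -
  obtain S where S: "\<And>k. nonanticipating_step M F (S k)" "\<And>\<epsilon>. \<epsilon> > 0 \<Longrightarrow> (\<lambda>k. measure M {\<omega> \<in> space M.
            (\<integral>\<^sup>+s\<in>{0..t}. ennreal ((H s \<omega> - step_value (S k) s \<omega>)\<^sup>2) \<partial>lborel) > ennreal \<epsilon>}) \<longlonglongrightarrow> 0"
       "\<And>\<epsilon>. \<epsilon> > 0 \<Longrightarrow> (\<lambda>k. measure M {\<omega> \<in> space M. \<bar>step_integral X (S k) t \<omega> - J \<omega>\<bar> > \<epsilon>}) \<longlonglongrightarrow> 0"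
    using J unfolding ito_integral_def by blast
  obtain S' where S': "\<And>k. nonanticipating_step M F (S' k)" "\<And>\<epsilon>. \<epsilon> > 0 \<Longrightarrow> (\<lambda>k. measure M {\<omega> \<in> space M.
            (\<integral>\<^sup>+s\<in>{0..t}. ennreal ((H' s \<omega> - step_value (S' k) s \<omega>)\<^sup>2) \<partial>lborel) > ennreal \<epsilon>}) \<longlonglongrightarrow> 0"
       "\<And>\<epsilon>. \<epsilon> > 0 \<Longrightarrow> (\<lambda>k. measure M {\<omega> \<in> space M. \<bar>step_integral X (S' k) t \<omega> - J' \<omega>\<bar> > \<epsilon>}) \<longlonglongrightarrow> 0"
    using J' unfolding ito_integral_def by blast
  have jm: "jointly_measurable t H" "jointly_measurable t H'"
    using ito_integral_jointly_measurable J J' t by blast+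
  have [measurable]: "J \<in> borel_measurable M" "J' \<in> borel_measurable M" using J J' by (simp_all add: ito_integral_def)
  define R where "R k = S k @ step_uminus (S' k)" for k
  have R: "nonanticipating_step M F (R k)" for k
    unfolding R_def by (intro nonanticipating_append nonanticipating_uminus S S')
  let ?u = "\<lambda>k \<omega>. \<integral>\<^sup>+s\<in>{0..t}. ennreal ((H s \<omega> - step_value (S k) s \<omega>)\<^sup>2) \<partial>lborel"
  let ?u' = "\<lambda>k \<omega>. \<integral>\<^sup>+s\<in>{0..t}. ennreal ((H' s \<omega> - step_value (S' k) s \<omega>)\<^sup>2) \<partial>lborel"
  let ?v = "\<lambda>k \<omega>. \<integral>\<^sup>+s\<in>{0..t}. ennreal ((H s \<omega> - H' s \<omega> - step_value (R k) s \<omega>)\<^sup>2) \<partial>lborel"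
  have um: "?u k \<in> borel_measurable M" "?u' k \<in> borel_measurable M" for k
    by (intro measurable_path_square_integral jointly_measurable_diff jm jointly_measurable_step_value S S')+
  have 1: "(\<lambda>k. measure M {\<omega> \<in> space M. ?v k \<omega> > ennreal \<delta>}) \<longlonglongrightarrow> 0" if \<delta>: "\<delta> > 0" for \<delta>
  proof (rule tendsto_sandwich[OF _ _ tendsto_const])
    have "(\<lambda>k. measure M {\<omega> \<in> space M. ?u k \<omega> > ennreal (\<delta>/4)} + measure M {\<omega> \<in> space M. ?u' k \<omega> > ennreal (\<delta>/4)}) \<longlonglongrightarrow> 0 + 0"
      using \<delta> by (intro tendsto_add S(2) S'(2)) auto
    thus "(\<lambda>k. measure M {\<omega> \<in> space M. ?u k \<omega> > ennreal (\<delta>/4)} + measure M {\<omega> \<in> space M. ?u' k \<omega> > ennreal (\<delta>/4)}) \<longlonglongrightarrow> 0"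
      by simp
    show "\<forall>\<^sub>F k in sequentially. measure M {\<omega> \<in> space M. ?v k \<omega> > ennreal \<delta>} \<le>
        measure M {\<omega> \<in> space M. ?u k \<omega> > ennreal (\<delta>/4)} + measure M {\<omega> \<in> space M. ?u' k \<omega> > ennreal (\<delta>/4)}"
    proof (intro always_eventually allI measure_mono2)
      fix k
      show "{\<omega> \<in> space M. ?v k \<omega> > ennreal \<delta>} \<subseteq>
        {\<omega> \<in> space M. ?u k \<omega> > ennreal (\<delta>/4)} \<union> {\<omega> \<in> space M. ?u' k \<omega> > ennreal (\<delta>/4)}"
      proof (rule subsetI, rule ccontr)
        fix \<omega> assume \<omega>: "\<omega> \<in> {\<omega> \<in> space M. ?v k \<omega> > ennreal \<delta>}"
          "\<omega> \<notin> {\<omega> \<in> space M. ?u k \<omega> > ennreal (\<delta>/4)} \<union> {\<omega> \<in> space M. ?u' k \<omega> > ennreal (\<delta>/4)}"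
        have le: "?u k \<omega> \<le> ennreal (\<delta>/4)" "?u' k \<omega> \<le> ennreal (\<delta>/4)" using \<omega> by (auto simp: not_less)
        have "?v k \<omega> = (\<integral>\<^sup>+s\<in>{0..t}. ennreal (((H s \<omega> - step_value (S k) s \<omega>) - (H' s \<omega> - step_value (S' k) s \<omega>))\<^sup>2) \<partial>lborel)"
          by (simp add: R_def step_value_append algebra_simps)
        also have "\<dots> \<le> 2 * (\<integral>\<^sup>+s\<in>{0..t}. ennreal (((H s \<omega> - step_value (S k) s \<omega>) - 0)\<^sup>2) \<partial>lborel) +
            2 * (\<integral>\<^sup>+s\<in>{0..t}. ennreal ((0 - (H' s \<omega> - step_value (S' k) s \<omega>))\<^sup>2) \<partial>lborel)"
          using \<omega> by (intro path_square_triangle[where G="\<lambda>_ _. 0"] jointly_measurable_diff jm jointly_measurable_step_value S S')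
             (auto simp: jointly_measurable_def split_beta)
        also have "\<dots> = 2 * ?u k \<omega> + 2 * ?u' k \<omega>" by (simp add: power2_commute)
        also have "\<dots> \<le> 2 * ennreal (\<delta>/4) + 2 * ennreal (\<delta>/4)"
          using le by (intro add_mono mult_left_mono) auto
        also have "\<dots> = ennreal 2 * ennreal (\<delta>/4) + ennreal 2 * ennreal (\<delta>/4)" by simp
        also have "\<dots> = ennreal \<delta>"
          using \<delta> by (simp only: ennreal_mult[symmetric] ennreal_plus[symmetric] zero_le_numeral divide_nonneg_pos less_imp_le zero_less_numeral mult_nonneg_nonneg) simp
        finally show False using \<omega>(1) by auto
      qed
    qed (use um in measurable)
  qed (simp add: always_eventually)
  have Im[measurable]: "step_integral X (S k) t \<in> borel_measurable M" "step_integral X (S' k) t \<in> borel_measurable M" for k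
    using step_integral_measurable[OF _ t] S(1) S'(1) borel_measurable_F_M by blast+
  have 2: "(\<lambda>k. measure M {\<omega> \<in> space M. \<bar>step_integral X (R k) t \<omega> - (J \<omega> - J' \<omega>)\<bar> > \<epsilon>}) \<longlonglongrightarrow> 0" if e: "\<epsilon> > 0" for \<epsilon>
  proof (rule tendsto_sandwich[OF _ _ tendsto_const])
    let ?p = "\<lambda>k. measure M {\<omega> \<in> space M. \<bar>step_integral X (S k) t \<omega> - J \<omega>\<bar> > \<epsilon>/2} +
      measure M {\<omega> \<in> space M. \<bar>step_integral X (S' k) t \<omega> - J' \<omega>\<bar> > \<epsilon>/2}"
    have "?p \<longlonglongrightarrow> 0 + 0" using e by (intro tendsto_add S(3) S'(3)) auto
    thus "?p \<longlonglongrightarrow> 0" by simp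
    show "\<forall>\<^sub>F k in sequentially. measure M {\<omega> \<in> space M. \<bar>step_integral X (R k) t \<omega> - (J \<omega> - J' \<omega>)\<bar> > \<epsilon>} \<le> ?p k"
    proof (intro always_eventually allI measure_mono2)
      fix k
      show "{\<omega> \<in> space M. \<bar>step_integral X (R k) t \<omega> - (J \<omega> - J' \<omega>)\<bar> > \<epsilon>} \<subseteq>
        {\<omega> \<in> space M. \<bar>step_integral X (S k) t \<omega> - J \<omega>\<bar> > \<epsilon>/2} \<union> {\<omega> \<in> space M. \<bar>step_integral X (S' k) t \<omega> - J' \<omega>\<bar> > \<epsilon>/2}"
      proof
        fix \<omega> assume \<omega>: "\<omega> \<in> {\<omega> \<in> space M. \<bar>step_integral X (R k) t \<omega> - (J \<omega> - J' \<omega>)\<bar> > \<epsilon>}"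
        hence "\<bar>step_integral X (S k) t \<omega> - step_integral X (S' k) t \<omega> - (J \<omega> - J' \<omega>)\<bar> > \<epsilon>"
          by (simp add: R_def step_integral_append)
        hence "\<bar>step_integral X (S k) t \<omega> - J \<omega>\<bar> > \<epsilon>/2 \<or> \<bar>step_integral X (S' k) t \<omega> - J' \<omega>\<bar> > \<epsilon>/2"
          by linarith
        thus "\<omega> \<in> {\<omega> \<in> space M. \<bar>step_integral X (S k) t \<omega> - J \<omega>\<bar> > \<epsilon>/2} \<union> {\<omega> \<in> space M. \<bar>step_integral X (S' k) t \<omega> - J' \<omega>\<bar> > \<epsilon>/2}"
          using \<omega> by auto
      qed
    qed measurable
  qed (simp add: always_eventually)
  have 3: "(\<lambda>(s, \<omega>). H s \<omega> - H' s \<omega>) \<in> borel_measurable (restrict_space borel {0..T} \<Otimes>\<^sub>M F T)" if "T \<in> {0..t}" for T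
  proof -
    have "(\<lambda>(s, \<omega>). H s \<omega>) \<in> borel_measurable (restrict_space borel {0..T} \<Otimes>\<^sub>M F T)"
      "(\<lambda>(s, \<omega>). H' s \<omega>) \<in> borel_measurable (restrict_space borel {0..T} \<Otimes>\<^sub>M F T)"
      using J J' that unfolding ito_integral_def by blast+
    from borel_measurable_diff[OF this] show ?thesis by (simp add: split_beta)
  qed
  show ?thesis
    unfolding ito_integral_def using 1 2 3 R by (intro conjI exI[of _ R]) auto
qed

end

section \<open>Brownian motions and their filtration\<close>

lemma Int_stable_INT:
  assumes "Int_stable G" "finite I" "I \<noteq> {}" "\<And>i. i \<in> I \<Longrightarrow> A i \<in> G"
  shows "(\<Inter>i\<in>I. A i) \<in> G"
  using assms(2,3,4)
proof (induction I rule: finite_ne_induct)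
  case (insert i I)
  thus ?case using Int_stableD[OF assms(1), of "A i" "\<Inter>i\<in>I. A i"] by simp
qed simp

context prob_space
begin

text \<open>A finite family of pairs is grouped by its first index. Each group's intersection lies
  in \<open>G z\<close> by stability, so the groups factorize by independence of G, and within a
  group \<open>E z\<close> factorizes.\<close>

lemma indep_sets_Times:
  assumes G: "indep_sets G UNIV" and E: "\<And>z. indep_sets (E z) UNIV"
    and sub: "\<And>z j. E z j \<subseteq> G z" and stable: "\<And>z. Int_stable (G z)"
  shows "indep_sets (\<lambda>(z, j). E z j) UNIV"
proof (rule indep_setsI)
  show "(case i of (z, j) \<Rightarrow> E z j) \<subseteq> events" for i
    using E[of "fst i"] by (auto simp: indep_sets_def split_beta)
next
  fix A J assume J: "J \<noteq> {}" "J \<subseteq> UNIV" "finite J" and A: "\<forall>j\<in>J. A j \<in> (case j of (z, j) \<Rightarrow> E z j)"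
  let ?Z = "fst ` J" and ?I = "\<lambda>z. {j. (z, j) \<in> J}"
  define B where "B z = (\<Inter>j\<in>?I z. A (z, j))" for z
  have fin: "finite (?I z)" for z
    using finite_subset[OF _ finite_imageI[OF J(3), of snd]] by (metis (no_types, lifting) image_eqI mem_Collect_eq snd_conv subsetI)
  have ne: "?I z \<noteq> {}" if "z \<in> ?Z" for z using that by auto
  have AE: "A (z, j) \<in> E z j" if "j \<in> ?I z" for z j using A that by auto
  have BG: "B z \<in> G z" if "z \<in> ?Z" for z
    unfolding B_def using AE sub by (intro Int_stable_INT[OF stable fin ne[OF that]]) blast
  have "(\<Inter>j\<in>J. A j) = (\<Inter>z\<in>?Z. B z)" by (force simp: B_def)
  hence "prob (\<Inter>j\<in>J. A j) = (\<Prod>z\<in>?Z. prob (B z))"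
    using indep_setsD[OF G, of ?Z B] J BG by auto
  also have "\<dots> = (\<Prod>z\<in>?Z. \<Prod>j\<in>?I z. prob (A (z, j)))"
  proof (intro prod.cong refl)
    fix z assume "z \<in> ?Z"
    show "prob (B z) = (\<Prod>j\<in>?I z. prob (A (z, j)))"
      unfolding B_def using AE by (intro indep_setsD[OF E[of z]] ne[OF \<open>z \<in> ?Z\<close>] fin) auto
  qed
  also have "\<dots> = (\<Prod>x\<in>Sigma ?Z ?I. prob (A x))"
    using J(3) fin by (subst prod.Sigma) (auto simp: split_beta)
  also have "Sigma ?Z ?I = J" by force
  finally show "prob (\<Inter>j\<in>J. A j) = (\<Prod>j\<in>J. prob (A j))" .
qed

end

section \<open>Independence of the past from the increments\<close>

locale brownian_family = prob_space M for M :: "'w measure" +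
  fixes w :: "real \<Rightarrow> int ^ 'd::finite \<Rightarrow> 'w \<Rightarrow> real"
  assumes bm: "independent_brownian_motions M w"
begin

lemma standard: "standard_brownian_motion M (\<lambda>t. w t z)"
  using bm by (simp add: independent_brownian_motions_def)

lemma measurable_w [measurable]: "0 \<le> t \<Longrightarrow> w t z \<in> borel_measurable M"
  using standard[of z] by (simp add: standard_brownian_motion_def)

abbreviation "F \<equiv> noise_filtration M w"

lemma generators_subset:
  "{w s z -` A \<inter> space M | s z A. 0 \<le> s \<and> s \<le> t \<and> A \<in> sets borel} \<union> null_sets M \<subseteq> sets M"
  using measurable_sets[OF measurable_w] by auto

lemma space_noise_filtration: "space (F t) = space M"
  unfolding noise_filtration_def using generators_subset[of t] sets.space_closed[of M]
  by (intro space_measure_of) blast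

lemma sets_noise_filtration:
  "sets (F t) = sigma_sets (space M) ({w s z -` A \<inter> space M | s z A. 0 \<le> s \<and> s \<le> t \<and> A \<in> sets borel} \<union> null_sets M)"
  unfolding noise_filtration_def using generators_subset[of t] sets.space_closed[of M]
  by (intro sets_measure_of) blast

sublocale filtered_prob_space M F
proof
  show "space (F t) = space M" for t by (rule space_noise_filtration)
  show "sets (F t) \<subseteq> sets M" for t
    unfolding sets_noise_filtration by (rule sets.sigma_sets_subset[OF generators_subset])
  show "sets (F s) \<subseteq> sets (F t)" if "s \<le> t" for s t
    unfolding sets_noise_filtration using that by (intro sigma_sets_mono' Un_mono subset_refl) (blast intro: order_trans)
  show "null_sets M \<subseteq> sets (F t)" for t
    unfolding sets_noise_filtration by (auto intro: sigma_sets.Basic)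
qed

lemma w_adapted:
  assumes "0 \<le> s" "s \<le> t" shows "w s z \<in> borel_measurable (F t)"
proof (rule measurableI)
  fix A :: "real set" assume "A \<in> sets borel"
  thus "w s z -` A \<inter> space (F t) \<in> sets (F t)"
    unfolding space_noise_filtration sets_noise_filtration using assms
    by (intro sigma_sets.Basic) blast
qed auto

definition path_events :: "int ^ 'd \<Rightarrow> 'w set set" where
  "path_events z = {(\<lambda>\<omega>. \<lambda>t\<in>{0..}. w t z \<omega>) -` A \<inter> space M | A. A \<in> sets (PiM {0..} (\<lambda>_. borel))}"

text \<open>Cylinder events of one path up to time s: a \<pi>-system, as the extension to generated
  \<sigma>-algebras requires.\<close>

definition past_events :: "real \<Rightarrow> int ^ 'd \<Rightarrow> 'w set set" where
  "past_events s z = {{\<omega> \<in> space M. \<forall>q\<in>Q. w q z \<omega> \<in> A q} | Q A. finite Q \<and> Q \<subseteq> {0..s} \<and> (\<forall>q. A q \<in> sets borel)}"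

definition increment_events :: "real \<Rightarrow> real \<Rightarrow> int ^ 'd \<Rightarrow> 'w set set" where
  "increment_events s r z = {{\<omega> \<in> space M. w r z \<omega> - w s z \<omega> \<in> A} | A. A \<in> sets borel}"

lemma Int_stable_path_events: "Int_stable (path_events z)"
proof (rule Int_stableI)
  fix a b assume "a \<in> path_events z" "b \<in> path_events z"
  then obtain A B where AB: "A \<in> sets (PiM {0..} (\<lambda>_. borel))" "B \<in> sets (PiM {0..} (\<lambda>_. borel))"
    "a = (\<lambda>\<omega>. \<lambda>t\<in>{0..}. w t z \<omega>) -` A \<inter> space M" "b = (\<lambda>\<omega>. \<lambda>t\<in>{0..}. w t z \<omega>) -` B \<inter> space M"
    unfolding path_events_def by blast
  hence "a \<inter> b = (\<lambda>\<omega>. \<lambda>t\<in>{0..}. w t z \<omega>) -` (A \<inter> B) \<inter> space M" by auto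
  thus "a \<inter> b \<in> path_events z" using AB(1,2) unfolding path_events_def by blast
qed

lemma Int_stable_past_events: "Int_stable (past_events s z)"
proof (rule Int_stableI)
  fix a b assume "a \<in> past_events s z" "b \<in> past_events s z"
  then obtain Q A Q' A' where *: "finite Q" "Q \<subseteq> {0..s}" "\<And>q. A q \<in> sets borel" "a = {\<omega> \<in> space M. \<forall>q\<in>Q. w q z \<omega> \<in> A q}"
    "finite Q'" "Q' \<subseteq> {0..s}" "\<And>q. A' q \<in> sets borel" "b = {\<omega> \<in> space M. \<forall>q\<in>Q'. w q z \<omega> \<in> A' q}"
    unfolding past_events_def by blast
  let ?A = "\<lambda>q. (if q \<in> Q then A q else UNIV) \<inter> (if q \<in> Q' then A' q else UNIV)"
  have "a \<inter> b = {\<omega> \<in> space M. \<forall>q\<in>Q \<union> Q'. w q z \<omega> \<in> ?A q}"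
    unfolding * by (auto split: if_splits)
  moreover have "\<forall>q. ?A q \<in> sets borel" using * by auto
  ultimately show "a \<inter> b \<in> past_events s z"
    unfolding past_events_def using * by (intro CollectI exI[of _ "Q \<union> Q'"] exI[of _ ?A]) auto
qed

lemma Int_stable_increment_events: "Int_stable (increment_events s r z)"
proof (rule Int_stableI)
  fix a b assume "a \<in> increment_events s r z" "b \<in> increment_events s r z"
  then obtain A B where AB: "A \<in> sets borel" "B \<in> sets borel" "a = {\<omega> \<in> space M. w r z \<omega> - w s z \<omega> \<in> A}" "b = {\<omega> \<in> space M. w r z \<omega> - w s z \<omega> \<in> B}"
    unfolding increment_events_def by blast
  hence "a \<inter> b = {\<omega> \<in> space M. w r z \<omega> - w s z \<omega> \<in> A \<inter> B}" by auto
  thus "a \<inter> b \<in> increment_events s r z" using AB(1,2) unfolding increment_events_def by blast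
qed

lemma past_events_path: "past_events s z \<subseteq> path_events z"
proof
  fix a assume "a \<in> past_events s z"
  then obtain Q A where *: "finite Q" "Q \<subseteq> {0..s}" "\<And>q. A q \<in> sets borel" "a = {\<omega> \<in> space M. \<forall>q\<in>Q. w q z \<omega> \<in> A q}"
    unfolding past_events_def by blast
  let ?P = "PiM {0..} (\<lambda>_. borel :: real measure)"
  have "{f \<in> space ?P. \<forall>q\<in>Q. f q \<in> A q} \<in> sets ?P"
  proof (rule sets.sets_Collect_finite_All[OF _ *(1)])
    fix q assume "q \<in> Q"
    hence "q \<in> {0..}" using *(2) by auto
    from measurable_sets[OF measurable_component_singleton[OF this, of "\<lambda>_. borel"] *(3)[of q]]
    show "{f \<in> space ?P. f q \<in> A q} \<in> sets ?P" by (simp add: vimage_def Int_def conj_commute)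
  qed
  moreover have "a = (\<lambda>\<omega>. \<lambda>t\<in>{0..}. w t z \<omega>) -` {f \<in> space ?P. \<forall>q\<in>Q. f q \<in> A q} \<inter> space M"
    using *(2) unfolding *(4) by (auto simp: space_PiM subset_iff)
  ultimately show "a \<in> path_events z" unfolding path_events_def by blast
qed

lemma increment_events_path:
  assumes "0 \<le> s" "0 \<le> r" shows "increment_events s r z \<subseteq> path_events z"
proof
  fix a assume "a \<in> increment_events s r z"
  then obtain A where *: "A \<in> sets borel" "a = {\<omega> \<in> space M. w r z \<omega> - w s z \<omega> \<in> A}"
    unfolding increment_events_def by blast
  let ?P = "PiM {0..} (\<lambda>_. borel :: real measure)"
  have "(\<lambda>f. f r - f s) \<in> borel_measurable ?P"
    using assms by (intro borel_measurable_diff measurable_component_singleton) auto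
  from measurable_sets[OF this *(1)] have "{f \<in> space ?P. f r - f s \<in> A} \<in> sets ?P"
    by (simp add: vimage_def Int_def conj_commute)
  moreover have "a = (\<lambda>\<omega>. \<lambda>t\<in>{0..}. w t z \<omega>) -` {f \<in> space ?P. f r - f s \<in> A} \<inter> space M"
    using assms unfolding *(2) by (auto simp: space_PiM)
  ultimately show "a \<in> path_events z" unfolding path_events_def by blast
qed

lemma path_events_measurable: "path_events z \<subseteq> events"
  using bm unfolding independent_brownian_motions_def indep_vars_def2 path_events_def by (auto dest: measurable_sets)

text \<open>Only independence of successive increments is given. With 0 and s adjoined to the
  observed times, the past values are partial sums of increments over a partition of [0, s], because
  the motion starts at 0 almost surely; the increment up to r comes next in the list.\<close>

lemma indep_past_increment_single:
  assumes sr: "0 \<le> s" "s < r" and a: "a \<in> past_events s z" and b: "b \<in> increment_events s r z"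
  shows "prob (a \<inter> b) = prob a * prob b"
proof -
  obtain Q A where Q: "finite Q" "Q \<subseteq> {0..s}" and A: "\<And>q. A q \<in> sets borel" and a_eq: "a = {\<omega> \<in> space M. \<forall>q\<in>Q. w q z \<omega> \<in> A q}"
    using a unfolding past_events_def by blast
  obtain C where C: "C \<in> sets borel" and b_eq: "b = {\<omega> \<in> space M. w r z \<omega> - w s z \<omega> \<in> C}"
    using b unfolding increment_events_def by blast
  define Q' where "Q' = Q \<union> {0, s}"
  have Q': "finite Q'" "Q' \<subseteq> {0..s}" "0 \<in> Q'" "s \<in> Q'" using Q sr unfolding Q'_def by auto
  define L where "L = sorted_list_of_set Q'"
  define n where "n = card Q' - 1"
  have "card Q' > 0" using Q'(1,3) by (auto simp: card_gt_0_iff)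
  hence L: "set L = Q'" "sorted_wrt (<) L" "length L = Suc n"
    using Q'(1) by (simp_all add: L_def n_def)
  \<comment> \<open>Increments with index below n describe the past; index n is the increment from s
    to r.\<close>
  define \<tau> where "\<tau> i = (if i \<le> n then L ! i else r)" for i
  have \<tau>_mem: "\<tau> i \<in> Q'" if "i \<le> n" for i
    using that L nth_mem[of i L] by (auto simp: \<tau>_def)
  have \<tau>_less: "\<tau> i < \<tau> j" if "i < j" "j \<le> n" for i j
    using that L sorted_wrt_nth_less[of "(<)" L i j] by (auto simp: \<tau>_def)
  have ex: "\<exists>i\<le>n. q = \<tau> i" if q: "q \<in> Q'" for q
  proof -
    have "q \<in> set L" using q L(1) by simp
    then obtain i where "i < length L" "L ! i = q" by (auto simp: in_set_conv_nth)
    thus ?thesis using L(3) by (intro exI[of _ i]) (auto simp: \<tau>_def)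
  qed
  have \<tau>0: "\<tau> 0 = 0"
  proof -
    obtain i where i: "i \<le> n" "0 = \<tau> i" using ex[OF Q'(3)] by blast
    have "0 \<le> \<tau> 0" using \<tau>_mem[of 0] Q'(2) by auto
    thus ?thesis using \<tau>_less[of 0 i] i by (cases "i = 0") auto
  qed
  have \<tau>n: "\<tau> n = s"
  proof -
    obtain i where i: "i \<le> n" "s = \<tau> i" using ex[OF Q'(4)] by blast
    have "\<tau> n \<le> s" using \<tau>_mem[of n] Q'(2) by auto
    thus ?thesis using \<tau>_less[of i n] i by (cases "i = n") auto
  qed
  have \<tau>Suc: "\<tau> (Suc n) = r" by (simp add: \<tau>_def)
  define D where "D i \<omega> = w (\<tau> (Suc i)) z \<omega> - w (\<tau> i) z \<omega>" for i \<omega>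
  have "\<forall>i<Suc n. \<tau> i < \<tau> (Suc i)"
    using \<tau>_less \<tau>n \<tau>Suc sr by (auto simp: less_Suc_eq)
  hence ind: "indep_vars (\<lambda>_. borel) D {..<Suc n}"
    using standard[of z] \<tau>0 unfolding standard_brownian_motion_def D_def[abs_def] by (auto)
  let ?P = "PiM {..<n} (\<lambda>_. borel :: real measure)" and ?R = "PiM {n} (\<lambda>_. borel :: real measure)"
  have iv: "indep_var ?P (\<lambda>\<omega>. restrict (\<lambda>i. D i \<omega>) {..<n}) ?R (\<lambda>\<omega>. restrict (\<lambda>i. D i \<omega>) {n})"
    by (rule indep_var_restrict[OF ind]) auto
  let ?SA = "{f \<in> space ?P. \<forall>k\<in>{k. k \<le> n \<and> \<tau> k \<in> Q}. (\<Sum>i<k. f i) \<in> A (\<tau> k)}"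
  let ?SC = "{f \<in> space ?R. f n \<in> C}"
  have SA: "?SA \<in> sets ?P"
  proof (rule sets.sets_Collect_finite_All)
    fix k assume k: "k \<in> {k. k \<le> n \<and> \<tau> k \<in> Q}"
    have "(\<lambda>f. \<Sum>i<k. f i) \<in> borel_measurable ?P"
      using k by (intro borel_measurable_sum measurable_component_singleton) auto
    from measurable_sets[OF this A[of "\<tau> k"]] show "{f \<in> space ?P. (\<Sum>i<k. f i) \<in> A (\<tau> k)} \<in> sets ?P"
      by (simp add: vimage_def Int_def conj_commute)
  qed auto
  have SC: "?SC \<in> sets ?R"
    using measurable_sets[OF measurable_component_singleton[of n "{n}" "\<lambda>_. borel"] C]
    by (simp add: vimage_def Int_def conj_commute)
  let ?a' = "(\<lambda>\<omega>. restrict (\<lambda>i. D i \<omega>) {..<n}) -` ?SA \<inter> space M"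
  have b_eq': "(\<lambda>\<omega>. restrict (\<lambda>i. D i \<omega>) {n}) -` ?SC \<inter> space M = b"
    by (auto simp: b_eq space_PiM D_def \<tau>n \<tau>Suc)
  have prod: "prob (?a' \<inter> b) = prob ?a' * prob b"
  proof -
    have "(\<lambda>\<omega>. (restrict (\<lambda>i. D i \<omega>) {..<n}, restrict (\<lambda>i. D i \<omega>) {n})) -` (?SA \<times> ?SC) \<inter> space M = ?a' \<inter> b"
      unfolding b_eq'[symmetric] by auto
    thus ?thesis using indep_varD[OF iv SA SC] b_eq' by simp
  qed
  have "AE \<omega> in M. w 0 z \<omega> = 0" using standard[of z] by (simp add: standard_brownian_motion_def)
  hence AEa: "AE \<omega> in M. \<omega> \<in> a \<longleftrightarrow> \<omega> \<in> ?a'"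
  proof eventually_elim
    case (elim \<omega>)
    have sum: "(\<Sum>i<k. D i \<omega>) = w (\<tau> k) z \<omega>" if "k \<le> n" for k
      using elim sum_lessThan_telescope[of "\<lambda>i. w (\<tau> i) z \<omega>" k] by (simp add: D_def \<tau>0)
    have "\<omega> \<in> ?a' \<longleftrightarrow> \<omega> \<in> space M \<and> (\<forall>k\<in>{k. k \<le> n \<and> \<tau> k \<in> Q}. w (\<tau> k) z \<omega> \<in> A (\<tau> k))"
      using sum by (auto simp: space_PiM)
    also have "\<dots> \<longleftrightarrow> \<omega> \<in> a"
      using ex unfolding a_eq Q'_def by blast
    finally show ?case ..
  qed
  have am: "a \<in> events" using past_events_path path_events_measurable a by blast
  have bm': "b \<in> events" using increment_events_path[of s r z] path_events_measurable b sr by auto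
  have am': "?a' \<in> events"
    using measurable_sets[OF indep_var_rv1[OF iv] SA] .
  have "prob a = prob ?a'" using AEa am am' by (intro measure_eq_AE) auto
  moreover have "prob (a \<inter> b) = prob (?a' \<inter> b)"
    using AEa am am' bm' by (intro measure_eq_AE) (auto elim!: eventually_mono)
  ultimately show ?thesis using prod by simp
qed

text \<open>The statement for one site is combined over all sites by
  \<open>indep_sets_Times\<close>, then generators are replaced by generated \<sigma>-algebras.
  Adjoining null sets to the past gives a family that is still stable under intersection, and the
  \<sigma>-algebra it generates contains \<open>F s\<close>.\<close>

lemma indep_past_increments:
  assumes sr: "0 \<le> s" "s < r"
  shows "indep_set (sets (F s)) (sigma_sets (space M) (\<Union>z. increment_events s r z))"
proof -
  let ?E = "\<lambda>z j. case_bool (past_events s z) (increment_events s r z) j"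
  have meas: "past_events s z \<subseteq> events" "increment_events s r z \<subseteq> events" for z
    using order_trans[OF past_events_path path_events_measurable]
      order_trans[OF increment_events_path path_events_measurable] sr by auto
  have "indep_sets path_events UNIV"
    using bm unfolding independent_brownian_motions_def indep_vars_def2 path_events_def[abs_def] by blast
  moreover have "indep_sets (?E z) UNIV" for z
    using indep_setI[OF meas indep_past_increment_single[OF sr]] by (simp add: indep_set_def)
  moreover have "?E z j \<subseteq> path_events z" for z j
    using past_events_path increment_events_path[of s r z] sr by (auto split: bool.split)
  ultimately have ind: "indep_sets (\<lambda>(z, j). ?E z j) UNIV"
    using Int_stable_path_events by (intro indep_sets_Times)
  have "indep_sets (\<lambda>j. sigma_sets (space M) (\<Union>i\<in>UNIV \<times> {j}. case i of (z, j) \<Rightarrow> ?E z j)) UNIV"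
  proof (rule indep_sets_collect_sigma)
    have "(\<Union>j\<in>(UNIV :: bool set). (UNIV :: (int ^ 'd) set) \<times> {j}) = UNIV" by auto
    thus "indep_sets (\<lambda>(z, j). ?E z j) (\<Union>j\<in>UNIV. UNIV \<times> {j})" using ind by (simp only:)
    show "Int_stable (case i of (z, j) \<Rightarrow> ?E z j)" for i
      using Int_stable_past_events Int_stable_increment_events by (auto split: prod.split bool.split)
  qed (auto simp: disjoint_family_on_def)
  also have "(\<lambda>j. sigma_sets (space M) (\<Union>i\<in>UNIV \<times> {j}. case i of (z, j) \<Rightarrow> ?E z j)) =
      case_bool (sigma_sets (space M) (\<Union>z. past_events s z)) (sigma_sets (space M) (\<Union>z. increment_events s r z))"
  proof
    fix j :: bool
    have "(\<Union>i\<in>UNIV \<times> {j}. case i of (z, j) \<Rightarrow> ?E z j) = (\<Union>z. ?E z j)" by blast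
    thus "sigma_sets (space M) (\<Union>i\<in>UNIV \<times> {j}. case i of (z, j) \<Rightarrow> ?E z j) =
      case_bool (sigma_sets (space M) (\<Union>z. past_events s z)) (sigma_sets (space M) (\<Union>z. increment_events s r z)) j"
      by (cases j) simp_all
  qed
  finally have ind2: "indep_set (sigma_sets (space M) (\<Union>z. past_events s z)) (sigma_sets (space M) (\<Union>z. increment_events s r z))"
    by (simp add: indep_set_def)
  let ?P = "sigma_sets (space M) (\<Union>z. past_events s z)" and ?I = "sigma_sets (space M) (\<Union>z. increment_events s r z)"
  \<comment> \<open>With a null set both sides of the product formula are 0.\<close>
  have "indep_set (?P \<union> null_sets M) ?I"
  proof (rule indep_setI)
    show "?P \<union> null_sets M \<subseteq> events" using indep_setD_ev1[OF ind2] by auto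
    show I: "?I \<subseteq> events" using indep_setD_ev2[OF ind2] .
    show "prob (a \<inter> b) = prob a * prob b" if "a \<in> ?P \<union> null_sets M" "b \<in> ?I" for a b
      using that(1)
    proof
      assume "a \<in> ?P" thus ?thesis using indep_setD[OF ind2] that(2) by blast
    next
      assume a: "a \<in> null_sets M"
      moreover have "a \<inter> b \<in> null_sets M" using a that(2) I by (intro null_set_Int2) auto
      ultimately show ?thesis by (simp add: null_sets_def measure_def)
    qed
  qed
  moreover have "Int_stable (?P \<union> null_sets M)"
  proof (rule Int_stableI)
    fix a b assume ab: "a \<in> ?P \<union> null_sets M" "b \<in> ?P \<union> null_sets M"
    have P: "?P \<subseteq> events" using indep_setD_ev1[OF ind2] .
    have "sigma_algebra (space M) ?P"
      using meas sets.space_closed[of M] by (intro sigma_algebra_sigma_sets) blast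
    then interpret P: sigma_algebra "space M" ?P .
    show "a \<inter> b \<in> ?P \<union> null_sets M"
    proof (cases "a \<in> ?P \<and> b \<in> ?P")
      case True thus ?thesis using P.Int by blast
    next
      case False
      hence "a \<in> null_sets M \<or> b \<in> null_sets M" using ab by auto
      moreover have "a \<in> events" "b \<in> events" using ab P by auto
      ultimately show ?thesis using null_set_Int1 null_set_Int2 by blast
    qed
  qed
  moreover have "Int_stable ?I"
  proof (rule Int_stableI)
    have "sigma_algebra (space M) ?I"
      using meas sets.space_closed[of M] by (intro sigma_algebra_sigma_sets) blast
    then interpret I: sigma_algebra "space M" ?I .
    show "a \<inter> b \<in> ?I" if "a \<in> ?I" "b \<in> ?I" for a b using I.Int that by blast
  qed
  ultimately have "indep_set (sigma_sets (space M) (?P \<union> null_sets M)) (sigma_sets (space M) ?I)"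
    by (rule indep_set_sigma_sets)
  hence "indep_sets (case_bool (sigma_sets (space M) (?P \<union> null_sets M)) (sigma_sets (space M) ?I)) UNIV"
    by (simp add: indep_set_def)
  hence "indep_sets (case_bool (sets (F s)) ?I) UNIV"
  proof (rule indep_sets_mono_sets)
    fix j :: bool
    have "sets (F s) \<subseteq> sigma_sets (space M) (?P \<union> null_sets M)"
      unfolding sets_noise_filtration
    proof (rule sigma_sets_mono', rule Un_mono)
      show "{w q z -` A \<inter> space M |q z A. 0 \<le> q \<and> q \<le> s \<and> A \<in> sets borel} \<subseteq> ?P"
      proof clarify
        fix q z and A :: "real set" assume q: "0 \<le> q" "q \<le> s" "A \<in> sets borel"
        have "w q z -` A \<inter> space M = {\<omega> \<in> space M. \<forall>p\<in>{q}. w p z \<omega> \<in> A}" by auto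
        hence "w q z -` A \<inter> space M \<in> past_events s z"
          unfolding past_events_def using q by (intro CollectI exI[of _ "{q}"] exI[of _ "\<lambda>_. A"]) auto
        thus "w q z -` A \<inter> space M \<in> ?P" by (intro sigma_sets.Basic) auto
      qed
    qed simp
    moreover have "?I \<subseteq> sigma_sets (space M) ?I" by (auto intro: sigma_sets.Basic)
    ultimately show "case_bool (sets (F s)) ?I j \<subseteq> case_bool (sigma_sets (space M) (?P \<union> null_sets M)) (sigma_sets (space M) ?I) j"
      by (cases j) auto
  qed
  thus ?thesis by (simp add: indep_set_def)
qed

lemma expectation_past_times_increment:
  assumes sr: "0 \<le> s" "s < r" and \<zeta>: "\<zeta> \<in> borel_measurable (F s)" "\<And>\<omega>. \<omega> \<in> space M \<Longrightarrow> \<bar>\<zeta> \<omega>\<bar> \<le> c"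
    and Y: "Y \<in> borel_measurable (sigma (space M) (\<Union>z. increment_events s r z))" "integrable M Y"
  shows "(\<integral>\<omega>. \<zeta> \<omega> * Y \<omega> \<partial>M) = (\<integral>\<omega>. \<zeta> \<omega> \<partial>M) * (\<integral>\<omega>. Y \<omega> \<partial>M :: real)"
proof -
  let ?I = "\<Union>z. increment_events s r z"
  have \<zeta>M: "\<zeta> \<in> borel_measurable M" using \<zeta>(1) by (rule borel_measurable_F_M)
  have "integrable M \<zeta>"
    using \<zeta>M \<zeta>(2) by (intro integrable_const_bound[where B=c]) auto
  have sub: "?I \<subseteq> Pow (space M)" by (auto simp: increment_events_def)
  have "indep_var borel \<zeta> borel Y"
    unfolding indep_var_eq
  proof (intro conjI \<zeta>M)
    show "Y \<in> borel_measurable M" using Y(2) by (rule borel_measurable_integrable)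
    note ind = indep_past_increments[OF sr]
    have "sigma_sets (space M) {\<zeta> -` A \<inter> space M |A. A \<in> sets borel} \<subseteq> sets (F s)"
    proof -
      have "sigma_sets (space (F s)) {\<zeta> -` A \<inter> space M |A. A \<in> sets borel} \<subseteq> sets (F s)"
        using measurable_sets[OF \<zeta>(1)] by (intro sets.sigma_sets_subset) (auto simp: space_noise_filtration)
      thus ?thesis by (simp add: space_noise_filtration)
    qed
    moreover have "sigma_sets (space M) {Y -` A \<inter> space M |A. A \<in> sets borel} \<subseteq> sigma_sets (space M) ?I"
    proof -
      have "{Y -` A \<inter> space M |A. A \<in> sets borel} \<subseteq> sigma_sets (space M) ?I"
        using measurable_sets[OF Y(1)] sub by (auto simp: space_measure_of_conv)
      from sigma_sets_mono[OF this] show ?thesis .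
    qed
    ultimately show "indep_set (sigma_sets (space M) {\<zeta> -` A \<inter> space M |A. A \<in> sets borel})
        (sigma_sets (space M) {Y -` A \<inter> space M |A. A \<in> sets borel})"
      using ind unfolding indep_set_def by (rule_tac indep_sets_mono_sets) (auto split: bool.splits)
  qed
  from indep_var_lebesgue_integral[OF this \<open>integrable M \<zeta>\<close> Y(2)] show ?thesis .
qed

section \<open>Moments of the increments and finite sums of the noise\<close>

lemma increment_moments:
  assumes sr: "0 \<le> s" "s < r"
  shows "integrable M (\<lambda>\<omega>. w r z \<omega> - w s z \<omega>)" "integrable M (\<lambda>\<omega>. (w r z \<omega> - w s z \<omega>)\<^sup>2)"
    "(\<integral>\<omega>. (w r z \<omega> - w s z \<omega>) \<partial>M) = 0" "(\<integral>\<omega>. (w r z \<omega> - w s z \<omega>)\<^sup>2 \<partial>M) = r - s"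
proof -
  let ?\<sigma> = "sqrt (r - s)"
  have D: "distributed M lborel (\<lambda>\<omega>. w r z \<omega> - w s z \<omega>) (normal_density 0 ?\<sigma>)"
    using standard[of z] sr unfolding standard_brownian_motion_def by blast
  have \<sigma>: "0 < ?\<sigma>" using sr by simp
  have "integrable lborel (\<lambda>x. normal_density 0 ?\<sigma> x * x)" using integrable_normal_moment_nz_1[OF \<sigma>, of 0] .
  thus 1: "integrable M (\<lambda>\<omega>. w r z \<omega> - w s z \<omega>)"
    by (subst distributed_integrable[OF D, of "\<lambda>x. x", symmetric]) auto
  have "integrable lborel (\<lambda>x. normal_density 0 ?\<sigma> x * x\<^sup>2)" using integrable_normal_moment[OF \<sigma>, of 0 2] by simp
  thus 2: "integrable M (\<lambda>\<omega>. (w r z \<omega> - w s z \<omega>)\<^sup>2)"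
    by (subst distributed_integrable[OF D, of "\<lambda>x. x\<^sup>2", symmetric]) auto
  show 3: "(\<integral>\<omega>. (w r z \<omega> - w s z \<omega>) \<partial>M) = 0"
    using normal_distributed_expectation[OF \<sigma> D] .
  show "(\<integral>\<omega>. (w r z \<omega> - w s z \<omega>)\<^sup>2 \<partial>M) = r - s"
    using normal_distributed_variance[OF \<sigma> D] sr by (simp add: 3)
qed

lemma increments_orthogonal:
  assumes sr: "0 \<le> s" "s < r" and z: "z \<noteq> z'"
  shows "integrable M (\<lambda>\<omega>. (w r z \<omega> - w s z \<omega>) * (w r z' \<omega> - w s z' \<omega>))"
    "(\<integral>\<omega>. (w r z \<omega> - w s z \<omega>) * (w r z' \<omega> - w s z' \<omega>) \<partial>M) = 0"
proof -
  let ?P = "PiM {0..} (\<lambda>_. borel :: real measure)"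
  have paths: "indep_vars (\<lambda>_. ?P) (\<lambda>z \<omega>. \<lambda>t\<in>{0..}. w t z \<omega>) UNIV"
    using bm by (simp add: independent_brownian_motions_def)
  have "(\<lambda>f. f r - f s) \<in> borel_measurable ?P"
    using sr by (intro borel_measurable_diff measurable_component_singleton) auto
  from indep_vars_compose2[OF paths, of "\<lambda>_ f. f r - f s" "\<lambda>_. borel"] this
  have "indep_vars (\<lambda>_. borel) (\<lambda>z \<omega>. w r z \<omega> - w s z \<omega>) UNIV"
    using sr by simp
  from indep_var_restrict[OF this, of "{z}" "{z'}"] z
  have "indep_var (PiM {z} (\<lambda>_. borel)) (\<lambda>\<omega>. restrict (\<lambda>z. w r z \<omega> - w s z \<omega>) {z})
      (PiM {z'} (\<lambda>_. borel)) (\<lambda>\<omega>. restrict (\<lambda>z. w r z \<omega> - w s z \<omega>) {z'})" by simp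
  from indep_var_compose[OF this, of "\<lambda>f. f z" borel "\<lambda>f. f z'" borel]
  have ind: "indep_var borel (\<lambda>\<omega>. w r z \<omega> - w s z \<omega>) borel (\<lambda>\<omega>. w r z' \<omega> - w s z' \<omega>)"
    by (simp add: o_def measurable_component_singleton)
  show "integrable M (\<lambda>\<omega>. (w r z \<omega> - w s z \<omega>) * (w r z' \<omega> - w s z' \<omega>))"
    by (rule indep_var_integrable[OF ind increment_moments(1)[OF sr] increment_moments(1)[OF sr]])
  show "(\<integral>\<omega>. (w r z \<omega> - w s z \<omega>) * (w r z' \<omega> - w s z' \<omega>) \<partial>M) = 0"
    using indep_var_lebesgue_integral[OF ind increment_moments(1)[OF sr] increment_moments(1)[OF sr]]
    by (simp add: increment_moments(3)[OF sr])
qed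

definition finite_noise :: "(int ^ 'd \<Rightarrow> real) \<Rightarrow> (int ^ 'd) set \<Rightarrow> real \<Rightarrow> 'w \<Rightarrow> real" where
  "finite_noise c Z t \<omega> = (\<Sum>z\<in>Z. c z * w t z \<omega>)"

text \<open>Independence of the sites cancels the mixed products, so the variance rate is the sum of
  the squared coefficients. The case s = r is split off because the density of an increment is given
  for s < r.\<close>

lemma integrator_finite_noise:
  assumes Z: "finite Z"
  shows "integrator M F (finite_noise c Z) (\<Sum>z\<in>Z. (c z)\<^sup>2)"
proof
  show "0 \<le> (\<Sum>z\<in>Z. (c z)\<^sup>2)" by (intro sum_nonneg) auto
  show "finite_noise c Z t \<in> borel_measurable (F t)" if "0 \<le> t" for t
    unfolding finite_noise_def[abs_def] using w_adapted[OF that order_refl]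
    by (intro borel_measurable_sum borel_measurable_times) auto
  have diff: "finite_noise c Z r \<omega> - finite_noise c Z s \<omega> = (\<Sum>z\<in>Z. c z * (w r z \<omega> - w s z \<omega>))" for s r \<omega>
    by (simp add: finite_noise_def sum_subtractf right_diff_distrib)
  have sq: "(finite_noise c Z r \<omega> - finite_noise c Z s \<omega>)\<^sup>2 =
      (\<Sum>z\<in>Z. \<Sum>z'\<in>Z. c z * c z' * ((w r z \<omega> - w s z \<omega>) * (w r z' \<omega> - w s z' \<omega>)))" for s r \<omega>
    unfolding diff power2_eq_square sum_product by (simp add: ac_simps)
  have prod: "integrable M (\<lambda>\<omega>. (w r z \<omega> - w s z \<omega>) * (w r z' \<omega> - w s z' \<omega>))"
      "(\<integral>\<omega>. (w r z \<omega> - w s z \<omega>) * (w r z' \<omega> - w s z' \<omega>) \<partial>M) = (if z = z' then r - s else 0)"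
      if "0 \<le> s" "s < r" for s r z z'
    using increments_orthogonal[OF that, of z z'] increment_moments(2,4)[OF that, of z]
    by (cases "z = z'"; simp add: power2_eq_square)+
  have fsq: "integrable M (\<lambda>\<omega>. (finite_noise c Z r \<omega> - finite_noise c Z s \<omega>)\<^sup>2)"
    "(\<integral>\<omega>. (finite_noise c Z r \<omega> - finite_noise c Z s \<omega>)\<^sup>2 \<partial>M) = (\<Sum>z\<in>Z. (c z)\<^sup>2) * (r - s)"
    if "0 \<le> s" "s < r" for s r
  proof -
    show "integrable M (\<lambda>\<omega>. (finite_noise c Z r \<omega> - finite_noise c Z s \<omega>)\<^sup>2)"
      unfolding sq using prod(1)[OF that] by simp
    have "(\<integral>\<omega>. (finite_noise c Z r \<omega> - finite_noise c Z s \<omega>)\<^sup>2 \<partial>M) = (\<Sum>z\<in>Z. \<Sum>z'\<in>Z. c z * c z' * (if z = z' then r - s else 0))"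
      unfolding sq using prod[OF that] by (subst Bochner_Integration.integral_sum; simp add: Bochner_Integration.integral_sum)
    also have "\<dots> = (\<Sum>z\<in>Z. (c z)\<^sup>2 * (r - s))"
      using Z by (intro sum.cong refl) (simp add: if_distrib[of "\<lambda>x. _ * x"] power2_eq_square cong: if_cong)
    finally show "(\<integral>\<omega>. (finite_noise c Z r \<omega> - finite_noise c Z s \<omega>)\<^sup>2 \<partial>M) = (\<Sum>z\<in>Z. (c z)\<^sup>2) * (r - s)"
      by (simp add: sum_distrib_right)
  qed
  have incr: "(\<lambda>\<omega>. w r z \<omega> - w s z \<omega>) \<in> borel_measurable (sigma (space M) (\<Union>z. increment_events s r z))" for s r z
  proof (rule measurableI)
    fix A :: "real set" assume "A \<in> sets borel"
    hence "{\<omega> \<in> space M. w r z \<omega> - w s z \<omega> \<in> A} \<in> (\<Union>z. increment_events s r z)"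
      by (auto simp: increment_events_def)
    moreover have "(\<Union>z. increment_events s r z) \<subseteq> Pow (space M)" by (auto simp: increment_events_def)
    ultimately show "(\<lambda>\<omega>. w r z \<omega> - w s z \<omega>) -` A \<inter> space (sigma (space M) (\<Union>z. increment_events s r z)) \<in> sets (sigma (space M) (\<Union>z. increment_events s r z))"
      by (auto simp: vimage_def Int_def conj_commute intro!: sigma_sets.Basic)
  qed simp
  have fincr: "(\<lambda>\<omega>. finite_noise c Z r \<omega> - finite_noise c Z s \<omega>) \<in> borel_measurable (sigma (space M) (\<Union>z. increment_events s r z))" for s r
    unfolding diff using incr by (intro borel_measurable_sum borel_measurable_times borel_measurable_const)
  show "integrable M (\<lambda>\<omega>. (finite_noise c Z r \<omega> - finite_noise c Z s \<omega>)\<^sup>2)" if "0 \<le> s" "s \<le> r" for s r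
    using fsq(1)[of s r] that by (cases "s = r") auto
  fix s r C :: real and \<zeta> :: "'w \<Rightarrow> real" assume sr: "0 \<le> s" "s \<le> r" and \<zeta>: "\<zeta> \<in> borel_measurable (F s)" "\<And>\<omega>. \<omega> \<in> space M \<Longrightarrow> \<bar>\<zeta> \<omega>\<bar> \<le> C"
  show "(\<integral>\<omega>. \<zeta> \<omega> * (finite_noise c Z r \<omega> - finite_noise c Z s \<omega>) \<partial>M) = 0"
  proof (cases "s = r")
    case False
    hence sr': "s < r" using sr by simp
    have "integrable M (\<lambda>\<omega>. finite_noise c Z r \<omega> - finite_noise c Z s \<omega>)"
      unfolding diff using increment_moments(1)[OF sr(1) sr'] by simp
    moreover have "(\<integral>\<omega>. finite_noise c Z r \<omega> - finite_noise c Z s \<omega> \<partial>M) = 0"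
      unfolding diff using increment_moments(1,3)[OF sr(1) sr'] by (subst Bochner_Integration.integral_sum) auto
    ultimately show ?thesis
      using expectation_past_times_increment[OF sr(1) sr' \<zeta> fincr] by simp
  qed simp
  show "(\<integral>\<omega>. \<zeta> \<omega> * (finite_noise c Z r \<omega> - finite_noise c Z s \<omega>)\<^sup>2 \<partial>M) = (\<Sum>z\<in>Z. (c z)\<^sup>2) * (r - s) * (\<integral>\<omega>. \<zeta> \<omega> \<partial>M)"
  proof (cases "s = r")
    case False
    hence sr': "s < r" using sr by simp
    show ?thesis
      using expectation_past_times_increment[OF sr(1) sr' \<zeta> borel_measurable_power[OF fincr] fsq(1)[OF sr(1) sr']] fsq(2)[OF sr(1) sr']
      by simp
  qed simp
qed

end

section \<open>Mean-square limits of integrators\<close>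

context prob_space
begin

lemma Cauchy_Schwarz_expectation:
  fixes f g :: "'a \<Rightarrow> real"
  assumes [measurable]: "f \<in> borel_measurable M" "g \<in> borel_measurable M"
    and f: "integrable M (\<lambda>x. (f x)\<^sup>2)" and g: "integrable M (\<lambda>x. (g x)\<^sup>2)"
  shows "(\<integral>x. \<bar>f x * g x\<bar> \<partial>M)\<^sup>2 \<le> (\<integral>x. (f x)\<^sup>2 \<partial>M) * (\<integral>x. (g x)\<^sup>2 \<partial>M)"
proof -
  have int: "integrable M (\<lambda>x. \<bar>f x * g x\<bar>)"
    by (intro integrable_abs integrable_mult_of_squares f g) auto
  have "(\<integral>\<^sup>+x. ennreal \<bar>f x\<bar> * ennreal \<bar>g x\<bar> \<partial>M)\<^sup>2 \<le> (\<integral>\<^sup>+x. (ennreal \<bar>f x\<bar>)\<^sup>2 \<partial>M) * (\<integral>\<^sup>+x. (ennreal \<bar>g x\<bar>)\<^sup>2 \<partial>M)"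
    by (intro Cauchy_Schwarz_nn_integral) auto
  also have "(\<integral>\<^sup>+x. ennreal \<bar>f x\<bar> * ennreal \<bar>g x\<bar> \<partial>M) = ennreal (\<integral>x. \<bar>f x * g x\<bar> \<partial>M)"
    using int by (simp add: nn_integral_eq_integral[symmetric] ennreal_mult abs_mult)
  also have "(\<integral>\<^sup>+x. (ennreal \<bar>f x\<bar>)\<^sup>2 \<partial>M) = ennreal (\<integral>x. (f x)\<^sup>2 \<partial>M)"
    using f by (simp add: nn_integral_eq_integral[symmetric] ennreal_power)
  also have "(\<integral>\<^sup>+x. (ennreal \<bar>g x\<bar>)\<^sup>2 \<partial>M) = ennreal (\<integral>x. (g x)\<^sup>2 \<partial>M)"
    using g by (simp add: nn_integral_eq_integral[symmetric] ennreal_power)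
  finally show ?thesis
    by (simp add: ennreal_power ennreal_mult[symmetric] ennreal_le_iff)
qed

text \<open>A single index with distance below 1 already gives square integrability of V. The linear
  functional converges by Cauchy-Schwarz against a bounded factor; for the quadratic one Vk^2 = V^2
  - 2 V (V - Vk) + (V - Vk)^2, where each correction is small for the same reason.\<close>

lemma L2_limit:
  fixes V :: "'a \<Rightarrow> real"
  assumes V[measurable]: "V \<in> borel_measurable M" and Vk[measurable]: "\<And>k. Vk k \<in> borel_measurable M"
    and int: "\<And>k. integrable M (\<lambda>x. (Vk k x)\<^sup>2)"
    and lim: "(\<lambda>k. \<integral>\<^sup>+x. ennreal ((V x - Vk k x)\<^sup>2) \<partial>M) \<longlonglongrightarrow> 0"
  shows "integrable M (\<lambda>x. (V x)\<^sup>2)"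
    and "\<zeta> \<in> borel_measurable M \<Longrightarrow> (\<And>x. x \<in> space M \<Longrightarrow> \<bar>\<zeta> x\<bar> \<le> c) \<Longrightarrow>
      (\<lambda>k. \<integral>x. \<zeta> x * Vk k x \<partial>M) \<longlonglongrightarrow> (\<integral>x. \<zeta> x * V x \<partial>M)"
    and "\<zeta> \<in> borel_measurable M \<Longrightarrow> (\<And>x. x \<in> space M \<Longrightarrow> \<bar>\<zeta> x\<bar> \<le> c) \<Longrightarrow>
      (\<lambda>k. \<integral>x. \<zeta> x * (Vk k x)\<^sup>2 \<partial>M) \<longlonglongrightarrow> (\<integral>x. \<zeta> x * (V x)\<^sup>2 \<partial>M)"
proof -
  have "eventually (\<lambda>k. (\<integral>\<^sup>+x. ennreal ((V x - Vk k x)\<^sup>2) \<partial>M) < 1) sequentially"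
    using lim by (rule order_tendstoD) simp
  then obtain k where k: "(\<integral>\<^sup>+x. ennreal ((V x - Vk k x)\<^sup>2) \<partial>M) < 1"
    by (auto simp: eventually_sequentially)
  have "(\<integral>\<^sup>+x. ennreal ((V x)\<^sup>2) \<partial>M) \<le> (\<integral>\<^sup>+x. 2 * ennreal ((V x - Vk k x)\<^sup>2) + 2 * ennreal ((Vk k x)\<^sup>2) \<partial>M)"
    using ennreal_square_add_le[of "V x - Vk k x" "Vk k x" for x] by (intro nn_integral_mono) simp
  also have "\<dots> = 2 * (\<integral>\<^sup>+x. ennreal ((V x - Vk k x)\<^sup>2) \<partial>M) + 2 * (\<integral>\<^sup>+x. ennreal ((Vk k x)\<^sup>2) \<partial>M)"
    by (simp add: nn_integral_add nn_integral_cmult)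
  also have "\<dots> < \<infinity>"
    using k int[of k] order.strict_trans[OF k, of \<top>] by (simp add: ennreal_mult_less_top integrable_iff_bounded)
  finally show V2: "integrable M (\<lambda>x. (V x)\<^sup>2)"
    by (simp add: integrable_iff_bounded)
  have D2: "integrable M (\<lambda>x. (V x - Vk k x)\<^sup>2)" for k
  proof -
    have "integrable M (\<lambda>x. (V x)\<^sup>2 - 2 * (V x * Vk k x) + (Vk k x)\<^sup>2)"
      using V2 int[of k] integrable_mult_of_squares[OF V Vk V2 int]
      by (intro Bochner_Integration.integrable_add Bochner_Integration.integrable_diff integrable_mult_right) auto
    thus ?thesis by (simp add: power2_diff algebra_simps)
  qed
  define d where "d k = (\<integral>x. (V x - Vk k x)\<^sup>2 \<partial>M)" for k
  have "(\<lambda>k. ennreal (d k)) \<longlonglongrightarrow> ennreal 0"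
    using lim D2 by (simp add: d_def nn_integral_eq_integral)
  hence d: "d \<longlonglongrightarrow> 0"
    by (rule tendsto_ennrealD) (auto simp: d_def intro!: always_eventually integral_nonneg)
  assume \<zeta>[measurable]: "\<zeta> \<in> borel_measurable M" and c: "\<And>x. x \<in> space M \<Longrightarrow> \<bar>\<zeta> x\<bar> \<le> c"
  have \<zeta>i: "integrable M (\<lambda>x. \<zeta> x * f x)" if "integrable M f" for f :: "'a \<Rightarrow> real"
  proof (rule Bochner_Integration.integrable_bound[OF integrable_mult_right[OF that, of c]])
    show "AE x in M. norm (\<zeta> x * f x) \<le> norm (c * f x)"
      using c by (intro AE_I2) (auto simp: abs_mult intro!: mult_right_mono order_trans[OF c])
    show "(\<lambda>x. \<zeta> x * f x) \<in> borel_measurable M" using borel_measurable_integrable[OF that] by measurable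
  qed
  have small: "(\<lambda>k. \<integral>x. \<zeta> x * (U x * (V x - Vk k x)) \<partial>M) \<longlonglongrightarrow> 0"
      if U[measurable]: "U \<in> borel_measurable M" and U2: "integrable M (\<lambda>x. (U x)\<^sup>2)" for U
  proof (rule Lim_null_comparison)
    have "(\<lambda>k. \<bar>c\<bar> * sqrt ((\<integral>x. (U x)\<^sup>2 \<partial>M) * d k)) \<longlonglongrightarrow> \<bar>c\<bar> * sqrt ((\<integral>x. (U x)\<^sup>2 \<partial>M) * 0)"
      by (intro tendsto_intros d)
    thus "(\<lambda>k. \<bar>c\<bar> * sqrt ((\<integral>x. (U x)\<^sup>2 \<partial>M) * d k)) \<longlonglongrightarrow> 0" by simp
    show "\<forall>\<^sub>F k in sequentially. norm (\<integral>x. \<zeta> x * (U x * (V x - Vk k x)) \<partial>M) \<le> \<bar>c\<bar> * sqrt ((\<integral>x. (U x)\<^sup>2 \<partial>M) * d k)"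
    proof (intro always_eventually allI)
      fix k
      have i: "integrable M (\<lambda>x. U x * (V x - Vk k x))" by (intro integrable_mult_of_squares U2 D2) auto
      have "norm (\<integral>x. \<zeta> x * (U x * (V x - Vk k x)) \<partial>M) \<le> (\<integral>x. \<bar>c\<bar> * \<bar>U x * (V x - Vk k x)\<bar> \<partial>M)"
      proof (rule order_trans[OF integral_norm_bound integral_mono[OF integrable_norm[OF \<zeta>i[OF i]] integrable_mult_right[OF integrable_abs[OF i]]]])
        fix x assume "x \<in> space M"
        hence "\<bar>\<zeta> x\<bar> \<le> \<bar>c\<bar>" using c[of x] by linarith
        thus "norm (\<zeta> x * (U x * (V x - Vk k x))) \<le> \<bar>c\<bar> * \<bar>U x * (V x - Vk k x)\<bar>"
          by (simp add: abs_mult mult_right_mono)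
      qed
      also have "\<dots> = \<bar>c\<bar> * (\<integral>x. \<bar>U x * (V x - Vk k x)\<bar> \<partial>M)" by simp
      also have "(\<integral>x. \<bar>U x * (V x - Vk k x)\<bar> \<partial>M) \<le> sqrt ((\<integral>x. (U x)\<^sup>2 \<partial>M) * d k)"
        unfolding d_def by (intro real_le_rsqrt Cauchy_Schwarz_expectation U2 D2) auto
      finally show "norm (\<integral>x. \<zeta> x * (U x * (V x - Vk k x)) \<partial>M) \<le> \<bar>c\<bar> * sqrt ((\<integral>x. (U x)\<^sup>2 \<partial>M) * d k)"
        by (simp add: mult_left_mono)
    qed
  qed
  have one: "integrable M (\<lambda>x. (1::real)\<^sup>2)" by simp
  have I1: "integrable M V" "integrable M (Vk k)" for k
    using integrable_mult_of_squares[OF _ V one V2] integrable_mult_of_squares[OF _ Vk one int] by auto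
  have e1: "(\<integral>x. \<zeta> x * Vk k x \<partial>M) = (\<integral>x. \<zeta> x * V x \<partial>M) - (\<integral>x. \<zeta> x * (1 * (V x - Vk k x)) \<partial>M)" for k
    using \<zeta>i[OF I1(1)] \<zeta>i[OF I1(2)] by (simp add: right_diff_distrib)
  have "(\<lambda>k. (\<integral>x. \<zeta> x * V x \<partial>M) - (\<integral>x. \<zeta> x * (1 * (V x - Vk k x)) \<partial>M)) \<longlonglongrightarrow> (\<integral>x. \<zeta> x * V x \<partial>M) - 0"
    by (intro tendsto_diff tendsto_const small) auto
  thus "(\<lambda>k. \<integral>x. \<zeta> x * Vk k x \<partial>M) \<longlonglongrightarrow> (\<integral>x. \<zeta> x * V x \<partial>M)" unfolding e1 by simp
  have e2: "(\<integral>x. \<zeta> x * (Vk k x)\<^sup>2 \<partial>M) = (\<integral>x. \<zeta> x * (V x)\<^sup>2 \<partial>M) - 2 * (\<integral>x. \<zeta> x * (V x * (V x - Vk k x)) \<partial>M) + (\<integral>x. \<zeta> x * (V x - Vk k x)\<^sup>2 \<partial>M)" for k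
  proof -
    have i: "integrable M (\<lambda>x. V x * (V x - Vk k x))" by (intro integrable_mult_of_squares V2 D2) auto
    have "(\<integral>x. \<zeta> x * (Vk k x)\<^sup>2 \<partial>M) = (\<integral>x. \<zeta> x * (V x)\<^sup>2 - 2 * (\<zeta> x * (V x * (V x - Vk k x))) + \<zeta> x * (V x - Vk k x)\<^sup>2 \<partial>M)"
      by (intro Bochner_Integration.integral_cong refl) (simp add: power2_eq_square algebra_simps)
    also have "\<dots> = (\<integral>x. \<zeta> x * (V x)\<^sup>2 \<partial>M) - 2 * (\<integral>x. \<zeta> x * (V x * (V x - Vk k x)) \<partial>M) + (\<integral>x. \<zeta> x * (V x - Vk k x)\<^sup>2 \<partial>M)"
      using \<zeta>i[OF V2] \<zeta>i[OF i] \<zeta>i[OF D2[of k]]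
      by (subst Bochner_Integration.integral_add, simp, simp, subst Bochner_Integration.integral_diff) auto
    finally show ?thesis .
  qed
  have "(\<lambda>k. \<integral>x. \<zeta> x * (V x - Vk k x)\<^sup>2 \<partial>M) \<longlonglongrightarrow> 0"
  proof (rule Lim_null_comparison)
    have "(\<lambda>k. \<bar>c\<bar> * d k) \<longlonglongrightarrow> \<bar>c\<bar> * 0" by (intro tendsto_intros d)
    thus "(\<lambda>k. \<bar>c\<bar> * d k) \<longlonglongrightarrow> 0" by simp
    show "\<forall>\<^sub>F k in sequentially. norm (\<integral>x. \<zeta> x * (V x - Vk k x)\<^sup>2 \<partial>M) \<le> \<bar>c\<bar> * d k"
    proof (intro always_eventually allI)
      fix k
      have "norm (\<integral>x. \<zeta> x * (V x - Vk k x)\<^sup>2 \<partial>M) \<le> (\<integral>x. \<bar>c\<bar> * (V x - Vk k x)\<^sup>2 \<partial>M)"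
      proof (rule order_trans[OF integral_norm_bound integral_mono[OF integrable_norm[OF \<zeta>i[OF D2]] integrable_mult_right[OF D2]]])
        fix x assume "x \<in> space M"
        hence "\<bar>\<zeta> x\<bar> \<le> \<bar>c\<bar>" using c[of x] by linarith
        thus "norm (\<zeta> x * (V x - Vk k x)\<^sup>2) \<le> \<bar>c\<bar> * (V x - Vk k x)\<^sup>2"
          by (simp add: abs_mult mult_right_mono)
      qed
      thus "norm (\<integral>x. \<zeta> x * (V x - Vk k x)\<^sup>2 \<partial>M) \<le> \<bar>c\<bar> * d k" by (simp add: d_def)
    qed
  qed
  hence "(\<lambda>k. (\<integral>x. \<zeta> x * (V x)\<^sup>2 \<partial>M) - 2 * (\<integral>x. \<zeta> x * (V x * (V x - Vk k x)) \<partial>M) + (\<integral>x. \<zeta> x * (V x - Vk k x)\<^sup>2 \<partial>M)) \<longlonglongrightarrow>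
      (\<integral>x. \<zeta> x * (V x)\<^sup>2 \<partial>M) - 2 * 0 + 0"
    by (intro tendsto_add tendsto_diff tendsto_mult tendsto_const small V2) auto
  thus "(\<lambda>k. \<integral>x. \<zeta> x * (Vk k x)\<^sup>2 \<partial>M) \<longlonglongrightarrow> (\<integral>x. \<zeta> x * (V x)\<^sup>2 \<partial>M)" unfolding e2 by simp
qed

end

context filtered_prob_space
begin

lemma integrator_AE_cong:
  assumes X: "integrator M F X B" and X': "\<And>t. 0 \<le> t \<Longrightarrow> X' t \<in> borel_measurable M"
    and eq: "\<And>t. 0 \<le> t \<Longrightarrow> AE \<omega> in M. X t \<omega> = X' t \<omega>"
  shows "integrator M F X' B"
proof -
  interpret X: integrator M F X B by fact
  have D: "AE \<omega> in M. X r \<omega> - X s \<omega> = X' r \<omega> - X' s \<omega>" if "0 \<le> s" "s \<le> r" for s r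
    using eq[of s] eq[of r] that by auto
  show ?thesis
  proof
    show "X' t \<in> borel_measurable (F t)" if "0 \<le> t" for t
      using X.adapted[OF that] X'[OF that] eq[OF that] by (rule borel_measurable_F_AE_eq)
    note [measurable] = X' X.measurable_X
    fix s r :: real assume sr: "0 \<le> s" "s \<le> r"
    hence r: "0 \<le> r" by simp
    show "integrable M (\<lambda>\<omega>. (X' r \<omega> - X' s \<omega>)\<^sup>2)"
      using X.increment_sq_integrable[OF sr]
      by (rule integrable_cong_AE_imp) (use D[OF sr] sr r in auto)
    fix \<zeta> :: "'w \<Rightarrow> real" and c assume \<zeta>: "\<zeta> \<in> borel_measurable (F s)" "\<And>\<omega>. \<omega> \<in> space M \<Longrightarrow> \<bar>\<zeta> \<omega>\<bar> \<le> c"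
    have [measurable]: "\<zeta> \<in> borel_measurable M" using \<zeta>(1) by (rule borel_measurable_F_M)
    have "(\<integral>\<omega>. \<zeta> \<omega> * (X' r \<omega> - X' s \<omega>) \<partial>M) = (\<integral>\<omega>. \<zeta> \<omega> * (X r \<omega> - X s \<omega>) \<partial>M)"
      using D[OF sr] sr r by (intro integral_cong_AE) auto
    thus "(\<integral>\<omega>. \<zeta> \<omega> * (X' r \<omega> - X' s \<omega>) \<partial>M) = 0" using X.increment_mean[OF sr \<zeta>] by simp
    have "(\<integral>\<omega>. \<zeta> \<omega> * (X' r \<omega> - X' s \<omega>)\<^sup>2 \<partial>M) = (\<integral>\<omega>. \<zeta> \<omega> * (X r \<omega> - X s \<omega>)\<^sup>2 \<partial>M)"
      using D[OF sr] sr r by (intro integral_cong_AE) auto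
    thus "(\<integral>\<omega>. \<zeta> \<omega> * (X' r \<omega> - X' s \<omega>)\<^sup>2 \<partial>M) = B * (r - s) * (\<integral>\<omega>. \<zeta> \<omega> \<partial>M)"
      using X.increment_variance[OF sr \<zeta>] by simp
  qed (rule X.B_nonneg)
qed

text \<open>Both defining identities involve one bounded test variable at a time, so
  \<open>L2_limit\<close> applies to each separately and only the variance rates have to
  converge.\<close>

lemma integrator_limit:
  assumes X: "\<And>k. integrator M F (Xk k) (Bk k)" and B: "Bk \<longlonglongrightarrow> B"
    and Z: "\<And>t. 0 \<le> t \<Longrightarrow> Z t \<in> borel_measurable (F t)"
    and lim: "\<And>t. 0 \<le> t \<Longrightarrow> (\<lambda>k. \<integral>\<^sup>+\<omega>. ennreal ((Z t \<omega> - Xk k t \<omega>)\<^sup>2) \<partial>M) \<longlonglongrightarrow> 0"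
  shows "integrator M F Z B"
proof
  show "0 \<le> B" using B integrator.B_nonneg[OF X] by (intro LIMSEQ_le_const[OF B]) auto
  show "Z t \<in> borel_measurable (F t)" if "0 \<le> t" for t using Z[OF that] .
  fix s r :: real assume sr: "0 \<le> s" "s \<le> r"
  hence r: "0 \<le> r" by simp
  have [measurable]: "Z t \<in> borel_measurable M" "Xk k t \<in> borel_measurable M" if "0 \<le> t" for k t
    using Z[OF that] integrator.measurable_X[OF X that] borel_measurable_F_M by auto
  have D: "(\<lambda>k. \<integral>\<^sup>+\<omega>. ennreal (((Z r \<omega> - Z s \<omega>) - (Xk k r \<omega> - Xk k s \<omega>))\<^sup>2) \<partial>M) \<longlonglongrightarrow> 0"
  proof (rule tendsto_sandwich[OF _ _ tendsto_const])
    have "(\<lambda>k. 2 * (\<integral>\<^sup>+\<omega>. ennreal ((Z r \<omega> - Xk k r \<omega>)\<^sup>2) \<partial>M) + 2 * (\<integral>\<^sup>+\<omega>. ennreal ((Z s \<omega> - Xk k s \<omega>)\<^sup>2) \<partial>M)) \<longlonglongrightarrow> 2 * 0 + 2 * 0"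
      using lim[OF r] lim[OF sr(1)] by (intro tendsto_add ennreal_tendsto_cmult) auto
    thus "(\<lambda>k. 2 * (\<integral>\<^sup>+\<omega>. ennreal ((Z r \<omega> - Xk k r \<omega>)\<^sup>2) \<partial>M) + 2 * (\<integral>\<^sup>+\<omega>. ennreal ((Z s \<omega> - Xk k s \<omega>)\<^sup>2) \<partial>M)) \<longlonglongrightarrow> 0" by simp
    show "\<forall>\<^sub>F k in sequentially. (\<integral>\<^sup>+\<omega>. ennreal (((Z r \<omega> - Z s \<omega>) - (Xk k r \<omega> - Xk k s \<omega>))\<^sup>2) \<partial>M) \<le>
      2 * (\<integral>\<^sup>+\<omega>. ennreal ((Z r \<omega> - Xk k r \<omega>)\<^sup>2) \<partial>M) + 2 * (\<integral>\<^sup>+\<omega>. ennreal ((Z s \<omega> - Xk k s \<omega>)\<^sup>2) \<partial>M)"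
    proof (intro always_eventually allI)
      fix k
      have "(\<integral>\<^sup>+\<omega>. ennreal (((Z r \<omega> - Z s \<omega>) - (Xk k r \<omega> - Xk k s \<omega>))\<^sup>2) \<partial>M) \<le>
          (\<integral>\<^sup>+\<omega>. 2 * ennreal ((Z r \<omega> - Xk k r \<omega>)\<^sup>2) + 2 * ennreal ((Z s \<omega> - Xk k s \<omega>)\<^sup>2) \<partial>M)"
      proof (rule nn_integral_mono)
        fix \<omega>
        have "(Z r \<omega> - Z s \<omega>) - (Xk k r \<omega> - Xk k s \<omega>) = (Z r \<omega> - Xk k r \<omega>) + - (Z s \<omega> - Xk k s \<omega>)" by simp
        thus "ennreal (((Z r \<omega> - Z s \<omega>) - (Xk k r \<omega> - Xk k s \<omega>))\<^sup>2) \<le> 2 * ennreal ((Z r \<omega> - Xk k r \<omega>)\<^sup>2) + 2 * ennreal ((Z s \<omega> - Xk k s \<omega>)\<^sup>2)"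
          using ennreal_square_add_le[of "Z r \<omega> - Xk k r \<omega>" "- (Z s \<omega> - Xk k s \<omega>)"] by (simp only: power2_minus)
      qed
      also have "\<dots> = 2 * (\<integral>\<^sup>+\<omega>. ennreal ((Z r \<omega> - Xk k r \<omega>)\<^sup>2) \<partial>M) + 2 * (\<integral>\<^sup>+\<omega>. ennreal ((Z s \<omega> - Xk k s \<omega>)\<^sup>2) \<partial>M)"
        using sr r by (simp add: nn_integral_add nn_integral_cmult)
      finally show "(\<integral>\<^sup>+\<omega>. ennreal (((Z r \<omega> - Z s \<omega>) - (Xk k r \<omega> - Xk k s \<omega>))\<^sup>2) \<partial>M) \<le> \<dots>" .
    qed
  qed simp
  have m: "(\<lambda>\<omega>. Z r \<omega> - Z s \<omega>) \<in> borel_measurable M" "\<And>k. (\<lambda>\<omega>. Xk k r \<omega> - Xk k s \<omega>) \<in> borel_measurable M"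
    using sr r by auto
  note L = L2_limit[OF m integrator.increment_sq_integrable[OF X sr] D]
  show "integrable M (\<lambda>\<omega>. (Z r \<omega> - Z s \<omega>)\<^sup>2)" by (rule L(1))
  fix \<zeta> :: "'w \<Rightarrow> real" and c assume \<zeta>: "\<zeta> \<in> borel_measurable (F s)" "\<And>\<omega>. \<omega> \<in> space M \<Longrightarrow> \<bar>\<zeta> \<omega>\<bar> \<le> c"
  have \<zeta>M: "\<zeta> \<in> borel_measurable M" using \<zeta>(1) by (rule borel_measurable_F_M)
  have "(\<lambda>k. 0) \<longlonglongrightarrow> (\<integral>\<omega>. \<zeta> \<omega> * (Z r \<omega> - Z s \<omega>) \<partial>M)"
    using L(2)[OF \<zeta>M \<zeta>(2)] integrator.increment_mean[OF X sr \<zeta>] by simp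
  thus "(\<integral>\<omega>. \<zeta> \<omega> * (Z r \<omega> - Z s \<omega>) \<partial>M) = 0" by (simp add: LIMSEQ_const_iff)
  have "(\<lambda>k. Bk k * (r - s) * (\<integral>\<omega>. \<zeta> \<omega> \<partial>M)) \<longlonglongrightarrow> (\<integral>\<omega>. \<zeta> \<omega> * (Z r \<omega> - Z s \<omega>)\<^sup>2 \<partial>M)"
    using L(3)[OF \<zeta>M \<zeta>(2)] integrator.increment_variance[OF X sr \<zeta>] by simp
  moreover have "(\<lambda>k. Bk k * (r - s) * (\<integral>\<omega>. \<zeta> \<omega> \<partial>M)) \<longlonglongrightarrow> B * (r - s) * (\<integral>\<omega>. \<zeta> \<omega> \<partial>M)"
    by (intro tendsto_intros B)
  ultimately show "(\<integral>\<omega>. \<zeta> \<omega> * (Z r \<omega> - Z s \<omega>)\<^sup>2 \<partial>M) = B * (r - s) * (\<integral>\<omega>. \<zeta> \<omega> \<partial>M)"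
    by (rule LIMSEQ_unique)
qed

end

text \<open>An integrator starting at 0 is, up to time T, its own integral of the constant 1, so the
  maximal inequality for step integrals applies to it.\<close>

lemma (in continuous_integrator) psup_integrator_bound:
  assumes X0: "\<And>\<omega>. \<omega> \<in> space M \<Longrightarrow> X 0 \<omega> = 0" and T: "0 \<le> T"
  shows "(\<integral>\<^sup>+\<omega>. psup T (\<lambda>t. X t \<omega>) \<partial>M) \<le> ennreal (4 * B * T)"
proof -
  let ?S = "[(0, T, \<lambda>_. 1)] :: 'w step_process"
  have S: "nonanticipating_step M F ?S" using T by (auto simp: nonanticipating_step_def)
  have "(\<integral>\<^sup>+\<omega>. psup T (\<lambda>t. X t \<omega>) \<partial>M) = (\<integral>\<^sup>+\<omega>. psup T (\<lambda>t. step_integral X ?S t \<omega>) \<partial>M)"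
    using X0 by (intro nn_integral_cong psup_cong) (simp add: min_def)
  also have "\<dots> \<le> 4 * ennreal B * l2_dist T (step_value ?S) (\<lambda>_ _. 0)"
    by (rule step_integral_psup[OF S T])
  also have "l2_dist T (step_value ?S) (\<lambda>_ _. 0) \<le> (\<integral>\<^sup>+\<omega>. (\<integral>\<^sup>+s. indicator {0..T} s \<partial>lborel) \<partial>M)"
    unfolding l2_dist_def by (intro nn_integral_mono) (auto simp: indicator_def)
  also have "\<dots> = ennreal T" using T by (simp add: emeasure_space_1)
  finally have "(\<integral>\<^sup>+\<omega>. psup T (\<lambda>t. X t \<omega>) \<partial>M) \<le> 4 * ennreal B * ennreal T" by (simp add: mult_left_mono)
  also have "\<dots> = ennreal (4 * B * T)" using T B_nonneg by (simp add: ennreal_mult mult.assoc)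
  finally show ?thesis .
qed

section \<open>A continuous version of the noise\<close>

context brownian_family
begin

text \<open>One null set serves all sites because the lattice is countable.\<close>

lemma ex_exceptional_null_set:
  "\<exists>N\<in>null_sets M. \<forall>\<omega>\<in>space M - N. \<forall>z. continuous_on {0..} (\<lambda>t. w t z \<omega>) \<and> w 0 z \<omega> = 0"
proof -
  have "AE \<omega> in M. \<forall>z. continuous_on {0..} (\<lambda>t. w t z \<omega>) \<and> w 0 z \<omega> = 0"
    using standard by (subst AE_all_countable) (auto simp: standard_brownian_motion_def)
  then obtain N where "{\<omega> \<in> space M. \<not> (\<forall>z. continuous_on {0..} (\<lambda>t. w t z \<omega>) \<and> w 0 z \<omega> = 0)} \<subseteq> N" "N \<in> null_sets M"
    by (auto elim!: AE_E simp: null_sets_def)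
  thus ?thesis by (intro bexI[of _ N]) auto
qed

text \<open>The sites are enumerated and added in blocks with variance rates below 8^-k, so by the
  maximal inequality the partial sums converge uniformly on bounded time intervals. V is the
  mean-square limit of the same sums, hence agrees with Z almost surely at each fixed time.\<close>

lemma ex_continuous_noise:
  assumes c: "(\<lambda>z. (c z)\<^sup>2) summable_on UNIV"
    and V: "\<And>t. 0 \<le> t \<Longrightarrow> V t \<in> borel_measurable M"
    and lim: "\<And>t. 0 \<le> t \<Longrightarrow> ((\<lambda>S. \<integral>\<^sup>+\<omega>. ennreal ((V t \<omega> - (\<Sum>z\<in>S. c z * w t z \<omega>))\<^sup>2) \<partial>M) \<longlongrightarrow> 0) (finite_subsets_at_top UNIV)"
  shows "\<exists>Z. continuous_integrator M F Z (\<Sum>\<^sub>\<infinity>z. (c z)\<^sup>2) \<and> (\<forall>t\<ge>0. AE \<omega> in M. V t \<omega> = Z t \<omega>)"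
proof -
  obtain N where N: "N \<in> null_sets M" "\<And>\<omega> z. \<omega> \<in> space M - N \<Longrightarrow> continuous_on {0..} (\<lambda>t. w t z \<omega>)" "\<And>\<omega> z. \<omega> \<in> space M - N \<Longrightarrow> w 0 z \<omega> = 0"
    using ex_exceptional_null_set by blast
  \<comment> \<open>Setting the finite sums to 0 on the exceptional set makes their paths continuous
    for every \<omega>.\<close>
  define G where "G D t \<omega> = (if \<omega> \<in> N then 0 else finite_noise c D t \<omega>)" for D t \<omega>
  have AEN: "AE \<omega> in M. \<omega> \<notin> N" using N(1) by (rule AE_not_in)
  have G_meas: "G D t \<in> borel_measurable M" if "0 \<le> t" for D t
    unfolding G_def[abs_def] finite_noise_def using N(1) that by (intro measurable_If_set) auto
  have G: "continuous_integrator M F (G D) (\<Sum>z\<in>D. (c z)\<^sup>2)" if "finite D" for D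
  proof -
    have "integrator M F (G D) (\<Sum>z\<in>D. (c z)\<^sup>2)"
      using integrator_finite_noise[OF that] G_meas
      by (rule integrator_AE_cong) (use AEN in \<open>auto simp: G_def\<close>)
    moreover have "continuous_integrator_axioms M (G D)"
    proof
      fix \<omega> assume "\<omega> \<in> space M"
      thus "continuous_on {0..} (\<lambda>t. G D t \<omega>)"
        using N(2)[of \<omega>] by (cases "\<omega> \<in> N") (auto simp: G_def finite_noise_def intro!: continuous_on_sum continuous_on_mult continuous_on_const)
    qed
    ultimately show ?thesis by (simp add: continuous_integrator_def)
  qed
  have G0: "G D 0 \<omega> = 0" if "\<omega> \<in> space M" for D \<omega>
    using N(3)[of \<omega>] that by (auto simp: G_def finite_noise_def)
  have G_diff: "G D' t \<omega> - G D t \<omega> = G (D' - D) t \<omega>" if "finite D'" "D \<subseteq> D'" for D D' t \<omega>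
    using that by (simp add: G_def finite_noise_def sum_diff)
  define A where "A n = {z :: int ^ 'd. to_nat z < n}" for n
  have A_fin: "finite (A n)" for n
    unfolding A_def using finite_vimageI[OF finite_lessThan[of n] inj_to_nat] by (simp add: vimage_def)
  have A_lim: "filterlim A (finite_subsets_at_top UNIV) sequentially"
    unfolding filterlim_finite_subsets_at_top
  proof (intro allI impI)
    fix X :: "(int ^ 'd) set" assume X: "finite X \<and> X \<subseteq> UNIV"
    define n where "n = Suc (Max (insert 0 (to_nat ` X)))"
    have "X \<subseteq> A m" if "n \<le> m" for m
    proof
      fix z assume "z \<in> X"
      hence "to_nat z \<le> Max (insert 0 (to_nat ` X))" using X by (intro Max_ge) auto
      thus "z \<in> A m" using that by (simp add: A_def n_def)
    qed
    thus "\<forall>\<^sub>F m in sequentially. finite (A m) \<and> X \<subseteq> A m \<and> A m \<subseteq> UNIV"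
      using A_fin by (auto simp: eventually_sequentially)
  qed
  define tot where "tot = (\<Sum>\<^sub>\<infinity>z. (c z)\<^sup>2)"
  have "((\<lambda>z. (c z)\<^sup>2) has_sum tot) UNIV" unfolding tot_def using c by (rule has_sum_infsum)
  hence "(sum (\<lambda>z. (c z)\<^sup>2) \<longlongrightarrow> tot) (finite_subsets_at_top UNIV)" by (simp add: has_sum_def)
  from filterlim_compose[OF this A_lim] have s: "(\<lambda>n. \<Sum>z\<in>A n. (c z)\<^sup>2) \<longlonglongrightarrow> tot" .
  \<comment> \<open>Half of 8^-k, because the variance rate of a block is a difference of two
    partial sums, each compared with \<open>tot\<close>.\<close>
  have "\<exists>N. \<forall>n\<ge>N. dist (\<Sum>z\<in>A n. (c z)\<^sup>2) tot < (1/8) ^ k / 2" for k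
    using tendstoD[OF s, of "(1/8) ^ k / 2"] by (simp add: eventually_sequentially)
  then obtain Nk where Nk: "\<And>k n. Nk k \<le> n \<Longrightarrow> dist (\<Sum>z\<in>A n. (c z)\<^sup>2) tot < (1/8) ^ k / 2" by metis
  \<comment> \<open>Summing the thresholds makes the block ends increase, and the extra k drives
    them to infinity.\<close>
  define K where "K k = (\<Sum>j\<le>k. Nk j) + k" for k
  have K1: "Nk k \<le> K k" for k
    unfolding K_def by (rule trans_le_add1[OF member_le_sum]) auto
  have K2: "K k \<le> K (Suc k)" for k by (simp add: K_def)
  have K3: "filterlim K at_top sequentially"
    by (rule filterlim_at_top_mono[OF filterlim_ident]) (auto simp: K_def)
  define Y where "Y k = G (A (K k))" for k
  have AK: "A (K k) \<subseteq> A (K (Suc k))" for k using K2[of k] by (auto simp: A_def)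
  have Y_ci: "continuous_integrator M F (Y k) (\<Sum>z\<in>A (K k). (c z)\<^sup>2)" for k
    unfolding Y_def by (rule G[OF A_fin])
  have Y_ca: "continuous_adapted (Y k)" for k
    using continuous_integrator.continuous[OF Y_ci] integrator.adapted[OF continuous_integrator.axioms(1)[OF Y_ci]]
    by (auto simp: continuous_adapted_def)
  have incr: "(\<integral>\<^sup>+\<omega>. psup T (\<lambda>t. Y (Suc k) t \<omega> - Y k t \<omega>) \<partial>M) \<le> ennreal (4 * T * (1/8) ^ k)" if T: "0 \<le> T" for T k
  proof -
    let ?D = "A (K (Suc k)) - A (K k)"
    have "(\<integral>\<^sup>+\<omega>. psup T (\<lambda>t. Y (Suc k) t \<omega> - Y k t \<omega>) \<partial>M) = (\<integral>\<^sup>+\<omega>. psup T (\<lambda>t. G ?D t \<omega>) \<partial>M)"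
      unfolding Y_def by (simp only: G_diff[OF A_fin AK])
    also have "\<dots> \<le> ennreal (4 * (\<Sum>z\<in>?D. (c z)\<^sup>2) * T)"
      using A_fin by (intro continuous_integrator.psup_integrator_bound[OF G] G0 T) auto
    also have "\<dots> \<le> ennreal (4 * T * (1/8) ^ k)"
    proof (rule ennreal_leI)
      have "(\<Sum>z\<in>?D. (c z)\<^sup>2) = (\<Sum>z\<in>A (K (Suc k)). (c z)\<^sup>2) - (\<Sum>z\<in>A (K k). (c z)\<^sup>2)"
        using A_fin AK by (intro sum_diff) auto
      also have "\<dots> \<le> (1/8) ^ k"
        using Nk[OF K1[of k]] Nk[OF order_trans[OF K1[of k] K2[of k]]] unfolding dist_real_def by linarith
      finally have "4 * (\<Sum>z\<in>?D. (c z)\<^sup>2) * T \<le> 4 * (1/8) ^ k * T" using T by (intro mult_right_mono mult_left_mono) auto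
      thus "4 * (\<Sum>z\<in>?D. (c z)\<^sup>2) * T \<le> 4 * T * (1/8) ^ k" by (simp add: ac_simps)
    qed
    finally show ?thesis .
  qed
  have incr2: "2 ^ k * (\<integral>\<^sup>+\<omega>. psup T (\<lambda>t. Y (Suc (n + k)) t \<omega> - Y (n + k) t \<omega>) \<partial>M) \<le> ennreal (4 * T * (1/8) ^ n * (1/4) ^ k)"
    if T: "0 \<le> T" for T n k
  proof -
    have "2 ^ k * (\<integral>\<^sup>+\<omega>. psup T (\<lambda>t. Y (Suc (n + k)) t \<omega> - Y (n + k) t \<omega>) \<partial>M) \<le> 2 ^ k * ennreal (4 * T * (1/8) ^ (n + k))"
      by (intro mult_left_mono incr T) auto
    also have "\<dots> = ennreal (2 ^ k * (4 * T * (1/8) ^ (n + k)))"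
      using T by (subst ennreal_mult) (auto simp: ennreal_2_power)
    also have "2 ^ k * (4 * T * (1/8) ^ (n + k)) = 4 * T * (1/8) ^ n * (2 * (1/8)) ^ k"
      by (simp only: power_add power_mult_distrib) (simp add: ac_simps)
    finally show ?thesis by simp
  qed
  have fin: "(\<Sum>k. 2 ^ k * (\<integral>\<^sup>+\<omega>. psup T (\<lambda>t. Y (Suc k) t \<omega> - Y k t \<omega>) \<partial>M)) < \<top>" if T: "0 \<le> T" for T
  proof (rule suminf_geometric_finite[where N=0 and c="4 * T"])
    show le: "2 ^ k * (\<integral>\<^sup>+\<omega>. psup T (\<lambda>t. Y (Suc k) t \<omega> - Y k t \<omega>) \<partial>M) \<le> ennreal (4 * T * (1/4) ^ k)" for k
      using incr2[of T k 0] T by simp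
    show "2 ^ k * (\<integral>\<^sup>+\<omega>. psup T (\<lambda>t. Y (Suc k) t \<omega> - Y k t \<omega>) \<partial>M) < \<top>" for k
      by (rule le_less_trans[OF le]) simp
  qed (use T in simp)
  obtain Z where Z: "continuous_adapted Z" "\<And>T n. 0 \<le> T \<Longrightarrow> (\<integral>\<^sup>+\<omega>. psup T (\<lambda>t. Z t \<omega> - Y n t \<omega>) \<partial>M)
    \<le> 2 * (\<Sum>k. 2 ^ k * (\<integral>\<^sup>+\<omega>. psup T (\<lambda>t. Y (Suc (n + k)) t \<omega> - Y (n + k) t \<omega>) \<partial>M))"
    using ex_uniform_limit_process[of Y, OF Y_ca fin] by auto
  have ZY: "(\<lambda>n. \<integral>\<^sup>+\<omega>. ennreal ((Z t \<omega> - Y n t \<omega>)\<^sup>2) \<partial>M) \<longlonglongrightarrow> 0" if t: "0 \<le> t" for t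
  proof (rule tendsto_sandwich[OF _ _ tendsto_const])
    have "(\<lambda>n. 2 * ennreal (4 * t * (1 / (1 - 1/4)) * (1/8) ^ n)) \<longlonglongrightarrow> 2 * ennreal (4 * t * (1 / (1 - 1/4)) * 0)"
      by (intro ennreal_tendsto_cmult tendsto_ennrealI tendsto_mult tendsto_const LIMSEQ_power_zero) auto
    thus "(\<lambda>n. 2 * ennreal (4 * t * (1 / (1 - 1/4)) * (1/8) ^ n)) \<longlonglongrightarrow> 0" by simp
    show "\<forall>\<^sub>F n in sequentially. (\<integral>\<^sup>+\<omega>. ennreal ((Z t \<omega> - Y n t \<omega>)\<^sup>2) \<partial>M) \<le> 2 * ennreal (4 * t * (1 / (1 - 1/4)) * (1/8) ^ n)"
    proof (intro always_eventually allI)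
      fix n
      have "(\<integral>\<^sup>+\<omega>. ennreal ((Z t \<omega> - Y n t \<omega>)\<^sup>2) \<partial>M) \<le> (\<integral>\<^sup>+\<omega>. psup t (\<lambda>t. Z t \<omega> - Y n t \<omega>) \<partial>M)"
        using t by (intro nn_integral_mono psup_upper) auto
      also have "\<dots> \<le> 2 * (\<Sum>k. 2 ^ k * (\<integral>\<^sup>+\<omega>. psup t (\<lambda>t. Y (Suc (n + k)) t \<omega> - Y (n + k) t \<omega>) \<partial>M))"
        by (rule Z(2)[OF t])
      also have "\<dots> \<le> 2 * (\<Sum>k. ennreal (4 * t * (1/8) ^ n * (1/4) ^ k))"
        by (intro mult_left_mono suminf_le incr2 t) auto
      also have "(\<Sum>k. ennreal (4 * t * (1/8) ^ n * (1/4) ^ k)) = ennreal (4 * t * (1/8) ^ n * (1 / (1 - 1/4)))"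
        using t by (intro suminf_ennreal_eq sums_mult geometric_sums) auto
      finally show "(\<integral>\<^sup>+\<omega>. ennreal ((Z t \<omega> - Y n t \<omega>)\<^sup>2) \<partial>M) \<le> 2 * ennreal (4 * t * (1 / (1 - 1/4)) * (1/8) ^ n)"
        by (simp add: ac_simps)
    qed
  qed simp
  have "integrator M F Z tot"
  proof (rule integrator_limit)
    show "integrator M F (Y k) (\<Sum>z\<in>A (K k). (c z)\<^sup>2)" for k by (rule continuous_integrator.axioms(1)[OF Y_ci])
    show "(\<lambda>k. \<Sum>z\<in>A (K k). (c z)\<^sup>2) \<longlonglongrightarrow> tot" by (rule filterlim_compose[OF s K3])
    show "Z t \<in> borel_measurable (F t)" if "0 \<le> t" for t using Z(1) that by (simp add: continuous_adapted_def)
  qed (rule ZY)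
  moreover have "continuous_integrator_axioms M Z"
    by unfold_locales (use Z(1) in \<open>simp add: continuous_adapted_def\<close>)
  ultimately have "continuous_integrator M F Z tot" by (simp add: continuous_integrator_def)
  moreover have "AE \<omega> in M. V t \<omega> = Z t \<omega>" if t: "0 \<le> t" for t
  proof -
    note [measurable] = V[OF t] continuous_adapted_measurable[OF Z(1) t] continuous_adapted_measurable[OF Y_ca t]
    have VY: "(\<lambda>n. \<integral>\<^sup>+\<omega>. ennreal ((V t \<omega> - Y n t \<omega>)\<^sup>2) \<partial>M) \<longlonglongrightarrow> 0"
    proof -
      have "(\<lambda>n. \<integral>\<^sup>+\<omega>. ennreal ((V t \<omega> - (\<Sum>z\<in>A (K n). c z * w t z \<omega>))\<^sup>2) \<partial>M) \<longlonglongrightarrow> 0"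
        by (rule filterlim_compose[OF lim[OF t] filterlim_compose[OF A_lim K3]])
      moreover have "(\<integral>\<^sup>+\<omega>. ennreal ((V t \<omega> - (\<Sum>z\<in>A (K n). c z * w t z \<omega>))\<^sup>2) \<partial>M) = (\<integral>\<^sup>+\<omega>. ennreal ((V t \<omega> - Y n t \<omega>)\<^sup>2) \<partial>M)" for n
        using AEN by (intro nn_integral_cong_AE) (auto simp: Y_def G_def finite_noise_def)
      ultimately show ?thesis by simp
    qed
    have "(\<lambda>n. 2 * (\<integral>\<^sup>+\<omega>. ennreal ((V t \<omega> - Y n t \<omega>)\<^sup>2) \<partial>M) + 2 * (\<integral>\<^sup>+\<omega>. ennreal ((Z t \<omega> - Y n t \<omega>)\<^sup>2) \<partial>M)) \<longlonglongrightarrow> 2 * 0 + 2 * 0"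
      using VY ZY[OF t] by (intro tendsto_add ennreal_tendsto_cmult) auto
    moreover have "(\<integral>\<^sup>+\<omega>. ennreal ((V t \<omega> - Z t \<omega>)\<^sup>2) \<partial>M) \<le> 2 * (\<integral>\<^sup>+\<omega>. ennreal ((V t \<omega> - Y n t \<omega>)\<^sup>2) \<partial>M) + 2 * (\<integral>\<^sup>+\<omega>. ennreal ((Z t \<omega> - Y n t \<omega>)\<^sup>2) \<partial>M)" for n
    proof -
      have "(\<integral>\<^sup>+\<omega>. ennreal ((V t \<omega> - Z t \<omega>)\<^sup>2) \<partial>M) \<le> (\<integral>\<^sup>+\<omega>. 2 * ennreal ((V t \<omega> - Y n t \<omega>)\<^sup>2) + 2 * ennreal ((Z t \<omega> - Y n t \<omega>)\<^sup>2) \<partial>M)"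
        using ennreal_square_add_le[of "V t \<omega> - Y n t \<omega>" "Y n t \<omega> - Z t \<omega>" for \<omega>]
        by (intro nn_integral_mono) (simp add: power2_commute[of "Y n t _"])
      also have "\<dots> = 2 * (\<integral>\<^sup>+\<omega>. ennreal ((V t \<omega> - Y n t \<omega>)\<^sup>2) \<partial>M) + 2 * (\<integral>\<^sup>+\<omega>. ennreal ((Z t \<omega> - Y n t \<omega>)\<^sup>2) \<partial>M)"
        by (simp add: nn_integral_add nn_integral_cmult)
      finally show ?thesis .
    qed
    ultimately have "(\<integral>\<^sup>+\<omega>. ennreal ((V t \<omega> - Z t \<omega>)\<^sup>2) \<partial>M) \<le> 2 * 0 + 2 * 0"
      using LIMSEQ_le_const by blast
    hence "AE \<omega> in M. ennreal ((V t \<omega> - Z t \<omega>)\<^sup>2) = 0"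
      by (subst nn_integral_0_iff_AE[symmetric]) auto
    thus ?thesis by eventually_elim (simp add: ennreal_eq_0_iff)
  qed
  ultimately show ?thesis unfolding tot_def by blast
qed

end

section \<open>Paths in the weighted space\<close>

lemma nn_integral_swap_countable:
  fixes f :: "'i::countable \<Rightarrow> 'a \<Rightarrow> ennreal"
  assumes N: "sigma_finite_measure N" and f: "\<And>x. f x \<in> borel_measurable N"
  shows "(\<integral>\<^sup>+\<omega>. \<integral>\<^sup>+x. f x \<omega> \<partial>count_space UNIV \<partial>N) = (\<integral>\<^sup>+x. \<integral>\<^sup>+\<omega>. f x \<omega> \<partial>N \<partial>count_space UNIV)"
proof -
  interpret N: sigma_finite_measure N by fact
  interpret C: sigma_finite_measure "count_space (UNIV :: 'i set)" by (rule sigma_finite_measure_count_space)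
  interpret P: pair_sigma_finite "count_space (UNIV :: 'i set)" N ..
  have "(\<lambda>(x, \<omega>). f x \<omega>) \<in> borel_measurable (count_space UNIV \<Otimes>\<^sub>M N)"
    using f by (intro measurable_pair_measure_countable1) auto
  from P.Fubini'[OF this] show ?thesis .
qed

lemma borel_measurable_nn_integral_countable:
  fixes f :: "'i::countable \<Rightarrow> 'a \<Rightarrow> ennreal"
  assumes f: "\<And>x. f x \<in> borel_measurable N"
  shows "(\<lambda>\<omega>. \<integral>\<^sup>+x. f x \<omega> \<partial>count_space UNIV) \<in> borel_measurable N"
proof -
  interpret C: sigma_finite_measure "count_space (UNIV :: 'i set)" by (rule sigma_finite_measure_count_space)
  have "(\<lambda>x. case x of (\<omega>, i) \<Rightarrow> f i \<omega>) \<in> borel_measurable (N \<Otimes>\<^sub>M count_space UNIV)"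
    using measurable_pair_swap[OF measurable_pair_measure_countable1[of UNIV "\<lambda>(i, \<omega>). f i \<omega>" N borel]] f
    by simp
  from C.borel_measurable_nn_integral[OF this] show ?thesis by simp
qed

lemma borel_measurable_integral_countable:
  fixes f :: "'i::countable \<Rightarrow> 'a \<Rightarrow> real"
  assumes f: "\<And>x. f x \<in> borel_measurable N"
  shows "(\<lambda>\<omega>. \<integral>x. f x \<omega> \<partial>count_space UNIV) \<in> borel_measurable N"
proof -
  interpret C: sigma_finite_measure "count_space (UNIV :: 'i set)" by (rule sigma_finite_measure_count_space)
  have "(\<lambda>x. case x of (\<omega>, i) \<Rightarrow> f i \<omega>) \<in> borel_measurable (N \<Otimes>\<^sub>M count_space UNIV)"
    using measurable_pair_swap[OF measurable_pair_measure_countable1[of UNIV "\<lambda>(i, \<omega>). f i \<omega>" N borel]] f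
    by simp
  from C.borel_measurable_lebesgue_integral[OF this] show ?thesis by simp
qed

text \<open>Each integration raises the power of t and supplies the next factor of the factorial.
  Existence uses this with g the successive Picard differences, uniqueness with the same function at
  every stage.\<close>

lemma iterated_integral_bound:
  fixes g :: "nat \<Rightarrow> real \<Rightarrow> ennreal"
  assumes C: "0 \<le> C" and c: "0 \<le> c"
    and g0: "\<And>t. 0 \<le> t \<Longrightarrow> t \<le> T \<Longrightarrow> g 0 t \<le> ennreal c"
    and gS: "\<And>n t. 0 \<le> t \<Longrightarrow> t \<le> T \<Longrightarrow> g (Suc n) t \<le> ennreal C * (\<integral>\<^sup>+s\<in>{0..t}. g n s \<partial>lborel)"
  shows "0 \<le> t \<Longrightarrow> t \<le> T \<Longrightarrow> g n t \<le> ennreal (c * (C * t) ^ n / fact n)"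
proof (induction n arbitrary: t)
  case (Suc n)
  have "g (Suc n) t \<le> ennreal C * (\<integral>\<^sup>+s\<in>{0..t}. g n s \<partial>lborel)" by (rule gS[OF Suc.prems])
  also have "(\<integral>\<^sup>+s\<in>{0..t}. g n s \<partial>lborel) \<le> (\<integral>\<^sup>+s. ennreal (c * (C * s) ^ n / fact n) * indicator {0..t} s \<partial>lborel)"
    using Suc by (intro nn_integral_mono) (auto simp: indicator_def)
  also have "\<dots> = ennreal (c * C ^ n * t ^ Suc n / fact (Suc n) - c * C ^ n * 0 ^ Suc n / fact (Suc n))"
  proof (rule nn_integral_FTC_Icc[where F="\<lambda>t. c * C ^ n * t ^ Suc n / fact (Suc n)"])
    fix s :: real assume "s \<in> {0..t}"
    hence s: "0 \<le> s" by simp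
    have "((\<lambda>t. c * C ^ n * t ^ Suc n / fact (Suc n)) has_real_derivative (c * C ^ n * (real (Suc n) * s ^ n) / fact (Suc n))) (at s)"
      by (rule derivative_eq_intros refl | simp)+
    also have "c * C ^ n * (real (Suc n) * s ^ n) / fact (Suc n) = c * (C * s) ^ n / fact n"
      by (simp add: power_mult_distrib field_simps del: of_nat_Suc)
    finally show "((\<lambda>t. c * C ^ n * t ^ Suc n / fact (Suc n)) has_real_derivative c * (C * s) ^ n / fact n) (at s)" .
    show "0 \<le> c * (C * s) ^ n / fact n" using C c s by simp
  qed (use Suc.prems in auto)
  finally have "g (Suc n) t \<le> ennreal C * ennreal (c * C ^ n * t ^ Suc n / fact (Suc n))"
    by (simp add: mult_left_mono)
  also have "\<dots> = ennreal (c * (C * t) ^ Suc n / fact (Suc n))"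
    using C c Suc.prems by (subst ennreal_mult[symmetric]) (auto simp: power_mult_distrib ac_simps)
  finally show ?case .
qed (use g0 in simp)

lemma continuous_on_lborel_integral:
  fixes g :: "real \<Rightarrow> real"
  assumes g: "continuous_on {0..} g"
  shows "continuous_on {0..} (\<lambda>t. LINT s:{0..t}|lborel. g s)"
proof (rule continuous_on_atLeast_0)
  fix n :: nat
  have sub: "continuous_on {0..t} g" for t by (rule continuous_on_subset[OF g]) auto
  have "continuous_on {0..real n} (\<lambda>t. integral {0..t} g)"
    by (rule indefinite_integral_continuous_1[OF integrable_continuous_real[OF sub]])
  moreover have "(LINT s:{0..t}|lborel. g s) = integral {0..t} g" for t
    by (rule set_borel_integral_eq_integral(2)[OF borel_integrable_atLeastAtMost'[OF sub]])
  ultimately show "continuous_on {0..real n} (\<lambda>t. LINT s:{0..t}|lborel. g s)" by simp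
qed

lemma square_lborel_integral_le:
  fixes g :: "real \<Rightarrow> real"
  assumes g: "continuous_on {0..} g" and t: "0 \<le> t"
  shows "ennreal ((LINT s:{0..t}|lborel. g s)\<^sup>2) \<le> ennreal t * (\<integral>\<^sup>+s\<in>{0..t}. ennreal ((g s)\<^sup>2) \<partial>lborel)"
proof -
  have sub: "continuous_on {0..t} g" by (rule continuous_on_subset[OF g]) auto
  have int: "integrable lborel (\<lambda>s. indicator {0..t} s *\<^sub>R g s)"
    using borel_integrable_atLeastAtMost'[OF sub] by (simp add: set_integrable_def)
  hence m[measurable]: "(\<lambda>s. indicator {0..t} s *\<^sub>R g s) \<in> borel_measurable lborel" by (rule borel_measurable_integrable)
  have [measurable]: "(\<lambda>s. indicator {0..t} s * g s) \<in> borel_measurable borel" using m by simp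
  have "ennreal (norm (LINT s:{0..t}|lborel. g s)) \<le> (\<integral>\<^sup>+s. ennreal (norm (indicator {0..t} s *\<^sub>R g s)) \<partial>lborel)"
    unfolding set_lebesgue_integral_def by (rule integral_norm_bound_ennreal[OF int])
  also have "\<dots> = (\<integral>\<^sup>+s. indicator {0..t} s * ennreal (norm (indicator {0..t} s *\<^sub>R g s)) \<partial>lborel)"
    by (intro nn_integral_cong) (auto simp: indicator_def)
  finally have "(ennreal (norm (LINT s:{0..t}|lborel. g s)))\<^sup>2 \<le> (\<integral>\<^sup>+s. indicator {0..t} s * ennreal (norm (indicator {0..t} s *\<^sub>R g s)) \<partial>lborel)\<^sup>2"
    by (intro power_mono) auto
  also have "\<dots> \<le> (\<integral>\<^sup>+s. (indicator {0..t} s)\<^sup>2 \<partial>lborel) * (\<integral>\<^sup>+s. (ennreal (norm (indicator {0..t} s *\<^sub>R g s)))\<^sup>2 \<partial>lborel)"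
    by (intro Cauchy_Schwarz_nn_integral) auto
  also have "(\<integral>\<^sup>+s. (indicator {0..t} s)\<^sup>2 \<partial>lborel) = (\<integral>\<^sup>+s. indicator {0..t} s \<partial>lborel)"
    by (intro nn_integral_cong) (auto simp: indicator_def)
  also have "\<dots> = ennreal t" using t by simp
  also have "(\<integral>\<^sup>+s. (ennreal (norm (indicator {0..t} s *\<^sub>R g s)))\<^sup>2 \<partial>lborel) = (\<integral>\<^sup>+s\<in>{0..t}. ennreal ((g s)\<^sup>2) \<partial>lborel)"
    by (intro nn_integral_cong) (auto simp: indicator_def ennreal_power)
  finally show ?thesis by (simp add: ennreal_power)
qed

section \<open>Paths that are continuous in the weighted norm, and the drift\<close>

context bounded_generator
begin

definition l2_continuous :: "(real \<Rightarrow> int ^ 'd \<Rightarrow> real) \<Rightarrow> bool" where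
  "l2_continuous f \<longleftrightarrow> (\<forall>t\<ge>0. f t \<in> l2w \<mu>) \<and>
    (\<forall>t\<ge>0. ((\<lambda>s. nsq \<mu> (\<lambda>x. f s x - f t x)) \<longlongrightarrow> 0) (at t within {0..}))"

lemma l2_continuous_iff_norm:
  assumes "\<And>t. 0 \<le> t \<Longrightarrow> f t \<in> l2w \<mu>"
  shows "l2_continuous f \<longleftrightarrow> (\<forall>t\<ge>0. ((\<lambda>s. l2w_norm \<mu> (\<lambda>x. f s x - f t x)) \<longlongrightarrow> 0) (at t within {0..}))"
proof -
  have "((\<lambda>s. nsq \<mu> (\<lambda>x. f s x - f t x)) \<longlongrightarrow> 0) (at t within {0..}) \<longleftrightarrow>
    ((\<lambda>s. l2w_norm \<mu> (\<lambda>x. f s x - f t x)) \<longlongrightarrow> 0) (at t within {0..})" if t: "0 \<le> t" for t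
  proof -
    let ?n = "\<lambda>s. l2w_norm \<mu> (\<lambda>x. f s x - f t x)"
    have "\<forall>\<^sub>F s in at t within {0..}. ennreal ((?n s)\<^sup>2) = nsq \<mu> (\<lambda>x. f s x - f t x)"
      unfolding eventually_at_filter
      by (intro always_eventually allI impI ennreal_l2w_norm_sq mu_nonneg l2w_diff assms t) auto
    hence "((\<lambda>s. nsq \<mu> (\<lambda>x. f s x - f t x)) \<longlongrightarrow> 0) (at t within {0..}) \<longleftrightarrow>
        ((\<lambda>s. ennreal ((?n s)\<^sup>2)) \<longlongrightarrow> 0) (at t within {0..})"
      by (intro tendsto_cong) (auto elim: eventually_mono)
    also have "\<dots> \<longleftrightarrow> ((\<lambda>s. (?n s)\<^sup>2) \<longlongrightarrow> 0) (at t within {0..})"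
      using tendsto_ennrealI[of "\<lambda>s. (?n s)\<^sup>2" 0] tendsto_ennrealD[of "\<lambda>s. (?n s)\<^sup>2" 0] by auto
    also have "\<dots> \<longleftrightarrow> (?n \<longlongrightarrow> 0) (at t within {0..})"
    proof
      assume "((\<lambda>s. (?n s)\<^sup>2) \<longlongrightarrow> 0) (at t within {0..})"
      from tendsto_real_sqrt[OF this] show "(?n \<longlongrightarrow> 0) (at t within {0..})"
        by (simp add: l2w_norm_nonneg mu_nonneg)
    next
      assume "(?n \<longlongrightarrow> 0) (at t within {0..})"
      from tendsto_power[OF this, of 2] show "((\<lambda>s. (?n s)\<^sup>2) \<longlongrightarrow> 0) (at t within {0..})" by simp
    qed
    finally show ?thesis .
  qed
  thus ?thesis using assms by (simp add: l2_continuous_def)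
qed

lemma square_le_nsq: "ennreal (\<mu> x * (f x)\<^sup>2) \<le> nsq \<mu> f"
  unfolding nsq_def by (rule nn_integral_ge_point) simp

lemma l2_continuous_coordinate:
  assumes f: "l2_continuous f" shows "continuous_on {0..} (\<lambda>t. f t x)"
  unfolding continuous_on_def
proof
  fix t :: real assume "t \<in> {0..}"
  hence lim: "((\<lambda>s. nsq \<mu> (\<lambda>x. f s x - f t x)) \<longlongrightarrow> 0) (at t within {0..})"
    using f by (simp add: l2_continuous_def)
  have "((\<lambda>s. ennreal (\<mu> x * (f s x - f t x)\<^sup>2)) \<longlongrightarrow> 0) (at t within {0..})"
    by (rule tendsto_sandwich[OF _ _ tendsto_const lim]) (auto intro!: always_eventually square_le_nsq)
  hence "((\<lambda>s. ennreal (\<mu> x * (f s x - f t x)\<^sup>2)) \<longlongrightarrow> ennreal 0) (at t within {0..})" by simp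
  hence "((\<lambda>s. \<mu> x * (f s x - f t x)\<^sup>2) \<longlongrightarrow> 0) (at t within {0..})"
    by (rule tendsto_ennrealD) (auto intro!: always_eventually mult_nonneg_nonneg mu_nonneg)
  from tendsto_mult[OF tendsto_const[of "1 / \<mu> x"] this]
  have "((\<lambda>s. (f s x - f t x)\<^sup>2) \<longlongrightarrow> 0) (at t within {0..})"
    using mu_pos[of x] by simp
  from tendsto_real_sqrt[OF this] have "((\<lambda>s. \<bar>f s x - f t x\<bar>) \<longlongrightarrow> 0) (at t within {0..})" by simp
  hence "((\<lambda>s. f s x - f t x) \<longlongrightarrow> 0) (at t within {0..})" by (rule tendsto_rabs_zero_cancel)
  thus "((\<lambda>s. f s x) \<longlongrightarrow> f t x) (at t within {0..})" by (simp add: LIM_zero_iff)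
qed

lemma l2_continuous_generator:
  assumes f: "l2_continuous f" shows "l2_continuous (\<lambda>t. generator a (f t))"
  unfolding l2_continuous_def
proof (intro conjI allI impI)
  have mem: "f t \<in> l2w \<mu>" if "0 \<le> t" for t using f that by (simp add: l2_continuous_def)
  fix t :: real assume t: "0 \<le> t"
  show "generator a (f t) \<in> l2w \<mu>" by (rule generator_l2w[OF mem[OF t]])
  have lim: "((\<lambda>s. nsq \<mu> (\<lambda>x. f s x - f t x)) \<longlongrightarrow> 0) (at t within {0..})"
    using f t by (simp add: l2_continuous_def)
  have "((\<lambda>s. (2 * K + 2) * nsq \<mu> (\<lambda>x. f s x - f t x)) \<longlongrightarrow> (2 * K + 2) * 0) (at t within {0..})"
    using K_finite by (intro ennreal_tendsto_cmult lim) (simp add: ennreal_mult_less_top)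
  hence up: "((\<lambda>s. (2 * K + 2) * nsq \<mu> (\<lambda>x. f s x - f t x)) \<longlongrightarrow> 0) (at t within {0..})" by simp
  show "((\<lambda>s. nsq \<mu> (\<lambda>x. generator a (f s) x - generator a (f t) x)) \<longlongrightarrow> 0) (at t within {0..})"
  proof (rule tendsto_sandwich[OF _ _ tendsto_const up])
    show "\<forall>\<^sub>F s in at t within {0..}. nsq \<mu> (\<lambda>x. generator a (f s) x - generator a (f t) x) \<le> (2 * K + 2) * nsq \<mu> (\<lambda>x. f s x - f t x)"
      unfolding eventually_at_filter
    proof (intro always_eventually allI impI)
      fix s :: real assume "s \<in> {0..}"
      hence s: "0 \<le> s" by simp
      have "(\<lambda>x. generator a (f s) x - generator a (f t) x) = generator a (\<lambda>x. f s x - f t x)"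
        using generator_diff[OF mem[OF s] mem[OF t]] by auto
      thus "nsq \<mu> (\<lambda>x. generator a (f s) x - generator a (f t) x) \<le> (2 * K + 2) * nsq \<mu> (\<lambda>x. f s x - f t x)"
        using nsq_generator[OF l2w_diff[OF mu_nonneg mem[OF s] mem[OF t]]] by simp
    qed
  qed simp
qed

lemma l2_continuous_diff:
  assumes f: "l2_continuous f" and g: "l2_continuous g"
  shows "l2_continuous (\<lambda>t x. f t x - g t x)"
  unfolding l2_continuous_def
proof (intro conjI allI impI)
  fix t :: real assume t: "0 \<le> t"
  show "(\<lambda>x. f t x - g t x) \<in> l2w \<mu>"
    using f g t by (intro l2w_diff mu_nonneg) (auto simp: l2_continuous_def)
  have "((\<lambda>s. 2 * nsq \<mu> (\<lambda>x. f s x - f t x) + 2 * nsq \<mu> (\<lambda>x. g s x - g t x)) \<longlongrightarrow> 2 * 0 + 2 * 0) (at t within {0..})"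
    using f g t by (intro tendsto_add ennreal_tendsto_cmult) (auto simp: l2_continuous_def)
  hence up: "((\<lambda>s. 2 * nsq \<mu> (\<lambda>x. f s x - f t x) + 2 * nsq \<mu> (\<lambda>x. g s x - g t x)) \<longlongrightarrow> 0) (at t within {0..})" by simp
  show "((\<lambda>s. nsq \<mu> (\<lambda>x. f s x - g s x - (f t x - g t x))) \<longlongrightarrow> 0) (at t within {0..})"
  proof (rule tendsto_sandwich[OF _ _ tendsto_const up])
    have "nsq \<mu> (\<lambda>x. f s x - g s x - (f t x - g t x)) \<le> 2 * nsq \<mu> (\<lambda>x. f s x - f t x) + 2 * nsq \<mu> (\<lambda>x. g s x - g t x)" for s
      using nsq_diff_le[where \<mu>=\<mu> and f="\<lambda>x. f s x - f t x" and g="\<lambda>x. g s x - g t x", OF mu_nonneg]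
      by (simp add: algebra_simps)
    thus "\<forall>\<^sub>F s in at t within {0..}. nsq \<mu> (\<lambda>x. f s x - g s x - (f t x - g t x)) \<le> 2 * nsq \<mu> (\<lambda>x. f s x - f t x) + 2 * nsq \<mu> (\<lambda>x. g s x - g t x)"
      by (intro always_eventually) auto
  qed simp
qed

text \<open>Otherwise times with ever larger norm would have a convergent subsequence, contradicting
  continuity at its limit. For uniqueness this provides, for each path, a truncation level that is
  not reached before T.\<close>

lemma l2_continuous_bounded:
  assumes f: "l2_continuous f"
  shows "\<exists>n::nat. \<forall>s\<in>{0..T}. nsq \<mu> (f s) \<le> of_nat n"
proof (rule ccontr)
  assume "\<not> ?thesis"
  hence "\<forall>n::nat. \<exists>s\<in>{0..T}. of_nat n < nsq \<mu> (f s)" by (simp add: not_le)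
  then obtain s where s: "\<And>n. s n \<in> {0..T}" "\<And>n::nat. of_nat n < nsq \<mu> (f (s n))" by metis
  have "seq_compact {0..T}" by (simp add: compact_imp_seq_compact)
  then obtain l r where l: "l \<in> {0..T}" "strict_mono r" "(s \<circ> r) \<longlonglongrightarrow> l"
    using s(1) unfolding seq_compact_def by blast
  have l0: "0 \<le> l" using l(1) by simp
  have "((\<lambda>s. nsq \<mu> (\<lambda>x. f s x - f l x)) \<longlongrightarrow> nsq \<mu> (\<lambda>x. f l x - f l x)) (at l within {0..})"
    using f l0 by (simp add: l2_continuous_def nsq_def)
  hence "continuous (at l within {0..}) (\<lambda>s. nsq \<mu> (\<lambda>x. f s x - f l x))"
    by (simp add: continuous_within)
  hence "(\<lambda>n. nsq \<mu> (\<lambda>x. f ((s \<circ> r) n) x - f l x)) \<longlonglongrightarrow> nsq \<mu> (\<lambda>x. f l x - f l x)"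
    by (rule continuous_within_tendsto_compose'[OF _ _ l(3)]) (use s(1) in auto)
  hence "(\<lambda>n. nsq \<mu> (\<lambda>x. f (s (r n)) x - f l x)) \<longlonglongrightarrow> 0" by (simp add: nsq_def)
  hence "\<forall>\<^sub>F n in sequentially. nsq \<mu> (\<lambda>x. f (s (r n)) x - f l x) < 1" by (rule order_tendstoD) simp
  then obtain N where N: "\<And>n. N \<le> n \<Longrightarrow> nsq \<mu> (\<lambda>x. f (s (r n)) x - f l x) < 1"
    by (auto simp: eventually_sequentially)
  have fin: "nsq \<mu> (f l) < \<top>" using f l0 by (simp add: l2_continuous_def l2w_iff_nsq mu_nonneg)
  then obtain m :: nat where m: "2 + 2 * nsq \<mu> (f l) < of_nat m"
  proof -
    have "2 + 2 * nsq \<mu> (f l) < \<top>" using fin by (simp add: ennreal_mult_less_top)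
    thus ?thesis using that ennreal_Ex_less_of_nat by blast
  qed
  define n where "n = max N m"
  have "of_nat m \<le> (of_nat (r n) :: ennreal)"
    using seq_suble[OF l(2), of n] by (simp add: n_def)
  also have "\<dots> < nsq \<mu> (f (s (r n)))" by (rule s(2))
  also have "\<dots> = nsq \<mu> (\<lambda>x. (f (s (r n)) x - f l x) + f l x)" by simp
  also have "\<dots> \<le> 2 * nsq \<mu> (\<lambda>x. f (s (r n)) x - f l x) + 2 * nsq \<mu> (f l)"
    by (rule nsq_add_le[OF mu_nonneg])
  also have "\<dots> \<le> 2 * 1 + 2 * nsq \<mu> (f l)"
    using N[of n] by (intro add_right_mono mult_left_mono) (auto simp: n_def less_imp_le)
  also have "\<dots> < of_nat m" using m by simp
  finally show False .
qed

text \<open>The supremum is taken at each site before summation, which majorizes the supremum of the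
  squared norm. Expectations then split into one-site expectations, where the maximal inequality
  applies, and a majorant for dominated convergence over the sites is at hand.\<close>

definition weighted_sup :: "real \<Rightarrow> (real \<Rightarrow> int ^ 'd \<Rightarrow> real) \<Rightarrow> ennreal" where
  "weighted_sup T f = (\<integral>\<^sup>+x. ennreal (\<mu> x) * psup T (\<lambda>t. f t x) \<partial>count_space UNIV)"

lemma weighted_sup_mono: "T \<le> T' \<Longrightarrow> weighted_sup T f \<le> weighted_sup T' f"
  unfolding weighted_sup_def by (intro nn_integral_mono mult_left_mono psup_mono) auto

lemma nsq_le_weighted_sup: "0 \<le> t \<Longrightarrow> t \<le> T \<Longrightarrow> nsq \<mu> (f t) \<le> weighted_sup T f"
  unfolding weighted_sup_def nsq_def
  by (intro nn_integral_mono) (auto simp: ennreal_mult mu_nonneg intro!: mult_left_mono psup_upper)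

lemma weighted_sup_add_le:
  "weighted_sup T (\<lambda>t x. f t x + g t x) \<le> 2 * weighted_sup T f + 2 * weighted_sup T g"
proof -
  have "weighted_sup T (\<lambda>t x. f t x + g t x) \<le>
      (\<integral>\<^sup>+x. 2 * (ennreal (\<mu> x) * psup T (\<lambda>t. f t x)) + 2 * (ennreal (\<mu> x) * psup T (\<lambda>t. g t x)) \<partial>count_space UNIV)"
    unfolding weighted_sup_def
  proof (rule nn_integral_mono)
    fix x
    have "ennreal (\<mu> x) * psup T (\<lambda>t. f t x + g t x) \<le> ennreal (\<mu> x) * (2 * psup T (\<lambda>t. f t x) + 2 * psup T (\<lambda>t. g t x))"
      by (intro mult_left_mono psup_add_le) auto
    thus "ennreal (\<mu> x) * psup T (\<lambda>t. f t x + g t x) \<le> 2 * (ennreal (\<mu> x) * psup T (\<lambda>t. f t x)) + 2 * (ennreal (\<mu> x) * psup T (\<lambda>t. g t x))"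
      by (simp add: distrib_left mult.left_commute)
  qed
  also have "\<dots> = 2 * weighted_sup T f + 2 * weighted_sup T g"
    by (simp add: weighted_sup_def nn_integral_add nn_integral_cmult)
  finally show ?thesis .
qed

lemma weighted_sup_uminus: "weighted_sup T (\<lambda>t x. - f t x) = weighted_sup T f"
  by (simp add: weighted_sup_def psup_def)

lemma weighted_sup_diff_le:
  "weighted_sup T (\<lambda>t x. f t x - g t x) \<le> 2 * weighted_sup T f + 2 * weighted_sup T g"
  using weighted_sup_add_le[of T f "\<lambda>t x. - g t x"] by (simp add: weighted_sup_uminus)

text \<open>Continuity at every site becomes continuity in norm by dominated convergence over the
  sites. The horizon t + 1 covers all times near t.\<close>

lemma l2_continuous_of_weighted_sup:
  assumes cont: "\<And>x. continuous_on {0..} (\<lambda>t. f t x)" and fin: "\<And>T. 0 \<le> T \<Longrightarrow> weighted_sup T f < \<top>"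
  shows "l2_continuous f"
  unfolding l2_continuous_def
proof (intro conjI allI impI)
  fix t :: real assume t: "0 \<le> t"
  show "f t \<in> l2w \<mu>"
    unfolding l2w_iff_nsq[OF mu_nonneg] using nsq_le_weighted_sup[OF t order_refl] fin[OF t] by (rule le_less_trans)
  show "((\<lambda>s. nsq \<mu> (\<lambda>x. f s x - f t x)) \<longlongrightarrow> 0) (at t within {0..})"
    unfolding tendsto_at_iff_sequentially
  proof (intro allI impI)
    fix s assume s: "\<forall>i. s i \<in> {0..} - {t}" and lim: "s \<longlonglongrightarrow> t"
    have "\<forall>\<^sub>F n in sequentially. s n < t + 1" using lim by (rule order_tendstoD) simp
    then obtain N where N: "\<And>n. N \<le> n \<Longrightarrow> s n < t + 1" by (auto simp: eventually_sequentially)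
    have "(\<lambda>n. \<integral>\<^sup>+x. ennreal (\<mu> x * (f (s (n + N)) x - f t x)\<^sup>2) \<partial>count_space UNIV) \<longlonglongrightarrow> (\<integral>\<^sup>+x. 0 \<partial>count_space (UNIV :: (int ^ 'd) set))"
    proof (rule nn_integral_dominated_convergence[where w="\<lambda>x. 4 * (ennreal (\<mu> x) * psup (t + 1) (\<lambda>t. f t x))"])
      show "AE x in count_space UNIV. ennreal (\<mu> x * (f (s (n + N)) x - f t x)\<^sup>2) \<le> 4 * (ennreal (\<mu> x) * psup (t + 1) (\<lambda>t. f t x))" for n
      proof (rule AE_I2)
        fix x
        have "ennreal ((f (s (n + N)) x - f t x)\<^sup>2) \<le> 2 * ennreal ((f (s (n + N)) x)\<^sup>2) + 2 * ennreal ((f t x)\<^sup>2)"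
          using ennreal_square_add_le[of "f (s (n + N)) x" "- f t x"] by simp
        also have "\<dots> \<le> 2 * psup (t + 1) (\<lambda>t. f t x) + 2 * psup (t + 1) (\<lambda>t. f t x)"
          using s t N[of "n + N"] by (intro add_mono mult_left_mono psup_upper) (auto simp: less_imp_le)
        also have "\<dots> = 4 * psup (t + 1) (\<lambda>t. f t x)" by (simp add: distrib_right[symmetric])
        finally have "ennreal (\<mu> x) * ennreal ((f (s (n + N)) x - f t x)\<^sup>2) \<le> ennreal (\<mu> x) * (4 * psup (t + 1) (\<lambda>t. f t x))"
          by (intro mult_left_mono) auto
        thus "ennreal (\<mu> x * (f (s (n + N)) x - f t x)\<^sup>2) \<le> 4 * (ennreal (\<mu> x) * psup (t + 1) (\<lambda>t. f t x))"
          by (simp add: ennreal_mult mu_nonneg mult.left_commute)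
      qed
      show "(\<integral>\<^sup>+x. 4 * (ennreal (\<mu> x) * psup (t + 1) (\<lambda>t. f t x)) \<partial>count_space UNIV) < \<infinity>"
        using fin[of "t + 1"] t by (simp add: nn_integral_cmult weighted_sup_def[symmetric] ennreal_mult_less_top)
      show "AE x in count_space UNIV. (\<lambda>n. ennreal (\<mu> x * (f (s (n + N)) x - f t x)\<^sup>2)) \<longlonglongrightarrow> 0"
      proof (rule AE_I2)
        fix x
        have "(\<lambda>n. f (s n) x) \<longlonglongrightarrow> f t x"
          using s t by (intro continuous_on_tendsto_compose[OF cont lim]) auto
        hence "(\<lambda>n. f (s (n + N)) x) \<longlonglongrightarrow> f t x" by (rule LIMSEQ_ignore_initial_segment)
        hence "(\<lambda>n. ennreal (\<mu> x * (f (s (n + N)) x - f t x)\<^sup>2)) \<longlonglongrightarrow> ennreal (\<mu> x * (f t x - f t x)\<^sup>2)"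
          by (intro tendsto_ennrealI tendsto_intros)
        thus "(\<lambda>n. ennreal (\<mu> x * (f (s (n + N)) x - f t x)\<^sup>2)) \<longlonglongrightarrow> 0" by simp
      qed
    qed auto
    hence "(\<lambda>n. nsq \<mu> (\<lambda>x. f (s (n + N)) x - f t x)) \<longlonglongrightarrow> 0" by (simp add: nsq_def)
    thus "((\<lambda>s. nsq \<mu> (\<lambda>x. f s x - f t x)) \<circ> s) \<longlonglongrightarrow> 0"
      unfolding o_def by (rule LIMSEQ_offset)
  qed
qed

definition drift :: "real \<Rightarrow> (real \<Rightarrow> int ^ 'd \<Rightarrow> real) \<Rightarrow> real \<Rightarrow> int ^ 'd \<Rightarrow> real" where
  "drift \<kappa> f t x = (LINT s:{0..t}|lborel. \<kappa> * generator a (f s) x)"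

lemma continuous_drift:
  "l2_continuous f \<Longrightarrow> continuous_on {0..} (\<lambda>t. drift \<kappa> f t x)"
  unfolding drift_def
  by (intro continuous_on_lborel_integral continuous_on_mult continuous_on_const l2_continuous_coordinate l2_continuous_generator)

lemma drift_diff:
  assumes f: "l2_continuous f" and g: "l2_continuous g" and t: "0 \<le> t"
  shows "drift \<kappa> (\<lambda>t x. f t x - g t x) t x = drift \<kappa> f t x - drift \<kappa> g t x"
proof -
  have int: "set_integrable lborel {0..t} (\<lambda>s. \<kappa> * generator a (f s) x)" if "l2_continuous f" for f
    using l2_continuous_coordinate[OF l2_continuous_generator[OF that], of x]
    by (intro borel_integrable_atLeastAtMost' continuous_on_mult continuous_on_const) (auto intro: continuous_on_subset)
  have "drift \<kappa> (\<lambda>t x. f t x - g t x) t x = (LINT s:{0..t}|lborel. \<kappa> * generator a (f s) x - \<kappa> * generator a (g s) x)"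
    unfolding drift_def
  proof (intro set_lebesgue_integral_cong allI impI)
    fix s :: real assume "s \<in> {0..t}"
    hence "f s \<in> l2w \<mu>" "g s \<in> l2w \<mu>" using f g by (auto simp: l2_continuous_def)
    thus "\<kappa> * generator a (\<lambda>x. f s x - g s x) x = \<kappa> * generator a (f s) x - \<kappa> * generator a (g s) x"
      by (simp add: generator_diff right_diff_distrib)
  qed simp
  also have "\<dots> = drift \<kappa> f t x - drift \<kappa> g t x"
    unfolding drift_def by (rule set_integral_diff(2)[OF int[OF f] int[OF g]])
  finally show ?thesis .
qed

lemma square_drift_le:
  assumes f: "l2_continuous f" and t: "0 \<le> t"
  shows "ennreal ((drift \<kappa> f t x)\<^sup>2) \<le> ennreal (\<kappa>\<^sup>2 * t) * (\<integral>\<^sup>+s\<in>{0..t}. ennreal ((generator a (f s) x)\<^sup>2) \<partial>lborel)"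
proof -
  have cont: "continuous_on {0..} (\<lambda>s. generator a (f s) x)"
    by (rule l2_continuous_coordinate[OF l2_continuous_generator[OF f]])
  have "drift \<kappa> f t x = \<kappa> * (LINT s:{0..t}|lborel. generator a (f s) x)"
    unfolding drift_def by (rule set_integral_mult_right)
  hence "ennreal ((drift \<kappa> f t x)\<^sup>2) = ennreal (\<kappa>\<^sup>2) * ennreal ((LINT s:{0..t}|lborel. generator a (f s) x)\<^sup>2)"
    by (simp add: power_mult_distrib ennreal_mult)
  also have "\<dots> \<le> ennreal (\<kappa>\<^sup>2) * (ennreal t * (\<integral>\<^sup>+s\<in>{0..t}. ennreal ((generator a (f s) x)\<^sup>2) \<partial>lborel))"
    by (intro mult_left_mono square_lborel_integral_le cont t) auto
  finally show ?thesis using t by (simp add: ennreal_mult mult.assoc)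
qed

text \<open>Cauchy-Schwarz in time at each site, exchange of the sum over sites with the time
  integral, then the operator bound at each fixed time. The squared norm of f stays under the time
  integral, as the iteration requires.\<close>

lemma weighted_sup_drift_le:
  assumes f: "l2_continuous f" and T: "0 \<le> T"
  shows "weighted_sup T (drift \<kappa> f) \<le> ennreal (\<kappa>\<^sup>2 * T) * ((2 * K + 2) * (\<integral>\<^sup>+s\<in>{0..T}. nsq \<mu> (f s) \<partial>lborel))"
proof -
  have cont: "continuous_on {0..} (\<lambda>s. generator a (f s) x)" for x
    by (rule l2_continuous_coordinate[OF l2_continuous_generator[OF f]])
  have m: "(\<lambda>s. ennreal ((generator a (f s) x)\<^sup>2) * indicator {0..T} s) \<in> borel_measurable lborel" for x
  proof -
    have "continuous_on {0..T} (\<lambda>s. generator a (f s) x)" by (rule continuous_on_subset[OF cont]) auto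
    from borel_measurable_continuous_on_indicator[OF _ this]
    have "(\<lambda>s. indicator {0..T} s *\<^sub>R generator a (f s) x) \<in> borel_measurable lborel" by simp
    hence "(\<lambda>s. ennreal ((indicator {0..T} s *\<^sub>R generator a (f s) x)\<^sup>2)) \<in> borel_measurable lborel" by measurable
    also have "(\<lambda>s. ennreal ((indicator {0..T} s *\<^sub>R generator a (f s) x)\<^sup>2)) = (\<lambda>s. ennreal ((generator a (f s) x)\<^sup>2) * indicator {0..T} s)"
      by (auto simp: fun_eq_iff indicator_def)
    finally show ?thesis .
  qed
  have "psup T (\<lambda>t. drift \<kappa> f t x) \<le> ennreal (\<kappa>\<^sup>2 * T) * (\<integral>\<^sup>+s\<in>{0..T}. ennreal ((generator a (f s) x)\<^sup>2) \<partial>lborel)" for x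
  proof (rule psup_least)
    fix t :: real assume t: "0 \<le> t" "t \<le> T"
    have "ennreal ((drift \<kappa> f t x)\<^sup>2) \<le> ennreal (\<kappa>\<^sup>2 * t) * (\<integral>\<^sup>+s\<in>{0..t}. ennreal ((generator a (f s) x)\<^sup>2) \<partial>lborel)"
      by (rule square_drift_le[OF f t(1)])
    also have "\<dots> \<le> ennreal (\<kappa>\<^sup>2 * T) * (\<integral>\<^sup>+s\<in>{0..T}. ennreal ((generator a (f s) x)\<^sup>2) \<partial>lborel)"
      using t by (intro mult_mono ennreal_leI mult_left_mono nn_integral_mono) (auto simp: indicator_def)
    finally show "ennreal ((drift \<kappa> f t x)\<^sup>2) \<le> \<dots>" .
  qed
  hence "weighted_sup T (drift \<kappa> f) \<le> (\<integral>\<^sup>+x. ennreal (\<mu> x) * (ennreal (\<kappa>\<^sup>2 * T) * (\<integral>\<^sup>+s\<in>{0..T}. ennreal ((generator a (f s) x)\<^sup>2) \<partial>lborel)) \<partial>count_space UNIV)"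
    unfolding weighted_sup_def by (intro nn_integral_mono mult_left_mono) auto
  also have "\<dots> = ennreal (\<kappa>\<^sup>2 * T) * (\<integral>\<^sup>+x. (\<integral>\<^sup>+s. ennreal (\<mu> x) * (ennreal ((generator a (f s) x)\<^sup>2) * indicator {0..T} s) \<partial>lborel) \<partial>count_space UNIV)"
  proof -
    have "(\<integral>\<^sup>+s. ennreal (\<mu> x) * (ennreal ((generator a (f s) x)\<^sup>2) * indicator {0..T} s) \<partial>lborel) =
        ennreal (\<mu> x) * (\<integral>\<^sup>+s\<in>{0..T}. ennreal ((generator a (f s) x)\<^sup>2) \<partial>lborel)" for x
      by (rule nn_integral_cmult[OF m])
    thus ?thesis by (subst nn_integral_cmult[symmetric]) (auto simp: mult.left_commute)
  qed
  also have "(\<integral>\<^sup>+x. (\<integral>\<^sup>+s. ennreal (\<mu> x) * (ennreal ((generator a (f s) x)\<^sup>2) * indicator {0..T} s) \<partial>lborel) \<partial>count_space UNIV) =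
      (\<integral>\<^sup>+s. (\<integral>\<^sup>+x. ennreal (\<mu> x) * (ennreal ((generator a (f s) x)\<^sup>2) * indicator {0..T} s) \<partial>count_space UNIV) \<partial>lborel)"
    using m by (intro nn_integral_swap_countable[symmetric] lborel.sigma_finite_measure_axioms) auto
  also have "\<dots> \<le> (\<integral>\<^sup>+s. (2 * K + 2) * (nsq \<mu> (f s) * indicator {0..T} s) \<partial>lborel)"
  proof (rule nn_integral_mono)
    fix s :: real
    show "(\<integral>\<^sup>+x. ennreal (\<mu> x) * (ennreal ((generator a (f s) x)\<^sup>2) * indicator {0..T} s) \<partial>count_space UNIV) \<le> (2 * K + 2) * (nsq \<mu> (f s) * indicator {0..T} s)"
    proof (cases "s \<in> {0..T}")
      case True
      hence "f s \<in> l2w \<mu>" using f by (simp add: l2_continuous_def)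
      from nsq_generator[OF this] show ?thesis using True by (simp add: nsq_def ennreal_mult mu_nonneg)
    qed simp
  qed
  also have "\<dots> \<le> (2 * K + 2) * (\<integral>\<^sup>+s\<in>{0..T}. nsq \<mu> (f s) \<partial>lborel)"
  proof -
    have "(\<lambda>s. nsq \<mu> (f s) * indicator {0..T} s) \<in> borel_measurable lborel"
    proof -
      have "(\<lambda>s. indicator {0..T} s *\<^sub>R f s x) \<in> borel_measurable lborel" for x
        using borel_measurable_continuous_on_indicator[OF _ continuous_on_subset[OF l2_continuous_coordinate[OF f, of x]], of "{0..T}"] by auto
      hence "(\<lambda>s. \<integral>\<^sup>+x. ennreal (\<mu> x * (indicator {0..T} s *\<^sub>R f s x)\<^sup>2) \<partial>count_space UNIV) \<in> borel_measurable lborel"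
        by (intro borel_measurable_nn_integral_countable measurable_compose[OF _ measurable_ennreal] borel_measurable_times borel_measurable_power) auto
      also have "(\<lambda>s. \<integral>\<^sup>+x. ennreal (\<mu> x * (indicator {0..T} s *\<^sub>R f s x)\<^sup>2) \<partial>count_space UNIV) = (\<lambda>s. nsq \<mu> (f s) * indicator {0..T} s)"
        by (auto simp: fun_eq_iff indicator_def nsq_def)
      finally show ?thesis .
    qed
    thus ?thesis by (simp add: nn_integral_cmult)
  qed
  finally show ?thesis by (simp add: mult_left_mono)
qed

end

section \<open>Existence\<close>

locale anderson = brownian_family M w + bounded_generator a \<mu> K
  for M :: "'w measure" and w :: "real \<Rightarrow> int ^ 'd::finite \<Rightarrow> 'w \<Rightarrow> real" and a \<mu> :: "int ^ 'd \<Rightarrow> real" and K +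
  fixes W :: "real \<Rightarrow> int ^ 'd \<Rightarrow> 'w \<Rightarrow> real" and b :: "int ^ 'd \<Rightarrow> real" and \<kappa> :: real
  assumes noise: "noise_field M b w W" and b_summable: "(\<lambda>z. (b z)\<^sup>2) summable_on UNIV"
    and mu_summable: "\<mu> summable_on UNIV"
begin

definition noise_variance :: real where "noise_variance = (\<Sum>\<^sub>\<infinity>z. (b z)\<^sup>2)"

text \<open>The reflection z to x - z permutes the lattice, so the variance rate is the same at
  every site; later constants are therefore uniform in x.\<close>

lemma ex_continuous_noise_field:
  "\<exists>Z. continuous_integrator M F Z noise_variance \<and> (\<forall>t\<ge>0. AE \<omega> in M. W t x \<omega> = Z t \<omega>)"
proof -
  have bij: "bij_betw (\<lambda>z. x - z) UNIV (UNIV :: (int ^ 'd) set)"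
    by (rule bij_betw_byWitness[where f'="\<lambda>z. x - z"]) auto
  have "(\<lambda>z. (b (x - z))\<^sup>2) summable_on UNIV"
    using b_summable summable_on_reindex_bij_betw[OF bij, of "\<lambda>z. (b z)\<^sup>2"] by simp
  moreover have "noise_variance = (\<Sum>\<^sub>\<infinity>z. (b (x - z))\<^sup>2)"
    unfolding noise_variance_def using infsum_reindex_bij_betw[OF bij, of "\<lambda>z. (b z)\<^sup>2"] by simp
  ultimately show ?thesis
    using ex_continuous_noise[of "\<lambda>z. b (x - z)" "\<lambda>t. W t x"] noise by (simp add: noise_field_def)
qed

definition continuous_noise :: "int ^ 'd \<Rightarrow> real \<Rightarrow> 'w \<Rightarrow> real" where
  "continuous_noise x = (SOME Z. continuous_integrator M F Z noise_variance \<and> (\<forall>t\<ge>0. AE \<omega> in M. W t x \<omega> = Z t \<omega>))"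

lemma continuous_noise:
  shows continuous_noise_integrator: "continuous_integrator M F (continuous_noise x) noise_variance"
    and continuous_noise_AE: "0 \<le> t \<Longrightarrow> AE \<omega> in M. W t x \<omega> = continuous_noise x t \<omega>"
  using someI_ex[OF ex_continuous_noise_field[of x]] by (auto simp: continuous_noise_def)

sublocale noise: continuous_integrator M F "continuous_noise x" noise_variance for x
  by (rule continuous_noise_integrator)

text \<open>The \<open>infsum\<close> is rewritten as an integral over counting measure, for which
  measurability in the parameter is available.\<close>

lemma measurable_generator:
  assumes f: "\<And>y. f y \<in> borel_measurable N" and l2: "\<And>\<omega>. \<omega> \<in> space N \<Longrightarrow> (\<lambda>y. f y \<omega>) \<in> l2w \<mu>"
  shows "(\<lambda>\<omega>. generator a (\<lambda>y. f y \<omega>) x) \<in> borel_measurable N"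
proof -
  have "generator a (\<lambda>y. f y \<omega>) x = (\<integral>z. a z * f (x + z) \<omega> \<partial>count_space UNIV) - f x \<omega>" if "\<omega> \<in> space N" for \<omega>
    using summable_average[OF l2[OF that], of x]
    by (simp add: generator_eq[OF l2[OF that]] infsum_eq_integral_count_space abs_mult a_nonneg)
  moreover have "(\<lambda>\<omega>. (\<integral>z. a z * f (x + z) \<omega> \<partial>count_space UNIV) - f x \<omega>) \<in> borel_measurable N"
    using f by (intro borel_measurable_diff borel_measurable_integral_countable borel_measurable_times) auto
  ultimately show ?thesis by (simp cong: measurable_cong)
qed

text \<open>Finiteness is imposed for every \<omega>, because \<open>anderson_solution\<close>
  demands membership and norm continuity everywhere on \<open>space M\<close>. Exceptional paths are
  reset to 0 by \<open>ex_l2_process_modification\<close>.\<close>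

definition l2_process :: "(real \<Rightarrow> int ^ 'd \<Rightarrow> 'w \<Rightarrow> real) \<Rightarrow> bool" where
  "l2_process u \<longleftrightarrow> (\<forall>x. continuous_adapted (\<lambda>t. u t x)) \<and>
    (\<forall>\<omega>\<in>space M. \<forall>T\<ge>0. weighted_sup T (\<lambda>t x. u t x \<omega>) < \<top>)"

lemma l2_process_continuous: "l2_process u \<Longrightarrow> \<omega> \<in> space M \<Longrightarrow> l2_continuous (\<lambda>t x. u t x \<omega>)"
  by (rule l2_continuous_of_weighted_sup) (auto simp: l2_process_def continuous_adapted_def)

lemma l2_process_diff:
  assumes "l2_process u" "l2_process v" shows "l2_process (\<lambda>t x \<omega>. u t x \<omega> - v t x \<omega>)"
  unfolding l2_process_def
proof (intro conjI allI ballI impI)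
  fix x show "continuous_adapted (\<lambda>t \<omega>. u t x \<omega> - v t x \<omega>)"
    using assms by (intro continuous_adapted_diff) (auto simp: l2_process_def)
next
  fix \<omega> and T :: real assume "\<omega> \<in> space M" "0 \<le> T"
  hence "2 * weighted_sup T (\<lambda>t x. u t x \<omega>) + 2 * weighted_sup T (\<lambda>t x. v t x \<omega>) < \<top>"
    using assms by (auto simp: l2_process_def ennreal_mult_less_top)
  thus "weighted_sup T (\<lambda>t x. u t x \<omega> - v t x \<omega>) < \<top>"
    by (rule le_less_trans[OF weighted_sup_diff_le])
qed

lemma continuous_adapted_generator:
  assumes u: "l2_process u" shows "continuous_adapted (\<lambda>t \<omega>. generator a (\<lambda>y. u t y \<omega>) x)"
  unfolding continuous_adapted_def
proof (intro conjI ballI allI impI)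
  fix \<omega> assume "\<omega> \<in> space M"
  from l2_continuous_coordinate[OF l2_continuous_generator[OF l2_process_continuous[OF u this]], of x]
  show "continuous_on {0..} (\<lambda>t. generator a (\<lambda>y. u t y \<omega>) x)" .
next
  fix t :: real assume t: "0 \<le> t"
  show "(\<lambda>\<omega>. generator a (\<lambda>y. u t y \<omega>) x) \<in> borel_measurable (F t)"
  proof (rule measurable_generator)
    fix y show "u t y \<in> borel_measurable (F t)" using u t by (auto simp: l2_process_def continuous_adapted_def)
  next
    fix \<omega> assume "\<omega> \<in> space (F t)"
    hence "\<omega> \<in> space M" by (simp add: space_F)
    from l2_process_continuous[OF u this] show "(\<lambda>y. u t y \<omega>) \<in> l2w \<mu>" using t by (simp add: l2_continuous_def)
  qed
qed

lemma continuous_adapted_drift: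
  assumes u: "l2_process u" shows "continuous_adapted (\<lambda>t \<omega>. drift \<kappa> (\<lambda>s y. u s y \<omega>) t x)"
  unfolding continuous_adapted_def
proof (intro conjI ballI allI impI)
  fix \<omega> assume "\<omega> \<in> space M"
  from continuous_drift[OF l2_process_continuous[OF u this]]
  show "continuous_on {0..} (\<lambda>t. drift \<kappa> (\<lambda>s y. u s y \<omega>) t x)" .
next
  fix t :: real assume t: "0 \<le> t"
  let ?G = "\<lambda>s \<omega>. generator a (\<lambda>y. u s y \<omega>) x"
  \<comment> \<open>With the time clamped to [0, t] the integrand is measurable for
    \<open>F t\<close> jointly with time, so the integral over [0, t] is known at time t.\<close>
  have "(\<lambda>(s, \<omega>). ?G (max 0 (min s t)) \<omega>) \<in> borel_measurable (borel \<Otimes>\<^sub>M F t)"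
    by (intro progressively_measurable_stopped continuous_imp_left_continuous_adapted continuous_adapted_generator u t)
  from measurable_pair_swap[OF this]
  have "(\<lambda>p. ?G (max 0 (min (snd p) t)) (fst p)) \<in> borel_measurable (F t \<Otimes>\<^sub>M borel)" by (simp add: split_beta)
  hence m: "(\<lambda>p. ?G (max 0 (min (snd p) t)) (fst p)) \<in> borel_measurable (F t \<Otimes>\<^sub>M lborel)"
    by (subst measurable_cong_sets[OF sets_pair_measure_cong[OF refl sets_lborel] refl])
  have "(\<lambda>(\<omega>, s). indicator {0..t} s *\<^sub>R (\<kappa> * ?G (max 0 (min s t)) \<omega>)) \<in> borel_measurable (F t \<Otimes>\<^sub>M lborel)"
    using m unfolding split_beta by measurable
  from lborel.borel_measurable_lebesgue_integral[OF this]
  have "(\<lambda>\<omega>. LINT s|lborel. indicator {0..t} s *\<^sub>R (\<kappa> * ?G (max 0 (min s t)) \<omega>)) \<in> borel_measurable (F t)" by simp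
  also have "(\<lambda>\<omega>. LINT s|lborel. indicator {0..t} s *\<^sub>R (\<kappa> * ?G (max 0 (min s t)) \<omega>)) = (\<lambda>\<omega>. drift \<kappa> (\<lambda>s y. u s y \<omega>) t x)"
    unfolding drift_def set_lebesgue_integral_def
    by (intro ext Bochner_Integration.integral_cong) (auto simp: indicator_def)
  finally show "(\<lambda>\<omega>. drift \<kappa> (\<lambda>s y. u s y \<omega>) t x) \<in> borel_measurable (F t)" .
qed

definition l2_sup_norm :: "real \<Rightarrow> (real \<Rightarrow> int ^ 'd \<Rightarrow> 'w \<Rightarrow> real) \<Rightarrow> ennreal" where
  "l2_sup_norm T u = (\<integral>\<^sup>+\<omega>. weighted_sup T (\<lambda>t x. u t x \<omega>) \<partial>M)"

lemma measurable_weighted_sup: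
  assumes u: "\<And>x. continuous_adapted (\<lambda>t. u t x)" and T: "0 \<le> T"
  shows "(\<lambda>\<omega>. weighted_sup T (\<lambda>t x. u t x \<omega>)) \<in> borel_measurable M"
  unfolding weighted_sup_def
  by (intro borel_measurable_nn_integral_countable borel_measurable_times_ennreal measurable_psup u T) auto

lemma l2_sup_norm_eq:
  assumes u: "\<And>x. continuous_adapted (\<lambda>t. u t x)" and T: "0 \<le> T"
  shows "l2_sup_norm T u = (\<integral>\<^sup>+x. ennreal (\<mu> x) * (\<integral>\<^sup>+\<omega>. psup T (\<lambda>t. u t x \<omega>) \<partial>M) \<partial>count_space UNIV)"
proof -
  note [measurable] = measurable_psup[OF u T]
  have "l2_sup_norm T u = (\<integral>\<^sup>+x. \<integral>\<^sup>+\<omega>. ennreal (\<mu> x) * psup T (\<lambda>t. u t x \<omega>) \<partial>M \<partial>count_space UNIV)"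
    unfolding l2_sup_norm_def weighted_sup_def by (intro nn_integral_swap_countable sigma_finite_measure) measurable
  thus ?thesis by (simp add: nn_integral_cmult)
qed

lemma l2_sup_norm_mono: "T \<le> T' \<Longrightarrow> l2_sup_norm T u \<le> l2_sup_norm T' u"
  unfolding l2_sup_norm_def by (intro nn_integral_mono weighted_sup_mono)

lemma l2_sup_norm_coordinate:
  assumes u: "\<And>x. continuous_adapted (\<lambda>t. u t x)" and T: "0 \<le> T"
  shows "ennreal (\<mu> x) * (\<integral>\<^sup>+\<omega>. psup T (\<lambda>t. u t x \<omega>) \<partial>M) \<le> l2_sup_norm T u"
  unfolding l2_sup_norm_eq[OF u T] by (rule nn_integral_ge_point) simp

lemma l2_sup_norm_coordinate_finite:
  assumes u: "\<And>x. continuous_adapted (\<lambda>t. u t x)" and T: "0 \<le> T" and fin: "l2_sup_norm T u < \<top>"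
  shows "(\<integral>\<^sup>+\<omega>. psup T (\<lambda>t. u t x \<omega>) \<partial>M) < \<top>"
  using le_less_trans[OF l2_sup_norm_coordinate[OF u T, of x] fin] mu_pos[of x]
  by (auto simp: ennreal_mult_less_top ennreal_eq_0_iff not_less)

lemma l2_sup_norm_add_le:
  assumes u: "\<And>x. continuous_adapted (\<lambda>t. u t x)" and v: "\<And>x. continuous_adapted (\<lambda>t. v t x)" and T: "0 \<le> T"
    and le: "AE \<omega> in M. weighted_sup T (\<lambda>t x. f t x \<omega>) \<le> 2 * weighted_sup T (\<lambda>t x. u t x \<omega>) + 2 * weighted_sup T (\<lambda>t x. v t x \<omega>)"
  shows "l2_sup_norm T f \<le> 2 * l2_sup_norm T u + 2 * l2_sup_norm T v"
proof -
  note [measurable] = measurable_weighted_sup[OF u T] measurable_weighted_sup[OF v T]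
  have "l2_sup_norm T f \<le> (\<integral>\<^sup>+\<omega>. 2 * weighted_sup T (\<lambda>t x. u t x \<omega>) + 2 * weighted_sup T (\<lambda>t x. v t x \<omega>) \<partial>M)"
    unfolding l2_sup_norm_def by (rule nn_integral_mono_AE[OF le])
  also have "\<dots> = 2 * l2_sup_norm T u + 2 * l2_sup_norm T v"
    unfolding l2_sup_norm_def by (simp add: nn_integral_add nn_integral_cmult)
  finally show ?thesis .
qed

lemma weighted_sup_finite_imp_le:
  assumes "T \<le> T'" "weighted_sup T' f < \<top>" shows "weighted_sup T f < \<top>"
  using weighted_sup_mono[OF assms(1)] assms(2) by (rule le_less_trans)

text \<open>A finite expectation leaves a null set of bad paths for each natural horizon. Setting
  the process to 0 on their union preserves adaptedness, since null sets belong to the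
  filtration.\<close>

lemma ex_l2_process_modification:
  assumes u: "\<And>x. continuous_adapted (\<lambda>t. u t x)" and fin: "\<And>T. 0 \<le> T \<Longrightarrow> l2_sup_norm T u < \<top>"
  shows "\<exists>v. l2_process v \<and> (AE \<omega> in M. \<forall>t x. v t x \<omega> = u t x \<omega>)"
proof -
  define N where "N = {\<omega> \<in> space M. \<not> (\<forall>n::nat. weighted_sup (real n) (\<lambda>t x. u t x \<omega>) < \<top>)}"
  note [measurable] = measurable_weighted_sup[OF u]
  have ae: "AE \<omega> in M. \<forall>n::nat. weighted_sup (real n) (\<lambda>t x. u t x \<omega>) < \<top>"
    unfolding AE_all_countable
  proof
    fix n :: nat
    have "AE \<omega> in M. weighted_sup (real n) (\<lambda>t x. u t x \<omega>) \<noteq> \<infinity>"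
      using fin[of "real n"] by (intro nn_integral_PInf_AE) (auto simp: l2_sup_norm_def)
    thus "AE \<omega> in M. weighted_sup (real n) (\<lambda>t x. u t x \<omega>) < \<top>" by eventually_elim (simp add: less_top)
  qed
  have "N \<in> sets M" unfolding N_def by measurable
  hence N: "N \<in> null_sets M" using ae by (simp add: AE_iff_null N_def)
  define v where "v t x \<omega> = (if \<omega> \<in> N then 0 else u t x \<omega>)" for t x \<omega>
  have "AE \<omega> in M. \<forall>t x. v t x \<omega> = u t x \<omega>"
    using AE_not_in[OF N] by eventually_elim (simp add: v_def)
  moreover have "l2_process v"
    unfolding l2_process_def
  proof (intro conjI allI ballI impI)
    fix x
    have "v t x \<in> borel_measurable (F t)" if t: "0 \<le> t" for t
    proof -
      have "N \<in> sets (F t)" by (rule mem_F_of_null(1)[OF N])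
      moreover have "u t x \<in> borel_measurable (F t)" using u t by (simp add: continuous_adapted_def)
      ultimately show ?thesis unfolding v_def by (intro measurable_If_set sets.Int sets.top) auto
    qed
    moreover have "continuous_on {0..} (\<lambda>t. v t x \<omega>)" if "\<omega> \<in> space M" for \<omega>
      using u that by (cases "\<omega> \<in> N") (auto simp: continuous_adapted_def v_def)
    ultimately show "continuous_adapted (\<lambda>t. v t x)" by (simp add: continuous_adapted_def)
  next
    fix \<omega> and T :: real assume \<omega>: "\<omega> \<in> space M" and "0 \<le> T"
    show "weighted_sup T (\<lambda>t x. v t x \<omega>) < \<top>"
    proof (cases "\<omega> \<in> N")
      case True thus ?thesis by (simp add: v_def weighted_sup_def)
    next
      case False
      hence "weighted_sup (real (nat \<lceil>T\<rceil>)) (\<lambda>t x. u t x \<omega>) < \<top>" using \<omega> by (auto simp: N_def)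
      hence "weighted_sup T (\<lambda>t x. u t x \<omega>) < \<top>" by (rule weighted_sup_finite_imp_le[rotated]) linarith
      thus ?thesis using False by (simp add: v_def)
    qed
  qed
  ultimately show ?thesis by blast
qed

end

context bounded_generator
begin

lemma weighted_sup_cong:
  "(\<And>t x. 0 \<le> t \<Longrightarrow> t \<le> T \<Longrightarrow> f t x = g t x) \<Longrightarrow> weighted_sup T f = weighted_sup T g"
  unfolding weighted_sup_def by (intro nn_integral_cong arg_cong2[where f="(*)"] psup_cong) auto

end

section \<open>Picard steps and their mean-square estimates\<close>

context anderson
begin

definition mean_square :: "real \<Rightarrow> (real \<Rightarrow> int ^ 'd \<Rightarrow> 'w \<Rightarrow> real) \<Rightarrow> ennreal" where
  "mean_square T d = (\<integral>\<^sup>+s\<in>{0..T}. (\<integral>\<^sup>+\<omega>. nsq \<mu> (\<lambda>x. d s x \<omega>) \<partial>M) \<partial>lborel)"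

text \<open>The sum over sites, the time integral and the expectation are interchanged by Tonelli.
  The first form receives the one-site integral bounds, the second the pathwise drift bound.\<close>

lemma mean_square_Fubini:
  assumes d: "\<And>x. jointly_measurable T (\<lambda>s. d s x)"
  shows "(\<integral>\<^sup>+x. ennreal (\<mu> x) * l2_dist T (\<lambda>s. d s x) (\<lambda>_ _. 0) \<partial>count_space UNIV) = mean_square T d"
    and "(\<integral>\<^sup>+\<omega>. (\<integral>\<^sup>+s\<in>{0..T}. nsq \<mu> (\<lambda>x. d s x \<omega>) \<partial>lborel) \<partial>M) = mean_square T d"
    and "(\<lambda>\<omega>. \<integral>\<^sup>+s\<in>{0..T}. nsq \<mu> (\<lambda>x. d s x \<omega>) \<partial>lborel) \<in> borel_measurable M"
proof -
  interpret P: pair_sigma_finite M lborel ..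
  let ?f = "\<lambda>x p. ennreal (\<mu> x) * (ennreal ((d (snd p) x (fst p))\<^sup>2) * indicator {0..T} (snd p))"
  let ?g = "\<lambda>p. \<integral>\<^sup>+x. ?f x p \<partial>count_space UNIV"
  have sq: "(\<lambda>p. ennreal ((d (snd p) x (fst p))\<^sup>2) * indicator {0..T} (snd p)) \<in> borel_measurable (M \<Otimes>\<^sub>M lborel)" for x
    using jointly_measurable_square[OF d[of x]] by (simp add: split_beta)
  have f: "?f x \<in> borel_measurable (M \<Otimes>\<^sub>M lborel)" for x by (intro borel_measurable_times_ennreal sq) auto
  have g: "?g \<in> borel_measurable (M \<Otimes>\<^sub>M lborel)" by (rule borel_measurable_nn_integral_countable[OF f])
  have eq: "?g (\<omega>, s) = nsq \<mu> (\<lambda>x. d s x \<omega>) * indicator {0..T} s" for \<omega> s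
    by (auto simp: nsq_def indicator_def ennreal_mult mu_nonneg)
  have fst: "(\<integral>\<^sup>+p. ?g p \<partial>(M \<Otimes>\<^sub>M lborel)) = (\<integral>\<^sup>+\<omega>. (\<integral>\<^sup>+s\<in>{0..T}. nsq \<mu> (\<lambda>x. d s x \<omega>) \<partial>lborel) \<partial>M)"
    unfolding eq[symmetric] by (rule lborel.nn_integral_fst[OF g, symmetric])
  have "(\<integral>\<^sup>+p. ?g p \<partial>(M \<Otimes>\<^sub>M lborel)) = (\<integral>\<^sup>+s. (\<integral>\<^sup>+\<omega>. ?g (\<omega>, s) \<partial>M) \<partial>lborel)"
    using P.nn_integral_snd[of ?g] g by (simp add: split_beta')
  also have "\<dots> = mean_square T d"
    unfolding mean_square_def eq by (intro nn_integral_cong) (auto simp: indicator_def)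
  finally have snd: "(\<integral>\<^sup>+p. ?g p \<partial>(M \<Otimes>\<^sub>M lborel)) = mean_square T d" .
  show "(\<integral>\<^sup>+\<omega>. (\<integral>\<^sup>+s\<in>{0..T}. nsq \<mu> (\<lambda>x. d s x \<omega>) \<partial>lborel) \<partial>M) = mean_square T d"
    using fst snd by simp
  show "(\<lambda>\<omega>. \<integral>\<^sup>+s\<in>{0..T}. nsq \<mu> (\<lambda>x. d s x \<omega>) \<partial>lborel) \<in> borel_measurable M"
    using lborel.borel_measurable_nn_integral_fst[OF g] unfolding eq .
  have "(\<integral>\<^sup>+p. ?g p \<partial>(M \<Otimes>\<^sub>M lborel)) = (\<integral>\<^sup>+x. (\<integral>\<^sup>+p. ?f x p \<partial>(M \<Otimes>\<^sub>M lborel)) \<partial>count_space UNIV)"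
    by (rule nn_integral_swap_countable[OF P.sigma_finite_measure_axioms f])
  also have "\<dots> = (\<integral>\<^sup>+x. ennreal (\<mu> x) * l2_dist T (\<lambda>s. d s x) (\<lambda>_ _. 0) \<partial>count_space UNIV)"
  proof (rule nn_integral_cong)
    fix x
    have "(\<integral>\<^sup>+p. ?f x p \<partial>(M \<Otimes>\<^sub>M lborel)) = ennreal (\<mu> x) * (\<integral>\<^sup>+p. ennreal ((d (snd p) x (fst p))\<^sup>2) * indicator {0..T} (snd p) \<partial>(M \<Otimes>\<^sub>M lborel))"
      by (rule nn_integral_cmult[OF sq])
    also have "(\<integral>\<^sup>+p. ennreal ((d (snd p) x (fst p))\<^sup>2) * indicator {0..T} (snd p) \<partial>(M \<Otimes>\<^sub>M lborel)) = l2_dist T (\<lambda>s. d s x) (\<lambda>_ _. 0)"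
      using lborel.nn_integral_fst[OF sq, of x] by (simp add: l2_dist_def)
    finally show "(\<integral>\<^sup>+p. ?f x p \<partial>(M \<Otimes>\<^sub>M lborel)) = ennreal (\<mu> x) * l2_dist T (\<lambda>s. d s x) (\<lambda>_ _. 0)" .
  qed
  finally show "(\<integral>\<^sup>+x. ennreal (\<mu> x) * l2_dist T (\<lambda>s. d s x) (\<lambda>_ _. 0) \<partial>count_space UNIV) = mean_square T d"
    using snd by simp
qed

lemma mean_square_le: "mean_square T d \<le> (\<integral>\<^sup>+s\<in>{0..T}. l2_sup_norm s d \<partial>lborel)"
  unfolding mean_square_def l2_sup_norm_def
  by (intro nn_integral_mono) (auto simp: indicator_def intro!: nn_integral_mono nsq_le_weighted_sup)

lemma mean_square_le':
  assumes "0 \<le> T" shows "mean_square T d \<le> ennreal T * l2_sup_norm T d"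
proof -
  have "mean_square T d \<le> (\<integral>\<^sup>+s. l2_sup_norm T d * indicator {0..T} s \<partial>lborel)"
    unfolding mean_square_def l2_sup_norm_def
    by (intro nn_integral_mono) (auto simp: indicator_def intro!: nn_integral_mono nsq_le_weighted_sup)
  also have "\<dots> = l2_sup_norm T d * ennreal T"
    using assms by (simp add: nn_integral_cmult_indicator)
  finally show ?thesis by (simp add: mult.commute)
qed

lemma l2_process_jointly_measurable: "l2_process u \<Longrightarrow> 0 \<le> T \<Longrightarrow> jointly_measurable T (\<lambda>s. u s x)"
  by (intro left_continuous_jointly_measurable continuous_imp_left_continuous_adapted) (simp add: l2_process_def)

lemma l2_sup_norm_drift_le:
  assumes d: "l2_process d" and T: "0 \<le> T"
  shows "l2_sup_norm T (\<lambda>t x \<omega>. drift \<kappa> (\<lambda>s y. d s y \<omega>) t x) \<le> ennreal (\<kappa>\<^sup>2 * T) * (2 * K + 2) * mean_square T d"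
proof -
  note m[measurable] = mean_square_Fubini(3)[OF l2_process_jointly_measurable[OF d T]]
  have "l2_sup_norm T (\<lambda>t x \<omega>. drift \<kappa> (\<lambda>s y. d s y \<omega>) t x) \<le>
      (\<integral>\<^sup>+\<omega>. ennreal (\<kappa>\<^sup>2 * T) * (2 * K + 2) * (\<integral>\<^sup>+s\<in>{0..T}. nsq \<mu> (\<lambda>x. d s x \<omega>) \<partial>lborel) \<partial>M)"
    unfolding l2_sup_norm_def
    by (intro nn_integral_mono order_trans[OF weighted_sup_drift_le[OF l2_process_continuous[OF d] T]]) (auto simp: mult.assoc)
  also have "\<dots> = ennreal (\<kappa>\<^sup>2 * T) * (2 * K + 2) * mean_square T d"
    by (subst nn_integral_cmult[OF m]) (simp add: mean_square_Fubini(2)[OF l2_process_jointly_measurable[OF d T]])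
  finally show ?thesis .
qed

text \<open>The one-site bound \<open>noise.ito_process_bound\<close> has the same constant at every
  site, so it can be summed with the weights \<mu>. Correlations between the noises at different
  sites do not enter a sum of one-site second moments.\<close>

lemma l2_sup_norm_ito_diff_le:
  assumes Y: "\<And>x. noise.ito_process x (\<lambda>t. u t x) (\<lambda>t. Y t x)" and Y': "\<And>x. noise.ito_process x (\<lambda>t. u' t x) (\<lambda>t. Y' t x)"
    and T: "0 \<le> T"
  shows "l2_sup_norm T (\<lambda>t x \<omega>. Y t x \<omega> - Y' t x \<omega>) \<le> 64 * ennreal noise_variance * mean_square T (\<lambda>t x \<omega>. u t x \<omega> - u' t x \<omega>)"
proof -
  have ca: "continuous_adapted (\<lambda>t \<omega>. Y t x \<omega> - Y' t x \<omega>)" for x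
    using Y[of x] Y'[of x] by (intro continuous_adapted_diff) (simp_all add: noise.ito_process_def)
  have j: "jointly_measurable T (\<lambda>t \<omega>. u t x \<omega> - u' t x \<omega>)" for x
    using Y[of x] Y'[of x] T by (intro jointly_measurable_diff) (simp_all add: noise.ito_process_def)
  have "l2_sup_norm T (\<lambda>t x \<omega>. Y t x \<omega> - Y' t x \<omega>) = (\<integral>\<^sup>+x. ennreal (\<mu> x) * (\<integral>\<^sup>+\<omega>. psup T (\<lambda>t. Y t x \<omega> - Y' t x \<omega>) \<partial>M) \<partial>count_space UNIV)"
    by (rule l2_sup_norm_eq[OF ca T])
  also have "\<dots> \<le> (\<integral>\<^sup>+x. 64 * ennreal noise_variance * (ennreal (\<mu> x) * l2_dist T (\<lambda>t \<omega>. u t x \<omega> - u' t x \<omega>) (\<lambda>_ _. 0)) \<partial>count_space UNIV)"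
  proof (rule nn_integral_mono)
    fix x
    have "(\<integral>\<^sup>+\<omega>. psup T (\<lambda>t. Y t x \<omega> - Y' t x \<omega>) \<partial>M) \<le> 64 * ennreal noise_variance * l2_dist T (\<lambda>t \<omega>. u t x \<omega> - u' t x \<omega>) (\<lambda>_ _. 0)"
      using noise.ito_process_bound[OF Y Y' T, of x] by (simp add: l2_dist_def)
    hence "ennreal (\<mu> x) * (\<integral>\<^sup>+\<omega>. psup T (\<lambda>t. Y t x \<omega> - Y' t x \<omega>) \<partial>M) \<le> ennreal (\<mu> x) * (64 * ennreal noise_variance * l2_dist T (\<lambda>t \<omega>. u t x \<omega> - u' t x \<omega>) (\<lambda>_ _. 0))"
      by (rule mult_left_mono) simp
    thus "ennreal (\<mu> x) * (\<integral>\<^sup>+\<omega>. psup T (\<lambda>t. Y t x \<omega> - Y' t x \<omega>) \<partial>M) \<le> 64 * ennreal noise_variance * (ennreal (\<mu> x) * l2_dist T (\<lambda>t \<omega>. u t x \<omega> - u' t x \<omega>) (\<lambda>_ _. 0))"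
      by (simp only: ac_simps)
  qed
  also have "\<dots> = 64 * ennreal noise_variance * mean_square T (\<lambda>t x \<omega>. u t x \<omega> - u' t x \<omega>)"
    using mean_square_Fubini(1)[OF j] by (simp add: nn_integral_cmult)
  finally show ?thesis .
qed

text \<open>A relation and not a map: stochastic integrals are determined up to null sets, and
  passing to paths of finite norm changes v on a null set.\<close>

definition picard_step :: "(real \<Rightarrow> int ^ 'd \<Rightarrow> 'w \<Rightarrow> real) \<Rightarrow> (real \<Rightarrow> int ^ 'd \<Rightarrow> 'w \<Rightarrow> real) \<Rightarrow> bool" where
  "picard_step u v \<longleftrightarrow> (\<exists>Y. (\<forall>x. noise.ito_process x (\<lambda>t. u t x) (\<lambda>t. Y t x)) \<and>
    (AE \<omega> in M. \<forall>t\<ge>0. \<forall>x. v t x \<omega> = 1 + drift \<kappa> (\<lambda>s y. u s y \<omega>) t x + Y t x \<omega>))"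

text \<open>Drift constant plus noise constant, each doubled by the quasi-triangle inequality. It
  may exceed 1; the decay comes from iterating the time integral.\<close>

definition contraction_const :: "real \<Rightarrow> ennreal" where
  "contraction_const T = 2 * (ennreal (\<kappa>\<^sup>2 * T) * (2 * K + 2)) + 2 * (64 * ennreal noise_variance)"

lemma contraction_const_finite: "contraction_const T < \<top>"
  using K_finite by (simp add: contraction_const_def ennreal_mult_less_top)

lemma contraction_const_mono: "T \<le> T' \<Longrightarrow> contraction_const T \<le> contraction_const T'"
  unfolding contraction_const_def
  by (intro add_mono mult_left_mono mult_right_mono ennreal_leI) auto

text \<open>The initial value 1 cancels and the drift is linear, so the difference consists of the
  drift of the difference and a difference of stochastic integrals.\<close>

lemma picard_step_contraction:
  assumes u: "l2_process u" and u': "l2_process u'" and v: "picard_step u v" and v': "picard_step u' v'" and T: "0 \<le> T"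
  shows "l2_sup_norm T (\<lambda>t x \<omega>. v t x \<omega> - v' t x \<omega>) \<le> contraction_const T * mean_square T (\<lambda>t x \<omega>. u t x \<omega> - u' t x \<omega>)"
proof -
  obtain Y where Y: "\<And>x. noise.ito_process x (\<lambda>t. u t x) (\<lambda>t. Y t x)"
    "AE \<omega> in M. \<forall>t\<ge>0. \<forall>x. v t x \<omega> = 1 + drift \<kappa> (\<lambda>s y. u s y \<omega>) t x + Y t x \<omega>"
    using v unfolding picard_step_def by blast
  obtain Y' where Y': "\<And>x. noise.ito_process x (\<lambda>t. u' t x) (\<lambda>t. Y' t x)"
    "AE \<omega> in M. \<forall>t\<ge>0. \<forall>x. v' t x \<omega> = 1 + drift \<kappa> (\<lambda>s y. u' s y \<omega>) t x + Y' t x \<omega>"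
    using v' unfolding picard_step_def by blast
  let ?d = "\<lambda>t x \<omega>. u t x \<omega> - u' t x \<omega>"
  have d: "l2_process ?d" by (rule l2_process_diff[OF u u'])
  let ?D = "\<lambda>t x \<omega>. drift \<kappa> (\<lambda>s y. ?d s y \<omega>) t x" and ?Z = "\<lambda>t x \<omega>. Y t x \<omega> - Y' t x \<omega>"
  have "l2_sup_norm T (\<lambda>t x \<omega>. v t x \<omega> - v' t x \<omega>) \<le> 2 * l2_sup_norm T ?D + 2 * l2_sup_norm T ?Z"
  proof (rule l2_sup_norm_add_le[OF _ _ T])
    show "continuous_adapted (\<lambda>t. ?D t x)" for x by (rule continuous_adapted_drift[OF d])
    show "continuous_adapted (\<lambda>t. ?Z t x)" for x
      using Y(1)[of x] Y'(1)[of x] by (intro continuous_adapted_diff) (simp_all add: noise.ito_process_def)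
    show "AE \<omega> in M. weighted_sup T (\<lambda>t x. v t x \<omega> - v' t x \<omega>) \<le> 2 * weighted_sup T (\<lambda>t x. ?D t x \<omega>) + 2 * weighted_sup T (\<lambda>t x. ?Z t x \<omega>)"
      using Y(2) Y'(2) AE_space
    proof eventually_elim
      case (elim \<omega>)
      have "weighted_sup T (\<lambda>t x. v t x \<omega> - v' t x \<omega>) = weighted_sup T (\<lambda>t x. ?D t x \<omega> + ?Z t x \<omega>)"
      proof (rule weighted_sup_cong)
        fix t :: real and x assume t: "0 \<le> t"
        show "v t x \<omega> - v' t x \<omega> = ?D t x \<omega> + ?Z t x \<omega>"
          using elim t drift_diff[OF l2_process_continuous[OF u elim(3)] l2_process_continuous[OF u' elim(3)] t, of \<kappa> x] by simp
      qed
      thus ?case by (simp add: weighted_sup_add_le)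
    qed
  qed
  also have "\<dots> \<le> 2 * (ennreal (\<kappa>\<^sup>2 * T) * (2 * K + 2) * mean_square T ?d) + 2 * (64 * ennreal noise_variance * mean_square T ?d)"
    by (intro add_mono mult_left_mono l2_sup_norm_drift_le l2_sup_norm_ito_diff_le d T Y(1) Y'(1)) auto
  also have "\<dots> = contraction_const T * mean_square T ?d"
    by (simp add: contraction_const_def distrib_right mult.assoc)
  finally show ?thesis .
qed

lemma l2_sup_norm_1_finite: "l2_sup_norm T (\<lambda>_ _ _. 1) < \<top>"
proof -
  have "weighted_sup T (\<lambda>_ _. 1) \<le> (\<integral>\<^sup>+x. ennreal (\<mu> x) * 1 \<partial>count_space UNIV)"
    unfolding weighted_sup_def by (intro nn_integral_mono mult_left_mono psup_least) auto
  also have "\<dots> < \<top>"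
    using mu_summable summable_on_iff_nn_integral[of \<mu>] mu_nonneg by simp
  finally show ?thesis by (simp add: l2_sup_norm_def emeasure_space_1)
qed

lemma l2_process_1: "l2_process (\<lambda>_ _ _. 1)"
proof -
  have "weighted_sup T (\<lambda>_ _. 1) < \<top>" for T using l2_sup_norm_1_finite[of T] by (simp add: l2_sup_norm_def emeasure_space_1)
  thus ?thesis by (auto simp: l2_process_def continuous_adapted_def)
qed

text \<open>Finiteness of the stochastic part comes from comparison with the zero integrand. The sum
  has finite expected norm, and a modification on a null set makes its norm finite on every path, so
  that the next step can start from it.\<close>

lemma ex_picard_step:
  assumes u: "l2_process u" and fin: "\<And>T. 0 \<le> T \<Longrightarrow> l2_sup_norm T u < \<top>"
  shows "\<exists>v. l2_process v \<and> (\<forall>T\<ge>0. l2_sup_norm T v < \<top>) \<and> picard_step u v"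
proof -
  have ca: "continuous_adapted (\<lambda>t. u t x)" for x using u by (simp add: l2_process_def)
  have "\<exists>Y. noise.ito_process x (\<lambda>t. u t x) Y" for x
  proof (rule noise.ex_ito_process[OF continuous_imp_left_continuous_adapted[OF ca]])
    fix T :: real assume T: "0 \<le> T"
    show "\<exists>D\<in>borel_measurable M. (\<integral>\<^sup>+\<omega>. D \<omega> \<partial>M) < \<top> \<and> (\<forall>\<omega>\<in>space M. psup T (\<lambda>t. u t x \<omega>) \<le> D \<omega>)"
      using measurable_psup[OF ca T] l2_sup_norm_coordinate_finite[OF ca T fin[OF T]] by (intro bexI[of _ "\<lambda>\<omega>. psup T (\<lambda>t. u t x \<omega>)"]) auto
  qed
  hence "\<forall>x. \<exists>Y. noise.ito_process x (\<lambda>t. u t x) Y" by blast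
  from choice[OF this] obtain Y0 where "\<And>x. noise.ito_process x (\<lambda>t. u t x) (Y0 x)" by blast
  then obtain Y where Y: "\<And>x. noise.ito_process x (\<lambda>t. u t x) (\<lambda>t. Y t x)"
    by (intro that[of "\<lambda>t x. Y0 x t"]) simp
  have caY: "continuous_adapted (\<lambda>t. Y t x)" for x using Y[of x] by (simp add: noise.ito_process_def)
  let ?D = "\<lambda>t x \<omega>. drift \<kappa> (\<lambda>s y. u s y \<omega>) t x"
  have caD: "continuous_adapted (\<lambda>t. ?D t x)" for x by (rule continuous_adapted_drift[OF u])
  let ?v = "\<lambda>t x \<omega>. 1 + ?D t x \<omega> + Y t x \<omega>"
  have ca1: "continuous_adapted (\<lambda>t \<omega>. 1 + ?D t x \<omega>)" for x
    using caD[of x] by (auto simp: continuous_adapted_def intro!: continuous_intros)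
  have cav: "continuous_adapted (\<lambda>t. ?v t x)" for x
    using caD[of x] caY[of x] by (auto simp: continuous_adapted_def intro!: continuous_intros borel_measurable_add)
  have finv: "l2_sup_norm T ?v < \<top>" if T: "0 \<le> T" for T
  proof -
    have ms: "mean_square T u < \<top>"
      using fin[OF T] by (intro le_less_trans[OF mean_square_le'[OF T]]) (simp add: ennreal_mult_less_top)
    have D: "l2_sup_norm T ?D < \<top>"
      using ms K_finite by (intro le_less_trans[OF l2_sup_norm_drift_le[OF u T]]) (simp add: ennreal_mult_less_top)
    have Yf: "l2_sup_norm T Y < \<top>"
    proof -
      have "l2_sup_norm T Y \<le> 64 * ennreal noise_variance * mean_square T u"
        using l2_sup_norm_ito_diff_le[of u Y "\<lambda>_ _ _. 0" "\<lambda>_ _ _. 0", OF Y noise.ito_process_0 T] by simp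
      also have "\<dots> < \<top>" using ms by (simp add: ennreal_mult_less_top)
      finally show ?thesis .
    qed
    have "l2_sup_norm T (\<lambda>t x \<omega>. 1 + ?D t x \<omega>) \<le> 2 * l2_sup_norm T (\<lambda>_ _ _. 1) + 2 * l2_sup_norm T ?D"
      using l2_process_1 by (intro l2_sup_norm_add_le caD T AE_I2 weighted_sup_add_le) (simp add: l2_process_def)
    also have "\<dots> < \<top>" using D l2_sup_norm_1_finite by (simp add: ennreal_mult_less_top)
    finally have D1: "l2_sup_norm T (\<lambda>t x \<omega>. 1 + ?D t x \<omega>) < \<top>" .
    have "l2_sup_norm T ?v \<le> 2 * l2_sup_norm T (\<lambda>t x \<omega>. 1 + ?D t x \<omega>) + 2 * l2_sup_norm T Y"
      by (intro l2_sup_norm_add_le ca1 caY T AE_I2 weighted_sup_add_le)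
    also have "\<dots> < \<top>" using D1 Yf by (simp add: ennreal_mult_less_top)
    finally show ?thesis .
  qed
  obtain v where v: "l2_process v" "AE \<omega> in M. \<forall>t x. v t x \<omega> = ?v t x \<omega>"
    using ex_l2_process_modification[OF cav finv] by blast
  have "l2_sup_norm T v = l2_sup_norm T ?v" for T
    unfolding l2_sup_norm_def using v(2) by (intro nn_integral_cong_AE) (auto elim!: eventually_mono)
  moreover have "picard_step u v"
    unfolding picard_step_def using Y v(2) by (intro exI[of _ Y]) (auto elim!: eventually_mono)
  ultimately show ?thesis using v(1) finv by auto
qed

end

lemma ennreal_suminf_tail_tendsto_0:
  fixes f :: "nat \<Rightarrow> ennreal"
  assumes fin: "(\<Sum>k. f k) < \<top>"
  shows "(\<lambda>n. \<Sum>k. f (n + k)) \<longlonglongrightarrow> 0"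
proof -
  have sums: "(\<lambda>n. \<Sum>k<n. f k) \<longlonglongrightarrow> (\<Sum>k. f k)" using summableI[of f] by (simp add: summable_LIMSEQ)
  have "(\<lambda>n. (\<Sum>k. f k) - (\<Sum>k<n. f k)) \<longlonglongrightarrow> (\<Sum>k. f k) - (\<Sum>k. f k)"
    using fin by (intro tendsto_diff_ennreal tendsto_const sums) auto
  moreover have "(\<Sum>k. f k) - (\<Sum>k<n. f k) = (\<Sum>k. f (n + k))" for n
  proof -
    have le: "(\<Sum>k<n. f k) \<le> (\<Sum>k. f k)" by (rule sum_le_suminf[OF summableI]) auto
    have "(\<Sum>k. f k) = (\<Sum>k. f (n + k)) + (\<Sum>k<n. f k)"
      using suminf_offset[OF summableI, of f n] by (simp add: add.commute)
    thus ?thesis using le fin by (metis ennreal_add_diff_cancel_right infinity_ennreal_def less_top neq_top_trans)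
  qed
  ultimately show ?thesis using fin by (simp add: ennreal_minus_eq_0)
qed

section \<open>The Picard sequence and its limit\<close>

context anderson
begin

lemma ex_picard_sequence:
  "\<exists>u. \<forall>n. (l2_process (u n) \<and> (\<forall>T\<ge>0. l2_sup_norm T (u n) < \<top>)) \<and> picard_step (u n) (u (Suc n))"
proof (rule dependent_nat_choice)
  show "\<exists>u. l2_process u \<and> (\<forall>T\<ge>0. l2_sup_norm T u < \<top>)" using l2_process_1 l2_sup_norm_1_finite by blast
next
  fix u and n :: nat assume "l2_process u \<and> (\<forall>T\<ge>0. l2_sup_norm T u < \<top>)"
  thus "\<exists>v. (l2_process v \<and> (\<forall>T\<ge>0. l2_sup_norm T v < \<top>)) \<and> picard_step u v"
    using ex_picard_step[of u] by blast
qed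

lemma l2_sup_norm_minus_commute: "l2_sup_norm T (\<lambda>t x \<omega>. u t x \<omega> - v t x \<omega>) = l2_sup_norm T (\<lambda>t x \<omega>. v t x \<omega> - u t x \<omega>)"
  unfolding l2_sup_norm_def weighted_sup_def
  by (intro nn_integral_cong arg_cong2[where f="(*)"] refl psup_minus_commute)

lemma l2_sup_norm_triangle:
  assumes "\<And>x. continuous_adapted (\<lambda>t. u t x)" "\<And>x. continuous_adapted (\<lambda>t. v t x)" "\<And>x. continuous_adapted (\<lambda>t. z t x)" "0 \<le> T"
  shows "l2_sup_norm T (\<lambda>t x \<omega>. u t x \<omega> - z t x \<omega>) \<le>
    2 * l2_sup_norm T (\<lambda>t x \<omega>. u t x \<omega> - v t x \<omega>) + 2 * l2_sup_norm T (\<lambda>t x \<omega>. v t x \<omega> - z t x \<omega>)"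
proof (intro l2_sup_norm_add_le continuous_adapted_diff assms AE_I2)
  fix \<omega>
  show "weighted_sup T (\<lambda>t x. u t x \<omega> - z t x \<omega>) \<le> 2 * weighted_sup T (\<lambda>t x. u t x \<omega> - v t x \<omega>) + 2 * weighted_sup T (\<lambda>t x. v t x \<omega> - z t x \<omega>)"
    using weighted_sup_add_le[of T "\<lambda>t x. u t x \<omega> - v t x \<omega>" "\<lambda>t x. v t x \<omega> - z t x \<omega>"] by simp
qed

text \<open>The factorial from \<open>iterated_integral_bound\<close> absorbs the weights 2^k,
  leaving an exponential series in 2 C T.\<close>

lemma picard_sequence_summable:
  assumes u: "\<And>n. l2_process (u n)" and fin: "\<And>n T. 0 \<le> T \<Longrightarrow> l2_sup_norm T (u n) < \<top>"
    and step: "\<And>n. picard_step (u n) (u (Suc n))" and T: "0 \<le> T"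
  shows "(\<Sum>k. 2 ^ k * l2_sup_norm T (\<lambda>t x \<omega>. u (Suc k) t x \<omega> - u k t x \<omega>)) < \<top>"
proof -
  let ?N = "\<lambda>k t. l2_sup_norm t (\<lambda>t x \<omega>. u (Suc k) t x \<omega> - u k t x \<omega>)"
  define c where "c = enn2real (?N 0 T)"
  define C where "C = enn2real (contraction_const T)"
  have ca: "continuous_adapted (\<lambda>t. u n t x)" for n x using u[of n] by (simp add: l2_process_def)
  have "?N 0 T \<le> 2 * l2_sup_norm T (u (Suc 0)) + 2 * l2_sup_norm T (u 0)"
    by (intro l2_sup_norm_add_le ca T AE_I2 weighted_sup_diff_le)
  also have "\<dots> < \<top>" using fin[OF T] by (simp add: ennreal_mult_less_top)
  finally have c: "?N 0 T = ennreal c" by (simp add: c_def)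
  have C: "contraction_const T = ennreal C" using contraction_const_finite[of T] by (simp add: C_def)
  have le: "?N k T \<le> ennreal (c * (C * T) ^ k / fact k)" for k
  proof (rule iterated_integral_bound[where g="?N" and T=T])
    fix t :: real assume t: "0 \<le> t" "t \<le> T"
    show "?N 0 t \<le> ennreal c" unfolding c[symmetric] by (rule l2_sup_norm_mono[OF t(2)])
    fix n
    have "?N (Suc n) t \<le> contraction_const t * mean_square t (\<lambda>t x \<omega>. u (Suc n) t x \<omega> - u n t x \<omega>)"
      by (rule picard_step_contraction[OF u u step step t(1)])
    also have "\<dots> \<le> contraction_const T * (\<integral>\<^sup>+s\<in>{0..t}. ?N n s \<partial>lborel)"
      by (intro mult_mono contraction_const_mono t mean_square_le) auto
    finally show "?N (Suc n) t \<le> ennreal C * (\<integral>\<^sup>+s\<in>{0..t}. ?N n s \<partial>lborel)" unfolding C .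
  qed (use T in \<open>auto simp: c_def C_def\<close>)
  have "(\<Sum>k. 2 ^ k * ?N k T) \<le> (\<Sum>k. ennreal (c * ((2 * (C * T)) ^ k / fact k)))"
  proof (intro suminf_le summableI)
    fix k
    have "2 ^ k * ?N k T \<le> ennreal (2 ^ k) * ennreal (c * (C * T) ^ k / fact k)"
      unfolding ennreal_2_power by (intro mult_left_mono le) auto
    also have "\<dots> = ennreal (c * ((2 * (C * T)) ^ k / fact k))"
      using T by (subst ennreal_mult[symmetric]) (auto simp: c_def C_def power_mult_distrib)
    finally show "2 ^ k * ?N k T \<le> ennreal (c * ((2 * (C * T)) ^ k / fact k))" .
  qed
  also have "\<dots> < \<top>"
  proof -
    have "summable (\<lambda>k. c * ((2 * (C * T)) ^ k / fact k))"
      using summable_exp[of "2 * (C * T)"] by (intro summable_mult) (simp add: divide_inverse mult.commute)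
    moreover have "0 \<le> c * ((2 * (C * T)) ^ k / fact k)" for k using T by (simp add: c_def C_def)
    ultimately show ?thesis unfolding less_top[symmetric] by (rule ennreal_suminf_neq_top)
  qed
  finally show ?thesis .
qed

text \<open>At one site the increments are bounded by those of the whole field divided by \<mu> x,
  so the one-site limits exist. Their tail bounds are then summed over the sites, which gives
  convergence in \<open>l2_sup_norm\<close>.\<close>

lemma ex_l2_process_limit:
  assumes u: "\<And>n. l2_process (u n)" and fin: "\<And>T. 0 \<le> T \<Longrightarrow> l2_sup_norm T (u 0) < \<top>"
    and sum: "\<And>T. 0 \<le> T \<Longrightarrow> (\<Sum>k. 2 ^ k * l2_sup_norm T (\<lambda>t x \<omega>. u (Suc k) t x \<omega> - u k t x \<omega>)) < \<top>"
  shows "\<exists>v. l2_process v \<and> (\<forall>T\<ge>0. l2_sup_norm T v < \<top>) \<and>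
    (\<forall>T\<ge>0. (\<lambda>n. l2_sup_norm T (\<lambda>t x \<omega>. v t x \<omega> - u n t x \<omega>)) \<longlonglongrightarrow> 0)"
proof -
  let ?N = "\<lambda>T k. l2_sup_norm T (\<lambda>t x \<omega>. u (Suc k) t x \<omega> - u k t x \<omega>)"
  let ?P = "\<lambda>T k x. \<integral>\<^sup>+\<omega>. psup T (\<lambda>t. u (Suc k) t x \<omega> - u k t x \<omega>) \<partial>M"
  have ca: "continuous_adapted (\<lambda>t. u n t x)" for n x using u[of n] by (simp add: l2_process_def)
  have P_le: "ennreal (\<mu> x) * ?P T k x \<le> ?N T k" if "0 \<le> T" for T k x
    by (rule l2_sup_norm_coordinate[OF continuous_adapted_diff[OF ca ca] that])
  have "\<exists>z. continuous_adapted z \<and> (\<forall>T\<ge>0. \<forall>n. (\<integral>\<^sup>+\<omega>. psup T (\<lambda>t. z t \<omega> - u n t x \<omega>) \<partial>M) \<le> 2 * (\<Sum>k. 2 ^ k * ?P T (n + k) x))" for x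
  proof (rule ex_uniform_limit_process[OF ca])
    fix T :: real assume T: "0 \<le> T"
    have "ennreal (\<mu> x) * (\<Sum>k. 2 ^ k * ?P T k x) = (\<Sum>k. 2 ^ k * (ennreal (\<mu> x) * ?P T k x))"
      by (subst ennreal_suminf_cmult[symmetric]) (simp add: mult.left_commute)
    also have "\<dots> \<le> (\<Sum>k. 2 ^ k * ?N T k)" by (intro suminf_le mult_left_mono P_le T summableI) auto
    also have "\<dots> < \<top>" by (rule sum[OF T])
    finally show "(\<Sum>k. 2 ^ k * ?P T k x) < \<top>"
      using mu_pos[of x] by (auto simp: ennreal_mult_less_top ennreal_eq_0_iff not_less)
  qed
  hence "\<forall>x. \<exists>z. continuous_adapted z \<and> (\<forall>T\<ge>0. \<forall>n. (\<integral>\<^sup>+\<omega>. psup T (\<lambda>t. z t \<omega> - u n t x \<omega>) \<partial>M) \<le> 2 * (\<Sum>k. 2 ^ k * ?P T (n + k) x))"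
    by blast
  from choice[OF this] obtain z0 where z0: "\<And>x. continuous_adapted (z0 x)"
    "\<And>x T n. 0 \<le> T \<Longrightarrow> (\<integral>\<^sup>+\<omega>. psup T (\<lambda>t. z0 x t \<omega> - u n t x \<omega>) \<partial>M) \<le> 2 * (\<Sum>k. 2 ^ k * ?P T (n + k) x)"
    by blast
  define z where "z t x = z0 x t" for t x
  have caz: "continuous_adapted (\<lambda>t. z t x)" for x using z0(1)[of x] by (simp add: z_def)
  have tail: "l2_sup_norm T (\<lambda>t x \<omega>. z t x \<omega> - u n t x \<omega>) \<le> 2 * (\<Sum>k. 2 ^ (n + k) * ?N T (n + k))" if T: "0 \<le> T" for T n
  proof -
    have "l2_sup_norm T (\<lambda>t x \<omega>. z t x \<omega> - u n t x \<omega>) = (\<integral>\<^sup>+x. ennreal (\<mu> x) * (\<integral>\<^sup>+\<omega>. psup T (\<lambda>t. z t x \<omega> - u n t x \<omega>) \<partial>M) \<partial>count_space UNIV)"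
      by (rule l2_sup_norm_eq[OF continuous_adapted_diff[OF caz ca] T])
    also have "\<dots> \<le> (\<integral>\<^sup>+x. 2 * (\<Sum>k. 2 ^ k * (ennreal (\<mu> x) * ?P T (n + k) x)) \<partial>count_space UNIV)"
    proof (rule nn_integral_mono)
      fix x
      have "ennreal (\<mu> x) * (\<integral>\<^sup>+\<omega>. psup T (\<lambda>t. z t x \<omega> - u n t x \<omega>) \<partial>M) \<le> ennreal (\<mu> x) * (2 * (\<Sum>k. 2 ^ k * ?P T (n + k) x))"
        unfolding z_def by (intro mult_left_mono z0(2) T) auto
      also have "\<dots> = 2 * (\<Sum>k. ennreal (\<mu> x) * (2 ^ k * ?P T (n + k) x))"
        by (subst ennreal_suminf_cmult) (simp add: mult.left_commute)
      finally show "ennreal (\<mu> x) * (\<integral>\<^sup>+\<omega>. psup T (\<lambda>t. z t x \<omega> - u n t x \<omega>) \<partial>M) \<le> 2 * (\<Sum>k. 2 ^ k * (ennreal (\<mu> x) * ?P T (n + k) x))"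
        by (simp add: mult.left_commute)
    qed
    also have "\<dots> = 2 * (\<Sum>k. 2 ^ k * (\<integral>\<^sup>+x. ennreal (\<mu> x) * ?P T (n + k) x \<partial>count_space UNIV))"
      by (simp add: nn_integral_cmult nn_integral_suminf)
    also have "\<dots> = 2 * (\<Sum>k. 2 ^ k * ?N T (n + k))"
      by (simp add: l2_sup_norm_eq[OF continuous_adapted_diff[OF ca ca] T])
    \<comment> \<open>The weights are enlarged so that the bound becomes the tail of a series known
      to converge.\<close>
    also have "\<dots> \<le> 2 * (\<Sum>k. 2 ^ (n + k) * ?N T (n + k))"
      by (intro mult_left_mono suminf_le summableI mult_right_mono) (auto intro!: power_increasing)
    finally show ?thesis .
  qed
  have lim: "(\<lambda>n. l2_sup_norm T (\<lambda>t x \<omega>. z t x \<omega> - u n t x \<omega>)) \<longlonglongrightarrow> 0" if T: "0 \<le> T" for T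
  proof (rule tendsto_sandwich[OF _ _ tendsto_const])
    have "(\<lambda>n. 2 * (\<Sum>k. 2 ^ (n + k) * ?N T (n + k))) \<longlonglongrightarrow> 2 * 0"
      by (intro ennreal_tendsto_cmult ennreal_suminf_tail_tendsto_0[where f="\<lambda>k. 2 ^ k * ?N T k"] sum T) simp
    thus "(\<lambda>n. 2 * (\<Sum>k. 2 ^ (n + k) * ?N T (n + k))) \<longlonglongrightarrow> 0" by simp
  qed (use tail[OF T] in auto)
  have finz: "l2_sup_norm T z < \<top>" if T: "0 \<le> T" for T
  proof -
    have "l2_sup_norm T (\<lambda>t x \<omega>. z t x \<omega> - u 0 t x \<omega>) \<le> 2 * (\<Sum>k. 2 ^ k * ?N T k)" using tail[OF T, of 0] by simp
    also have "\<dots> < \<top>" using sum[OF T] by (simp add: ennreal_mult_less_top)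
    finally have *: "l2_sup_norm T (\<lambda>t x \<omega>. z t x \<omega> - u 0 t x \<omega>) < \<top>" .
    have "l2_sup_norm T z \<le> 2 * l2_sup_norm T (\<lambda>t x \<omega>. z t x \<omega> - u 0 t x \<omega>) + 2 * l2_sup_norm T (u 0)"
    proof (intro l2_sup_norm_add_le continuous_adapted_diff caz ca T AE_I2)
      fix \<omega>
      show "weighted_sup T (\<lambda>t x. z t x \<omega>) \<le> 2 * weighted_sup T (\<lambda>t x. z t x \<omega> - u 0 t x \<omega>) + 2 * weighted_sup T (\<lambda>t x. u 0 t x \<omega>)"
        using weighted_sup_add_le[of T "\<lambda>t x. z t x \<omega> - u 0 t x \<omega>" "\<lambda>t x. u 0 t x \<omega>"] by simp
    qed
    also have "\<dots> < \<top>" using * fin[OF T] by (simp add: ennreal_mult_less_top)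
    finally show ?thesis .
  qed
  obtain v where v: "l2_process v" "AE \<omega> in M. \<forall>t x. v t x \<omega> = z t x \<omega>"
    using ex_l2_process_modification[OF caz finz] by blast
  have "l2_sup_norm T v = l2_sup_norm T z" for T
    unfolding l2_sup_norm_def using v(2) by (intro nn_integral_cong_AE) (auto elim!: eventually_mono)
  moreover have "l2_sup_norm T (\<lambda>t x \<omega>. v t x \<omega> - u n t x \<omega>) = l2_sup_norm T (\<lambda>t x \<omega>. z t x \<omega> - u n t x \<omega>)" for T n
    unfolding l2_sup_norm_def using v(2) by (intro nn_integral_cong_AE) (auto elim!: eventually_mono)
  ultimately show ?thesis using v(1) lim finz by auto
qed

lemma l2_sup_norm_0_imp_AE_eq:
  assumes u: "\<And>x. continuous_adapted (\<lambda>t. d t x)" and 0: "\<And>T. 0 \<le> T \<Longrightarrow> l2_sup_norm T d = 0"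
  shows "AE \<omega> in M. \<forall>t\<ge>0. \<forall>x. d t x \<omega> = 0"
proof -
  have "AE \<omega> in M. \<forall>n::nat. weighted_sup (real n) (\<lambda>t x. d t x \<omega>) = 0"
    unfolding AE_all_countable using 0 measurable_weighted_sup[OF u]
    by (auto simp: l2_sup_norm_def nn_integral_0_iff_AE)
  thus ?thesis
  proof eventually_elim
    case (elim \<omega>)
    show ?case
    proof (intro allI impI)
      fix t :: real and x assume t: "0 \<le> t"
      have "ennreal (\<mu> x * (d t x \<omega>)\<^sup>2) \<le> nsq \<mu> (\<lambda>x. d t x \<omega>)" by (rule square_le_nsq)
      also have "\<dots> \<le> weighted_sup (real (nat \<lceil>t\<rceil>)) (\<lambda>t x. d t x \<omega>)"
        using t by (intro nsq_le_weighted_sup[where f="\<lambda>t x. d t x \<omega>"]) linarith+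
      also have "\<dots> = 0" using elim by blast
      finally have "\<mu> x * (d t x \<omega>)\<^sup>2 \<le> 0" by (simp add: ennreal_eq_0_iff)
      thus "d t x \<omega> = 0" using mu_pos[of x] by (auto simp: mult_le_0_iff)
    qed
  qed
qed

text \<open>Instead of passing to the limit inside the equation, one more Picard step v is taken
  from the limit z. The iterate \<open>u (Suc n)\<close> is close to z by convergence and close to v
  by \<open>picard_step_contraction\<close>, hence v = z almost surely.\<close>

lemma ex_picard_fixpoint: "\<exists>u. l2_process u \<and> picard_step u u"
proof -
  obtain u where u: "\<And>n. l2_process (u n)" "\<And>n T. 0 \<le> T \<Longrightarrow> l2_sup_norm T (u n) < \<top>" "\<And>n. picard_step (u n) (u (Suc n))"
    using ex_picard_sequence by blast
  obtain z where z: "l2_process z" "\<And>T. 0 \<le> T \<Longrightarrow> l2_sup_norm T z < \<top>"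
    "\<And>T. 0 \<le> T \<Longrightarrow> (\<lambda>n. l2_sup_norm T (\<lambda>t x \<omega>. z t x \<omega> - u n t x \<omega>)) \<longlonglongrightarrow> 0"
    using ex_l2_process_limit[where u=u, OF u(1,2) picard_sequence_summable[where u=u, OF u]] by blast
  obtain v where v: "l2_process v" "picard_step z v" using ex_picard_step[OF z(1,2)] by blast
  have ca: "l2_process u \<Longrightarrow> continuous_adapted (\<lambda>t. u t x)" for u x by (simp add: l2_process_def)
  have "l2_sup_norm T (\<lambda>t x \<omega>. v t x \<omega> - z t x \<omega>) = 0" if T: "0 \<le> T" for T
  proof -
    let ?e = "\<lambda>n. l2_sup_norm T (\<lambda>t x \<omega>. z t x \<omega> - u n t x \<omega>)"
    let ?c = "contraction_const T * ennreal T"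
    have le: "l2_sup_norm T (\<lambda>t x \<omega>. v t x \<omega> - z t x \<omega>) \<le> 2 * (?c * ?e n) + 2 * ?e (Suc n)" for n
    proof -
      have "l2_sup_norm T (\<lambda>t x \<omega>. v t x \<omega> - z t x \<omega>) \<le>
          2 * l2_sup_norm T (\<lambda>t x \<omega>. v t x \<omega> - u (Suc n) t x \<omega>) + 2 * l2_sup_norm T (\<lambda>t x \<omega>. u (Suc n) t x \<omega> - z t x \<omega>)"
        by (intro l2_sup_norm_triangle ca v u z T)
      also have "l2_sup_norm T (\<lambda>t x \<omega>. v t x \<omega> - u (Suc n) t x \<omega>) \<le> contraction_const T * mean_square T (\<lambda>t x \<omega>. z t x \<omega> - u n t x \<omega>)"
        by (rule picard_step_contraction[OF z(1) u(1) v(2) u(3) T])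
      also have "\<dots> \<le> contraction_const T * (ennreal T * ?e n)"
        by (intro mult_left_mono mean_square_le' T) auto
      finally show ?thesis
        by (simp add: l2_sup_norm_minus_commute[of T "u (Suc n)" z] mult.assoc add_mono mult_left_mono)
    qed
    have "(\<lambda>n. 2 * (?c * ?e n) + 2 * ?e (Suc n)) \<longlonglongrightarrow> 2 * (?c * 0) + 2 * 0"
      using contraction_const_finite[of T]
      by (intro tendsto_add ennreal_tendsto_cmult z(3) T LIMSEQ_Suc) (auto simp: ennreal_mult_less_top)
    from LIMSEQ_le_const[OF this exI[of _ 0]] le have "l2_sup_norm T (\<lambda>t x \<omega>. v t x \<omega> - z t x \<omega>) \<le> 2 * (?c * 0) + 2 * 0"
      by blast
    thus ?thesis by simp
  qed
  hence eq: "AE \<omega> in M. \<forall>t\<ge>0. \<forall>x. v t x \<omega> - z t x \<omega> = 0"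
    by (intro l2_sup_norm_0_imp_AE_eq continuous_adapted_diff ca v z)
  obtain Y where Y: "\<And>x. noise.ito_process x (\<lambda>t. z t x) (\<lambda>t. Y t x)"
    "AE \<omega> in M. \<forall>t\<ge>0. \<forall>x. v t x \<omega> = 1 + drift \<kappa> (\<lambda>s y. z s y \<omega>) t x + Y t x \<omega>"
    using v(2) unfolding picard_step_def by blast
  from eq Y(2) have "AE \<omega> in M. \<forall>t\<ge>0. \<forall>x. z t x \<omega> = 1 + drift \<kappa> (\<lambda>s y. z s y \<omega>) t x + Y t x \<omega>"
    by eventually_elim simp
  thus ?thesis using z(1) Y(1) unfolding picard_step_def by blast
qed

lemma measurable_W: "0 \<le> t \<Longrightarrow> W t x \<in> borel_measurable M"
  using noise by (simp add: noise_field_def)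

lemma ex_anderson_solution: "\<exists>u. anderson_solution M F W \<kappa> a \<mu> u"
proof -
  obtain u where u: "l2_process u" "picard_step u u" using ex_picard_fixpoint by blast
  obtain Y where Y: "\<And>x. noise.ito_process x (\<lambda>t. u t x) (\<lambda>t. Y t x)"
    "AE \<omega> in M. \<forall>t\<ge>0. \<forall>x. u t x \<omega> = 1 + drift \<kappa> (\<lambda>s y. u s y \<omega>) t x + Y t x \<omega>"
    using u(2) unfolding picard_step_def by blast
  have ca: "continuous_adapted (\<lambda>t. u t x)" for x using u(1) by (simp add: l2_process_def)
  have l2: "\<forall>\<omega>\<in>space M. \<forall>t\<ge>0. (\<lambda>x. u t x \<omega>) \<in> l2w \<mu>"
    using l2_process_continuous[OF u(1)] by (auto simp: l2_continuous_def)
  moreover have "\<forall>\<omega>\<in>space M. \<forall>t\<ge>0. ((\<lambda>s. l2w_norm \<mu> (\<lambda>x. u s x \<omega> - u t x \<omega>)) \<longlongrightarrow> 0) (at t within {0..})"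
  proof
    fix \<omega> assume \<omega>: "\<omega> \<in> space M"
    show "\<forall>t\<ge>0. ((\<lambda>s. l2w_norm \<mu> (\<lambda>x. u s x \<omega> - u t x \<omega>)) \<longlongrightarrow> 0) (at t within {0..})"
      using l2_process_continuous[OF u(1) \<omega>] l2_continuous_iff_norm[of "\<lambda>t x. u t x \<omega>"] l2 \<omega> by blast
  qed
  moreover have "\<forall>t\<ge>0. \<forall>x. u t x \<in> borel_measurable (F t)" using ca by (auto simp: continuous_adapted_def)
  moreover have "\<forall>t\<ge>0. \<forall>x. \<exists>J. ito_integral M F (\<lambda>s. W s x) (\<lambda>s. u s x) t J \<and>
      (AE \<omega> in M. u t x \<omega> = 1 + (LINT s:{0..t}|lborel. \<kappa> * generator a (\<lambda>y. u s y \<omega>) x) + J \<omega>)"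
  proof (intro allI impI exI conjI)
    fix t :: real and x assume t: "0 \<le> t"
    have J: "ito_integral M F (continuous_noise x) (\<lambda>s. u s x) t (Y t x)"
      by (rule noise.ito_process_imp_ito_integral[OF Y(1) continuous_imp_left_continuous_adapted[OF ca] t])
    have "AE \<omega> in M. continuous_noise x s \<omega> = W s x \<omega>" if "0 \<le> s" for s
      using continuous_noise_AE[OF that, of x] by eventually_elim simp
    thus "ito_integral M F (\<lambda>s. W s x) (\<lambda>s. u s x) t (Y t x)"
      using noise.measurable_X measurable_W by (intro ito_integral_AE_cong[OF J t]) auto
    show "AE \<omega> in M. u t x \<omega> = 1 + (LINT s:{0..t}|lborel. \<kappa> * generator a (\<lambda>y. u s y \<omega>) x) + Y t x \<omega>"
      using Y(2) by eventually_elim (use t in \<open>simp add: drift_def\<close>)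
  qed
  ultimately show ?thesis unfolding anderson_solution_def by blast
qed

end

section \<open>Uniqueness\<close>

text \<open>Fatou's lemma for the sum over sites, each term converging by continuity.\<close>

lemma (in bounded_generator) nsq_lower_semicontinuous:
  assumes f: "\<And>x. continuous_on {0..} (\<lambda>t. f t x)" and r: "r \<longlonglongrightarrow> t" "\<And>k. 0 \<le> r k" "0 \<le> t"
    and le: "\<And>k. nsq \<mu> (f (r k)) \<le> c"
  shows "nsq \<mu> (f t) \<le> c"
proof -
  have "nsq \<mu> (f t) = (\<integral>\<^sup>+x. liminf (\<lambda>k. ennreal (\<mu> x * (f (r k) x)\<^sup>2)) \<partial>count_space UNIV)"
    unfolding nsq_def
  proof (rule nn_integral_cong)
    fix x
    have "(\<lambda>k. f (r k) x) \<longlonglongrightarrow> f t x"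
      using r by (intro continuous_on_tendsto_compose[OF f r(1)]) auto
    hence "(\<lambda>k. ennreal (\<mu> x * (f (r k) x)\<^sup>2)) \<longlonglongrightarrow> ennreal (\<mu> x * (f t x)\<^sup>2)"
      by (intro tendsto_ennrealI tendsto_intros)
    thus "ennreal (\<mu> x * (f t x)\<^sup>2) = liminf (\<lambda>k. ennreal (\<mu> x * (f (r k) x)\<^sup>2))"
      by (simp add: lim_imp_Liminf)
  qed
  also have "\<dots> \<le> liminf (\<lambda>k. nsq \<mu> (f (r k)))"
    unfolding nsq_def by (rule nn_integral_liminf) simp
  also have "\<dots> \<le> liminf (\<lambda>k. c)" by (intro Liminf_mono always_eventually allI le)
  finally show ?thesis by (simp add: Liminf_const)
qed

lemma ex_rational_sequence_below:
  fixes t :: real assumes "0 < t"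
  shows "\<exists>r. r \<longlonglongrightarrow> t \<and> (\<forall>k. r k \<in> \<rat> \<and> 0 \<le> r k \<and> r k < t)"
proof -
  have "\<exists>q\<in>\<rat>. max 0 (t - 1 / real (Suc k)) < q \<and> q < t" for k
    using assms by (intro Rats_dense_in_real) simp
  hence "\<forall>k. \<exists>q. q \<in> \<rat> \<and> max 0 (t - 1 / real (Suc k)) < q \<and> q < t" by blast
  from choice[OF this] obtain r where r: "\<And>k. r k \<in> \<rat> \<and> max 0 (t - 1 / real (Suc k)) < r k \<and> r k < t" by blast
  have lim: "(\<lambda>k. t - 1 / real (Suc k)) \<longlonglongrightarrow> t"
    using tendsto_diff[OF tendsto_const[of t] LIMSEQ_inverse_real_of_nat] by (simp add: inverse_eq_divide)
  have "r \<longlonglongrightarrow> t"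
    by (rule tendsto_sandwich[OF _ _ lim tendsto_const]) (use r in \<open>auto intro!: always_eventually less_imp_le\<close>)
  thus ?thesis using r by (intro exI[of _ r]) (auto intro: less_imp_le)
qed

section \<open>Truncation of the difference of two solutions\<close>

context anderson
begin

definition l2_adapted :: "(real \<Rightarrow> int ^ 'd \<Rightarrow> 'w \<Rightarrow> real) \<Rightarrow> bool" where
  "l2_adapted d \<longleftrightarrow> (\<forall>\<omega>\<in>space M. l2_continuous (\<lambda>t x. d t x \<omega>)) \<and> (\<forall>t\<ge>0. \<forall>x. d t x \<in> borel_measurable (F t))"

lemma l2_adapted_continuous_adapted: "l2_adapted d \<Longrightarrow> continuous_adapted (\<lambda>t. d t x)"
  unfolding l2_adapted_def continuous_adapted_def by (auto intro: l2_continuous_coordinate)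

lemma l2_adapted_diff: "l2_adapted u \<Longrightarrow> l2_adapted v \<Longrightarrow> l2_adapted (\<lambda>t x \<omega>. u t x \<omega> - v t x \<omega>)"
  unfolding l2_adapted_def by (auto intro!: l2_continuous_diff borel_measurable_diff)

text \<open>
  Testing only rational times strictly before \<open>s\<close> makes this event both measurable at time \<open>s\<close> and
  left-continuous in \<open>s\<close>; lower semicontinuity of the norm extends the bound to all of \<open>[0, s]\<close>.
\<close>

definition controlled :: "(real \<Rightarrow> int ^ 'd \<Rightarrow> 'w \<Rightarrow> real) \<Rightarrow> nat \<Rightarrow> real \<Rightarrow> 'w \<Rightarrow> bool" where
  "controlled d n s \<omega> \<longleftrightarrow> (\<forall>r\<in>{r\<in>\<rat>. 0 \<le> r \<and> (r < s \<or> r = 0)}. nsq \<mu> (\<lambda>x. d r x \<omega>) \<le> of_nat n)"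

text \<open>After loss of control the value is 0, not frozen. At each time the process is then
  either d or 0, so an estimate of d on the event of control is an estimate of the truncation
  everywhere.\<close>

definition truncated :: "(real \<Rightarrow> int ^ 'd \<Rightarrow> 'w \<Rightarrow> real) \<Rightarrow> nat \<Rightarrow> real \<Rightarrow> int ^ 'd \<Rightarrow> 'w \<Rightarrow> real" where
  "truncated d n s x \<omega> = (if controlled d n s \<omega> then d s x \<omega> else 0)"

lemma controlled_mono: "controlled d n t \<omega> \<Longrightarrow> s \<le> t \<Longrightarrow> controlled d n s \<omega>"
  by (auto simp: controlled_def)

lemma controlled_imp_le:
  assumes d: "l2_adapted d" and \<omega>: "\<omega> \<in> space M" and c: "controlled d n s \<omega>" and r: "0 \<le> r" "r \<le> s"
  shows "nsq \<mu> (\<lambda>x. d r x \<omega>) \<le> of_nat n"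
proof (cases "r = 0")
  case True thus ?thesis using c by (auto simp: controlled_def)
next
  case False
  then obtain q where q: "q \<longlonglongrightarrow> r" "\<And>k. q k \<in> \<rat> \<and> 0 \<le> q k \<and> q k < r"
    using ex_rational_sequence_below[of r] r by auto
  show ?thesis
  proof (rule nsq_lower_semicontinuous[where f="\<lambda>t x. d t x \<omega>", OF _ q(1) _ r(1)])
    show "continuous_on {0..} (\<lambda>t. d t x \<omega>)" for x
      using l2_adapted_continuous_adapted[OF d, of x] \<omega> by (simp add: continuous_adapted_def)
    show "nsq \<mu> (\<lambda>x. d (q k) x \<omega>) \<le> of_nat n" for k
      using c q(2)[of k] r by (auto simp: controlled_def)
  qed (use q in auto)
qed

lemma measurable_nsq: "(\<And>x. f x \<in> borel_measurable N) \<Longrightarrow> (\<lambda>\<omega>. nsq \<mu> (\<lambda>x. f x \<omega>)) \<in> borel_measurable N"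
  unfolding nsq_def by (intro borel_measurable_nn_integral_countable) measurable

lemma controlled_sets:
  assumes d: "l2_adapted d" and s: "0 \<le> s"
  shows "{\<omega> \<in> space M. controlled d n s \<omega>} \<in> sets (F s)"
proof -
  let ?R = "{r\<in>\<rat>. 0 \<le> r \<and> (r < s \<or> r = 0)}"
  have "countable ?R" by (rule countable_subset[OF _ countable_rat]) auto
  moreover have "{\<omega> \<in> space (F s). nsq \<mu> (\<lambda>x. d r x \<omega>) \<le> of_nat n} \<in> sets (F s)" if "r \<in> ?R" for r
  proof -
    have "(\<lambda>\<omega>. nsq \<mu> (\<lambda>x. d r x \<omega>)) \<in> borel_measurable (F s)"
    proof (rule measurable_nsq)
      fix x
      have r: "0 \<le> r" "r \<le> s" using that s by auto
      have "d r x \<in> borel_measurable (F r)" using d r(1) by (simp add: l2_adapted_def)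
      thus "d r x \<in> borel_measurable (F s)" by (rule borel_measurable_F_mono[OF _ r(2)])
    qed
    thus ?thesis by measurable
  qed
  ultimately have "{\<omega> \<in> space (F s). \<forall>r\<in>?R. nsq \<mu> (\<lambda>x. d r x \<omega>) \<le> of_nat n} \<in> sets (F s)"
    by (intro sets.sets_Collect_countable_All') auto
  thus ?thesis by (simp add: space_F controlled_def)
qed

text \<open>A violation at a rational time r < t is seen by every s between r and t, so control
  cannot be lost exactly at t without having been lost shortly before.\<close>

lemma eventually_controlled_at_left:
  assumes t: "0 < t" shows "\<forall>\<^sub>F s in at_left t. controlled d n s \<omega> = controlled d n t \<omega>"
proof (cases "controlled d n t \<omega>")
  case True
  thus ?thesis using controlled_mono[OF True] by (auto simp: eventually_at_filter intro!: always_eventually)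
next
  case False
  then obtain r where r: "r \<in> \<rat>" "0 \<le> r" "r < t \<or> r = 0" "\<not> nsq \<mu> (\<lambda>x. d r x \<omega>) \<le> of_nat n"
    by (auto simp: controlled_def)
  have rt: "r < t" using r(3) t by auto
  have "\<forall>\<^sub>F s in at_left t. r < s \<and> s < t"
    using rt eventually_at_left_real[of r t] by (auto elim!: eventually_mono)
  thus ?thesis
  proof eventually_elim
    case (elim s)
    hence "\<not> controlled d n s \<omega>" using r unfolding controlled_def by blast
    thus ?case using False by simp
  qed
qed

lemma left_continuous_adapted_truncated:
  assumes d: "l2_adapted d" shows "left_continuous_adapted (\<lambda>s. truncated d n s x)"
  unfolding left_continuous_adapted_def
proof (intro conjI allI ballI impI)
  fix t :: real assume t: "0 \<le> t"
  have "d t x \<in> borel_measurable (F t)" using d t by (simp add: l2_adapted_def)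
  moreover have "{\<omega> \<in> space (F t). controlled d n t \<omega>} \<in> sets (F t)" using controlled_sets[OF d t] by (simp add: space_F)
  ultimately show "truncated d n t x \<in> borel_measurable (F t)"
    unfolding truncated_def by (intro measurable_If) auto
next
  fix \<omega> and t :: real assume \<omega>: "\<omega> \<in> space M" and t: "0 < t"
  have "continuous_on {0..} (\<lambda>t. d t x \<omega>)"
    using l2_adapted_continuous_adapted[OF d, of x] \<omega> by (simp add: continuous_adapted_def)
  hence "continuous_on {0<..} (\<lambda>t. d t x \<omega>)" by (rule continuous_on_subset) auto
  hence "isCont (\<lambda>t. d t x \<omega>) t" using t by (simp add: continuous_on_eq_continuous_at)
  hence "((\<lambda>s. d s x \<omega>) \<longlongrightarrow> d t x \<omega>) (at_left t)" unfolding isCont_def by (rule tendsto_within_subset) simp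
  hence lim: "((\<lambda>s. if controlled d n t \<omega> then d s x \<omega> else 0) \<longlongrightarrow> truncated d n t x \<omega>) (at_left t)"
    by (simp add: truncated_def)
  have "\<forall>\<^sub>F s in at_left t. (if controlled d n t \<omega> then d s x \<omega> else 0) = truncated d n s x \<omega>"
    using eventually_controlled_at_left[OF t, of d n \<omega>] by eventually_elim (simp add: truncated_def)
  from Lim_transform_eventually[OF lim this]
  show "((\<lambda>s. truncated d n s x \<omega>) \<longlongrightarrow> truncated d n t x \<omega>) (at_left t)" .
qed

lemma nsq_truncated_le:
  assumes d: "l2_adapted d" and \<omega>: "\<omega> \<in> space M" and s: "0 \<le> s"
  shows "nsq \<mu> (\<lambda>x. truncated d n s x \<omega>) \<le> of_nat n"
  using controlled_imp_le[OF d \<omega> _ s order_refl] by (cases "controlled d n s \<omega>") (simp_all add: truncated_def nsq_def)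

lemma truncated_eq: "controlled d n t \<omega> \<Longrightarrow> s \<le> t \<Longrightarrow> truncated d n s x \<omega> = d s x \<omega>"
  using controlled_mono by (simp add: truncated_def)

text \<open>One coordinate squared is at most the squared norm divided by \<open>\<mu> x\<close>, so
  a constant majorizes the truncated process, whatever moments d has.\<close>

lemma ex_ito_process_truncated:
  assumes d: "l2_adapted d" shows "\<exists>Y. noise.ito_process x (\<lambda>s. truncated d n s x) Y"
proof (rule noise.ex_ito_process[OF left_continuous_adapted_truncated[OF d]])
  fix T :: real
  have "psup T (\<lambda>t. truncated d n t x \<omega>) \<le> ennreal (real n / \<mu> x)" if \<omega>: "\<omega> \<in> space M" for \<omega>
  proof (rule psup_least)
    fix t :: real assume t: "0 \<le> t"
    have "ennreal (\<mu> x * (truncated d n t x \<omega>)\<^sup>2) \<le> nsq \<mu> (\<lambda>x. truncated d n t x \<omega>)" by (rule square_le_nsq)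
    also have "\<dots> \<le> of_nat n" by (rule nsq_truncated_le[OF d \<omega> t])
    finally have "\<mu> x * (truncated d n t x \<omega>)\<^sup>2 \<le> real n" by (simp add: ennreal_of_nat_eq_real_of_nat)
    thus "ennreal ((truncated d n t x \<omega>)\<^sup>2) \<le> ennreal (real n / \<mu> x)"
      using mu_pos[of x] by (intro ennreal_leI) (simp add: pos_le_divide_eq mult.commute)
  qed
  thus "\<exists>D\<in>borel_measurable M. (\<integral>\<^sup>+\<omega>. D \<omega> \<partial>M) < \<top> \<and> (\<forall>\<omega>\<in>space M. psup T (\<lambda>t. truncated d n t x \<omega>) \<le> D \<omega>)"
    by (intro bexI[of _ "\<lambda>_. ennreal (real n / \<mu> x)"]) (auto simp: emeasure_space_1)
qed

text \<open>Where control holds at time t, the truncation agrees with d on all of [0, t], so by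
  localization d satisfies its equation there with the integral of the truncation. Elsewhere the
  truncation vanishes at t. Hence its mean squared norm, bounded by n, is at most a constant times
  its own time integral, and iterating forces it to 0.\<close>

lemma mean_square_truncated_eq_0:
  assumes d: "l2_adapted d"
    and eq: "\<And>t x. 0 \<le> t \<Longrightarrow> \<exists>J. ito_integral M F (continuous_noise x) (\<lambda>s. d s x) t J \<and>
      (AE \<omega> in M. d t x \<omega> = drift \<kappa> (\<lambda>s y. d s y \<omega>) t x + J \<omega>)"
    and t: "0 \<le> t"
  shows "(\<integral>\<^sup>+\<omega>. nsq \<mu> (\<lambda>x. truncated d n t x \<omega>) \<partial>M) = 0"
proof -
  let ?h = "truncated d n"
  let ?g = "\<lambda>t. \<integral>\<^sup>+\<omega>. nsq \<mu> (\<lambda>x. ?h t x \<omega>) \<partial>M"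
  have "\<forall>x. \<exists>Y. noise.ito_process x (\<lambda>s. ?h s x) Y" using ex_ito_process_truncated[OF d] by blast
  from choice[OF this] obtain Y0 where Y0: "\<And>x. noise.ito_process x (\<lambda>s. ?h s x) (Y0 x)" by blast
  define Y where "Y t x = Y0 x t" for t x
  have Y: "noise.ito_process x (\<lambda>t. ?h t x) (\<lambda>t. Y t x)" for x using Y0[of x] by (simp add: Y_def)
  have caY: "continuous_adapted (\<lambda>t. Y t x)" for x using Y[of x] by (simp add: noise.ito_process_def)
  have j: "jointly_measurable T (\<lambda>s. ?h s x)" if "0 \<le> T" for T x
    by (rule left_continuous_jointly_measurable[OF left_continuous_adapted_truncated[OF d] that])
  have step: "?g t \<le> contraction_const t * mean_square t ?h" if t: "0 \<le> t" for t
  proof -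
    let ?A = "\<lambda>\<omega>. \<integral>\<^sup>+s\<in>{0..t}. nsq \<mu> (\<lambda>x. ?h s x \<omega>) \<partial>lborel"
    let ?c = "ennreal (\<kappa>\<^sup>2 * t) * (2 * K + 2)"
    have AE1: "AE \<omega> in M. controlled d n t \<omega> \<longrightarrow> d t x \<omega> = drift \<kappa> (\<lambda>s y. d s y \<omega>) t x + Y t x \<omega>" for x
    proof -
      obtain J where J: "ito_integral M F (continuous_noise x) (\<lambda>s. d s x) t J"
        "AE \<omega> in M. d t x \<omega> = drift \<kappa> (\<lambda>s y. d s y \<omega>) t x + J \<omega>" using eq[OF t, of x] by blast
      have "{\<omega> \<in> space M. controlled d n t \<omega>} \<in> sets M" using controlled_sets[OF d t] sets_F by blast
      hence "AE \<omega> in M. \<omega> \<in> {\<omega> \<in> space M. controlled d n t \<omega>} \<longrightarrow> J \<omega> = Y t x \<omega>"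
        by (rule noise.ito_integral_local[OF J(1) Y _ t]) (auto intro: truncated_eq[symmetric])
      with J(2) AE_space show ?thesis by eventually_elim auto
    qed
    have "AE \<omega> in M. \<forall>x. controlled d n t \<omega> \<longrightarrow> d t x \<omega> = drift \<kappa> (\<lambda>s y. d s y \<omega>) t x + Y t x \<omega>"
      unfolding AE_all_countable using AE1 by blast
    hence AE2: "AE \<omega> in M. nsq \<mu> (\<lambda>x. ?h t x \<omega>) \<le> 2 * (?c * ?A \<omega>) + 2 * nsq \<mu> (\<lambda>x. Y t x \<omega>)"
      using AE_space
    proof eventually_elim
      case (elim \<omega>)
      show ?case
      proof (cases "controlled d n t \<omega>")
        case True
        have cont: "l2_continuous (\<lambda>t x. d t x \<omega>)" using d elim(2) by (simp add: l2_adapted_def)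
        have "nsq \<mu> (\<lambda>x. ?h t x \<omega>) = nsq \<mu> (\<lambda>x. drift \<kappa> (\<lambda>s y. d s y \<omega>) t x + Y t x \<omega>)"
          using elim(1) True by (simp add: truncated_def)
        also have "\<dots> \<le> 2 * nsq \<mu> (drift \<kappa> (\<lambda>s y. d s y \<omega>) t) + 2 * nsq \<mu> (\<lambda>x. Y t x \<omega>)"
          by (rule nsq_add_le[OF mu_nonneg])
        also have "nsq \<mu> (drift \<kappa> (\<lambda>s y. d s y \<omega>) t) \<le> weighted_sup t (drift \<kappa> (\<lambda>s y. d s y \<omega>))"
          by (rule nsq_le_weighted_sup[OF t order_refl])
        also have "\<dots> \<le> ennreal (\<kappa>\<^sup>2 * t) * ((2 * K + 2) * (\<integral>\<^sup>+s\<in>{0..t}. nsq \<mu> (\<lambda>x. d s x \<omega>) \<partial>lborel))"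
          by (rule weighted_sup_drift_le[OF cont t])
        also have "(\<integral>\<^sup>+s\<in>{0..t}. nsq \<mu> (\<lambda>x. d s x \<omega>) \<partial>lborel) = ?A \<omega>"
          using True by (intro nn_integral_cong) (auto simp: indicator_def truncated_eq)
        finally show ?thesis by (simp add: mult.assoc add_mono mult_left_mono)
      next
        case False
        thus ?thesis by (simp add: truncated_def nsq_def)
      qed
    qed
    note [measurable] = mean_square_Fubini(3)[OF j[OF t]]
    have [measurable]: "(\<lambda>\<omega>. nsq \<mu> (\<lambda>x. Y t x \<omega>)) \<in> borel_measurable M"
      by (intro measurable_nsq continuous_adapted_measurable[OF caY t])
    have "?g t \<le> (\<integral>\<^sup>+\<omega>. 2 * (?c * ?A \<omega>) + 2 * nsq \<mu> (\<lambda>x. Y t x \<omega>) \<partial>M)"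
      by (rule nn_integral_mono_AE[OF AE2])
    also have "\<dots> = 2 * (?c * (\<integral>\<^sup>+\<omega>. ?A \<omega> \<partial>M)) + 2 * (\<integral>\<^sup>+\<omega>. nsq \<mu> (\<lambda>x. Y t x \<omega>) \<partial>M)"
      by (simp add: nn_integral_add nn_integral_cmult)
    also have "(\<integral>\<^sup>+\<omega>. ?A \<omega> \<partial>M) = mean_square t ?h" by (rule mean_square_Fubini(2)[OF j[OF t]])
    also have "(\<integral>\<^sup>+\<omega>. nsq \<mu> (\<lambda>x. Y t x \<omega>) \<partial>M) \<le> l2_sup_norm t Y"
      unfolding l2_sup_norm_def by (intro nn_integral_mono nsq_le_weighted_sup[where f="\<lambda>t x. Y t x _"] t order_refl)
    also have "l2_sup_norm t Y \<le> 64 * ennreal noise_variance * mean_square t ?h"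
      using l2_sup_norm_ito_diff_le[of ?h Y "\<lambda>_ _ _. 0" "\<lambda>_ _ _. 0", OF Y noise.ito_process_0 t] by simp
    finally show ?thesis
      by (simp add: contraction_const_def distrib_right mult.assoc add_left_mono mult_left_mono)
  qed
  define C where "C = enn2real (contraction_const t)"
  have C: "contraction_const t = ennreal C" using contraction_const_finite[of t] by (simp add: C_def)
  \<comment> \<open>The same function stands at every stage of the iteration, started from the
    truncation level n; letting the number of stages grow gives 0.\<close>
  have "?g t \<le> ennreal (real n * (C * t) ^ k / fact k)" for k
  proof (rule iterated_integral_bound[where g="\<lambda>_. ?g" and T=t])
    fix s :: real assume s: "0 \<le> s" "s \<le> t"
    have "?g s \<le> (\<integral>\<^sup>+\<omega>. of_nat n \<partial>M)" by (intro nn_integral_mono nsq_truncated_le d s)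
    thus "?g s \<le> ennreal (real n)" by (simp add: emeasure_space_1 ennreal_of_nat_eq_real_of_nat)
    have "?g s \<le> contraction_const s * mean_square s ?h" by (rule step[OF s(1)])
    also have "\<dots> \<le> contraction_const t * mean_square s ?h" by (intro mult_right_mono contraction_const_mono s) simp
    finally show "?g s \<le> ennreal C * (\<integral>\<^sup>+r\<in>{0..s}. ?g r \<partial>lborel)" by (simp add: C mean_square_def)
  qed (use t in \<open>auto simp: C_def\<close>)
  moreover have "(\<lambda>k. ennreal (real n * (C * t) ^ k / fact k)) \<longlonglongrightarrow> ennreal 0"
  proof (rule tendsto_ennrealI)
    have "(\<lambda>k. (C * t) ^ k / fact k) \<longlonglongrightarrow> 0"
      using summable_LIMSEQ_zero[OF summable_exp[of "C * t"]] by (simp add: divide_inverse mult.commute)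
    from tendsto_mult[OF tendsto_const[of "real n"] this] show "(\<lambda>k. real n * (C * t) ^ k / fact k) \<longlonglongrightarrow> 0" by simp
  qed
  ultimately have "?g t \<le> ennreal 0" by (intro LIMSEQ_le_const[of _ "ennreal 0"]) auto
  thus ?thesis by simp
qed

section \<open>Indistinguishability of two solutions\<close>

lemma anderson_solution_l2_adapted:
  assumes u: "anderson_solution M F W \<kappa> a \<mu> u" shows "l2_adapted u"
  unfolding l2_adapted_def
proof (intro conjI ballI)
  fix \<omega> assume \<omega>: "\<omega> \<in> space M"
  show "l2_continuous (\<lambda>t x. u t x \<omega>)"
    using u \<omega> by (subst l2_continuous_iff_norm) (auto simp: anderson_solution_def)
qed (use u in \<open>simp add: anderson_solution_def\<close>)

text \<open>Vanishing mean squares give a null set for each time and level; a common one is obtained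
  for rational times and natural levels, and path continuity carries the equality to all
  times.\<close>

lemma anderson_solution_unique:
  assumes u: "anderson_solution M F W \<kappa> a \<mu> u" and v: "anderson_solution M F W \<kappa> a \<mu> v"
  shows "AE \<omega> in M. \<forall>t\<ge>0. \<forall>x. u t x \<omega> = v t x \<omega>"
proof -
  let ?d = "\<lambda>t x \<omega>. u t x \<omega> - v t x \<omega>"
  note lu = anderson_solution_l2_adapted[OF u] and lv = anderson_solution_l2_adapted[OF v]
  have d: "l2_adapted ?d" by (rule l2_adapted_diff[OF lu lv])
  have eq: "\<exists>J. ito_integral M F (continuous_noise x) (\<lambda>s. ?d s x) t J \<and>
      (AE \<omega> in M. ?d t x \<omega> = drift \<kappa> (\<lambda>s y. ?d s y \<omega>) t x + J \<omega>)" if t: "0 \<le> t" for t x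
  proof -
    have ex: "\<exists>J. ito_integral M F (continuous_noise x) (\<lambda>s. u s x) t J \<and> (AE \<omega> in M. u t x \<omega> = 1 + drift \<kappa> (\<lambda>s y. u s y \<omega>) t x + J \<omega>)"
      if u: "anderson_solution M F W \<kappa> a \<mu> u" for u
    proof -
      obtain J where J: "ito_integral M F (\<lambda>s. W s x) (\<lambda>s. u s x) t J"
        "AE \<omega> in M. u t x \<omega> = 1 + drift \<kappa> (\<lambda>s y. u s y \<omega>) t x + J \<omega>"
        using u t unfolding anderson_solution_def drift_def by blast
      have "ito_integral M F (continuous_noise x) (\<lambda>s. u s x) t J"
        using noise.measurable_X measurable_W continuous_noise_AE by (intro ito_integral_AE_cong[OF J(1) t]) auto
      thus ?thesis using J(2) by blast
    qed
    obtain J where J: "ito_integral M F (continuous_noise x) (\<lambda>s. u s x) t J"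
      "AE \<omega> in M. u t x \<omega> = 1 + drift \<kappa> (\<lambda>s y. u s y \<omega>) t x + J \<omega>" using ex[OF u] by blast
    obtain J' where J': "ito_integral M F (continuous_noise x) (\<lambda>s. v s x) t J'"
      "AE \<omega> in M. v t x \<omega> = 1 + drift \<kappa> (\<lambda>s y. v s y \<omega>) t x + J' \<omega>" using ex[OF v] by blast
    have "AE \<omega> in M. ?d t x \<omega> = drift \<kappa> (\<lambda>s y. ?d s y \<omega>) t x + (J \<omega> - J' \<omega>)"
      using J(2) J'(2) AE_space
    proof eventually_elim
      case (elim \<omega>)
      have "l2_continuous (\<lambda>t x. u t x \<omega>)" "l2_continuous (\<lambda>t x. v t x \<omega>)"
        using lu lv elim(3) by (simp_all add: l2_adapted_def)
      from drift_diff[OF this t, of \<kappa> x] elim(1,2) show ?case by simp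
    qed
    thus ?thesis using noise.ito_integral_diff[OF J(1) J'(1) t] by blast
  qed
  \<comment> \<open>The nonnegative rationals are indexed by the countable type \<open>rat\<close>
    through \<open>max 0\<close>, so that \<open>AE_all_countable\<close> applies.\<close>
  have "AE \<omega> in M. \<forall>q::rat. \<forall>n. nsq \<mu> (\<lambda>x. truncated ?d n (max 0 (of_rat q)) x \<omega>) = 0"
    unfolding AE_all_countable
  proof (intro allI)
    fix q :: rat and n :: nat
    let ?t = "max 0 (of_rat q) :: real"
    have t: "0 \<le> ?t" by simp
    have "truncated ?d n ?t x \<in> borel_measurable M" for x
      using left_continuous_adapted_truncated[OF d, of n x] t unfolding left_continuous_adapted_def
      by (blast intro: borel_measurable_F_M)
    hence "(\<lambda>\<omega>. nsq \<mu> (\<lambda>x. truncated ?d n ?t x \<omega>)) \<in> borel_measurable M" by (rule measurable_nsq)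
    from nn_integral_0_iff_AE[OF this] mean_square_truncated_eq_0[OF d eq t, of n]
    show "AE \<omega> in M. nsq \<mu> (\<lambda>x. truncated ?d n ?t x \<omega>) = 0" by simp
  qed
  thus ?thesis using AE_space
  proof eventually_elim
    case (elim \<omega>)
    have cont: "l2_continuous (\<lambda>t x. ?d t x \<omega>)" using d elim(2) by (simp add: l2_adapted_def)
    have rat: "?d r x \<omega> = 0" if r: "r \<in> \<rat>" "0 \<le> r" for r :: real and x
    proof -
      \<comment> \<open>The level n depends on the path: on [0, r] the continuous path is bounded,
        so at this level the truncation is inactive up to r.\<close>
      obtain n :: nat where "\<forall>s\<in>{0..r}. nsq \<mu> (\<lambda>x. ?d s x \<omega>) \<le> of_nat n" using l2_continuous_bounded[OF cont, of r] by blast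
      hence c: "controlled ?d n r \<omega>" using r by (auto simp: controlled_def)
      obtain q where q: "r = of_rat q" using r(1) by (auto simp: Rats_def)
      have "nsq \<mu> (\<lambda>x. truncated ?d n (max 0 (of_rat q)) x \<omega>) = 0" using elim(1) by blast
      moreover have "max 0 (of_rat q) = r" using q r(2) by simp
      ultimately have "nsq \<mu> (\<lambda>x. truncated ?d n r x \<omega>) = 0" by simp
      hence "nsq \<mu> (\<lambda>x. ?d r x \<omega>) = 0" using c by (simp add: truncated_def)
      hence "ennreal (\<mu> x * (?d r x \<omega>)\<^sup>2) \<le> 0" using square_le_nsq[of x "\<lambda>x. ?d r x \<omega>"] by simp
      hence "\<mu> x * (?d r x \<omega>)\<^sup>2 \<le> 0" by (simp add: ennreal_eq_0_iff)
      thus ?thesis using mu_pos[of x] by (auto simp: mult_le_0_iff)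
    qed
    show ?case
    proof (intro allI impI)
      fix t :: real and x assume t: "0 \<le> t"
      have "?d t x \<omega> = 0"
      proof (cases "t = 0")
        case True thus ?thesis using rat[of 0 x] by simp
      next
        case False
        then obtain q where q: "q \<longlonglongrightarrow> t" "\<And>k. q k \<in> \<rat> \<and> 0 \<le> q k \<and> q k < t"
          using ex_rational_sequence_below[of t] t by auto
        have "(\<lambda>k. ?d (q k) x \<omega>) \<longlonglongrightarrow> ?d t x \<omega>"
          using q t by (intro continuous_on_tendsto_compose[OF l2_continuous_coordinate[OF cont, of x] q(1)]) auto
        moreover have "(\<lambda>k. ?d (q k) x \<omega>) = (\<lambda>k. 0)" using q(2) by (intro ext rat) auto
        ultimately have "(\<lambda>k. 0) \<longlonglongrightarrow> ?d t x \<omega>" by simp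
        from LIMSEQ_unique[OF this tendsto_const] show ?thesis .
      qed
      thus "u t x \<omega> = v t x \<omega>" by simp
    qed
  qed
qed

end

theorem theorem4p1:
  fixes M :: "'w measure"
    and w W :: "real \<Rightarrow> int ^ 'd::finite \<Rightarrow> 'w \<Rightarrow> real"
    and a b \<mu> :: "int ^ 'd \<Rightarrow> real"
    and \<kappa> :: real
  assumes "prob_space M"
    and "\<kappa> > 0"
    and "walk_kernel a"
    and "independent_brownian_motions M w"
    and "noise_field M b w W"
    and "regular_weight \<mu>"
    and "(\<lambda>z. (b z)\<^sup>2) summable_on UNIV"
    and "\<mu> summable_on UNIV"
    and "light_tail a \<mu> \<or> moderate_or_heavy_tail a \<mu>"
  shows "generator_bounded a \<mu> \<and>
    (\<exists>u. anderson_solution M (noise_filtration M w) W \<kappa> a \<mu> u) \<and>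
    (\<forall>u v. anderson_solution M (noise_filtration M w) W \<kappa> a \<mu> u \<longrightarrow>
           anderson_solution M (noise_filtration M w) W \<kappa> a \<mu> v \<longrightarrow>
           (AE \<omega> in M. \<forall>t\<ge>0. \<forall>x. u t x \<omega> = v t x \<omega>))"
proof -
  obtain K where "kernel_bound a \<mu> K"
    using light_tail_kernel_bound[OF assms(6,3)] heavy_tail_kernel_bound[OF assms(6,3,8)] assms(9) by blast
  then interpret anderson M w a \<mu> K W b \<kappa>
    using assms by (intro anderson.intro anderson_axioms.intro brownian_family.intro brownian_family_axioms.intro bounded_generator.intro)
      (auto simp: regular_weight_def)
  show ?thesis using generator_bounded ex_anderson_solution anderson_solution_unique by blast
qed

end
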